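(* Let $r$ be an integer with $0\leq r\leq 8$. Then for every integer $n\geq 1$, the polynomial $$L_n^{\langle r\rangle}(x)=\sum_{j=0}^{n}\binom{n-j+r}{n-j}\frac{x^j}{j!}$$ is irreducible over $\mathbb{Q}$ and its Galois group over $\mathbb{Q}$ contains the alternating group $A_n$.
   Context: The Galois group of a degree $n$ polynomial is viewed as a permutation group on its $n$ roots. *)

theory Defs
  imports
    Complex_Main
    "HOL-Computational_Algebra.Computational_Algebra"
    "HOL-Combinatorics.Combinatorics"
begin

definition L_poly :: "nat \<Rightarrow> nat \<Rightarrow> rat poly" where
  "L_poly r n = (\<Sum>j\<le>n. monom (of_nat ((n - j + r) choose (n - j)) / fact j) j)"

definition complex_roots :: "rat poly \<Rightarrow> complex set" where
  "complex_roots f = {z. poly (map_poly of_rat f) z = 0}"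

(* The subfield Q(S) of the complex numbers. The nonzero condition in the inverse rule is not
   needed, because inverse 0 = 0. *)
inductive_set rat_adjoin :: "complex set \<Rightarrow> complex set" for S :: "complex set" where
  rat: "z \<in> \<rat> \<Longrightarrow> z \<in> rat_adjoin S"
| gen: "z \<in> S \<Longrightarrow> z \<in> rat_adjoin S"
| minus: "z \<in> rat_adjoin S \<Longrightarrow> - z \<in> rat_adjoin S"
| inverse: "z \<in> rat_adjoin S \<Longrightarrow> inverse z \<in> rat_adjoin S"
| add: "z \<in> rat_adjoin S \<Longrightarrow> w \<in> rat_adjoin S \<Longrightarrow> z + w \<in> rat_adjoin S"
| mult: "z \<in> rat_adjoin S \<Longrightarrow> w \<in> rat_adjoin S \<Longrightarrow> z * w \<in> rat_adjoin S"

definition splitting_field :: "rat poly \<Rightarrow> complex set" where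
  "splitting_field f = rat_adjoin (complex_roots f)"

(* The elements of Aut(K/Q) for a subfield K of the complex numbers, as total functions
   whose values outside K are irrelevant. *)
definition rat_automorphisms :: "complex set \<Rightarrow> (complex \<Rightarrow> complex) set" where
  "rat_automorphisms K = {\<sigma>. bij_betw \<sigma> K K \<and>
     (\<forall>x\<in>K. \<forall>y\<in>K. \<sigma> (x + y) = \<sigma> x + \<sigma> y) \<and>
     (\<forall>x\<in>K. \<forall>y\<in>K. \<sigma> (x * y) = \<sigma> x * \<sigma> y) \<and>
     (\<forall>q\<in>\<rat>. \<sigma> q = q)}"

(* The Galois group of f over Q as a group of permutations of the roots of f: perm_restrict
   makes each automorphism the identity outside the root set, as required by "permutes". *)
definition galois_group :: "rat poly \<Rightarrow> (complex \<Rightarrow> complex) set" where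
  "galois_group f =
     (\<lambda>\<sigma>. perm_restrict \<sigma> (complex_roots f)) ` rat_automorphisms (splitting_field f)"

definition alternating_group :: "'a set \<Rightarrow> ('a \<Rightarrow> 'a) set" where
  "alternating_group S = {p. p permutes S \<and> evenperm p}"

end

theory Submission
  imports
    Defs
    "HOL-Number_Theory.Cong"
    "HOL-Computational_Algebra.Field_as_Ring"
begin

text \<open>Extend the \<open>p\<close>-adic absolute value to the algebraic numbers. If \<open>p\<close> does not divide \<open>n + r choose r\<close>, then
  the Newton polygon of the polynomial \<open>L\<close> of degree \<open>n\<close> is the one of the exponential polynomial at all large slopes,
  and every factor of degree \<open>k\<close> satisfies \<open>k mod p\<^sup>e \<le> n mod p\<^sup>e\<close> for all \<open>e\<close> (Coleman's argument). For \<open>r \<le> 8\<close> this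
  implies that \<open>n\<close> divides \<open>840 k\<close> and that \<open>n (n - 1) \<cdots> (n - k + 1)\<close> has no prime factor exceeding \<open>k + 8\<close>. For
  \<open>30 \<le> k \<le> n / 2\<close> this contradicts a theorem of Sylvester type, proved by Erdos's estimate of \<open>n choose k\<close>; the
  finitely many remaining pairs are excluded by further congruences, by Newton polygons at other primes, or because
  \<open>L\<close> is positive on the reals for even \<open>n\<close>.

  For the Galois group, a slope with denominator a prime \<open>d > n / 2\<close> forces \<open>d\<close> to divide the order of the
  decomposition group, so by Cauchy's theorem the group contains a \<open>d\<close>-cycle. If \<open>d + 3 \<le> n\<close>, Jordan's theorem applies.
  Such slopes exist for \<open>n \<ge> 8\<close>, again by the theorem of Sylvester type. For \<open>n \<le> 5\<close> there is a 3-cycle, and for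
  \<open>n = 6, 7\<close> there is a 5-cycle, and a power of a Frobenius element is a 3-cycle.\<close>


section \<open>Permutation groups containing a cycle of prime length\<close>

text \<open>For \<open>r = 0\<close> every prime is admissible, and the congruences alone give that
  \<open>n\<close> divides the degree \<open>k\<close> of a factor. The binomial coefficients cost
  the primes that divide them: a prime power dividing \<open>n\<close> survives if it exceeds
  \<open>r\<close>, and a prime with \<open>n mod p < k\<close> survives if it exceeds
  \<open>k + r\<close>. Hence the factor 840 and the margin 8. The bound
  \<open>n \<le> 840 * k\<close> in turn keeps the quotient of \<open>n\<close> by \<open>k\<close>
  in a bounded range where the estimate involves the square root of \<open>n\<close>. All arithmetic
  uses one real-valued absolute value on the algebraic numbers; there are no completions and no
  prime ideals. Decomposition group and Frobenius elements are reached through products over the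
  whole Galois group, whose coefficients are rational. A prime \<open>d > n / 2\<close> is wanted
  because two orbits of length \<open>d\<close> do not fit into \<open>n\<close> points, so an
  element of order \<open>d\<close> is a single cycle. For \<open>n = 6, 7\<close> no prime exceeds
  \<open>n / 2\<close> and leaves three points over, which is why a 3-cycle is sought by other
  means.\<close>

lemma prime_cong_card_fixpoints:
  fixes f :: "'b \<Rightarrow> 'b"
  assumes "finite X" "prime p" "f ` X \<subseteq> X" "\<And>x. x \<in> X \<Longrightarrow> (f ^^ p) x = x"
  shows "p dvd card {x \<in> X. f x \<noteq> x}"
  using assms(1,3,4)
proof (induction "card X" arbitrary: X rule: less_induct)
  case less
  have it: "(f ^^ k) x \<in> X" if "x \<in> X" for k x
    using that less.prems(2) by (induction k) auto
  show ?case
  proof (cases "\<exists>x\<in>X. f x \<noteq> x")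
    case False
    then have "{x \<in> X. f x \<noteq> x} = {}" by auto
    then show ?thesis by (simp only: card.empty dvd_0_right)
  next
    case True
    then obtain x where x: "x \<in> X" "f x \<noteq> x" by auto
    have p1: "p > 1" using \<open>prime p\<close> prime_gt_1_nat by blast
    have period: "(f ^^ (q * p + r)) x = (f ^^ r) x" for q r
    proof (induction q)
      case (Suc q)
      have "(f ^^ (Suc q * p + r)) x = (f ^^ (q * p + r)) ((f ^^ p) x)"
        by (simp add: funpow_add[symmetric] add.commute add.left_commute flip: comp_apply[of "f ^^ _"])
      then show ?case using Suc less.prems(3)[OF x(1)] by simp
    qed simp
    have periodm: "(f ^^ r) x = (f ^^ (r mod p)) x" for r
      using period[of "r div p" "r mod p"] by simp
    have triv: "(f ^^ j) x \<noteq> x" if "0 < j" "j < p" for j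
    proof
      assume e: "(f ^^ j) x = x"
      have "coprime j p" using that \<open>prime p\<close>
        by (metis coprime_commute nat_dvd_not_less prime_imp_coprime)
      then obtain k where k: "[j * k = 1] (mod p)" using cong_solve_coprime_nat by auto
      have "(f ^^ (j * k)) x = x" for k
        by (induction k) (simp_all add: funpow_add e)
      then have "(f ^^ (j * k)) x = x" .
      moreover have "j * k mod p = 1" using k p1 by (simp add: cong_def)
      ultimately show False using periodm[of "j * k"] x(2) by simp
    qed
    \<comment> \<open>The orbit of a moved point has exactly \<open>p\<close> elements and none of
      them is fixed. Removing it leaves a set that \<open>f\<close> still maps into itself, to which
      the induction hypothesis applies.\<close>
    define O' where "O' = (\<lambda>i. (f ^^ i) x) ` {..<p}"
    have inj: "inj_on (\<lambda>i. (f ^^ i) x) {..<p}"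
    proof (rule linorder_inj_onI)
      fix i j assume ij: "i < j" "i \<in> {..<p}" "j \<in> {..<p}"
      show "(f ^^ i) x \<noteq> (f ^^ j) x"
      proof
        assume e: "(f ^^ i) x = (f ^^ j) x"
        have "(f ^^ (p - j + i)) x = (f ^^ (p - j + j)) x"
          unfolding funpow_add using e by simp
        also have "\<dots> = x" using ij less.prems(3)[OF x(1)] by simp
        finally have E: "(f ^^ (p - j + i)) x = x" .
        have "0 < p - j + i" "p - j + i < p" using ij by auto
        from triv[OF this] E show False by (rule notE)
      qed
    qed (simp add: linear)
    have cO: "card O' = p" unfolding O'_def using card_image[OF inj] by simp
    have OX: "O' \<subseteq> X" unfolding O'_def using it[OF x(1)] by auto
    have fO: "f ` O' \<subseteq> O'"
    proof
      fix y assume "y \<in> f ` O'"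
      then obtain i where "y = (f ^^ (Suc i)) x" unfolding O'_def by auto
      then have "y = (f ^^ (Suc i mod p)) x" using periodm[of "Suc i"] by simp
      then show "y \<in> O'" unfolding O'_def using p1 by (auto intro!: imageI)
    qed
    have mv: "f y \<noteq> y" if "y \<in> O'" for y
    proof
      assume e: "f y = y"
      from that obtain i where i: "i < p" "y = (f ^^ i) x" unfolding O'_def by auto
      have ey: "(f ^^ k) y = y" for k by (induction k) (simp_all add: e)
      have "y = (f ^^ (p - i)) y" using ey by simp
      also have "\<dots> = x" using i less.prems(3)[OF x(1)]
        by (simp add: funpow_add[symmetric] flip: comp_apply[of "f ^^ _"])
      finally show False using e x(2) by simp
    qed
    have inj': "\<And>y. y \<in> X \<Longrightarrow> f y \<in> O' \<Longrightarrow> y \<in> O'"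
    proof -
      fix y assume y: "y \<in> X" "f y \<in> O'"
      have "y = (f ^^ (p - 1)) (f y)"
        using less.prems(3)[OF y(1)] p1
        by (metis Suc_diff_1 funpow_swap1 funpow_simps_right(2) comp_apply less_trans zero_less_one)
      moreover have "(f ^^ k) z \<in> O'" if "z \<in> O'" for k z
        using that fO by (induction k) auto
      ultimately show "y \<in> O'" using y(2) by metis
    qed
    have "p dvd card {y \<in> X - O'. f y \<noteq> y}"
    proof (rule less.hyps)
      show "card (X - O') < card X" using OX cO p1 less.prems(1)
        by (metis card_Diff_subset card_gt_0_iff diff_less finite_subset gr_zeroI less_nat_zero_code card_mono le_zero_eq)
      show "finite (X - O')" using less.prems(1) by simp
      show "f ` (X - O') \<subseteq> X - O'" using less.prems(2) inj' by auto
    qed (use less.prems(3) in auto)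
    moreover have "{y \<in> X. f y \<noteq> y} = {y \<in> X - O'. f y \<noteq> y} \<union> O'" using OX mv by auto
    moreover have "card ({y \<in> X - O'. f y \<noteq> y} \<union> O') = card {y \<in> X - O'. f y \<noteq> y} + card O'"
      by (rule card_Un_disjoint) (use less.prems(1) OX finite_subset in auto)
    ultimately show ?thesis using cO by simp
  qed
qed

section \<open>Cycles of prime length\<close>

definition is_cycle :: "nat \<Rightarrow> ('a \<Rightarrow> 'a) \<Rightarrow> 'a set \<Rightarrow> bool" where
  "is_cycle p c C \<longleftrightarrow> (\<exists>e. bij_betw e {..<p} C \<and> (\<forall>i<p. c (e i) = e (Suc i mod p)) \<and> (\<forall>x. x \<notin> C \<longrightarrow> c x = x))"

lemma is_cycle_ex:
  assumes "is_cycle p c C" "p > 0"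
  shows "\<exists>e. bij_betw e {..<p} C \<and> (\<forall>i k. i < p \<longrightarrow> (c ^^ k) (e i) = e ((i + k) mod p)) \<and>
    (\<forall>x k. x \<notin> C \<longrightarrow> (c ^^ k) x = x)"
proof -
  from assms obtain e where e: "bij_betw e {..<p} C" "\<forall>i<p. c (e i) = e (Suc i mod p)"
    "\<forall>x. x \<notin> C \<longrightarrow> c x = x" unfolding is_cycle_def by auto
  have "(c ^^ k) (e i) = e ((i + k) mod p)" if "i < p" for i k
    using that e(2) assms(2) by (induction k) (auto simp: mod_Suc_eq)
  moreover have "(c ^^ k) x = x" if "x \<notin> C" for x k
    using that e(3) by (induction k) auto
  ultimately show ?thesis using e(1) by blast
qed

lemma is_cycle_card: "is_cycle p c C \<Longrightarrow> card C = p"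
  unfolding is_cycle_def by (metis bij_betw_same_card card_lessThan)

lemma is_cycle_finite: "is_cycle p c C \<Longrightarrow> finite C"
  unfolding is_cycle_def by (metis bij_betw_finite finite_lessThan)

lemma is_cycle_conj:
  assumes "is_cycle p c C" "bij g"
  shows "is_cycle p (g \<circ> c \<circ> inv g) (g ` C)"
proof -
  from assms obtain e where e: "bij_betw e {..<p} C" "\<forall>i<p. c (e i) = e (Suc i mod p)"
    "\<forall>x. x \<notin> C \<longrightarrow> c x = x" unfolding is_cycle_def by auto
  have g: "\<And>x. inv g (g x) = x" "\<And>x. g (inv g x) = x"
    using assms(2) by (simp_all add: bij_is_inj bij_is_surj surj_f_inv_f)
  have "bij_betw (g \<circ> e) {..<p} (g ` C)"
    by (rule bij_betw_trans[OF e(1)]) (meson assms(2) bij_betw_imageI bij_is_inj inj_on_subset subset_UNIV)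
  moreover have "\<forall>i<p. (g \<circ> c \<circ> inv g) ((g \<circ> e) i) = (g \<circ> e) (Suc i mod p)"
    using e(2) g by simp
  moreover have "(g \<circ> c \<circ> inv g) x = x" if "x \<notin> g ` C" for x
  proof -
    have "inv g x \<notin> C" using that g(2) by (metis imageI)
    then show ?thesis using e(3) g by simp
  qed
  ultimately show ?thesis unfolding is_cycle_def by blast
qed

lemma is_cycle_funpow_trans:
  assumes "is_cycle p c C" "p > 0" "x \<in> C" "y \<in> C"
  obtains i where "i < p" "(c ^^ i) x = y"
proof -
  obtain e where e: "bij_betw e {..<p} C" "\<And>i k. i < p \<Longrightarrow> (c ^^ k) (e i) = e ((i + k) mod p)"
    "\<And>x k. x \<notin> C \<Longrightarrow> (c ^^ k) x = x"
    using is_cycle_ex[OF assms(1,2)] by blast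
  have "x \<in> e ` {..<p}" "y \<in> e ` {..<p}" using e(1) assms(3,4) unfolding bij_betw_def by auto
  then obtain a b where ab: "a < p" "b < p" "x = e a" "y = e b" by auto
  have "(a + (p + b - a) mod p) mod p = b" using ab
    by (simp add: mod_add_right_eq)
  then have "(c ^^ ((p + b - a) mod p)) x = y" using e(2)[of a "(p + b - a) mod p"] ab by simp
  moreover have "(p + b - a) mod p < p" using assms(2) by simp
  ultimately show ?thesis using that by blast
qed

text \<open>An exponent that moves \<open>x\<close> is prime to \<open>p\<close>, hence invertible
  modulo \<open>p\<close>, so the powers of \<open>c ^^ i\<close> already reach all of
  \<open>C\<close>.\<close>

lemma is_cycle_gen:
  assumes "is_cycle p c C" "prime p" "x \<in> C" "(c ^^ i) x \<noteq> x" "z \<in> C"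
  shows "\<exists>k. ((c ^^ i) ^^ k) x = z"
proof -
  have p0: "p > 0" using assms(2) prime_gt_0_nat by blast
  obtain e where e: "bij_betw e {..<p} C" "\<And>i k. i < p \<Longrightarrow> (c ^^ k) (e i) = e ((i + k) mod p)"
    "\<And>x k. x \<notin> C \<Longrightarrow> (c ^^ k) x = x"
    using is_cycle_ex[OF assms(1) p0] by blast
  have "x \<in> e ` {..<p}" "z \<in> e ` {..<p}" using e(1) assms(3,5) unfolding bij_betw_def by auto
  then obtain a b where ab: "a < p" "b < p" "x = e a" "z = e b" by auto
  have "\<not> p dvd i" using assms(4) e(2)[of a i] ab by auto
  then have "coprime i p" using assms(2) by (metis coprime_commute prime_imp_coprime)
  then obtain k where k: "[i * k = 1] (mod p)" using cong_solve_coprime_nat by auto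
  have "(a + i * (k * (p + b - a))) mod p = b"
  proof -
    have "[a + i * k * (p + b - a) = a + 1 * (p + b - a)] (mod p)"
      by (intro cong_add cong_mult k) auto
    moreover have "(a + 1 * (p + b - a)) mod p = b" using ab by simp
    ultimately show ?thesis by (simp add: cong_def mult.assoc)
  qed
  then have "(c ^^ (i * (k * (p + b - a)))) x = z" using e(2) ab by simp
  then show ?thesis by (metis funpow_mult)
qed

lemma is_cycle_funpow_p:
  assumes "is_cycle p c C" "p > 0" shows "c ^^ p = id"
proof
  fix x
  obtain e where e: "bij_betw e {..<p} C" "\<And>i k. i < p \<Longrightarrow> (c ^^ k) (e i) = e ((i + k) mod p)"
    "\<And>x k. x \<notin> C \<Longrightarrow> (c ^^ k) x = x" using is_cycle_ex[OF assms] by blast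
  show "(c ^^ p) x = id x"
  proof (cases "x \<in> C")
    case True
    then obtain a where "a < p" "x = e a" using e(1) unfolding bij_betw_def by auto
    then show ?thesis using e(2) by simp
  next
    case False then show ?thesis using e(3) by simp
  qed
qed

text \<open>A map commuting with \<open>c\<close> is determined on \<open>C\<close> by its value at
  one point, and some power of \<open>c\<close> has the same value there.\<close>

lemma is_cycle_centralizer:
  assumes "is_cycle p c C" "p > 0" "x ` C \<subseteq> C" "x \<circ> c = c \<circ> x"
  obtains j where "j < p" "\<And>y. y \<in> C \<Longrightarrow> x y = (c ^^ j) y"
proof -
  obtain e where e: "bij_betw e {..<p} C" "\<And>i k. i < p \<Longrightarrow> (c ^^ k) (e i) = e ((i + k) mod p)"
    "\<And>x k. x \<notin> C \<Longrightarrow> (c ^^ k) x = x"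
    using is_cycle_ex[OF assms(1,2)] by blast
  have "e 0 \<in> C" using e(1) assms(2) unfolding bij_betw_def by auto
  then obtain j where j: "j < p" "(c ^^ j) (e 0) = x (e 0)"
    using is_cycle_funpow_trans[OF assms(1,2)] assms(3) by (metis image_subset_iff)
  have "x (c y) = c (x y)" for y using fun_cong[OF assms(4), of y] by simp
  then have comm: "x ((c ^^ k) y) = (c ^^ k) (x y)" for k y
    by (induction k) simp_all
  have "x y = (c ^^ j) y" if "y \<in> C" for y
  proof -
    obtain i where "i < p" "(c ^^ i) (e 0) = y"
      by (rule is_cycle_funpow_trans[OF assms(1,2) \<open>e 0 \<in> C\<close> \<open>y \<in> C\<close>])
    then show ?thesis using comm j(2) by (metis add.commute comp_apply funpow_add)
  qed
  then show ?thesis using that j(1) by blast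
qed

text \<open>All orbits of moved points have length \<open>p\<close>, and two disjoint ones would
  need \<open>2 * p\<close> points. This turns the element of prime order given by Cauchy's theorem
  into a single cycle.\<close>

lemma is_cycle_of_order:
  assumes "finite S" "prime p" "card S < 2 * p" "g permutes S" "g ^^ p = id" "g \<noteq> id"
  obtains C where "is_cycle p g C" "C \<subseteq> S"
proof -
  obtain x where x: "g x \<noteq> x" using assms(6) by (metis eq_id_iff)
  have p0: "p > 0" using assms(2) prime_gt_0_nat by blast
  have xS: "x \<in> S" using x assms(4) by (meson permutes_not_in)
  have gS: "(g ^^ k) y \<in> S \<longleftrightarrow> y \<in> S" for k y
    using assms(4) by (induction k) (auto simp: permutes_in_image)
  have periodm: "(g ^^ k) y = (g ^^ (k mod p)) y" for k y
  proof -
    have "(g ^^ k) y = (g ^^ (p * (k div p) + k mod p)) y" by simp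
    also have "\<dots> = ((g ^^ p) ^^ (k div p)) ((g ^^ (k mod p)) y)"
      unfolding funpow_mult[symmetric] funpow_add by simp
    finally show ?thesis using assms(5) by simp
  qed
  define e where "e y = (\<lambda>i. (g ^^ i) y)" for y
  have triv: "(g ^^ j) y \<noteq> y" if "0 < j" "j < p" "g y \<noteq> y" for j y
  proof
    assume a: "(g ^^ j) y = y"
    have "coprime j p" using that assms(2)
      by (metis coprime_commute nat_dvd_not_less prime_imp_coprime)
    then obtain k where k: "[j * k = 1] (mod p)" using cong_solve_coprime_nat by auto
    have "(g ^^ (j * k)) y = y" for k
      by (induction k) (simp_all add: funpow_add a)
    then have "(g ^^ (j * k)) y = y" .
    moreover have "j * k mod p = 1" using k prime_gt_1_nat[OF assms(2)] by (simp add: cong_def)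
    ultimately show False using periodm[of "j * k" y] that(3) by simp
  qed
  have inj: "inj_on (e y) {..<p}" if "g y \<noteq> y" for y
  proof (rule linorder_inj_onI)
    fix i j assume ij: "i < j" "i \<in> {..<p}" "j \<in> {..<p}"
    show "e y i \<noteq> e y j"
    proof
      assume a: "e y i = e y j"
      have "(g ^^ (p - j + i)) y = (g ^^ (p - j + j)) y"
        unfolding funpow_add using a e_def by simp
      also have "\<dots> = y" using ij assms(5) by simp
      finally have E: "(g ^^ (p - j + i)) y = y" .
      have "0 < p - j + i" "p - j + i < p" using ij by auto
      from triv[OF this that] E show False by (rule notE)
    qed
  qed (simp add: linear)
  define C where "C = e x ` {..<p}"
  have "g y = y" if "y \<notin> C" for y
  proof (rule ccontr)
    assume y: "g y \<noteq> y"
    have yS: "y \<in> S" using y assms(4) by (meson permutes_not_in)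
    have "e y ` {..<p} \<inter> C = {}"
    proof (rule ccontr)
      assume "e y ` {..<p} \<inter> C \<noteq> {}"
      then obtain i j where ij: "i < p" "j < p" "(g ^^ i) y = (g ^^ j) x"
        unfolding C_def e_def by auto
      have "y = (g ^^ (p - i + i)) y" using ij assms(5) by simp
      also have "\<dots> = (g ^^ (p - i + j)) x" unfolding funpow_add using ij by simp
      also have "\<dots> = e x ((p - i + j) mod p)" unfolding e_def by (rule periodm)
      finally show False using that p0 unfolding C_def by auto
    qed
    then have "card (e y ` {..<p} \<union> C) = p + p"
      unfolding C_def using inj[OF y] inj[OF x] by (subst card_Un_disjoint) (auto simp: card_image)
    moreover have "e y ` {..<p} \<union> C \<subseteq> S" unfolding C_def e_def using xS yS gS by auto
    then have "card (e y ` {..<p} \<union> C) \<le> card S" by (rule card_mono[OF assms(1)])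
    ultimately show False using assms(3) by linarith
  qed
  moreover have "bij_betw (e x) {..<p} C" unfolding C_def using inj[OF x] by (simp add: bij_betw_def)
  moreover have "\<forall>i<p. g (e x i) = e x (Suc i mod p)"
    unfolding e_def by (metis periodm funpow.simps(2) comp_apply)
  ultimately have "is_cycle p g C" unfolding is_cycle_def by blast
  moreover have "C \<subseteq> S" unfolding C_def e_def using xS gS by auto
  ultimately show ?thesis using that by blast
qed

section \<open>Three-cycles\<close>

definition cyc3 :: "'a \<Rightarrow> 'a \<Rightarrow> 'a \<Rightarrow> 'a \<Rightarrow> 'a" where
  "cyc3 a b d = transpose a b \<circ> transpose b d"

lemma cyc3_apply:
  assumes "a \<noteq> b" "b \<noteq> d" "a \<noteq> d"
  shows "cyc3 a b d a = b" "cyc3 a b d b = d" "cyc3 a b d d = a"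
    "x \<noteq> a \<Longrightarrow> x \<noteq> b \<Longrightarrow> x \<noteq> d \<Longrightarrow> cyc3 a b d x = x"
  using assms by (auto simp: cyc3_def transpose_def)

lemma cyc3_rot: "a \<noteq> b \<Longrightarrow> b \<noteq> d \<Longrightarrow> a \<noteq> d \<Longrightarrow> cyc3 a b d = cyc3 b d a"
  by (rule ext) (auto simp: cyc3_def transpose_def)

lemma cyc3_sq: "a \<noteq> b \<Longrightarrow> b \<noteq> d \<Longrightarrow> a \<noteq> d \<Longrightarrow> cyc3 a b d \<circ> cyc3 a b d = cyc3 a d b"
  by (rule ext) (auto simp: cyc3_def transpose_def)

lemma cyc3_conj:
  assumes "bij g" shows "g \<circ> cyc3 a b d \<circ> inv g = cyc3 (g a) (g b) (g d)"
proof
  fix x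
  have g: "\<And>x y. g x = g y \<longleftrightarrow> x = y" "\<And>x. inv g (g x) = x" using assms
    by (auto simp: bij_is_inj inj_eq)
  obtain y where "x = g y" using assms by (metis bij_pointE)
  then show "(g \<circ> cyc3 a b d \<circ> inv g) x = cyc3 (g a) (g b) (g d) x"
    using g by (auto simp: cyc3_def transpose_def)
qed

lemma is_cycle_3:
  assumes "is_cycle 3 c C"
  obtains a b d where "a \<noteq> b" "b \<noteq> d" "a \<noteq> d" "C = {a, b, d}" "c = cyc3 a b d"
proof -
  from assms obtain e where e: "bij_betw e {..<3} C" "\<forall>i<3. c (e i) = e (Suc i mod 3)"
    "\<forall>x. x \<notin> C \<longrightarrow> c x = x" unfolding is_cycle_def by auto
  have s: "{..<3::nat} = {0,1,2}" by auto
  have d: "e 0 \<noteq> e 1" "e 1 \<noteq> e 2" "e 0 \<noteq> e 2" using e(1) unfolding bij_betw_def s by auto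
  have C: "C = {e 0, e 1, e 2}" using e(1) unfolding bij_betw_def s by auto
  have c: "c (e 0) = e 1" "c (e 1) = e 2" "c (e 2) = e 0"
    using e(2)[rule_format, of 0] e(2)[rule_format, of 1] e(2)[rule_format, of 2] by (simp_all add: numeral_2_eq_2)
  have "c = cyc3 (e 0) (e 1) (e 2)"
  proof
    fix x show "c x = cyc3 (e 0) (e 1) (e 2) x"
      using c d e(3) C cyc3_apply[OF d(1,2,3)] by (cases "x \<in> C") auto
  qed
  then show ?thesis using that d C by blast
qed

lemma three_cycleI:
  assumes "card A = 3" "\<And>x. x \<in> A \<Longrightarrow> g x \<in> A" "\<And>x. x \<in> A \<Longrightarrow> g x \<noteq> x" "\<And>x. x \<notin> A \<Longrightarrow> g x = x" "inj g"
  obtains a b d where "a \<noteq> b" "b \<noteq> d" "a \<noteq> d" "A = {a, b, d}" "g = cyc3 a b d"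
proof -
  obtain a b d where A: "A = {a, b, d}" "a \<noteq> b" "b \<noteq> d" "a \<noteq> d"
    using assms(1) by (metis card_3_iff)
  have i: "g a \<noteq> g b" "g b \<noteq> g d" "g a \<noteq> g d" using A assms(5) by (auto dest: injD)
  have "g a \<in> {b, d}" using assms(2,3)[of a] A by auto
  then show ?thesis
  proof
    assume ga: "g a = b"
    have "g b = d" "g d = a" using assms(2,3)[of b] assms(2,3)[of d] i ga A by auto
    then have "g = cyc3 a b d" using ga cyc3_apply[OF A(2,3,4)] assms(4) A(1) by (intro ext) (metis insertE singletonD)
    then show ?thesis using that A by blast
  next
    assume "g a \<in> {d}" then have ga: "g a = d" by simp
    have "g d = b" "g b = a" using assms(2,3)[of b] assms(2,3)[of d] i ga A by auto
    then have "g = cyc3 a d b" using ga cyc3_apply[of a d b] assms(4) A by (intro ext) (metis insertE singletonD)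
    then show ?thesis using that[of a d b] A by auto
  qed
qed

section \<open>Finite permutation groups and Cauchy's theorem\<close>

locale perm_group =
  fixes S :: "'a set" and G :: "('a \<Rightarrow> 'a) set"
  assumes fin: "finite S"
    and perm: "g \<in> G \<Longrightarrow> g permutes S"
    and one: "id \<in> G"
    and comp: "g \<in> G \<Longrightarrow> h \<in> G \<Longrightarrow> g \<circ> h \<in> G"
    and inv: "g \<in> G \<Longrightarrow> inv g \<in> G"
begin

lemma bijG: "g \<in> G \<Longrightarrow> bij g" using perm permutes_bij by blast

lemma inv_app [simp]: "g \<in> G \<Longrightarrow> inv g (g x) = x" "g \<in> G \<Longrightarrow> g (inv g x) = x"
  using perm permutes_inverses by metis+

lemma inv_comp [simp]: "g \<in> G \<Longrightarrow> inv g \<circ> g = id" "g \<in> G \<Longrightarrow> g \<circ> inv g = id"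
  by (simp_all add: fun_eq_iff)

lemma finG: "finite G"
  by (rule finite_subset[OF _ finite_permutations[OF fin]]) (use perm in auto)

lemma powG: "g \<in> G \<Longrightarrow> g ^^ k \<in> G"
  by (induction k) (auto simp: one comp)

lemma inG: "g \<in> G \<Longrightarrow> g x \<in> S \<longleftrightarrow> x \<in> S" using perm permutes_in_image by metis

lemma imgG: "g \<in> G \<Longrightarrow> D \<subseteq> S \<Longrightarrow> g ` D \<subseteq> S" using inG by blast

lemma injG: "g \<in> G \<Longrightarrow> g x = g y \<longleftrightarrow> x = y" using inv_app by metis

lemma cardG: "g \<in> G \<Longrightarrow> card (g ` D) = card D"
  by (intro card_image) (auto simp: inj_on_def injG)

text \<open>McKay's argument: rotation acts on the \<open>p\<close>-tuples with product
  \<open>id\<close>. There are \<open>card G ^ (p - 1)\<close> of them, so the number of tuples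
  fixed by rotation is divisible by \<open>p\<close>. These are the constant tuples, and besides the
  tuple of identities there must be another one.\<close>

theorem cauchy:
  assumes "prime p" "p dvd card G"
  obtains g where "g \<in> G" "g ^^ p = id" "g \<noteq> id"
proof -
  have p1: "p > 1" using assms(1) prime_gt_1_nat by blast
  define pr where "pr xs = foldr (\<circ>) xs (id :: 'a \<Rightarrow> 'a)" for xs
  define X where "X = {xs. length xs = p \<and> set xs \<subseteq> G \<and> pr xs = id}"
  have prG: "pr xs \<in> G" if "set xs \<subseteq> G" for xs
    using that unfolding pr_def by (induction xs) (auto simp: one comp)
  have pr_snoc: "pr (xs @ [x]) = pr xs \<circ> x" for xs x
    unfolding pr_def by (induction xs) (auto simp: comp_assoc)
  have pr_Cons: "pr (x # xs) = x \<circ> pr xs" for xs x unfolding pr_def by simp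
  define Y where "Y = {ys. set ys \<subseteq> G \<and> length ys = p - 1}"
  \<comment> \<open>The first entry of such a tuple is the inverse of the product of the others,
    which are arbitrary.\<close>
  have X_eq: "X = (\<lambda>ys. inv (pr ys) # ys) ` Y"
  proof (intro equalityI subsetI)
    fix xs assume xs: "xs \<in> X"
    then obtain y ys where y: "xs = y # ys" unfolding X_def using p1 by (cases xs) auto
    have yG: "y \<in> G" "set ys \<subseteq> G" using xs y unfolding X_def by auto
    have "y \<circ> pr ys = id" using xs y pr_Cons unfolding X_def by simp
    then have "y \<circ> (pr ys \<circ> inv (pr ys)) = inv (pr ys)" unfolding comp_assoc[symmetric] by simp
    then have "y = inv (pr ys)" using prG[OF yG(2)] by simp
    then show "xs \<in> (\<lambda>ys. inv (pr ys) # ys) ` Y" using y xs yG unfolding Y_def X_def by auto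
  next
    fix xs assume "xs \<in> (\<lambda>ys. inv (pr ys) # ys) ` Y"
    then show "xs \<in> X" unfolding X_def Y_def using p1 prG inv by (auto simp: pr_Cons)
  qed
  have "card X = card Y" unfolding X_eq by (rule card_image) (auto simp: inj_on_def)
  also have "\<dots> = card G ^ (p - 1)" unfolding Y_def by (rule card_lists_length_eq[OF finG])
  finally have cX: "card X = card G ^ (p - 1)" .
  have "card G dvd card G ^ (p - 1)" using p1 by (intro dvd_power) simp
  then have pX: "p dvd card X" using assms(2) cX by (metis dvd_trans)
  have finX: "finite X" unfolding X_eq Y_def using finite_lists_length_eq[OF finG] by simp
  have rot: "rotate1 ` X \<subseteq> X"
  proof
    fix zs assume "zs \<in> rotate1 ` X"
    then obtain xs where xs: "xs \<in> X" "zs = rotate1 xs" by auto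
    then obtain y ys where y: "xs = y # ys" unfolding X_def using p1 by (cases xs) auto
    have yG: "y \<in> G" "set ys \<subseteq> G" using xs y unfolding X_def by auto
    have e: "y \<circ> pr ys = id" using xs y pr_Cons unfolding X_def by simp
    then have "inv y \<circ> (y \<circ> pr ys) = inv y" by simp
    then have "pr ys = inv y" using yG unfolding comp_assoc[symmetric] by simp
    then have "pr ys \<circ> y = id" using yG by simp
    then show "zs \<in> X" using xs y unfolding X_def by (auto simp: pr_snoc)
  qed
  have "p dvd card {x \<in> X. rotate1 x \<noteq> x}"
    using finX assms(1) rot
  proof (rule prime_cong_card_fixpoints)
    fix x assume "x \<in> X"
    then have "rotate p x = x" unfolding X_def by (auto intro: rotate_id)
    then show "(rotate1 ^^ p) x = x" by (simp add: rotate_def)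
  qed
  moreover have "card X = card {x \<in> X. rotate1 x \<noteq> x} + card {x \<in> X. rotate1 x = x}"
  proof -
    have "X = {x \<in> X. rotate1 x \<noteq> x} \<union> {x \<in> X. rotate1 x = x}" by blast
    then show ?thesis using card_Un_disjoint[of "{x \<in> X. rotate1 x \<noteq> x}" "{x \<in> X. rotate1 x = x}"] finX
      by fastforce
  qed
  ultimately have "p dvd card {x \<in> X. rotate1 x = x}" using pX by (simp add: dvd_add_right_iff)
  have pr_rep: "pr (replicate k x) = x ^^ k" for k x
    by (induction k) (simp_all add: pr_def)
  have idr: "replicate p id \<in> {x \<in> X. rotate1 x = x}"
    unfolding X_def using one p1 by (auto simp: pr_rep rotate1_replicate)
  have "card {x \<in> X. rotate1 x = x} \<noteq> 1"
    using \<open>p dvd card {x \<in> X. rotate1 x = x}\<close> p1 by auto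
  then obtain xs where xs: "xs \<in> X" "rotate1 xs = xs" "xs \<noteq> replicate p id"
    using idr by (metis (mono_tags, lifting) is_singletonI' is_singleton_altdef mem_Collect_eq empty_iff)
  have rk: "rotate k xs = xs" for k using xs(2) by (induction k) (auto simp: rotate_def)
  have nth: "xs ! k = xs ! 0" if "k < p" for k
  proof -
    have "xs \<noteq> []" "k < length xs" using that xs(1) unfolding X_def by auto
    then have "rotate k xs ! 0 = xs ! (k mod length xs)" by (subst nth_rotate) auto
    then show ?thesis using rk[of k] \<open>k < length xs\<close> by simp
  qed
  have "xs = replicate p (xs ! 0)"
  proof (rule nth_equalityI)
    show "length xs = length (replicate p (xs ! 0))" using xs(1) unfolding X_def by simp
    fix i assume "i < length xs"
    then have "i < p" using xs(1) unfolding X_def by simp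
    then show "xs ! i = replicate p (xs ! 0) ! i" using nth[of i] by simp
  qed
  moreover have "xs ! 0 \<in> G"
  proof -
    have "xs ! 0 \<in> set xs" using xs(1) p1 unfolding X_def by (intro nth_mem) auto
    then show ?thesis using xs(1) unfolding X_def by auto
  qed
  moreover have "pr xs = id" using xs(1) unfolding X_def by simp
  ultimately show ?thesis using that[of "xs ! 0"] xs(3) pr_rep by metis
qed

section \<open>Subsets moved transitively by elements that fix the complement\<close>

definition fixer :: "'a set \<Rightarrow> ('a \<Rightarrow> 'a) set" where
  "fixer D = {g \<in> G. \<forall>x. x \<notin> D \<longrightarrow> g x = x}"

text \<open>Sets of this kind are what Jordan's argument enlarges: it starts from the support of a
  cycle and adds one point at a time.\<close>

definition transitive_fixer :: "'a set \<Rightarrow> bool" where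
  "transitive_fixer D \<longleftrightarrow> D \<subseteq> S \<and> (\<forall>x\<in>D. \<forall>y\<in>D. \<exists>g\<in>fixer D. g x = y)"

lemma fixerD: "g \<in> fixer D \<Longrightarrow> g \<in> G" "g \<in> fixer D \<Longrightarrow> x \<notin> D \<Longrightarrow> g x = x"
  unfolding fixer_def by auto

lemma fixer_comp: "g \<in> fixer D \<Longrightarrow> h \<in> fixer D \<Longrightarrow> g \<circ> h \<in> fixer D"
  unfolding fixer_def using comp by auto

lemma fixer_inv: "g \<in> fixer D \<Longrightarrow> inv g \<in> fixer D"
  unfolding fixer_def using inv by (auto, metis inv_app(1))

lemma fixer_in: "g \<in> fixer D \<Longrightarrow> g x \<in> D \<longleftrightarrow> x \<in> D"
  by (metis fixerD injG)

lemma fixer_mono: "D \<subseteq> E \<Longrightarrow> fixer D \<subseteq> fixer E" unfolding fixer_def by auto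

lemma fixer_pow: "g \<in> fixer D \<Longrightarrow> g ^^ k \<in> fixer D"
  by (induction k) (auto simp: fixer_comp, auto simp: fixer_def one)

lemma fixer_conj:
  assumes "h \<in> fixer D" "g \<in> G" shows "g \<circ> h \<circ> inv g \<in> fixer (g ` D)"
proof -
  have "(g \<circ> h \<circ> inv g) x = x" if "x \<notin> g ` D" for x
  proof -
    have "inv g x \<notin> D"
    proof
      assume "inv g x \<in> D"
      then have "g (inv g x) \<in> g ` D" by (rule imageI)
      then show False using that assms(2) by simp
    qed
    then show ?thesis using assms(2) fixerD(2)[OF assms(1)] by simp
  qed
  then show ?thesis unfolding fixer_def using assms fixerD(1) comp inv by simp
qed

lemma transitive_fixer_conj:
  assumes "transitive_fixer D" "g \<in> G" shows "transitive_fixer (g ` D)"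
  unfolding transitive_fixer_def
proof (intro conjI ballI)
  show "g ` D \<subseteq> S" using assms imgG unfolding transitive_fixer_def by blast
  fix x y assume "x \<in> g ` D" "y \<in> g ` D"
  then obtain a b where ab: "a \<in> D" "b \<in> D" "x = g a" "y = g b" by auto
  obtain h where h: "h \<in> fixer D" "h a = b" using assms(1) ab unfolding transitive_fixer_def by blast
  have "(g \<circ> h \<circ> inv g) x = y" using ab h assms(2) by simp
  then show "\<exists>k\<in>fixer (g ` D). k x = y" using fixer_conj[OF h(1) assms(2)] by blast
qed

lemma transitive_fixer_Un:
  assumes "transitive_fixer A" "transitive_fixer B" "A \<inter> B \<noteq> {}" shows "transitive_fixer (A \<union> B)"
proof -
  obtain z where z: "z \<in> A" "z \<in> B" using assms(3) by auto
  have F: "fixer A \<subseteq> fixer (A \<union> B)" "fixer B \<subseteq> fixer (A \<union> B)" by (simp_all add: fixer_mono)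
  have "\<exists>g\<in>fixer (A \<union> B). g x = z" if "x \<in> A \<union> B" for x
    using that assms(1,2) z F unfolding transitive_fixer_def by blast
  moreover have "\<exists>g\<in>fixer (A \<union> B). g z = x" if "x \<in> A \<union> B" for x
    using that assms(1,2) z F unfolding transitive_fixer_def by blast
  ultimately have "\<exists>g\<in>fixer (A \<union> B). g x = y" if "x \<in> A \<union> B" "y \<in> A \<union> B" for x y
    using that by (metis comp_apply fixer_comp)
  then show ?thesis using assms(1,2) unfolding transitive_fixer_def by blast
qed

end

section \<open>Jordan's theorem on multiple transitivity\<close>

locale cycle_group = perm_group S G for S :: "'a set" and G +
  fixes c C p
  assumes trans: "x \<in> S \<Longrightarrow> y \<in> S \<Longrightarrow> \<exists>g\<in>G. g x = y"
    and cG: "c \<in> G" and prime: "prime p" and cyc: "is_cycle p c C" and CS: "C \<subseteq> S"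
    and large: "card S < 2 * p"
begin

lemma p1: "p > 1" using prime prime_gt_1_nat by blast
lemma p0: "p > 0" using p1 by simp

lemma cardC: "card C = p" using is_cycle_card[OF cyc] .

lemma c_fixer: "c \<in> fixer C"
  unfolding fixer_def using cG cyc by (auto simp: is_cycle_def)

lemma transitive_fixer_C: "transitive_fixer C"
  unfolding transitive_fixer_def
proof (intro conjI ballI CS)
  fix x y assume "x \<in> C" "y \<in> C"
  then obtain i where "(c ^^ i) x = y" using is_cycle_funpow_trans[OF cyc p0] by metis
  then show "\<exists>g\<in>fixer C. g x = y" using fixer_pow[OF c_fixer] by blast
qed

text \<open>A block meeting the support \<open>C'\<close> of a conjugate of \<open>c\<close> cannot
  leave it: a point outside is fixed by \<open>c'\<close>, so the powers of \<open>c'\<close>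
  preserve the block, which would then contain all of \<open>C'\<close> although it has fewer than
  \<open>p\<close> elements. Inside \<open>C'\<close> two points of the block are joined by a power
  of \<open>c'\<close>, and this power again sweeps out \<open>C'\<close>.\<close>

lemma block_trivial:
  assumes "transitive_fixer \<Delta>" "g \<in> G" "g ` C \<subseteq> \<Delta>" "D \<subseteq> \<Delta>" "D \<noteq> {}" "card D < p"
    "\<And>h. h \<in> fixer \<Delta> \<Longrightarrow> h ` D = D \<or> h ` D \<inter> D = {}"
  shows "card D = 1"
proof -
  define c' where "c' = g \<circ> c \<circ> inv g"
  define C' where "C' = g ` C"
  have cyc': "is_cycle p c' C'" unfolding c'_def C'_def using is_cycle_conj[OF cyc bijG[OF assms(2)]] .
  have c'f: "c' ^^ i \<in> fixer \<Delta>" for i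
    using fixer_pow[OF fixer_conj[OF c_fixer assms(2)]] fixer_mono[OF assms(3)] unfolding c'_def C'_def by blast
  have finD: "finite D" using assms(1,4) fin unfolding transitive_fixer_def by (meson finite_subset)
  have "C' \<noteq> {}" using is_cycle_card[OF cyc'] p0 by auto
  then obtain x where x: "x \<in> C'" by auto
  obtain d where d: "d \<in> D" using assms(5) by auto
  obtain h where h: "h \<in> fixer \<Delta>" "h d = x"
    using assms(1,3,4) d x unfolding transitive_fixer_def C'_def by (meson subsetD)
  define E where "E = h ` D"
  have cE: "card E = card D" unfolding E_def using cardG fixerD(1)[OF h(1)] by simp
  have finE: "finite E" unfolding E_def using finD by simp
  have xE: "x \<in> E" unfolding E_def using d h by auto
  have blE: "k ` E = E" if k: "k \<in> fixer \<Delta>" and ne: "k ` E \<inter> E \<noteq> {}" for k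
  proof -
    have hG: "h \<in> G" using fixerD h by blast
    define k' where "k' = inv h \<circ> k \<circ> h"
    have k': "k' \<in> fixer \<Delta>" unfolding k'_def using fixer_comp fixer_inv h(1) k by blast
    have hk: "h (k' y) = k (h y)" for y unfolding k'_def using hG by simp
    obtain u v where uv: "u \<in> D" "v \<in> D" "k (h u) = h v" using ne unfolding E_def by auto
    then have "h (k' u) = h v" using hk by simp
    then have "k' u = v" using injG[OF hG] by simp
    then have "k' ` D \<inter> D \<noteq> {}" using uv by auto
    then have "k' ` D = D" using assms(7)[OF k'] by blast
    then have "h ` k' ` D = h ` D" by simp
    then show ?thesis unfolding E_def image_image hk .
  qed
  have CE: "\<not> C' \<subseteq> E"
  proof
    assume "C' \<subseteq> E"
    from card_mono[OF finE this] show False using is_cycle_card[OF cyc'] cE assms(6) by linarith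
  qed
  have "E \<subseteq> C'"
  proof (rule ccontr)
    assume "\<not> E \<subseteq> C'"
    then obtain y where y: "y \<in> E" "y \<notin> C'" by auto
    have "(c' ^^ i) y = y" for i using y(2) is_cycle_ex[OF cyc' p0] by blast
    then have "(c' ^^ i) ` E \<inter> E \<noteq> {}" for i using y(1) by (metis disjoint_iff imageI)
    then have e: "(c' ^^ i) ` E = E" for i using blE[OF c'f] by blast
    have "C' \<subseteq> E"
    proof
      fix z assume "z \<in> C'"
      then obtain i where "(c' ^^ i) x = z" using is_cycle_funpow_trans[OF cyc' p0 x] by metis
      then show "z \<in> E" using e xE by blast
    qed
    then show False using CE by simp
  qed
  have "E = {x}"
  proof (rule ccontr)
    assume "E \<noteq> {x}"
    then obtain y where y: "y \<in> E" "y \<noteq> x" using xE by auto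
    then have "y \<in> C'" using \<open>E \<subseteq> C'\<close> by auto
    then obtain i where i: "(c' ^^ i) x = y" using is_cycle_funpow_trans[OF cyc' p0 x] by metis
    then have "y \<in> (c' ^^ i) ` E \<inter> E" using xE y by auto
    then have e: "(c' ^^ i) ` E = E" using blE[OF c'f] by blast
    have e': "((c' ^^ i) ^^ k) x \<in> E" for k
      by (induction k) (use xE e in auto)
    have "C' \<subseteq> E"
    proof
      fix z assume "z \<in> C'"
      then obtain k where "((c' ^^ i) ^^ k) x = z"
        using is_cycle_gen[OF cyc' prime x] i y(2) by metis
      then show "z \<in> E" using e' by blast
    qed
    then show False using CE by simp
  qed
  then show ?thesis using cE by simp
qed

text \<open>Among the elements that move \<Delta> out of itself take one for which the part of the
  image outside \<Delta> is smallest. Minimality makes this overhang a block for the fixer of the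
  image; it has fewer than \<open>p\<close> points because \<open>card S < 2 * p\<close>, so
  \<open>block_trivial\<close> leaves a single point.\<close>

lemma transitive_fixer_extend:
  assumes "transitive_fixer \<Delta>" "C \<subseteq> \<Delta>" "\<Delta> \<noteq> S"
  obtains y where "y \<in> S" "y \<notin> \<Delta>" "transitive_fixer (insert y \<Delta>)"
proof -
  have DS: "\<Delta> \<subseteq> S" using assms(1) unfolding transitive_fixer_def by simp
  have finD: "finite \<Delta>" using DS fin finite_subset by blast
  have pD: "p \<le> card \<Delta>" using card_mono[OF finD assms(2)] cardC by simp
  define M where "M = {g \<in> G. \<not> g ` \<Delta> \<subseteq> \<Delta>}"
  have "C \<noteq> {}" using cardC p0 by auto
  then obtain x where x: "x \<in> C" by auto
  obtain y where y: "y \<in> S" "y \<notin> \<Delta>" using DS assms(3) by auto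
  obtain g0 where "g0 \<in> G" "g0 x = y" using trans x y CS by blast
  then have "g0 \<in> M" unfolding M_def using x y assms(2) by auto
  then obtain g where g: "g \<in> M" "\<And>h. h \<in> M \<Longrightarrow> card (g ` \<Delta> - \<Delta>) \<le> card (h ` \<Delta> - \<Delta>)"
    using ex_has_least_nat[of "\<lambda>h. h \<in> M" g0 "\<lambda>h. card (h ` \<Delta> - \<Delta>)"] by blast
  have gG: "g \<in> G" using g(1) unfolding M_def by simp
  define D where "D = g ` \<Delta> - \<Delta>"
  have Dne: "D \<noteq> {}" using g(1) unfolding M_def D_def by auto
  have finD': "finite D" unfolding D_def using finD by simp
  have gDS: "g ` \<Delta> \<subseteq> S" using imgG[OF gG DS] .
  have cg: "card (g ` \<Delta>) = card \<Delta>" using cardG[OF gG] .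
  have "card D \<le> card (S - \<Delta>)" unfolding D_def by (rule card_mono) (use fin gDS in auto)
  also have "\<dots> = card S - card \<Delta>" using card_Diff_subset[OF finD DS] .
  finally have cD: "card D < p" using pD large by linarith
  have "card D = 1"
  proof (rule block_trivial[OF transitive_fixer_conj[OF assms(1) gG] gG _ _ Dne cD])
    show "g ` C \<subseteq> g ` \<Delta>" using assms(2) by auto
    show "D \<subseteq> g ` \<Delta>" unfolding D_def by auto
    fix h assume h: "h \<in> fixer (g ` \<Delta>)"
    have hG: "h \<in> G" using fixerD h by blast
    show "h ` D = D \<or> h ` D \<inter> D = {}"
    proof (rule ccontr)
      assume a: "\<not> (h ` D = D \<or> h ` D \<inter> D = {})"
      have hgD: "h y \<in> g ` \<Delta> \<longleftrightarrow> y \<in> g ` \<Delta>" for y using fixer_in[OF h] .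
      \<comment> \<open>Since \<open>h\<close> is the identity outside the image of \<Delta> under
        \<open>g\<close>, its own overhang lies in \<open>D\<close>. If \<open>h\<close> neither
        preserves \<open>D\<close> nor moves it off itself, this overhang is non-empty and smaller
        than \<open>D\<close>, against the choice of \<open>g\<close>.\<close>
      have e: "h ` \<Delta> - \<Delta> = D - h ` D"
      proof (intro equalityI subsetI)
        fix z assume z: "z \<in> h ` \<Delta> - \<Delta>"
        then obtain u where u: "u \<in> \<Delta>" "z = h u" by auto
        have "u \<in> g ` \<Delta>" using u z fixerD(2)[OF h, of u] by (cases "u \<in> g ` \<Delta>") auto
        then have "z \<in> g ` \<Delta>" using hgD u by auto
        moreover have "z \<notin> h ` D"
        proof
          assume "z \<in> h ` D"
          then obtain v where "v \<in> D" "h v = h u" using u by auto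
          then show False using u injG[OF hG] unfolding D_def by auto
        qed
        ultimately show "z \<in> D - h ` D" using z unfolding D_def by auto
      next
        fix z assume z: "z \<in> D - h ` D"
        define u where "u = inv h z"
        have zu: "z = h u" unfolding u_def using hG by simp
        have "u \<in> g ` \<Delta>" using hgD[of u] z zu unfolding D_def by auto
        moreover have "u \<notin> D" using z zu by auto
        ultimately have "u \<in> \<Delta>" unfolding D_def by auto
        then show "z \<in> h ` \<Delta> - \<Delta>" using zu z unfolding D_def by auto
      qed
      have chD: "card (h ` D) = card D" using cardG[OF hG] .
      have "\<not> D \<subseteq> h ` D" using card_subset_eq[of "h ` D" D] chD a finD' by auto
      then have "h ` \<Delta> - \<Delta> \<noteq> {}" unfolding e by blast
      then have "h \<in> M" unfolding M_def using hG by blast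
      then have "card D \<le> card (D - h ` D)" using g(2) e unfolding D_def by metis
      moreover have "D - h ` D \<subset> D" using a by auto
      ultimately show False using psubset_card_mono[OF finD', of "D - h ` D"] by linarith
    qed
  qed
  then obtain z where z: "D = {z}" by (metis card_1_singletonE)
  have "\<Delta> \<inter> g ` \<Delta> \<noteq> {}"
  proof
    assume "\<Delta> \<inter> g ` \<Delta> = {}"
    then have "D = g ` \<Delta>" unfolding D_def by auto
    then have "card \<Delta> = card {z}" using cg z by metis
    then show False using pD p1 by simp
  qed
  then have "transitive_fixer (\<Delta> \<union> g ` \<Delta>)" by (rule transitive_fixer_Un[OF assms(1) transitive_fixer_conj[OF assms(1) gG]])
  moreover have "\<Delta> \<union> g ` \<Delta> = insert z \<Delta>" using z unfolding D_def by auto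
  moreover have "z \<in> S" "z \<notin> \<Delta>" using z gDS unfolding D_def by auto
  ultimately show ?thesis using that by metis
qed

text \<open>Points outside \<Delta> are prescribed one after the other. If \<open>g\<close> realises
  \<open>f\<close> on all of them but \<open>y\<close>, the preimage of \<open>f y\<close> under
  \<open>g\<close> lies in \<open>insert y \<Delta>\<close>, and the transitive fixer of that set
  moves \<open>y\<close> there without disturbing the other points. For \<open>\<Delta> = C\<close>
  the group realises every injection on the complement of the cycle.\<close>

lemma extend_injection_fixer:
  assumes "transitive_fixer \<Delta>" "C \<subseteq> \<Delta>" "inj_on f (S - \<Delta>)" "f ` (S - \<Delta>) \<subseteq> S"
  shows "\<exists>g\<in>G. \<forall>x\<in>S - \<Delta>. g x = f x"
  using assms
proof (induction "card (S - \<Delta>)" arbitrary: \<Delta> rule: less_induct)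
  case less
  show ?case
  proof (cases "\<Delta> = S")
    case True then show ?thesis using one by auto
  next
    case False
    obtain y where y: "y \<in> S" "y \<notin> \<Delta>" "transitive_fixer (insert y \<Delta>)"
      using transitive_fixer_extend[OF less.prems(1,2) False] by blast
    have sub: "S - insert y \<Delta> \<subseteq> S - \<Delta>" by auto
    have "card (S - insert y \<Delta>) < card (S - \<Delta>)"
      by (rule psubset_card_mono) (use fin y in auto)
    then have "\<exists>g\<in>G. \<forall>x\<in>S - insert y \<Delta>. g x = f x"
    proof (rule less.hyps)
      show "transitive_fixer (insert y \<Delta>)" "C \<subseteq> insert y \<Delta>" using y(3) less.prems(2) by auto
      show "inj_on f (S - insert y \<Delta>)" using less.prems(3) sub by (rule inj_on_subset)
      show "f ` (S - insert y \<Delta>) \<subseteq> S" using less.prems(4) sub by blast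
    qed
    then obtain g where g: "g \<in> G" "\<And>x. x \<in> S - insert y \<Delta> \<Longrightarrow> g x = f x" by blast
    have "f y \<in> S" using less.prems(4) y by auto
    then have w: "inv g (f y) \<in> S" using inG[OF inv[OF g(1)]] by simp
    have "inv g (f y) \<in> insert y \<Delta>"
    proof (rule ccontr)
      assume a: "inv g (f y) \<notin> insert y \<Delta>"
      then have "f (inv g (f y)) = f y" using g(2)[of "inv g (f y)"] w g(1) by simp
      then have "inv g (f y) = y" using less.prems(3) a w y unfolding inj_on_def by auto
      then show False using a by simp
    qed
    then obtain h where h: "h \<in> fixer (insert y \<Delta>)" "h y = inv g (f y)"
      using y(3) unfolding transitive_fixer_def by blast
    have "(g \<circ> h) x = f x" if "x \<in> S - \<Delta>" for x
    proof (cases "x = y")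
      case True then show ?thesis using h g(1) by simp
    next
      case False then show ?thesis using that g(2) fixerD(2)[OF h(1)] by simp
    qed
    moreover have "g \<circ> h \<in> G" using comp g(1) fixerD(1) h(1) by blast
    ultimately show ?thesis by blast
  qed
qed

lemmas extend_injection = extend_injection_fixer[OF transitive_fixer_C subset_refl]

text \<open>One point \<open>u\<close> outside \<open>C\<close> is enough: an injection on
  \<open>S - C\<close> controls its image. A second point \<open>v\<close> in \<open>C\<close> is
  corrected by an element of the fixer of \<open>C\<close>, which leaves \<open>u\<close>
  alone.\<close>

lemma two_transitive:
  assumes "C \<noteq> S" "a \<in> S" "b \<in> S" "x \<in> S" "y \<in> S" "a \<noteq> b" "x \<noteq> y"
  shows "\<exists>g\<in>G. g a = x \<and> g b = y"
proof -
  obtain u where u: "u \<in> S" "u \<notin> C" using assms(1) CS by auto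
  obtain v where v: "v \<in> S" "v \<noteq> u" "v \<in> C \<or> C = S - {u} \<or> v \<notin> C" using assms by metis
  have main: "\<exists>g\<in>G. g u = a \<and> g v = b" if ab: "a \<in> S" "b \<in> S" "a \<noteq> b" "v \<in> S" "v \<noteq> u" for a b v
  proof -
    define t where "t = transpose u a"
    define f where "f = transpose (t v) b \<circ> t"
    have f: "f permutes S" unfolding f_def t_def
      by (intro permutes_compose permutes_swap_id) (use ab u in \<open>auto simp: transpose_def\<close>)
    have fu: "f u = a" "f v = b" unfolding f_def t_def using ab by (auto simp: transpose_def)
    have "inj_on f (S - C)" using permutes_inj_on[OF f] .
    moreover have "f ` (S - C) \<subseteq> S" using permutes_in_image[OF f] by auto
    ultimately have "\<exists>g\<in>G. \<forall>x\<in>S - C. g x = f x" by (rule extend_injection)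
    then obtain g where g: "g \<in> G" "\<And>x. x \<in> S - C \<Longrightarrow> g x = f x" by blast
    have gu: "g u = a" using g(2)[of u] fu u by simp
    define w where "w = inv g b"
    have gw: "g w = b" unfolding w_def using g(1) by simp
    have wS: "w \<in> S" unfolding w_def using inG[OF inv[OF g(1)]] ab by simp
    show ?thesis
    proof (cases "v \<in> C")
      case False
      then have "g v = b" using g(2)[of v] fu ab by simp
      then show ?thesis using g(1) gu by auto
    next
      case True
      have "w \<in> C"
      proof (rule ccontr)
        assume wC: "w \<notin> C"
        then have "f w = b" using g(2)[of w] gw wS by simp
        then have "f w = f v" using fu by simp
        then have "w = v" using permutes_inj[OF f] by (meson injD)
        then show False using wC True by simp
      qed
      then obtain k where k: "k \<in> fixer C" "k v = w" using transitive_fixer_C True unfolding transitive_fixer_def by blast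
      have "(g \<circ> k) u = a" "(g \<circ> k) v = b" using k fixerD(2)[OF k(1)] u gu gw by auto
      then show ?thesis using comp[OF g(1) fixerD(1)[OF k(1)]] by blast
    qed
  qed
  obtain g1 where g1: "g1 \<in> G" "g1 u = a" "g1 v = b" using main assms v by metis
  obtain g2 where g2: "g2 \<in> G" "g2 u = x" "g2 v = y" using main assms v by metis
  have "(g2 \<circ> inv g1) a = x" "(g2 \<circ> inv g1) b = y" using g1 g2 by auto
  then show ?thesis using comp[OF g2(1) inv[OF g1(1)]] by blast
qed

end

section \<open>Generation of the alternating group by 3-cycles\<close>

context perm_group
begin

definition cyc3_in where "cyc3_in x y z \<longleftrightarrow> x \<in> S \<and> y \<in> S \<and> z \<in> S \<and> x \<noteq> y \<and> y \<noteq> z \<and> x \<noteq> z \<and> cyc3 x y z \<in> G"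

lemma cyc3_in_rot: "cyc3_in x y z \<Longrightarrow> cyc3_in y z x" unfolding cyc3_in_def using cyc3_rot by metis

lemma cyc3_in_swap: "cyc3_in x y z \<Longrightarrow> cyc3_in x z y"
  unfolding cyc3_in_def using cyc3_sq comp by metis

lemma cyc3_in_conj:
  assumes "cyc3_in x y z" "g \<in> G" shows "cyc3_in (g x) (g y) (g z)"
proof -
  have "cyc3 (g x) (g y) (g z) \<in> G" unfolding cyc3_conj[OF bijG[OF assms(2)], symmetric]
    using assms comp inv unfolding cyc3_in_def by blast
  then show ?thesis using assms unfolding cyc3_in_def by (simp add: injG[OF assms(2)] inG[OF assms(2)])
qed

lemma cyc3_in_conj3: "cyc3_in x y z \<Longrightarrow> cyc3_in a b d \<Longrightarrow> cyc3_in (cyc3 a b d x) (cyc3 a b d y) (cyc3 a b d z)"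
  using cyc3_in_conj unfolding cyc3_in_def by blast

text \<open>Conjugation by the 3-cycles supported in \<open>D\<close> moves \<open>x\<close> and
  \<open>z\<close> to any other pair of points of \<open>D\<close> and keeps
  \<open>y\<close>.\<close>

lemma cyc3_in_extend:
  assumes "\<And>u v w. u \<in> D \<Longrightarrow> v \<in> D \<Longrightarrow> w \<in> D \<Longrightarrow> u \<noteq> v \<Longrightarrow> v \<noteq> w \<Longrightarrow> u \<noteq> w \<Longrightarrow> cyc3_in u v w"
    and xz: "x \<in> D" "z \<in> D" "y \<notin> D" "cyc3_in x z y"
    and uv: "u \<in> D" "v \<in> D" "u \<noteq> v"
  shows "cyc3_in u v y"
proof -
  have ne: "x \<noteq> z" "x \<noteq> y" "z \<noteq> y" using xz(4) unfolding cyc3_in_def by auto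
  have one: "cyc3_in z u y \<and> cyc3_in x u y" if "u \<in> D" "u \<noteq> x" "u \<noteq> z" for u
  proof -
    have t: "cyc3_in x z u" using assms(1) that xz ne by auto
    have uy: "u \<noteq> y" using that xz by auto
    have "cyc3_in z u y" using cyc3_in_conj3[OF xz(4) t] cyc3_apply[of x z u] ne that uy by simp
    moreover from this have "cyc3_in u x y" using cyc3_in_conj3[OF _ t, of z u y] cyc3_apply[of x z u] ne that uy by simp
    ultimately show ?thesis using cyc3_in_rot cyc3_in_swap by blast
  qed
  consider "u = x" "v = z" | "u = z" "v = x" | "u = x" "v \<noteq> z" | "u = z" "v \<noteq> x" | "u \<noteq> x" "u \<noteq> z" "v = x" | "u \<noteq> x" "u \<noteq> z" "v = z"
    | "u \<noteq> x" "u \<noteq> z" "v \<noteq> x" "v \<noteq> z" by blast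
  then show ?thesis
  proof cases
    case 7
    have t: "cyc3_in z u v" using assms(1) uv xz 7 by auto
    have "cyc3_in z u y" using one uv 7 by auto
    moreover have "u \<noteq> y" "v \<noteq> y" using uv xz by auto
    ultimately show ?thesis using cyc3_in_conj3[OF _ t, of z u y] cyc3_apply[of z u v] 7 uv ne by simp
  qed (use one[of u] one[of v] uv xz cyc3_in_rot cyc3_in_swap in blast)+
qed

text \<open>Take a largest \<open>D\<close> all of whose 3-cycles are present. For \<open>y\<close>
  outside \<open>D\<close>, two-transitivity conjugates the given 3-cycle into one through
  \<open>a\<close> and \<open>y\<close>. From it a 3-cycle with two points in \<open>D\<close> and
  third point \<open>y\<close> is made, and \<open>cyc3_in_extend\<close> enlarges
  \<open>D\<close>.\<close>

lemma cyc3_in_all_of_two_transitive: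
  assumes two: "\<And>a b x y. a \<in> S \<Longrightarrow> b \<in> S \<Longrightarrow> x \<in> S \<Longrightarrow> y \<in> S \<Longrightarrow> a \<noteq> b \<Longrightarrow> x \<noteq> y \<Longrightarrow> \<exists>g\<in>G. g a = x \<and> g b = y"
    and T0: "cyc3_in a b d" and xyz: "x \<in> S" "y \<in> S" "z \<in> S" "x \<noteq> y" "y \<noteq> z" "x \<noteq> z"
  shows "cyc3_in x y z"
proof -
  have pair: "\<exists>z. cyc3_in x y z" if "x \<in> S" "y \<in> S" "x \<noteq> y" for x y
    using two[of a b x y] cyc3_in_conj[OF T0] T0 that unfolding cyc3_in_def by metis
  define P where "P D \<longleftrightarrow> D \<subseteq> S \<and> {a, b, d} \<subseteq> D \<and>
    (\<forall>u\<in>D. \<forall>v\<in>D. \<forall>w\<in>D. u \<noteq> v \<longrightarrow> v \<noteq> w \<longrightarrow> u \<noteq> w \<longrightarrow> cyc3_in u v w)" for D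
  have "P {a, b, d}" unfolding P_def using T0 cyc3_in_rot cyc3_in_swap unfolding cyc3_in_def by blast
  moreover have "\<forall>D. P D \<longrightarrow> card D < Suc (card S)"
    unfolding P_def using card_mono[OF fin] by (simp add: le_imp_less_Suc)
  ultimately obtain D where D: "P D" "\<And>E. P E \<Longrightarrow> card E \<le> card D"
    using ex_has_greatest_nat[of P "{a, b, d}" card "Suc (card S)"] by blast
  have DS: "D \<subseteq> S" using D unfolding P_def by simp
  have finD: "finite D" using DS fin finite_subset by blast
  have DT: "\<And>u v w. u \<in> D \<Longrightarrow> v \<in> D \<Longrightarrow> w \<in> D \<Longrightarrow> u \<noteq> v \<Longrightarrow> v \<noteq> w \<Longrightarrow> u \<noteq> w \<Longrightarrow> cyc3_in u v w"
    using D(1) unfolding P_def by blast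
  have "D = S"
  proof (rule ccontr)
    assume "D \<noteq> S"
    then obtain y where y: "y \<in> S" "y \<notin> D" using DS by auto
    have abd: "a \<in> D" "b \<in> D" "d \<in> D" "a \<noteq> b" "b \<noteq> d" "a \<noteq> d" using D(1) T0 unfolding P_def cyc3_in_def by auto
    have "\<exists>u v. u \<in> D \<and> v \<in> D \<and> cyc3_in u v y"
    proof -
      obtain z where z: "cyc3_in a y z" using pair abd y DS by blast
      show ?thesis
      proof (cases "z \<in> D")
        case True
        then show ?thesis using z abd cyc3_in_rot cyc3_in_swap by blast
      next
        case False
        have zn: "b \<noteq> y" "d \<noteq> y" "b \<noteq> z" "d \<noteq> z" using abd y False by auto
        have zz: "a \<noteq> y" "y \<noteq> z" "a \<noteq> z" using z unfolding cyc3_in_def by auto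
        \<comment> \<open>Conjugation by \<open>cyc3 a y z\<close> replaces \<open>a\<close> by
          \<open>y\<close> and fixes \<open>b\<close> and \<open>d\<close>.\<close>
        have "cyc3_in b d a" using DT abd by metis
        from cyc3_in_conj3[OF this z] have "cyc3_in b d y"
          using cyc3_apply(1)[OF zz] cyc3_apply(4)[OF zz, of b] cyc3_apply(4)[OF zz, of d] zn abd by simp
        then show ?thesis using abd by blast
      qed
    qed
    then obtain u v where uv: "u \<in> D" "v \<in> D" "cyc3_in u v y" by blast
    have ext: "cyc3_in u' v' y" if "u' \<in> D" "v' \<in> D" "u' \<noteq> v'" for u' v'
      using cyc3_in_extend[OF DT uv(1,2) y(2) uv(3) that] by blast
    have "P (insert y D)" unfolding P_def
    proof (intro conjI ballI impI)
      show "insert y D \<subseteq> S" "{a, b, d} \<subseteq> insert y D" using DS y abd by auto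
      fix u v w assume "u \<in> insert y D" "v \<in> insert y D" "w \<in> insert y D" "u \<noteq> v" "v \<noteq> w" "u \<noteq> w"
      then consider "u \<in> D" "v \<in> D" "w \<in> D" | "u = y" "v \<in> D" "w \<in> D" | "v = y" "u \<in> D" "w \<in> D" | "w = y" "v \<in> D" "u \<in> D"
        by blast
      then show "cyc3_in u v w"
        using \<open>u \<noteq> v\<close> \<open>v \<noteq> w\<close> \<open>u \<noteq> w\<close> DT ext cyc3_in_rot by cases metis+
    qed
    then have "card (insert y D) \<le> card D" using D(2) by blast
    then show False using y finD by simp
  qed
  then show ?thesis using DT xyz by simp
qed

text \<open>Composing \<open>q\<close> with a 3-cycle that sends \<open>q x\<close> back to
  \<open>x\<close> and involves a third moved point makes \<open>x\<close> fixed and moves no new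
  point. The third moved point exists because an even permutation is not a transposition.\<close>

theorem even_perm_in_G:
  assumes all: "\<And>x y z. x \<in> S \<Longrightarrow> y \<in> S \<Longrightarrow> z \<in> S \<Longrightarrow> x \<noteq> y \<Longrightarrow> y \<noteq> z \<Longrightarrow> x \<noteq> z \<Longrightarrow> cyc3_in x y z"
    and q: "q permutes S" "evenperm q"
  shows "q \<in> G"
  using q
proof (induction "card {x. q x \<noteq> x}" arbitrary: q rule: less_induct)
  case less
  have sub: "{x. q x \<noteq> x} \<subseteq> S" using less.prems(1) permutes_not_in by fastforce
  then have finM: "finite {x. q x \<noteq> x}" using fin finite_subset by blast
  show ?case
  proof (cases "q = id")
    case True then show ?thesis using one by simp
  next
    case False
    then obtain x where x: "q x \<noteq> x" by (metis eq_id_iff)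
    define y where "y = q x"
    have inj: "\<And>u v. q u = q v \<longleftrightarrow> u = v" using permutes_inj[OF less.prems(1)] by (simp add: inj_eq)
    have xy: "x \<noteq> y" "q y \<noteq> y" using x y_def inj by auto
    have "\<exists>z. z \<noteq> x \<and> z \<noteq> y \<and> q z \<noteq> z"
    proof (rule ccontr)
      assume a: "\<nexists>z. z \<noteq> x \<and> z \<noteq> y \<and> q z \<noteq> z"
      have "q y = x" using a xy inj y_def by metis
      then have "q = transpose x y" using a y_def by (auto simp: fun_eq_iff transpose_def)
      then show False using less.prems(2) xy by (simp add: evenperm_swap)
    qed
    then obtain z where z: "z \<noteq> x" "z \<noteq> y" "q z \<noteq> z" by auto
    have S: "x \<in> S" "y \<in> S" "z \<in> S" using sub x xy z by auto
    have t: "cyc3 y x z \<in> G" using all[of y x z] S z xy unfolding cyc3_in_def by auto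
    define r where "r = cyc3 y x z \<circ> q"
    have ap: "cyc3 y x z y = x" "cyc3 y x z x = z" "cyc3 y x z z = y"
      "\<And>u. u \<noteq> y \<Longrightarrow> u \<noteq> x \<Longrightarrow> u \<noteq> z \<Longrightarrow> cyc3 y x z u = u"
      using cyc3_apply[of y x z] xy z by auto
    have rx: "r x = x" unfolding r_def using ap y_def by simp
    have rS: "{u. r u \<noteq> u} \<subseteq> {u. q u \<noteq> u}"
    proof
      fix u assume u: "u \<in> {u. r u \<noteq> u}"
      show "u \<in> {u. q u \<noteq> u}"
      proof (rule ccontr)
        assume "u \<notin> {u. q u \<noteq> u}"
        then have qu: "q u = u" by simp
        then have "u \<noteq> y" "u \<noteq> x" "u \<noteq> z" using xy x z by auto
        then show False using u qu ap(4) unfolding r_def by simp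
      qed
    qed
    have "{u. r u \<noteq> u} \<subset> {u. q u \<noteq> u}" using rS rx x by auto
    then have lt: "card {u. r u \<noteq> u} < card {u. q u \<noteq> u}" using finM by (rule psubset_card_mono[rotated])
    have rp: "r permutes S" unfolding r_def using permutes_compose less.prems(1) perm[OF t] by blast
    have ev: "evenperm (cyc3 y x z)" unfolding cyc3_def
      using xy z by (simp add: evenperm_comp permutation_swap_id evenperm_swap)
    have "evenperm r" unfolding r_def
      using evenperm_comp ev less.prems(2) permutes_imp_permutation[OF fin] perm[OF t] less.prems(1) by metis
    then have "r \<in> G" using less.hyps[OF lt rp] by simp
    then have "inv (cyc3 y x z) \<circ> r \<in> G" using comp inv t by blast
    moreover have "inv (cyc3 y x z) \<circ> r = q" unfolding r_def using t by (simp add: fun_eq_iff)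
    ultimately show ?thesis by simp
  qed
qed

lemma alternating_subset:
  assumes "\<And>x y z. x \<in> S \<Longrightarrow> y \<in> S \<Longrightarrow> z \<in> S \<Longrightarrow> x \<noteq> y \<Longrightarrow> y \<noteq> z \<Longrightarrow> x \<noteq> z \<Longrightarrow> cyc3_in x y z"
  shows "alternating_group S \<subseteq> G"
  using even_perm_in_G[OF assms] unfolding alternating_group_def by blast

end

context cycle_group
begin

lemma alternating_of_three_cycle:
  assumes "C \<noteq> S" "cyc3 a b d \<in> G" "a \<noteq> b" "b \<noteq> d" "a \<noteq> d"
  shows "alternating_group S \<subseteq> G"
proof (rule alternating_subset)
  have "a \<in> S" "b \<in> S" "d \<in> S"
    using cyc3_apply[OF assms(3-5)] assms(3-5) perm[OF assms(2)] permutes_not_in by metis+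
  then have T0: "cyc3_in a b d" unfolding cyc3_in_def using assms by simp
  fix x y z assume "x \<in> S" "y \<in> S" "z \<in> S" "x \<noteq> y" "y \<noteq> z" "x \<noteq> z"
  then show "cyc3_in x y z"
    by (intro cyc3_in_all_of_two_transitive[OF _ T0] two_transitive[OF assms(1)])
qed

lemma alternating_three:
  assumes "p = 3" "C = S"
  shows "alternating_group S \<subseteq> G"
proof (rule alternating_subset)
  obtain a b d where abd: "a \<noteq> b" "b \<noteq> d" "a \<noteq> d" "C = {a, b, d}" "c = cyc3 a b d"
    using cyc assms(1) is_cycle_3 by metis
  have "cyc3_in a b d" unfolding cyc3_in_def using abd assms(2) cG by auto
  then have all: "cyc3_in a b d" "cyc3_in b d a" "cyc3_in d a b" "cyc3_in a d b" "cyc3_in d b a" "cyc3_in b a d" using cyc3_in_rot cyc3_in_swap by blast+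
  fix x y z assume "x \<in> S" "y \<in> S" "z \<in> S" "x \<noteq> y" "y \<noteq> z" "x \<noteq> z"
  then show "cyc3_in x y z" using all abd(4) assms(2) by auto
qed

end

section \<open>The normaliser of the cycle\<close>

context cycle_group
begin

lemma conj_pow:
  assumes "g \<in> G" shows "g \<circ> (h ^^ k) \<circ> inv g = (g \<circ> h \<circ> inv g) ^^ k"
proof -
  have "g ((h ^^ k) x) = ((g \<circ> h \<circ> inv g) ^^ k) (g x)" for x
  proof (induction k)
    case (Suc k)
    show ?case unfolding funpow.simps comp_apply Suc[symmetric, unfolded comp_apply]
      using assms Suc by (metis inv_app(1) comp_apply)
  qed simp
  from this[of "inv g _"] show ?thesis using assms by (simp add: fun_eq_iff)
qed

lemma cycle_pow_ne: "0 < i \<Longrightarrow> i < p \<Longrightarrow> is_cycle p d C \<Longrightarrow> x \<in> C \<Longrightarrow> (d ^^ i) x \<noteq> x"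
proof
  assume a: "0 < i" "i < p" "is_cycle p d C" "x \<in> C" "(d ^^ i) x = x"
  obtain e where e: "bij_betw e {..<p} C" "\<forall>i k. i < p \<longrightarrow> (d ^^ k) (e i) = e ((i + k) mod p)"
    using is_cycle_ex[OF a(3) p0] by blast
  obtain j where j: "j < p" "x = e j" using a(4) e(1) unfolding bij_betw_def by auto
  then have "e ((j + i) mod p) = e j" using e(2) a(5) by auto
  then have "(j + i) mod p = j" using e(1) j p0 unfolding bij_betw_def inj_on_def by auto
  then show False using a(1,2) j(1) by (auto simp: mod_if split: if_splits)
qed

lemma cycle_pow_inv:
  assumes "0 < i" "i < p"
  obtains k where "[i * k = 1] (mod p)"
proof -
  have "coprime i p" using assms prime by (metis coprime_commute nat_dvd_not_less prime_imp_coprime)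
  then show ?thesis using cong_solve_coprime_nat that by auto
qed

lemma cycle_pow_mod:
  assumes "is_cycle p d C" "[i = j] (mod p)" shows "d ^^ i = d ^^ j"
proof -
  have "d ^^ n = d ^^ (n mod p)" for n
  proof -
    have "d ^^ (p * (n div p) + n mod p) = (d ^^ p) ^^ (n div p) \<circ> d ^^ (n mod p)"
      unfolding funpow_mult[symmetric] funpow_add by simp
    then show ?thesis using is_cycle_funpow_p[OF assms(1) p0] by simp
  qed
  then show ?thesis using assms(2) unfolding cong_def by metis
qed

text \<open>A Sylow argument. Let \<open>X\<close> consist of the conjugates of the non-trivial
  powers of \<open>d\<close>. Conjugation by \<open>d\<close> fixes exactly \<open>p - 1\<close>
  elements of \<open>X\<close>, the powers of \<open>d\<close>, so \<open>card X\<close> is not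
  divisible by \<open>p\<close>. Hence conjugation by \<open>c\<close> also fixes some element of
  \<open>X\<close>; it commutes with \<open>c\<close> and is therefore a power of
  \<open>c\<close>.\<close>

lemma cycles_conj:
  assumes d: "d \<in> fixer C" "is_cycle p d C"
  shows "\<exists>a\<in>fixer C. \<exists>k. a \<circ> d \<circ> inv a = c ^^ k"
proof -
  define X where "X = {a \<circ> (d ^^ i) \<circ> inv a | a i. a \<in> fixer C \<and> 0 < i \<and> i < p}"
  have XF: "x \<in> fixer C" if "x \<in> X" for x
    using that fixer_comp fixer_inv fixer_pow[OF d(1)] unfolding X_def by blast
  have finX: "finite X"
    by (rule finite_subset[OF _ finG]) (use XF fixerD in auto)
  have Xconj: "b \<circ> x \<circ> inv b \<in> X" if bf: "b \<in> fixer C" and xX: "x \<in> X" for b x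
  proof -
    obtain a i where ai: "a \<in> fixer C" "0 < i" "i < p" "x = a \<circ> (d ^^ i) \<circ> inv a"
      using xX unfolding X_def by blast
    have "inv (b \<circ> a) = inv a \<circ> inv b"
      using ai(1) bf fixerD bijG by (intro o_inv_distrib) auto
    then have "b \<circ> x \<circ> inv b = (b \<circ> a) \<circ> (d ^^ i) \<circ> inv (b \<circ> a)"
      unfolding ai(4) by (simp add: comp_assoc)
    then show ?thesis unfolding X_def using ai fixer_comp[OF bf ai(1)] by blast
  qed
  define \<phi> where "\<phi> b x = b \<circ> x \<circ> inv b" for b x :: "'a \<Rightarrow> 'a"
  have phi_dvd: "p dvd card {x \<in> X. \<phi> b x \<noteq> x}" if b: "b \<in> fixer C" "is_cycle p b C" for b
    using finX prime
  proof (rule prime_cong_card_fixpoints)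
    show "\<phi> b ` X \<subseteq> X" unfolding \<phi>_def using Xconj[OF b(1)] by auto
    fix x assume "x \<in> X"
    have bG: "b \<in> G" using b fixerD by blast
    have "(\<phi> b ^^ k) x = (b ^^ k) \<circ> x \<circ> inv (b ^^ k)" for k
    proof (induction k)
      case (Suc k)
      have "inv (b \<circ> b ^^ k) = inv (b ^^ k) \<circ> inv b"
        using bG powG bijG by (intro o_inv_distrib) auto
      then show ?case using Suc unfolding \<phi>_def funpow.simps comp_apply by (metis comp_assoc)
    qed simp
    then show "(\<phi> b ^^ p) x = x" using is_cycle_funpow_p[OF b(2) p0] by simp
  qed
  have "C \<noteq> {}" using cardC p0 by auto
  then obtain x0 where x0: "x0 \<in> C" by auto
  have central: "\<exists>j<p. x = b ^^ j" if b: "b \<in> fixer C" "is_cycle p b C" and x: "x \<in> fixer C" "\<phi> b x = x" for b x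
  proof -
    have bG: "b \<in> G" using b fixerD by blast
    have "b \<circ> x \<circ> (inv b \<circ> b) = x \<circ> b" using x(2) unfolding \<phi>_def by (simp add: comp_assoc[symmetric])
    then have "x \<circ> b = b \<circ> x" using bG by simp
    moreover have "x ` C \<subseteq> C" using fixer_in[OF x(1)] by auto
    ultimately obtain j where j: "j < p" "\<And>y. y \<in> C \<Longrightarrow> x y = (b ^^ j) y"
      using is_cycle_centralizer[OF b(2) p0] by metis
    have "x y = (b ^^ j) y" for y
      using j(2) fixerD(2)[OF x(1)] fixerD(2)[OF fixer_pow[OF b(1)]] by (cases "y \<in> C") auto
    then show ?thesis using j(1) by blast
  qed
  have "{x \<in> X. \<phi> d x = x} = (\<lambda>i. d ^^ i) ` {1..<p}"
  proof (intro equalityI subsetI)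
    fix x assume x: "x \<in> {x \<in> X. \<phi> d x = x}"
    then obtain j where j: "j < p" "x = d ^^ j" using central[OF d] XF by blast
    have "x \<noteq> id"
    proof
      assume "x = id"
      then obtain a i where ai: "a \<in> fixer C" "0 < i" "i < p" "id = a \<circ> (d ^^ i) \<circ> inv a"
        using x unfolding X_def by auto
      have aG: "a \<in> G" using ai fixerD by blast
      have "a ((d ^^ i) (inv a (a x0))) = id (a x0)" using fun_cong[OF ai(4), of "a x0"] by simp
      then have "a ((d ^^ i) x0) = a x0" using aG by simp
      then have "(d ^^ i) x0 = x0" using injG[OF aG] by simp
      then show False using cycle_pow_ne[OF ai(2,3) d(2) x0] by simp
    qed
    then have "j \<noteq> 0" using j by auto
    then show "x \<in> (\<lambda>i. d ^^ i) ` {1..<p}" using j by auto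
  next
    fix x assume "x \<in> (\<lambda>i. d ^^ i) ` {1..<p}"
    then obtain i where "i \<in> {1..<p}" and i3: "x = d ^^ i" by (rule imageE)
    then have i: "0 < i" "i < p" "x = d ^^ i" by simp_all
    have dG: "d \<in> G" using d fixerD by blast
    have "id \<in> fixer C" unfolding fixer_def using one by simp
    then have "x \<in> X" unfolding X_def using i by force
    moreover have "\<phi> d x = x" unfolding \<phi>_def i(3)
    proof -
      have "d \<circ> d ^^ i \<circ> inv d = d ^^ i \<circ> (d \<circ> inv d)"
        by (simp add: fun_eq_iff funpow_swap1)
      then show "d \<circ> d ^^ i \<circ> inv d = d ^^ i" using dG by simp
    qed
    ultimately show "x \<in> {x \<in> X. \<phi> d x = x}" by simp
  qed
  moreover have "card ((\<lambda>i. d ^^ i) ` {1..<p}) = p - 1"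
  proof -
    have "inj_on (\<lambda>i. d ^^ i) {1..<p}"
    proof (rule linorder_inj_onI)
      fix i j assume ij: "i < j" "i \<in> {1..<p}" "j \<in> {1..<p}"
      show "d ^^ i \<noteq> d ^^ j"
      proof
        assume "d ^^ i = d ^^ j"
        then have "d ^^ (p - j) \<circ> d ^^ i = d ^^ (p - j) \<circ> d ^^ j" by simp
        then have "d ^^ (p - j + i) = id"
          unfolding funpow_add[symmetric] using ij is_cycle_funpow_p[OF d(2) p0] by simp
        moreover have "0 < p - j + i" "p - j + i < p" using ij by auto
        note cycle_pow_ne[OF this d(2) x0]
        ultimately show False by (simp del: funpow.simps)
      qed
    qed (simp add: linear)
    then show ?thesis by (simp add: card_image)
  qed
  ultimately have fd: "card {x \<in> X. \<phi> d x = x} = p - 1" by simp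
  have split: "card X = card {x \<in> X. \<phi> b x \<noteq> x} + card {x \<in> X. \<phi> b x = x}" for b
  proof -
    have "X = {x \<in> X. \<phi> b x \<noteq> x} \<union> {x \<in> X. \<phi> b x = x}" by blast
    then show ?thesis using card_Un_disjoint[of "{x \<in> X. \<phi> b x \<noteq> x}" "{x \<in> X. \<phi> b x = x}"] finX
      by fastforce
  qed
  have "{x \<in> X. \<phi> c x = x} \<noteq> {}"
  proof
    assume "{x \<in> X. \<phi> c x = x} = {}"
    then have "card {x \<in> X. \<phi> c x = x} = 0" by (simp only: card.empty)
    then have "p dvd card X" using split[of c] phi_dvd[OF c_fixer cyc] by simp
    then have "p dvd card {x \<in> X. \<phi> d x = x}" using split[of d] phi_dvd[OF d] by (simp add: dvd_add_right_iff)
    then have "p dvd p - 1" using fd by simp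
    then show False using p1 by (auto dest: dvd_imp_le)
  qed
  then obtain x where x: "x \<in> X" "\<phi> c x = x" by blast
  obtain j where j: "x = c ^^ j" using central[OF c_fixer cyc XF[OF x(1)] x(2)] by blast
  obtain a i where ai: "a \<in> fixer C" "0 < i" "i < p" "x = a \<circ> (d ^^ i) \<circ> inv a"
    using x(1) unfolding X_def by blast
  have aG: "a \<in> G" using ai fixerD by blast
  obtain k where k: "[i * k = 1] (mod p)" using cycle_pow_inv ai by blast
  have "a \<circ> d \<circ> inv a = a \<circ> (d ^^ (i * k)) \<circ> inv a" using cycle_pow_mod[OF d(2) k] by simp
  also have "\<dots> = x ^^ k" unfolding ai(4) funpow_mult[symmetric] conj_pow[OF aG] ..
  also have "\<dots> = c ^^ (j * k)" unfolding j funpow_mult ..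
  finally show ?thesis using ai(1) by blast
qed

text \<open>A Frattini argument: an element inducing \<pi> maps \<open>C\<close> to itself and
  conjugates \<open>c\<close> to another cycle on \<open>C\<close>. By \<open>cycles_conj\<close> an
  element of the fixer of \<open>C\<close>, which changes nothing on \<open>S - C\<close>, takes
  that cycle to a power of \<open>c\<close>.\<close>

lemma normalizer_extend:
  assumes "\<pi> permutes (S - C)"
  shows "\<exists>g\<in>G. (\<forall>x\<in>S - C. g x = \<pi> x) \<and> (\<exists>k. g \<circ> c \<circ> inv g = c ^^ k)"
proof -
  have "inj_on \<pi> (S - C)" using permutes_inj_on[OF assms] .
  moreover have "\<pi> ` (S - C) \<subseteq> S" using permutes_in_image[OF assms] by auto
  ultimately obtain g where g: "g \<in> G" "\<And>x. x \<in> S - C \<Longrightarrow> g x = \<pi> x"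
    using extend_injection by blast
  have gC: "g x \<in> C" if "x \<in> C" for x
  proof (rule ccontr)
    assume a: "g x \<notin> C"
    have "g x \<in> S - C" using a that CS inG[OF g(1)] by auto
    then obtain y where y: "y \<in> S - C" "\<pi> y = g x"
      using permutes_image[OF assms] by (metis imageE)
    then have "g y = g x" using g(2) by simp
    then have "y = x" using injG[OF g(1)] by simp
    then show False using y that by simp
  qed
  have "g ` C = C"
    by (rule card_subset_eq) (use gC is_cycle_finite[OF cyc] cardG[OF g(1)] in auto)
  then have d: "g \<circ> c \<circ> inv g \<in> fixer C" "is_cycle p (g \<circ> c \<circ> inv g) C"
    using fixer_conj[OF c_fixer g(1)] is_cycle_conj[OF cyc bijG[OF g(1)]] by auto
  obtain a k where a: "a \<in> fixer C" "a \<circ> (g \<circ> c \<circ> inv g) \<circ> inv a = c ^^ k"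
    using cycles_conj[OF d] by blast
  have aG: "a \<in> G" using a fixerD by blast
  have "inv (a \<circ> g) = inv g \<circ> inv a"
    using aG g(1) bijG by (intro o_inv_distrib) auto
  then have "(a \<circ> g) \<circ> c \<circ> inv (a \<circ> g) = c ^^ k" using a(2) by (simp add: comp_assoc)
  moreover have "(a \<circ> g) x = \<pi> x" if "x \<in> S - C" for x
    using g(2)[OF that] fixerD(2)[OF a(1)] that permutes_in_image[OF assms, of x] by simp
  ultimately show ?thesis using comp[OF aG g(1)] by blast
qed

text \<open>Two elements that normalise the group generated by \<open>c\<close> and induce overlapping transpositions on the complement of
  \<open>C\<close> have a commutator that induces a 3-cycle there and, since the automorphism group of a cyclic group is
  abelian, centralises \<open>c\<close>; so it acts on \<open>C\<close> as a power of \<open>c\<close>.\<close>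

theorem jordan:
  assumes "p + 3 \<le> card S" shows "alternating_group S \<subseteq> G"
proof -
  have "card (S - C) = card S - p" using card_Diff_subset[OF is_cycle_finite[OF cyc] CS] cardC by simp
  then have "3 \<le> card (S - C)" using assms by simp
  then obtain B where B: "B \<subseteq> S - C" "card B = 3" by (metis obtain_subset_with_card_n)
  then obtain a b d where abd: "a \<in> S - C" "b \<in> S - C" "d \<in> S - C" "a \<noteq> b" "b \<noteq> d" "a \<noteq> d"
    by (metis card_3_iff insert_subset)
  obtain m k where m: "m \<in> G" "\<And>x. x \<in> S - C \<Longrightarrow> m x = transpose a b x" "m \<circ> c \<circ> inv m = c ^^ k"
    using normalizer_extend[OF permutes_swap_id[OF abd(1,2)]] by blast
  obtain n l where n: "n \<in> G" "\<And>x. x \<in> S - C \<Longrightarrow> n x = transpose a d x" "n \<circ> c \<circ> inv n = c ^^ l"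
    using normalizer_extend[OF permutes_swap_id[OF abd(1,3)]] by blast
  define z where "z = m \<circ> n \<circ> inv m \<circ> inv n"
  have zG: "z \<in> G" unfolding z_def using m n comp inv by simp
  have mc: "m (c x) = (c ^^ k) (m x)" for x using fun_cong[OF m(3), of "m x"] m(1) by simp
  have nc: "n (c x) = (c ^^ l) (n x)" for x using fun_cong[OF n(3), of "n x"] n(1) by simp
  have mck: "m ((c ^^ i) x) = (c ^^ (k * i)) (m x)" for i x
    by (induction i) (simp_all add: mc funpow_add)
  have nck: "n ((c ^^ i) x) = (c ^^ (l * i)) (n x)" for i x
    by (induction i) (simp_all add: nc funpow_add)
  define K where "K = k * l"
  \<comment> \<open>Both orders of composition raise \<open>c\<close> to the same power
    \<open>K\<close>. So the commutator \<open>z\<close> commutes with \<open>c ^^ K\<close> and, as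
    \<open>K\<close> is prime to \<open>p\<close>, with \<open>c\<close>.\<close>
  have mn: "m (n (c x)) = (c ^^ K) (m (n x))" for x unfolding nc mck K_def ..
  have nm: "n (m (c x)) = (c ^^ K) (n (m x))" for x unfolding mc nck K_def by (simp add: mult.commute)
  have znm: "z (n (m x)) = m (n x)" for x unfolding z_def using m n by simp
  have zK: "z ((c ^^ K) y) = (c ^^ K) (z y)" for y
  proof -
    define x where "x = inv m (inv n y)"
    have y: "y = n (m x)" unfolding x_def using m n by simp
    show ?thesis unfolding y nm[symmetric] znm mn ..
  qed
  have "K mod p \<noteq> 0"
  proof
    assume "K mod p = 0"
    then have "c ^^ K = c ^^ 0" by (intro cycle_pow_mod[OF cyc]) (simp add: cong_def)
    then have "m (n (c x)) = m (n x)" for x using mn by simp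
    then have "c x = x" for x using injG m n by metis
    moreover have "C \<noteq> {}" using cardC p0 by auto
    ultimately show False using cycle_pow_ne[of 1 c] cyc p1 by auto
  qed
  then obtain K' where "[(K mod p) * K' = 1] (mod p)" using cycle_pow_inv[of "K mod p"] p0 by auto
  then have K': "[K * K' = 1] (mod p)" by (simp add: cong_def mod_mult_left_eq)
  have "z ((c ^^ (K * i)) y) = (c ^^ (K * i)) (z y)" for i y
    by (induction i) (simp_all add: funpow_add zK)
  moreover have "c ^^ (K * K') = c" using cycle_pow_mod[OF cyc K'] by simp
  ultimately have zc: "z (c y) = c (z y)" for y by metis
  have mS: "m x \<in> S - C \<longleftrightarrow> x \<in> S - C" and nS: "n x \<in> S - C \<longleftrightarrow> x \<in> S - C" for x
  proof -
    have *: "g x \<in> S - C \<longleftrightarrow> x \<in> S - C" if g: "g \<in> G" "\<And>x. x \<in> S - C \<Longrightarrow> g x = transpose u v x" "u \<in> S - C" "v \<in> S - C" for g u v x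
    proof
      assume "x \<in> S - C" then show "g x \<in> S - C" using g by (auto simp: transpose_def)
    next
      assume a: "g x \<in> S - C"
      define y where "y = transpose u v (g x)"
      have y: "y \<in> S - C" unfolding y_def using a g by (auto simp: transpose_def)
      then have "g y = g x" unfolding y_def using g(2) by simp
      then show "x \<in> S - C" using y injG[OF g(1)] by simp
    qed
    show "m x \<in> S - C \<longleftrightarrow> x \<in> S - C" using *[OF m(1,2)] abd by blast
    show "n x \<in> S - C \<longleftrightarrow> x \<in> S - C" using *[OF n(1,2)] abd by blast
  qed
  have zval: "z (transpose a d (transpose a b x)) = transpose a b (transpose a d x)" if "x \<in> S - C" for x
    using znm[of x] m(2)[OF that] n(2)[OF that] m(2)[of "n x"] n(2)[of "m x"] mS[of x] nS[of x] that by auto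
  have za: "z d = a" using zval[of b] abd by (simp add: transpose_def split: if_splits)
  have zb: "z a = b" using zval[of d] abd by (simp add: transpose_def split: if_splits)
  have zd: "z b = d" using zval[of a] abd by (simp add: transpose_def split: if_splits)
  have zo: "z x = x" if "x \<in> S - C" "x \<noteq> a" "x \<noteq> b" "x \<noteq> d" for x
    using zval[of x] that by (simp add: transpose_def)
  have zinC: "z ` C \<subseteq> C"
  proof
    fix y assume "y \<in> z ` C"
    then obtain x where x: "x \<in> C" "y = z x" by auto
    define w where "w = inv m (inv n x)"
    have xw: "x = n (m w)" unfolding w_def using m n by simp
    then have "w \<notin> S - C" using mS nS x by auto
    then have "m (n w) \<notin> S - C" using mS nS by auto
    moreover have "y \<in> S" using x CS inG[OF zG] by auto
    ultimately show "y \<in> C" using x xw znm by auto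
  qed
  have "z \<circ> c = c \<circ> z" using zc by (simp add: fun_eq_iff)
  then obtain j where j: "j < p" "\<And>y. y \<in> C \<Longrightarrow> z y = (c ^^ j) y"
    using is_cycle_centralizer[OF cyc p0 zinC] by blast
  \<comment> \<open>On \<open>C\<close> the factor \<open>c ^^ (p - j)\<close> cancels
    \<open>z\<close>, and elsewhere it is the identity; only the 3-cycle on the three outer points
    remains.\<close>
  define w where "w = z \<circ> (c ^^ (p - j))"
  have wG: "w \<in> G" unfolding w_def using zG powG[OF cG] comp by simp
  have cfix: "(c ^^ i) x = x" if "x \<notin> C" for i x using fixerD(2)[OF fixer_pow[OF c_fixer] that] .
  have "w x = cyc3 a b d x" for x
  proof -
    consider "x \<in> C" | "x = a" | "x = b" | "x = d" | "x \<in> S - C" "x \<noteq> a" "x \<noteq> b" "x \<noteq> d" | "x \<notin> S" by auto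
    then show ?thesis
    proof cases
      case 1
      have "(c ^^ (p - j)) x \<in> C" using fixer_in[OF fixer_pow[OF c_fixer]] 1 by blast
      then have "w x = (c ^^ (j + (p - j))) x" unfolding w_def using j(2) by (simp add: funpow_add)
      also have "\<dots> = x" using j(1) is_cycle_funpow_p[OF cyc p0] by simp
      also have "\<dots> = cyc3 a b d x"
        by (rule cyc3_apply(4)[OF abd(4,5,6), symmetric]) (use 1 abd in auto)
      finally show ?thesis .
    next
      case 6
      then have "x \<notin> C" "z x = x" "x \<noteq> a" "x \<noteq> b" "x \<noteq> d" using CS abd perm[OF zG] permutes_not_in by auto
      then show ?thesis unfolding w_def using cfix cyc3_apply(4)[OF abd(4,5,6)] by simp
    qed (use abd cfix za zb zd zo cyc3_apply[OF abd(4,5,6)] in \<open>auto simp: w_def\<close>)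
  qed
  then have "cyc3 a b d \<in> G" using wG by (metis ext)
  moreover have "C \<noteq> S" using abd by auto
  ultimately show ?thesis using alternating_of_three_cycle abd by blast
qed

end

section \<open>Algebraic numbers and embeddings of fields\<close>

interpretation rat_vs: vector_space "\<lambda>(q::rat) (z::complex). of_rat q * z"
  by unfold_locales (simp_all add: algebra_simps of_rat_add of_rat_mult)

lemma algebraic_of_rat_poly:
  assumes "p \<noteq> 0" "poly (map_poly of_rat p) x = 0"
  shows "algebraic (x :: complex)"
proof -
  have "\<forall>i. coeff (map_poly of_rat p) i \<in> (\<rat> :: complex set)" by (simp add: coeff_map_poly)
  moreover have "map_poly of_rat p \<noteq> (0 :: complex poly)" using assms(1)
    by (metis (no_types, lifting) coeff_0 coeff_map_poly of_rat_0 of_rat_eq_0_iff poly_eqI)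
  ultimately show ?thesis using assms(2) unfolding algebraic_altdef by blast
qed

lemma algebraic_rat_polyE:
  assumes "algebraic (x :: complex)"
  obtains p :: "rat poly" where "p \<noteq> 0" "poly (map_poly of_rat p) x = 0"
proof -
  from assms obtain q where q: "\<forall>i. coeff q i \<in> \<rat>" "q \<noteq> 0" "poly q x = 0" unfolding algebraic_altdef by blast
  define f where "f z = (SOME r. of_rat r = (z :: complex))" for z
  have f: "of_rat (f z) = z" if "z \<in> \<rat>" for z
  proof -
    have "\<exists>r. of_rat r = z" using that by (elim Rats_cases) auto
    then show ?thesis unfolding f_def by (rule someI_ex)
  qed
  have "f 0 = 0" using f[of 0] by simp
  then have m: "map_poly of_rat (map_poly f q) = q"
    by (intro poly_eqI) (simp add: coeff_map_poly f q(1))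
  then have "map_poly f q \<noteq> 0" using q(2) by auto
  then show ?thesis using that[of "map_poly f q"] m q(3) by simp
qed

text \<open>The powers of \<open>x\<close> up to \<open>card B\<close> either are not distinct or
  are linearly dependent over \<open>\<rat>\<close>; both give a rational polynomial with root
  \<open>x\<close>.\<close>

lemma algebraic_if_powers_in_span:
  assumes "finite B" "\<And>k. x ^ k \<in> rat_vs.span B"
  shows "algebraic x"
proof -
  define N where "N = card B"
  show ?thesis
  proof (cases "inj_on (\<lambda>k. x ^ k) {..N}")
    case False
    then obtain i j where ij: "i \<noteq> j" "x ^ i = x ^ j" unfolding inj_on_def by auto
    have "monom 1 i - monom 1 j \<noteq> (0 :: rat poly)"
      using ij(1) by (metis coeff_0 coeff_diff coeff_monom diff_zero zero_neq_one)
    moreover have "map_poly of_rat (monom 1 i - monom 1 j :: rat poly) = monom 1 i - (monom 1 j :: complex poly)"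
      by (intro poly_eqI) (simp add: coeff_map_poly of_rat_diff)
    ultimately show ?thesis
      using algebraic_of_rat_poly[of "monom 1 i - monom 1 j" x] ij(2) by (simp add: poly_monom)
  next
    case True
    define V where "V = (\<lambda>k. x ^ k) ` {..N}"
    have cV: "card V = Suc N" unfolding V_def using card_image[OF True] by simp
    have "rat_vs.dependent V"
    proof (rule ccontr)
      assume "\<not> rat_vs.dependent V"
      then have "card V \<le> card B"
        using rat_vs.independent_span_bound[OF assms(1), of V] assms(2) unfolding V_def by auto
      then show False using cV unfolding N_def by simp
    qed
    then obtain t u where tu: "finite t" "t \<subseteq> V" "(\<Sum>v\<in>t. of_rat (u v) * v) = 0" "\<exists>v\<in>t. u v \<noteq> 0"
      unfolding rat_vs.dependent_explicit by blast
    define K where "K = {k \<in> {..N}. x ^ k \<in> t}"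
    have tK: "t = (\<lambda>k. x ^ k) ` K" unfolding K_def using tu(2) unfolding V_def by auto
    have injK: "inj_on (\<lambda>k. x ^ k) K" by (rule inj_on_subset[OF True]) (auto simp: K_def)
    have finK: "finite K" unfolding K_def by simp
    define p where "p = (\<Sum>k\<in>K. monom (u (x ^ k)) k)"
    have cp: "coeff p k = (if k \<in> K then u (x ^ k) else 0)" for k
      unfolding p_def using finK by (simp add: coeff_sum if_distrib sum.delta cong: if_cong)
    have "p \<noteq> 0" using tu(4) cp unfolding tK by (metis (no_types, lifting) coeff_0 imageE)
    have "map_poly of_rat p = (\<Sum>k\<in>K. monom (of_rat (u (x ^ k))) k :: complex poly)"
    proof (rule poly_eqI)
      fix n
      have "coeff (\<Sum>k\<in>K. monom (of_rat (u (x ^ k))) k :: complex poly) n = (if n \<in> K then of_rat (u (x ^ n)) else 0)"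
        using finK by (simp add: coeff_sum if_distrib sum.delta cong: if_cong)
      then show "coeff (map_poly of_rat p) n = coeff (\<Sum>k\<in>K. monom (of_rat (u (x ^ k))) k :: complex poly) n"
        by (simp add: coeff_map_poly cp)
    qed
    then have "poly (map_poly of_rat p) x = (\<Sum>k\<in>K. of_rat (u (x ^ k)) * x ^ k)"
      by (simp add: poly_sum poly_monom)
    also have "\<dots> = 0" using tu(3) unfolding tK sum.reindex[OF injK] by simp
    finally show ?thesis using algebraic_of_rat_poly[OF \<open>p \<noteq> 0\<close>] by simp
  qed
qed

text \<open>The products of powers of \<open>x\<close> and \<open>y\<close> below the degrees of two
  annihilating polynomials span a space closed under multiplication by \<open>x\<close> and by
  \<open>y\<close>; it contains all powers of \<open>x + y\<close> and of
  \<open>x * y\<close>.\<close>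

lemma finite_dim_ring:
  assumes "algebraic (x :: complex)" "algebraic y"
  obtains B where "finite B" "1 \<in> rat_vs.span B"
    "\<And>v. v \<in> rat_vs.span B \<Longrightarrow> x * v \<in> rat_vs.span B" "\<And>v. v \<in> rat_vs.span B \<Longrightarrow> y * v \<in> rat_vs.span B"
proof -
  have red: "\<exists>d. \<exists>c. z ^ d = (\<Sum>i<d. of_rat (c i) * z ^ i)" if z: "algebraic z" for z :: complex
  proof -
    obtain p :: "rat poly" where p: "p \<noteq> 0" "poly (map_poly of_rat p) z = 0"
      using algebraic_rat_polyE[OF z] by blast
    define l where "l = coeff p (degree p)"
    have l: "l \<noteq> 0" unfolding l_def using p(1) by simp
    have dm: "degree (map_poly of_rat p :: complex poly) = degree p" by (rule degree_map_poly) simp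
    have "0 = (\<Sum>i\<le>degree p. of_rat (coeff p i) * z ^ i)"
      using p(2) unfolding poly_altdef dm by (simp add: coeff_map_poly)
    also have "\<dots> = (\<Sum>i<degree p. of_rat (coeff p i) * z ^ i) + of_rat l * z ^ degree p"
      unfolding l_def by (simp add: lessThan_Suc_atMost[symmetric])
    finally have "of_rat l * z ^ degree p = - (\<Sum>i<degree p. of_rat (coeff p i) * z ^ i)"
      by (simp add: eq_neg_iff_add_eq_0 add.commute)
    then have "z ^ degree p = - (\<Sum>i<degree p. of_rat (coeff p i) * z ^ i) / of_rat l"
      using l by (simp add: field_simps)
    also have "\<dots> = (\<Sum>i<degree p. of_rat (- coeff p i / l) * z ^ i)"
      by (simp add: sum_divide_distrib sum_negf[symmetric] of_rat_divide of_rat_minus)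
    finally show ?thesis by (intro exI[of _ "degree p"] exI[of _ "\<lambda>i. - coeff p i / l"])
  qed
  obtain a c where a: "x ^ a = (\<Sum>i<a. of_rat (c i) * x ^ i)" using red[OF assms(1)] by blast
  obtain b e where b: "y ^ b = (\<Sum>i<b. of_rat (e i) * y ^ i)" using red[OF assms(2)] by blast
  define B where "B = (\<lambda>(i, j). x ^ i * y ^ j) ` ({..<a} \<times> {..<b})"
  have finB: "finite B" unfolding B_def by simp
  have inB: "x ^ i * y ^ j \<in> rat_vs.span B" if "i < a" "j < b" for i j
    by (rule rat_vs.span_base) (use that in \<open>force simp: B_def\<close>)
  have xa: "x ^ a * y ^ j \<in> rat_vs.span B" if "j < b" for j
    unfolding a sum_distrib_right mult.assoc
    by (intro rat_vs.span_sum rat_vs.span_scale inB) (use that in auto)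
  have yb: "x ^ i * y ^ b \<in> rat_vs.span B" if "i < a" for i
  proof -
    have "x ^ i * y ^ b = (\<Sum>j<b. of_rat (e j) * (x ^ i * y ^ j))"
      unfolding b sum_distrib_left by (intro sum.cong) auto
    then show ?thesis by (auto intro!: rat_vs.span_sum rat_vs.span_scale inB that)
  qed
  have cl: "z * v \<in> rat_vs.span B" if "v \<in> rat_vs.span B" "\<And>w. w \<in> B \<Longrightarrow> z * w \<in> rat_vs.span B" for z v
    using that(1)
  proof (induction rule: rat_vs.span_induct_alt)
    case base then show ?case by (simp add: rat_vs.span_zero)
  next
    case (step q w v)
    have "z * (of_rat q * w + v) = of_rat q * (z * w) + z * v" by (simp add: algebra_simps)
    then show ?case using rat_vs.span_add rat_vs.span_scale that(2)[OF step(1)] step by simp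
  qed
  have "x * w \<in> rat_vs.span B" if wB: "w \<in> B" for w
  proof -
    obtain i j where ij: "i < a" "j < b" "w = x ^ i * y ^ j" using wB unfolding B_def by auto
    show ?thesis
    proof (cases "Suc i < a")
      case True then show ?thesis using inB[OF True ij(2)] ij by (simp add: mult.assoc)
    next
      case False
      then have "Suc i = a" using ij by simp
      then show ?thesis using xa[OF ij(2)] ij(3) by (metis mult.assoc power_Suc)
    qed
  qed
  moreover have "y * w \<in> rat_vs.span B" if wB: "w \<in> B" for w
  proof -
    obtain i j where ij: "i < a" "j < b" "w = x ^ i * y ^ j" using wB unfolding B_def by auto
    have e: "y * w = x ^ i * y ^ Suc j" using ij by (simp add: algebra_simps)
    show ?thesis
    proof (cases "Suc j < b")
      case True then show ?thesis unfolding e using inB[OF ij(1) True] by blast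
    next
      case False
      then have "Suc j = b" using ij by simp
      then show ?thesis using yb[OF ij(1)] e by metis
    qed
  qed
  moreover have "1 \<in> rat_vs.span B"
  proof -
    have "a > 0" using a by (cases a) auto
    moreover have "b > 0" using b by (cases b) auto
    ultimately show ?thesis using inB[of 0 0] by simp
  qed
  ultimately show ?thesis using that finB cl by blast
qed

lemma algebraic_add_mult:
  assumes "algebraic (x :: complex)" "algebraic y"
  shows "algebraic (x + y)" "algebraic (x * y)"
proof -
  obtain B where B: "finite B" "1 \<in> rat_vs.span B"
    "\<And>v. v \<in> rat_vs.span B \<Longrightarrow> x * v \<in> rat_vs.span B" "\<And>v. v \<in> rat_vs.span B \<Longrightarrow> y * v \<in> rat_vs.span B"
    using finite_dim_ring[OF assms] by blast
  have "(x + y) ^ k \<in> rat_vs.span B" for k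
    by (induction k) (simp_all add: B distrib_right rat_vs.span_add)
  then show "algebraic (x + y)" using algebraic_if_powers_in_span B(1) by blast
  have "(x * y) ^ k \<in> rat_vs.span B" for k
    by (induction k) (simp_all add: B mult.assoc)
  then show "algebraic (x * y)" using algebraic_if_powers_in_span B(1) by blast
qed

lemma algebraic_add [intro]: "algebraic (x :: complex) \<Longrightarrow> algebraic y \<Longrightarrow> algebraic (x + y)"
  and algebraic_mult [intro]: "algebraic (x :: complex) \<Longrightarrow> algebraic y \<Longrightarrow> algebraic (x * y)"
  using algebraic_add_mult by blast+

lemma algebraic_Rats [intro]: "x \<in> \<rat> \<Longrightarrow> algebraic (x :: complex)"
  by (elim Rats_cases) (simp add: rat_imp_algebraic)

lemma algebraic_of_rat [simp, intro]: "algebraic (of_rat q :: complex)" by auto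

lemma algebraic_one [simp, intro]: "algebraic (1 :: complex)"
  using algebraic_of_rat[of 1] by simp

lemma algebraic_diff [intro]: "algebraic (x :: complex) \<Longrightarrow> algebraic y \<Longrightarrow> algebraic (x - y)"
  using algebraic_add[of x "- y"] by auto

lemma algebraic_power [intro]: "algebraic (x :: complex) \<Longrightarrow> algebraic (x ^ n)"
  by (induction n) auto

lemma algebraic_divide [intro]: "algebraic (x :: complex) \<Longrightarrow> algebraic y \<Longrightarrow> algebraic (x / y)"
  unfolding divide_inverse by auto

lemma algebraic_sum: "(\<And>i. i \<in> A \<Longrightarrow> algebraic (f i :: complex)) \<Longrightarrow> algebraic (\<Sum>i\<in>A. f i)"
  by (induction A rule: infinite_finite_induct) auto

lemma algebraic_power_int [intro]: "algebraic (x :: complex) \<Longrightarrow> algebraic (x powi n)"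
  unfolding power_int_def by auto

lemma rat_adjoin_algebraic:
  assumes "\<And>z. z \<in> S \<Longrightarrow> algebraic z" "z \<in> rat_adjoin S"
  shows "algebraic z"
  using assms(2) by induction (use assms(1) in auto)

section \<open>Extension of homomorphisms between subfields of the complex numbers\<close>

definition subfield :: "complex set \<Rightarrow> bool" where
  "subfield E \<longleftrightarrow> \<rat> \<subseteq> E \<and> (\<forall>x\<in>E. \<forall>y\<in>E. x + y \<in> E \<and> x * y \<in> E) \<and> (\<forall>x\<in>E. - x \<in> E \<and> inverse x \<in> E)"

definition field_hom :: "complex set \<Rightarrow> (complex \<Rightarrow> complex) \<Rightarrow> bool" where
  "field_hom E \<tau> \<longleftrightarrow> (\<forall>x\<in>E. \<forall>y\<in>E. \<tau> (x + y) = \<tau> x + \<tau> y \<and> \<tau> (x * y) = \<tau> x * \<tau> y) \<and> (\<forall>q\<in>\<rat>. \<tau> q = q)"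

definition coeffs_in :: "complex set \<Rightarrow> complex poly \<Rightarrow> bool" where
  "coeffs_in E p \<longleftrightarrow> (\<forall>i. coeff p i \<in> E)"

lemma subfieldD:
  assumes "subfield E"
  shows "x \<in> \<rat> \<Longrightarrow> x \<in> E" "x \<in> E \<Longrightarrow> y \<in> E \<Longrightarrow> x + y \<in> E" "x \<in> E \<Longrightarrow> y \<in> E \<Longrightarrow> x * y \<in> E"
    "x \<in> E \<Longrightarrow> - x \<in> E" "x \<in> E \<Longrightarrow> inverse x \<in> E" "0 \<in> E" "1 \<in> E"
    "x \<in> E \<Longrightarrow> y \<in> E \<Longrightarrow> x - y \<in> E" "x \<in> E \<Longrightarrow> y \<in> E \<Longrightarrow> x / y \<in> E"
proof -
  show *: "x \<in> \<rat> \<Longrightarrow> x \<in> E" "x \<in> E \<Longrightarrow> y \<in> E \<Longrightarrow> x + y \<in> E" "x \<in> E \<Longrightarrow> y \<in> E \<Longrightarrow> x * y \<in> E"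
    "x \<in> E \<Longrightarrow> - x \<in> E" "x \<in> E \<Longrightarrow> inverse x \<in> E" for x y
    using assms unfolding subfield_def by auto
  show "0 \<in> E" "1 \<in> E" using assms unfolding subfield_def by auto
  show "x \<in> E \<Longrightarrow> y \<in> E \<Longrightarrow> x - y \<in> E" using *(2)[of x "- y"] *(4)[of y] by simp
  show "x \<in> E \<Longrightarrow> y \<in> E \<Longrightarrow> x / y \<in> E" using *(3)[of x "inverse y"] *(5)[of y] by (simp add: divide_inverse)
qed

lemma subfield_sum: "subfield E \<Longrightarrow> (\<And>i. i \<in> A \<Longrightarrow> f i \<in> E) \<Longrightarrow> sum f A \<in> E"
  by (induction A rule: infinite_finite_induct) (auto simp: subfieldD)

lemma subfield_Rats: "subfield \<rat>"
  unfolding subfield_def by auto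

lemma coeffs_in_arith:
  assumes "subfield E"
  shows "coeffs_in E p \<Longrightarrow> coeffs_in E q \<Longrightarrow> coeffs_in E (p + q)"
    "coeffs_in E p \<Longrightarrow> coeffs_in E q \<Longrightarrow> coeffs_in E (p - q)"
    "coeffs_in E p \<Longrightarrow> coeffs_in E (- p)"
    "coeffs_in E p \<Longrightarrow> coeffs_in E q \<Longrightarrow> coeffs_in E (p * q)"
    "x \<in> E \<Longrightarrow> coeffs_in E (monom x n)" "coeffs_in E 0" "x \<in> E \<Longrightarrow> coeffs_in E [:x:]"
    "coeffs_in E 1"
  using assms unfolding coeffs_in_def
  by (auto simp: subfieldD coeff_mult coeff_pCons intro!: subfield_sum split: nat.split)

text \<open>The usual division, carried out again because a subfield is a set here and the
  coefficients of quotient and remainder have to stay in it.\<close>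

lemma coeffs_in_division:
  assumes E: "subfield E" and g: "coeffs_in E g" "g \<noteq> 0" and f: "coeffs_in E f"
  shows "\<exists>q r. coeffs_in E q \<and> coeffs_in E r \<and> f = q * g + r \<and> (r = 0 \<or> degree r < degree g)"
  using f
proof (induction "degree f" arbitrary: f rule: less_induct)
  case less
  show ?case
  proof (cases "f = 0 \<or> degree f < degree g")
    case True
    then show ?thesis using less.prems coeffs_in_arith(6)[OF E] by (intro exI[of _ 0] exI[of _ f]) auto
  next
    case False
    define h where "h = monom (lead_coeff f / lead_coeff g) (degree f - degree g)"
    have "lead_coeff f / lead_coeff g \<in> E"
      using less.prems g(1) unfolding coeffs_in_def by (intro subfieldD(9)[OF E]) auto
    then have h: "coeffs_in E h" unfolding h_def by (rule coeffs_in_arith(5)[OF E])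
    define f' where "f' = f - h * g"
    have f': "coeffs_in E f'" unfolding f'_def
      by (rule coeffs_in_arith(2)[OF E less.prems coeffs_in_arith(4)[OF E h g(1)]])
    have lc: "lead_coeff f \<noteq> 0" "lead_coeff g \<noteq> 0" using False g by auto
    have hn: "h \<noteq> 0" unfolding h_def using lc by (simp add: monom_eq_0_iff)
    have dh: "degree (h * g) = degree f"
    proof -
      have "degree h = degree f - degree g" unfolding h_def using lc by (simp add: degree_monom_eq)
      then show ?thesis using False degree_mult_eq[OF hn g(2)] by simp
    qed
    have lh: "coeff (h * g) (degree f) = lead_coeff f"
      using lead_coeff_mult[of h g] dh lc hn unfolding h_def by (simp add: degree_monom_eq)
    show ?thesis
    proof (cases "f' = 0")
      case True
      then have "f = h * g + 0" unfolding f'_def by simp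
      then show ?thesis using h coeffs_in_arith(6)[OF E] by blast
    next
      case ne: False
      have "coeff f' (degree f) = 0" unfolding f'_def using lh by simp
      moreover have "degree f' \<le> degree f" unfolding f'_def using dh by (intro degree_diff_le) auto
      ultimately have "degree f' < degree f"
        using ne by (metis le_neq_implies_less leading_coeff_0_iff)
      from less.hyps[OF this f'] obtain q r where qr: "coeffs_in E q" "coeffs_in E r" "f' = q * g + r"
        "r = 0 \<or> degree r < degree g" by blast
      have "f = (q + h) * g + r" using qr(3) unfolding f'_def by (simp add: algebra_simps)
      then show ?thesis using qr h coeffs_in_arith(1)[OF E] by blast
    qed
  qed
qed

lemma field_homD:
  assumes "field_hom E \<tau>"
  shows "x \<in> E \<Longrightarrow> y \<in> E \<Longrightarrow> \<tau> (x + y) = \<tau> x + \<tau> y" "x \<in> E \<Longrightarrow> y \<in> E \<Longrightarrow> \<tau> (x * y) = \<tau> x * \<tau> y"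
    "x \<in> \<rat> \<Longrightarrow> \<tau> x = x" "\<tau> 0 = 0" "\<tau> 1 = 1"
  using assms unfolding field_hom_def by auto

lemma field_hom_minus:
  assumes "subfield E" "field_hom E \<tau>" "x \<in> E" shows "\<tau> (- x) = - \<tau> x"
proof -
  have "\<tau> (x + - x) = \<tau> x + \<tau> (- x)" using field_homD(1)[OF assms(2,3)] subfieldD(4)[OF assms(1,3)] by blast
  then show ?thesis using field_homD(4)[OF assms(2)] by (simp add: eq_neg_iff_add_eq_0 add.commute)
qed

lemma field_hom_diff:
  assumes "subfield E" "field_hom E \<tau>" "x \<in> E" "y \<in> E" shows "\<tau> (x - y) = \<tau> x - \<tau> y"
  using field_homD(1)[OF assms(2,3), of "- y"] subfieldD(4)[OF assms(1,4)] field_hom_minus[OF assms(1,2,4)] by simp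

lemma field_hom_nonzero:
  assumes "subfield E" "field_hom E \<tau>" "x \<in> E" "x \<noteq> 0" shows "\<tau> x \<noteq> 0"
proof
  assume a: "\<tau> x = 0"
  have "\<tau> (x * inverse x) = \<tau> x * \<tau> (inverse x)"
    using field_homD(2)[OF assms(2,3)] subfieldD(5)[OF assms(1,3)] by blast
  then show False using a assms(4) field_homD(5)[OF assms(2)] by simp
qed

lemma field_hom_inverse:
  assumes "subfield E" "field_hom E \<tau>" "x \<in> E" shows "\<tau> (inverse x) = inverse (\<tau> x)"
proof (cases "x = 0")
  case True then show ?thesis using field_homD(4)[OF assms(2)] by simp
next
  case False
  have "\<tau> (x * inverse x) = \<tau> x * \<tau> (inverse x)"
    using field_homD(2)[OF assms(2,3)] subfieldD(5)[OF assms(1,3)] by blast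
  then show ?thesis using False field_homD(5)[OF assms(2)] by (simp add: inverse_unique)
qed

lemma field_hom_inj:
  assumes "subfield E" "field_hom E \<tau>" "x \<in> E" "y \<in> E" "\<tau> x = \<tau> y" shows "x = y"
  using field_hom_nonzero[OF assms(1,2), of "x - y"] field_hom_diff[OF assms(1-4)] subfieldD(8)[OF assms(1,3,4)] assms(5)
  by auto

lemma field_hom_sum:
  assumes "subfield E" "field_hom E \<tau>" "\<And>i. i \<in> A \<Longrightarrow> f i \<in> E"
  shows "\<tau> (sum f A) = (\<Sum>i\<in>A. \<tau> (f i))"
  using assms(3)
  by (induction A rule: infinite_finite_induct)
     (auto simp: field_homD(4)[OF assms(2)] field_homD(1)[OF assms(2)] subfield_sum[OF assms(1)])

lemma map_poly_hom:
  assumes "subfield E" "field_hom E \<tau>" "coeffs_in E p" "coeffs_in E q"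
  shows "map_poly \<tau> (p + q) = map_poly \<tau> p + map_poly \<tau> q"
    "map_poly \<tau> (p - q) = map_poly \<tau> p - map_poly \<tau> q"
    "map_poly \<tau> (p * q) = map_poly \<tau> p * map_poly \<tau> q"
proof -
  note [simp] = coeff_map_poly[where f = \<tau>, OF field_homD(4)[OF assms(2)]]
  have c: "coeff p i \<in> E" "coeff q i \<in> E" for i using assms unfolding coeffs_in_def by auto
  show "map_poly \<tau> (p + q) = map_poly \<tau> p + map_poly \<tau> q"
    by (intro poly_eqI) (simp add: field_homD(1)[OF assms(2)] c)
  show "map_poly \<tau> (p - q) = map_poly \<tau> p - map_poly \<tau> q"
    by (intro poly_eqI) (simp add: field_hom_diff[OF assms(1,2)] c)
  show "map_poly \<tau> (p * q) = map_poly \<tau> p * map_poly \<tau> q"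
    by (intro poly_eqI) (simp add: coeff_mult field_hom_sum[OF assms(1,2)] field_homD(2)[OF assms(2)] subfieldD(3)[OF assms(1)] c)
qed

lemma hom_poly:
  assumes "subfield E" "field_hom E \<tau>" "coeffs_in E p" "x \<in> E"
  shows "\<tau> (poly p x) = poly (map_poly \<tau> p) (\<tau> x)"
proof -
  have c: "coeff p i \<in> E" for i using assms unfolding coeffs_in_def by auto
  have xn: "x ^ n \<in> E \<and> \<tau> (x ^ n) = \<tau> x ^ n" for n
    by (induction n) (use assms(4) subfieldD[OF assms(1)] field_homD[OF assms(2)] in auto)
  have "degree (map_poly \<tau> p) = degree p"
  proof (cases "p = 0")
    case False
    then show ?thesis by (intro map_poly_degree_eq field_hom_nonzero[OF assms(1,2)]) (use c in auto)
  qed simp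
  then show ?thesis unfolding poly_altdef
    by (simp add: coeff_map_poly[where f = \<tau>, OF field_homD(4)[OF assms(2)]] field_hom_sum[OF assms(1,2)]
        field_homD(2)[OF assms(2)] subfieldD(3)[OF assms(1)] c xn)
qed

text \<open>The field generated by \<alpha> is described by quotients
  \<open>poly p \<alpha> / poly q \<alpha>\<close>. One direction of the equivalence makes the new
  value independent of the representation, the other keeps the denominators different from 0 at
  \<beta>.\<close>

lemma extend_hom:
  assumes E: "subfield E" and t: "field_hom E \<tau>"
    and iff: "\<And>p. coeffs_in E p \<Longrightarrow> poly p \<alpha> = 0 \<longleftrightarrow> poly (map_poly \<tau> p) \<beta> = 0"
  shows "\<exists>E' \<tau>'. subfield E' \<and> field_hom E' \<tau>' \<and> E \<subseteq> E' \<and> \<alpha> \<in> E' \<and> \<tau>' \<alpha> = \<beta> \<and> (\<forall>x\<in>E. \<tau>' x = \<tau> x)"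
proof -
  define R where "R p q x \<longleftrightarrow> coeffs_in E p \<and> coeffs_in E q \<and> poly q \<alpha> \<noteq> 0 \<and> x = poly p \<alpha> / poly q \<alpha>" for p q x
  define V where "V p q = poly (map_poly \<tau> p) \<beta> / poly (map_poly \<tau> q) \<beta>" for p q
  define E' where "E' = {x. \<exists>p q. R p q x}"
  define \<tau>' where "\<tau>' x = (SOME y. \<exists>p q. R p q x \<and> y = V p q)" for x
  note ar = coeffs_in_arith[OF E]
  note mh = map_poly_hom[OF E t]
  have nz: "poly (map_poly \<tau> q) \<beta> \<noteq> 0" if "R p q x" for p q x
    using that iff unfolding R_def by blast
  have wd: "V p q = V p' q'" if "R p q x" "R p' q' x" for p q p' q' x
  proof -
    have c: "coeffs_in E p" "coeffs_in E q" "coeffs_in E p'" "coeffs_in E q'" using that unfolding R_def by auto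
    have "poly (p * q' - p' * q) \<alpha> = 0" using that unfolding R_def by (simp add: field_simps)
    then have "poly (map_poly \<tau> (p * q' - p' * q)) \<beta> = 0"
      using iff[OF ar(2)[OF ar(4)[OF c(1) c(4)] ar(4)[OF c(3) c(2)]]] by simp
    then have "poly (map_poly \<tau> p) \<beta> * poly (map_poly \<tau> q') \<beta> = poly (map_poly \<tau> p') \<beta> * poly (map_poly \<tau> q) \<beta>"
      using c ar by (simp add: mh)
    then show ?thesis unfolding V_def using nz that by (simp add: field_simps)
  qed
  have val: "\<tau>' x = V p q" if "R p q x" for p q x
    unfolding \<tau>'_def by (rule some_equality) (use that wd in blast)+
  have m1: "map_poly \<tau> 1 = 1" using field_homD(5)[OF t] by (simp add: map_poly_1')
  have mc: "map_poly \<tau> [:x:] = [:\<tau> x:]" for x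
    by (intro poly_eqI) (simp add: coeff_map_poly[where f = \<tau>, OF field_homD(4)[OF t]] coeff_pCons field_homD(4)[OF t] split: nat.split)
  have Rconst: "R [:x:] 1 x" "V [:x:] 1 = \<tau> x" if "x \<in> E" for x
    using that ar(7)[OF that] ar(8) unfolding R_def V_def by (simp_all add: m1 mc)
  have RA: "R [:0, 1:] 1 \<alpha>" "V [:0, 1:] 1 = \<beta>"
  proof -
    have "[:0, 1:] = monom (1 :: complex) 1" by (simp add: monom_Suc)
    then have "coeffs_in E [:0, 1:]" using ar(5)[of 1 1] subfieldD(7)[OF E] by simp
    then show "R [:0, 1:] 1 \<alpha>" using ar unfolding R_def by auto
    have "map_poly \<tau> [:0, 1:] = [:0, 1:]"
      by (intro poly_eqI) (simp add: coeff_map_poly[where f = \<tau>, OF field_homD(4)[OF t]] coeff_pCons field_homD[OF t] split: nat.split)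
    then show "V [:0, 1:] 1 = \<beta>" unfolding V_def by (simp add: m1)
  qed
  have Radd: "R (p * q' + p' * q) (q * q') (x + y) \<and> V (p * q' + p' * q) (q * q') = V p q + V p' q'"
    and Rmul: "R (p * p') (q * q') (x * y) \<and> V (p * p') (q * q') = V p q * V p' q'"
    if "R p q x" "R p' q' y" for p q p' q' x y
  proof -
    have c: "coeffs_in E p" "coeffs_in E q" "coeffs_in E p'" "coeffs_in E q'" using that unfolding R_def by auto
    have q0: "poly q \<alpha> \<noteq> 0" "poly q' \<alpha> \<noteq> 0" and xy: "x = poly p \<alpha> / poly q \<alpha>" "y = poly p' \<alpha> / poly q' \<alpha>"
      using that unfolding R_def by auto
    show "R (p * q' + p' * q) (q * q') (x + y) \<and> V (p * q' + p' * q) (q * q') = V p q + V p' q'"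
    proof
      show "R (p * q' + p' * q) (q * q') (x + y)" unfolding R_def using c ar q0 by (simp add: xy add_frac_eq)
      show "V (p * q' + p' * q) (q * q') = V p q + V p' q'"
        unfolding V_def using c ar nz[OF that(1)] nz[OF that(2)] by (simp add: mh add_frac_eq)
    qed
    show "R (p * p') (q * q') (x * y) \<and> V (p * p') (q * q') = V p q * V p' q'"
      using that c ar unfolding R_def V_def by (auto simp: mh)
  qed
  have "subfield E'"
    unfolding subfield_def
  proof (intro conjI ballI subsetI)
    fix x :: complex assume "x \<in> \<rat>" then show "x \<in> E'" unfolding E'_def using Rconst(1) subfieldD(1)[OF E] by blast
  next
    fix x y assume "x \<in> E'" "y \<in> E'"
    then show "x + y \<in> E'" "x * y \<in> E'" unfolding E'_def using Radd Rmul by blast+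
  next
    fix x assume "x \<in> E'"
    then obtain p q where pq: "R p q x" unfolding E'_def by blast
    have "R (- p) q (- x)" using pq ar unfolding R_def by auto
    then show "- x \<in> E'" unfolding E'_def by blast
    show "inverse x \<in> E'"
    proof (cases "x = 0")
      case True then show ?thesis using pq unfolding E'_def by auto
    next
      case False
      then have "R q p (inverse x)" using pq unfolding R_def by (auto simp: field_simps)
      then show ?thesis unfolding E'_def by blast
    qed
  qed
  moreover have "field_hom E' \<tau>'"
    unfolding field_hom_def
  proof (intro conjI ballI)
    fix x y assume "x \<in> E'" "y \<in> E'"
    then obtain p q p' q' where R: "R p q x" "R p' q' y" unfolding E'_def by blast
    show "\<tau>' (x + y) = \<tau>' x + \<tau>' y" "\<tau>' (x * y) = \<tau>' x * \<tau>' y"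
      using val[OF conjunct1[OF Radd[OF R]]] val[OF conjunct1[OF Rmul[OF R]]] val[OF R(1)] val[OF R(2)]
        conjunct2[OF Radd[OF R]] conjunct2[OF Rmul[OF R]] by simp_all
  next
    fix x :: complex assume x: "x \<in> \<rat>"
    then show "\<tau>' x = x" using Rconst[OF subfieldD(1)[OF E x]] val field_homD(3)[OF t x] by metis
  qed
  moreover have "E \<subseteq> E'" unfolding E'_def using Rconst by blast
  moreover have "\<alpha> \<in> E'" "\<tau>' \<alpha> = \<beta>" using RA val unfolding E'_def by auto
  moreover have "\<forall>x\<in>E. \<tau>' x = \<tau> x" using Rconst val by metis
  ultimately show ?thesis by blast
qed

text \<open>\<beta> is a root of the image of \<open>m\<close>, a polynomial of least degree over
  \<open>E\<close> that vanishes at \<alpha>. Division by \<open>m\<close> gives one direction of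
  the equivalence.\<close>

lemma exists_conjugate:
  assumes E: "subfield E" and t: "field_hom E \<tau>" and "algebraic \<alpha>"
  shows "\<exists>\<beta>. \<forall>p. coeffs_in E p \<longrightarrow> (poly p \<alpha> = 0 \<longleftrightarrow> poly (map_poly \<tau> p) \<beta> = 0)"
proof -
  note ar = coeffs_in_arith[OF E]
  note mh = map_poly_hom[OF E t]
  obtain f where f: "\<forall>i. coeff f i \<in> \<rat>" "f \<noteq> 0" "poly f \<alpha> = 0"
    using assms(3) unfolding algebraic_altdef by blast
  define Q where "Q p \<longleftrightarrow> coeffs_in E p \<and> p \<noteq> 0 \<and> poly p \<alpha> = 0" for p
  have "Q f" unfolding Q_def coeffs_in_def using f subfieldD(1)[OF E] by blast
  then obtain m where m: "Q m" "\<And>p. Q p \<Longrightarrow> degree m \<le> degree p"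
    using ex_has_least_nat[of Q f degree] by blast
  have mE: "coeffs_in E m" "m \<noteq> 0" "poly m \<alpha> = 0" using m(1) unfolding Q_def by auto
  have deg_t: "degree (map_poly \<tau> p) = degree p" if "coeffs_in E p" for p
  proof (cases "p = 0")
    case False
    then show ?thesis using that by (intro map_poly_degree_eq field_hom_nonzero[OF E t]) (auto simp: coeffs_in_def)
  qed simp
  have t0: "map_poly \<tau> p \<noteq> 0" if "coeffs_in E p" "p \<noteq> 0" for p
  proof -
    have "coeff (map_poly \<tau> p) (degree p) \<noteq> 0"
      using that field_hom_nonzero[OF E t] by (simp add: coeff_map_poly field_homD(4)[OF t] coeffs_in_def)
    then show ?thesis by auto
  qed
  have "degree m \<noteq> 0"
  proof
    assume "degree m = 0"
    then obtain c where "m = [:c:]" by (metis degree_eq_zeroE)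
    then show False using mE by simp
  qed
  then have "degree (map_poly \<tau> m) \<noteq> 0" using deg_t[OF mE(1)] by simp
  then obtain \<beta> where b: "poly (map_poly \<tau> m) \<beta> = 0"
    using fundamental_theorem_of_algebra[of "map_poly \<tau> m"] by (auto simp: constant_degree)
  have fwd: "poly (map_poly \<tau> p) \<beta> = 0" if p: "coeffs_in E p" "poly p \<alpha> = 0" for p
  proof -
    obtain q r where qr: "coeffs_in E q" "coeffs_in E r" "p = q * m + r" "r = 0 \<or> degree r < degree m"
      using coeffs_in_division[OF E mE(1,2) p(1)] by blast
    have "poly r \<alpha> = 0" using p(2) mE(3) qr(3) by simp
    then have "r = 0" using qr m(2)[of r] unfolding Q_def by fastforce
    then have "map_poly \<tau> p = map_poly \<tau> q * map_poly \<tau> m" using qr mh mE by simp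
    then show ?thesis using b by simp
  qed
  \<comment> \<open>Otherwise a polynomial \<open>s\<close> of least degree whose image vanishes at
    \<beta> has smaller degree than \<open>m\<close> and divides it. Then one factor in
    \<open>m = u * s\<close> vanishes at \<alpha>, against the choice of \<open>m\<close>.\<close>
  have bwd: "poly p \<alpha> = 0" if p: "coeffs_in E p" "poly (map_poly \<tau> p) \<beta> = 0" for p
  proof (rule ccontr)
    assume pa: "poly p \<alpha> \<noteq> 0"
    define W where "W r \<longleftrightarrow> coeffs_in E r \<and> r \<noteq> 0 \<and> degree r < degree m \<and> poly (map_poly \<tau> r) \<beta> = 0" for r
    obtain q r where qr: "coeffs_in E q" "coeffs_in E r" "p = q * m + r" "r = 0 \<or> degree r < degree m"
      using coeffs_in_division[OF E mE(1,2) p(1)] by blast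
    have "r \<noteq> 0" using pa qr(3) mE(3) by auto
    have "map_poly \<tau> p = map_poly \<tau> q * map_poly \<tau> m + map_poly \<tau> r" using qr mh mE ar by simp
    then have "poly (map_poly \<tau> r) \<beta> = 0" using p(2) b by simp
    then have "W r" using \<open>r \<noteq> 0\<close> qr unfolding W_def by simp
    then obtain s where s: "W s" "\<And>u. W u \<Longrightarrow> degree s \<le> degree u"
      using ex_has_least_nat[of W r degree] by blast
    have sE: "coeffs_in E s" "s \<noteq> 0" "degree s < degree m" "poly (map_poly \<tau> s) \<beta> = 0" using s(1) unfolding W_def by auto
    obtain u v where uv: "coeffs_in E u" "coeffs_in E v" "m = u * s + v" "v = 0 \<or> degree v < degree s"
      using coeffs_in_division[OF E sE(1,2) mE(1)] by blast
    have "map_poly \<tau> m = map_poly \<tau> u * map_poly \<tau> s + map_poly \<tau> v" using uv mh sE ar by simp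
    then have "poly (map_poly \<tau> v) \<beta> = 0" using b sE(4) by simp
    then have "v = 0" using s(2)[of v] uv sE(3) unfolding W_def by fastforce
    then have mus: "m = u * s" using uv by simp
    then have un: "u \<noteq> 0" using mE(2) by auto
    have "degree s \<noteq> 0"
    proof
      assume "degree s = 0"
      then obtain c where c: "s = [:c:]" by (metis degree_eq_zeroE)
      then have "c \<in> E" "c \<noteq> 0" using sE unfolding coeffs_in_def by (auto simp: coeff_pCons dest: spec[of _ 0])
      then have "\<tau> c \<noteq> 0" using field_hom_nonzero[OF E t] by blast
      then show False using sE(4) c by (simp add: map_poly_pCons field_homD(4)[OF t])
    qed
    then have "degree u < degree m" using mus un sE(2) by (simp add: degree_mult_eq)
    moreover have "poly u \<alpha> = 0 \<or> poly s \<alpha> = 0" using mus mE(3) by simp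
    ultimately show False using m(2)[of u] m(2)[of s] uv un sE unfolding Q_def by fastforce
  qed
  show ?thesis using fwd bwd by blast
qed

lemma extend_hom_finite:
  assumes "finite A" "\<And>a. a \<in> A \<Longrightarrow> algebraic a" "subfield E" "field_hom E \<tau>"
  shows "\<exists>E' \<tau>'. subfield E' \<and> field_hom E' \<tau>' \<and> E \<subseteq> E' \<and> A \<subseteq> E' \<and> (\<forall>x\<in>E. \<tau>' x = \<tau> x)"
  using assms(1,2)
proof (induction A rule: finite_induct)
  case empty then show ?case using assms(3,4) by blast
next
  case (insert a A)
  then obtain E1 t1 where 1: "subfield E1" "field_hom E1 t1" "E \<subseteq> E1" "A \<subseteq> E1" "\<forall>x\<in>E. t1 x = \<tau> x" by auto
  obtain b where "\<forall>p. coeffs_in E1 p \<longrightarrow> (poly p a = 0 \<longleftrightarrow> poly (map_poly t1 p) b = 0)"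
    using exists_conjugate[OF 1(1,2)] insert.prems by blast
  then obtain E2 t2 where "subfield E2" "field_hom E2 t2" "E1 \<subseteq> E2" "a \<in> E2" "\<forall>x\<in>E1. t2 x = t1 x"
    using extend_hom[OF 1(1,2), of a b] by blast
  then show ?case using 1 by (intro exI[of _ E2] exI[of _ t2]) auto
qed

section \<open>Rational polynomials and their splitting fields\<close>

abbreviation cp :: "rat poly \<Rightarrow> complex poly" where "cp f \<equiv> map_poly of_rat f"

lemma cp_arith:
  "cp (p + q) = cp p + cp q" "cp (p - q) = cp p - cp q" "cp (p * q) = cp p * cp q" "cp 1 = 1" "cp 0 = 0"
  "degree (cp p) = degree p" "lead_coeff (cp p) = of_rat (lead_coeff p)" "cp p = 0 \<longleftrightarrow> p = 0"
  "coeff (cp p) i = of_rat (coeff p i)"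
proof -
  show d: "degree (cp p) = degree p" by (rule degree_map_poly) simp
  show "lead_coeff (cp p) = of_rat (lead_coeff p)" using d by (simp add: coeff_map_poly)
  show "cp p = 0 \<longleftrightarrow> p = 0" by (simp add: poly_eq_iff coeff_map_poly)
  show "coeff (cp p) i = of_rat (coeff p i)" by (simp add: coeff_map_poly)
qed (auto intro!: poly_eqI simp: coeff_map_poly of_rat_add of_rat_diff coeff_mult of_rat_sum of_rat_mult)

lemma coeffs_in_Rats_ex:
  assumes "coeffs_in \<rat> q" obtains p where "q = cp p"
proof -
  define f where "f z = (SOME r. of_rat r = (z :: complex))" for z
  have f: "of_rat (f z) = z" if "z \<in> \<rat>" for z
  proof -
    have "\<exists>r. of_rat r = z" using that by (elim Rats_cases) auto
    then show ?thesis unfolding f_def by (rule someI_ex)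
  qed
  have "f 0 = 0" using f[of 0] by simp
  then have "cp (map_poly f q) = q"
    using assms unfolding coeffs_in_def by (intro poly_eqI) (simp add: coeff_map_poly f)
  then show ?thesis using that by metis
qed

lemma irreducible_root_dvd:
  fixes f p :: "rat poly"
  assumes "irreducible f" "poly (cp f) x = 0" "poly (cp p) x = 0"
  shows "f dvd p"
proof (rule ccontr)
  assume "\<not> f dvd p"
  then have "coprime f p"
    by (intro prime_elem_imp_coprime[OF irreducible_imp_prime_elem_gcd[OF assms(1)] \<open>\<not> f dvd p\<close>])
  then obtain u v where "u * f + v * p = 1"
    using bezout_coefficients_fst_snd[of f p] by (metis coprime_imp_gcd_eq_1)
  then have "cp u * cp f + cp v * cp p = 1" by (metis cp_arith(1,3,4))
  then have "poly (cp u * cp f + cp v * cp p) x = 1" by simp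
  then show False using assms(2,3) by simp
qed

lemma rsquarefree_card_roots:
  assumes "rsquarefree (p :: complex poly)"
  shows "card {z. poly p z = 0} = degree p"
proof -
  have p0: "p \<noteq> 0" using assms unfolding rsquarefree_def by simp
  have "degree p = size (proots p)" by (simp add: size_proots_complex)
  also have "\<dots> = (\<Sum>z\<in>set_mset (proots p). count (proots p) z)" by (rule size_multiset_overloaded_eq)
  also have "\<dots> = (\<Sum>z\<in>{z. poly p z = 0}. 1)"
  proof (rule sum.cong)
    show "set_mset (proots p) = {z. poly p z = 0}" using p0 by simp
    fix z assume "z \<in> {z. poly p z = 0}"
    then have "Polynomial.order z p \<noteq> 0" using p0 by (simp add: order_root)
    moreover have "Polynomial.order z p = 0 \<or> Polynomial.order z p = 1" using assms unfolding rsquarefree_def by blast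
    ultimately show "count (proots p) z = 1" using p0 by (metis count_proots)
  qed
  finally show ?thesis by simp
qed

lemma complex_roots_finite: "f \<noteq> 0 \<Longrightarrow> finite (complex_roots f)"
  unfolding complex_roots_def by (rule poly_roots_finite) (simp add: cp_arith)

lemma complex_roots_algebraic: "f \<noteq> 0 \<Longrightarrow> z \<in> complex_roots f \<Longrightarrow> algebraic z"
  unfolding complex_roots_def using algebraic_of_rat_poly by auto

lemma splitting_field_algebraic: "f \<noteq> 0 \<Longrightarrow> z \<in> splitting_field f \<Longrightarrow> algebraic z"
  unfolding splitting_field_def using rat_adjoin_algebraic complex_roots_algebraic by blast

lemma subfield_splitting_field: "subfield (splitting_field f)"
  unfolding splitting_field_def subfield_def by (auto intro: rat_adjoin.intros)

lemma roots_in_splitting_field: "complex_roots f \<subseteq> splitting_field f"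
  unfolding splitting_field_def by (auto intro: rat_adjoin.gen)

lemma rat_adjoin_least:
  assumes "subfield E" "S \<subseteq> E" shows "rat_adjoin S \<subseteq> E"
proof
  fix z assume "z \<in> rat_adjoin S"
  then show "z \<in> E" by induction (use assms subfieldD[OF assms(1)] in auto)
qed

lemma rat_automorphisms_hom: "\<sigma> \<in> rat_automorphisms K \<Longrightarrow> field_hom K \<sigma>"
  unfolding rat_automorphisms_def field_hom_def by simp

lemma hom_maps_roots:
  assumes "subfield E" "field_hom E \<tau>" "z \<in> E" "poly (cp f) z = 0"
  shows "poly (cp f) (\<tau> z) = 0"
proof -
  have "coeffs_in E (cp f)" unfolding coeffs_in_def using subfieldD(1)[OF assms(1)] by (simp add: coeff_map_poly)
  then have "\<tau> (poly (cp f) z) = poly (map_poly \<tau> (cp f)) (\<tau> z)" by (rule hom_poly[OF assms(1,2) _ assms(3)])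
  moreover have "map_poly \<tau> (cp f) = cp f"
    by (intro poly_eqI) (simp add: coeff_map_poly[where f = \<tau>, OF field_homD(4)[OF assms(2)]] coeff_map_poly field_homD(3)[OF assms(2)])
  ultimately show ?thesis using assms(4) field_homD(4)[OF assms(2)] by simp
qed

text \<open>On the finite root set an injective map into itself is a permutation, so the splitting
  field and its image are generated by the same roots.\<close>

lemma hom_restrict_automorphism:
  assumes f: "f \<noteq> 0" and E: "subfield E" "field_hom E \<tau>" "complex_roots f \<subseteq> E"
  shows "\<tau> \<in> rat_automorphisms (splitting_field f)"
proof -
  define R where "R = complex_roots f"
  define K where "K = splitting_field f"
  have KE: "K \<subseteq> E" unfolding K_def splitting_field_def by (rule rat_adjoin_least[OF E(1,3)])
  have inj: "inj_on \<tau> K" using field_hom_inj[OF E(1,2)] KE unfolding inj_on_def by blast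
  have RK: "R \<subseteq> K" unfolding R_def K_def by (rule roots_in_splitting_field)
  have tR: "\<tau> ` R \<subseteq> R"
    using hom_maps_roots[OF E(1,2)] E(3) unfolding R_def complex_roots_def by auto
  have tR': "\<tau> ` R = R"
    by (rule endo_inj_surj) (use complex_roots_finite[OF f] tR inj_on_subset[OF inj RK] in \<open>auto simp: R_def\<close>)
  have sub: "\<tau> z \<in> K" if "z \<in> rat_adjoin R" for z
  proof -
    have "z \<in> K \<and> \<tau> z \<in> K" using that
    proof induction
      case (rat z) then show ?case using field_homD(3)[OF E(2)] unfolding K_def splitting_field_def by (simp add: rat_adjoin.rat)
    next
      case (gen z) then show ?case using tR RK by auto
    next
      case (minus z) then show ?case using KE field_hom_minus[OF E(1,2), of z] subfieldD(4)[OF subfield_splitting_field] unfolding K_def by auto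
    next
      case (inverse z) then show ?case using KE field_hom_inverse[OF E(1,2), of z] subfieldD(5)[OF subfield_splitting_field] unfolding K_def by auto
    next
      case (add z w) then show ?case using field_homD(1)[OF E(2) subsetD[OF KE] subsetD[OF KE], of z w] subfieldD(2)[OF subfield_splitting_field] unfolding K_def by metis
    next
      case (mult z w) then show ?case using field_homD(2)[OF E(2) subsetD[OF KE] subsetD[OF KE], of z w] subfieldD(3)[OF subfield_splitting_field] unfolding K_def by metis
    qed
    then show ?thesis by simp
  qed
  have KR: "K = rat_adjoin R" unfolding K_def R_def splitting_field_def ..
  have sur: "z \<in> \<tau> ` K" if "z \<in> rat_adjoin R" for z
    using that
  proof induction
    case (rat z)
    then show ?case using field_homD(3)[OF E(2)] subfieldD(1)[OF subfield_splitting_field] unfolding K_def by (metis image_eqI)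
  next
    case (gen z) then show ?case using tR' RK by auto
  next
    case (minus z)
    then obtain x where "x \<in> K" "z = \<tau> x" by auto
    then have "- z = \<tau> (- x)" "- x \<in> K" using KE field_hom_minus[OF E(1,2), of x] subfieldD(4)[OF subfield_splitting_field] unfolding K_def by auto
    then show ?case by blast
  next
    case (inverse z)
    then obtain x where "x \<in> K" "z = \<tau> x" by auto
    then have "inverse z = \<tau> (inverse x)" "inverse x \<in> K" using KE field_hom_inverse[OF E(1,2), of x] subfieldD(5)[OF subfield_splitting_field] unfolding K_def by auto
    then show ?case by blast
  next
    case (add z w)
    then obtain x y where "x \<in> K" "z = \<tau> x" "y \<in> K" "w = \<tau> y" by auto
    then have "z + w = \<tau> (x + y)" "x + y \<in> K" using field_homD(1)[OF E(2) subsetD[OF KE] subsetD[OF KE], of x y] subfieldD(2)[OF subfield_splitting_field] unfolding K_def by metis+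
    then show ?case by blast
  next
    case (mult z w)
    then obtain x y where "x \<in> K" "z = \<tau> x" "y \<in> K" "w = \<tau> y" by auto
    then have "z * w = \<tau> (x * y)" "x * y \<in> K" using field_homD(2)[OF E(2) subsetD[OF KE] subsetD[OF KE], of x y] subfieldD(3)[OF subfield_splitting_field] unfolding K_def by metis+
    then show ?case by blast
  qed
  have "bij_betw \<tau> K K" unfolding bij_betw_def using inj sub sur KR by blast
  moreover have "\<forall>x\<in>K. \<forall>y\<in>K. \<tau> (x + y) = \<tau> x + \<tau> y" "\<forall>x\<in>K. \<forall>y\<in>K. \<tau> (x * y) = \<tau> x * \<tau> y"
    using KE field_homD[OF E(2)] by blast+
  moreover have "\<forall>q\<in>\<rat>. \<tau> q = q" using field_homD(3)[OF E(2)] by blast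
  ultimately show ?thesis unfolding rat_automorphisms_def K_def by simp
qed

text \<open>The homomorphism is first defined on \<open>\<rat>\<close> with \<open>x\<close>
  adjoined and then extended to the roots of \<open>f\<close>, which it permutes.\<close>

lemma conjugate_automorphism:
  assumes f: "f \<noteq> 0" and g: "irreducible g" "poly (cp g) x = 0" "poly (cp g) y = 0"
  shows "\<exists>\<sigma>\<in>rat_automorphisms (splitting_field f). \<sigma> x = y"
proof -
  have id: "field_hom \<rat> (\<lambda>x. x)" unfolding field_hom_def by simp
  have iff: "poly p x = 0 \<longleftrightarrow> poly (map_poly (\<lambda>x. x) p) y = 0" if "coeffs_in \<rat> p" for p
  proof -
    obtain q where q: "p = cp q" using coeffs_in_Rats_ex \<open>coeffs_in \<rat> p\<close> by blast
    have "poly (cp q) u = 0" if "g dvd q" "poly (cp g) u = 0" for u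
      using that by (elim dvdE) (simp add: cp_arith)
    then show ?thesis using irreducible_root_dvd[OF g(1)] g q by (metis map_poly_idI')
  qed
  obtain E1 t1 where 1: "subfield E1" "field_hom E1 t1" "x \<in> E1" "t1 x = y"
    using extend_hom[OF subfield_Rats id iff] by blast
  obtain E2 t2 where 2: "subfield E2" "field_hom E2 t2" "complex_roots f \<subseteq> E2" "\<forall>x\<in>E1. t2 x = t1 x"
    using extend_hom_finite[OF complex_roots_finite[OF f] complex_roots_algebraic[OF f] 1(1,2)] by blast
  show ?thesis using hom_restrict_automorphism[OF f 2(1,2,3)] 2(4) 1 by auto
qed

lemma algebraic_irreducible:
  assumes "algebraic (x :: complex)"
  obtains g :: "rat poly" where "irreducible g" "poly (cp g) x = 0"
proof -
  obtain p :: "rat poly" where p: "p \<noteq> 0" "poly (cp p) x = 0" using algebraic_rat_polyE[OF assms] by blast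
  define Q where "Q g \<longleftrightarrow> g \<noteq> 0 \<and> poly (cp g) x = 0" for g
  obtain g where g: "Q g" "\<And>h. Q h \<Longrightarrow> degree g \<le> degree h"
    using ex_has_least_nat[of Q p degree] p unfolding Q_def by blast
  have g0: "g \<noteq> 0" "poly (cp g) x = 0" using g(1) unfolding Q_def by auto
  have dg: "degree g \<noteq> 0"
  proof
    assume "degree g = 0"
    then obtain c where "g = [:c:]" by (metis degree_eq_zeroE)
    then show False using g0 by (auto simp: map_poly_pCons)
  qed
  have "irreducible g"
  proof (rule irreducibleI)
    show "g \<noteq> 0" by fact
    show "\<not> g dvd 1" using dg by (metis is_unit_iff_degree g0(1))
    fix a b assume ab: "g = a * b"
    then have n: "a \<noteq> 0" "b \<noteq> 0" using g0 by auto
    have d: "degree g = degree a + degree b" using ab n by (simp add: degree_mult_eq)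
    have "poly (cp a) x = 0 \<or> poly (cp b) x = 0" using g0(2) ab by (simp add: cp_arith)
    then have "degree g \<le> degree a \<or> degree g \<le> degree b" using g(2) n unfolding Q_def by blast
    then have "degree a = 0 \<or> degree b = 0" using d by auto
    then show "a dvd 1 \<or> b dvd 1" using n by (simp add: is_unit_iff_degree)
  qed
  then show ?thesis using that g0 by blast
qed

text \<open>Every root of the irreducible polynomial of \<open>x\<close> is an image of
  \<open>x\<close> under an automorphism, so \<open>x\<close> is its only root; being squarefree,
  the polynomial is linear.\<close>

lemma fixed_is_rational:
  assumes f: "f \<noteq> 0" and x: "x \<in> splitting_field f" "\<And>\<sigma>. \<sigma> \<in> rat_automorphisms (splitting_field f) \<Longrightarrow> \<sigma> x = x"
  shows "x \<in> \<rat>"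
proof -
  obtain g :: "rat poly" where g: "irreducible g" "poly (cp g) x = 0"
    using algebraic_irreducible[OF splitting_field_algebraic[OF f x(1)]] by blast
  have uniq: "y = x" if "poly (cp g) y = 0" for y
    using conjugate_automorphism[OF f g that] x(2) by auto
  have g0: "cp g \<noteq> 0" using g(1) by (auto simp: cp_arith)
  have sq: "rsquarefree (cp g)"
  proof (rule ccontr)
    assume "\<not> rsquarefree (cp g)"
    then obtain u where u: "poly (cp g) u = 0" "poly (pderiv (cp g)) u = 0"
      using rsquarefree_roots by blast
    have "pderiv (cp g) = cp (pderiv g)"
      by (intro poly_eqI) (simp add: coeff_pderiv coeff_map_poly of_rat_mult of_rat_add)
    then have "g dvd pderiv g" using irreducible_root_dvd[OF g(1) u(1), of "pderiv g"] u(2) by metis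
    have dg: "degree g \<noteq> 0" using g(1) g0 by (metis irreducible_not_unit is_unit_iff_degree cp_arith(8))
    then show False using \<open>g dvd pderiv g\<close> by simp
  qed
  have "card {z. poly (cp g) z = 0} = degree (cp g)"
    by (rule rsquarefree_card_roots[OF sq])
  moreover have "{z. poly (cp g) z = 0} = {x}" using uniq g(2) by blast
  ultimately have "card {x} = degree (cp g)" by (simp only:)
  then have d1: "degree g = 1" by (simp add: cp_arith(6))
  define a b where "a = coeff g 0" and "b = coeff g 1"
  have "g = [:a, b:]"
  proof (rule poly_eqI)
    fix i :: nat
    consider "i = 0" | "i = 1" | "i > 1" by linarith
    then show "coeff g i = coeff [:a, b:] i"
    proof cases
      case 3
      then have "coeff g i = 0" using d1 by (intro coeff_eq_0) simp
      moreover have "coeff [:a, b:] i = 0" using 3 by (intro coeff_eq_0) (simp add: degree_pCons_eq_if)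
      ultimately show ?thesis by simp
    qed (simp_all add: a_def b_def)
  qed
  moreover have "b \<noteq> 0" unfolding b_def using d1 by (metis degree_0 leading_coeff_0_iff zero_neq_one)
  ultimately have ab: "g = [:a, b:]" "b \<noteq> 0" by simp_all
  have "of_rat a + x * of_rat b = 0" using g(2) unfolding ab(1) by (simp add: map_poly_pCons)
  then have "x = of_rat (- a / b)" using ab(2) by (simp add: of_rat_divide of_rat_minus field_simps eq_neg_iff_add_eq_0)
  then show ?thesis by simp
qed

section \<open>The Galois group as a group of permutations\<close>

locale splitting =
  fixes f :: "rat poly"
  assumes f0: "f \<noteq> 0"
begin

abbreviation "R \<equiv> complex_roots f"
abbreviation "K \<equiv> splitting_field f"
abbreviation "A \<equiv> rat_automorphisms K"
abbreviation "G \<equiv> galois_group f"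

lemmas subK = subfield_splitting_field[of f]
lemmas RK = roots_in_splitting_field[of f]

lemma finR: "finite R" by (rule complex_roots_finite[OF f0])

lemma A_K: "\<sigma> \<in> A \<Longrightarrow> x \<in> K \<Longrightarrow> \<sigma> x \<in> K"
  unfolding rat_automorphisms_def bij_betw_def by auto

lemma A_R: "\<sigma> \<in> A \<Longrightarrow> x \<in> R \<Longrightarrow> \<sigma> x \<in> R"
  using hom_maps_roots[OF subK rat_automorphisms_hom] RK unfolding complex_roots_def by blast

lemma A_inj: "\<sigma> \<in> A \<Longrightarrow> inj_on \<sigma> K"
  unfolding rat_automorphisms_def bij_betw_def by auto

lemma perm_restrict_permutes: "\<sigma> \<in> A \<Longrightarrow> perm_restrict \<sigma> R permutes R"
proof -
  assume s: "\<sigma> \<in> A"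
  have i: "inj_on \<sigma> R" using A_inj[OF s] RK by (rule inj_on_subset)
  have "\<sigma> ` R = R" by (rule endo_inj_surj) (use finR A_R[OF s] i in auto)
  then have "bij_betw \<sigma> R R" using i unfolding bij_betw_def by simp
  then have "bij_betw (perm_restrict \<sigma> R) R R"
    by (rule bij_betw_cong[THEN iffD1, rotated]) (simp add: perm_restrict_def)
  then show ?thesis by (rule bij_imp_permutes) (simp add: perm_restrict_def)
qed

lemma A_comp: "\<sigma> \<in> A \<Longrightarrow> \<tau> \<in> A \<Longrightarrow> \<sigma> \<circ> \<tau> \<in> A"
proof -
  assume a: "\<sigma> \<in> A" "\<tau> \<in> A"
  have "bij_betw (\<sigma> \<circ> \<tau>) K K" using a bij_betw_trans unfolding rat_automorphisms_def by blast
  then show ?thesis using a A_K[OF a(2)] unfolding rat_automorphisms_def by simp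
qed

lemma A_id: "id \<in> A"
  unfolding rat_automorphisms_def by auto

lemma perm_restrict_comp:
  "\<tau> \<in> A \<Longrightarrow> perm_restrict (\<sigma> \<circ> \<tau>) R = perm_restrict \<sigma> R \<circ> perm_restrict \<tau> R"
  using A_R by (auto simp: fun_eq_iff perm_restrict_def)

lemma A_determined:
  assumes "\<sigma> \<in> A" "\<tau> \<in> A" "\<And>x. x \<in> R \<Longrightarrow> \<sigma> x = \<tau> x" "z \<in> K"
  shows "\<sigma> z = \<tau> z"
proof -
  note h = rat_automorphisms_hom[OF assms(1)] rat_automorphisms_hom[OF assms(2)]
  have KR: "K = rat_adjoin R" unfolding splitting_field_def ..
  have "z \<in> rat_adjoin R" using assms(4) KR by simp
  then show ?thesis
  proof induction
    case (rat z) then show ?case using field_homD(3)[OF h(1)] field_homD(3)[OF h(2)] by simp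
  next
    case (gen z) then show ?case using assms(3) by simp
  next
    case (minus z) then show ?case using field_hom_minus[OF subK h(1)] field_hom_minus[OF subK h(2)] KR by simp
  next
    case (inverse z) then show ?case using field_hom_inverse[OF subK h(1)] field_hom_inverse[OF subK h(2)] KR by simp
  next
    case (add z w) then show ?case using field_homD(1)[OF h(1)] field_homD(1)[OF h(2)] KR by simp
  next
    case (mult z w) then show ?case using field_homD(2)[OF h(1)] field_homD(2)[OF h(2)] KR by simp
  qed
qed

lemma G_permutes: "g \<in> G \<Longrightarrow> g permutes R"
  unfolding galois_group_def using perm_restrict_permutes by auto

lemma G_id: "id \<in> G"
proof -
  have "perm_restrict id R = id" by (auto simp: perm_restrict_def)
  then show ?thesis unfolding galois_group_def using A_id by (metis imageI)
qed

lemma G_comp: "g \<in> G \<Longrightarrow> h \<in> G \<Longrightarrow> g \<circ> h \<in> G"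
proof -
  assume "g \<in> G" "h \<in> G"
  then obtain \<sigma> \<tau> where s: "\<sigma> \<in> A" "\<tau> \<in> A" "g = perm_restrict \<sigma> R" "h = perm_restrict \<tau> R"
    unfolding galois_group_def by blast
  then have "g \<circ> h = perm_restrict (\<sigma> \<circ> \<tau>) R" using perm_restrict_comp[OF s(2)] by simp
  then show ?thesis unfolding galois_group_def using A_comp[OF s(1,2)] by blast
qed

lemma G_fin: "finite G"
  by (rule finite_subset[OF _ finite_permutations[OF finR]]) (use G_permutes in auto)

lemma comp_inj_on: "h \<in> G \<Longrightarrow> inj_on (\<lambda>g. g \<circ> h) G"
proof (rule inj_onI)
  fix a b assume h: "h \<in> G" and e: "a \<circ> h = b \<circ> h"
  have "(a \<circ> h) \<circ> inv h = (b \<circ> h) \<circ> inv h" using e by (rule arg_cong)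
  then show "a = b" unfolding comp_assoc permutes_inv_o(1)[OF G_permutes[OF h]] by simp
qed

lemma G_inv: "g \<in> G \<Longrightarrow> inv g \<in> G"
proof -
  assume g: "g \<in> G"
  have "(\<lambda>h. h \<circ> g) ` G = G"
    by (rule endo_inj_surj) (use G_fin G_comp g comp_inj_on in auto)
  then obtain h where h: "h \<in> G" "h \<circ> g = id" using G_id by (metis imageE)
  have "h \<circ> (g \<circ> inv g) = inv g" using h(2) by (simp add: comp_assoc[symmetric])
  then have "inv g = h" using permutes_inv_o(1)[OF G_permutes[OF g]] by simp
  then show ?thesis using h by simp
qed

sublocale gal: perm_group R G
  by unfold_locales (use finR G_permutes G_id G_comp G_inv in auto)

text \<open>Elements of \<open>G\<close> are permutations of the roots; to act on the whole
  splitting field they need an automorphism that induces them. By \<open>A_determined\<close> the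
  choice does not matter on \<open>K\<close>, and statements about \<open>rep\<close> are confined
  to arguments in \<open>K\<close>.\<close>

definition rep :: "(complex \<Rightarrow> complex) \<Rightarrow> complex \<Rightarrow> complex" where
  "rep g = (SOME \<sigma>. \<sigma> \<in> A \<and> perm_restrict \<sigma> R = g)"

lemma rep: "g \<in> G \<Longrightarrow> rep g \<in> A" "g \<in> G \<Longrightarrow> perm_restrict (rep g) R = g"
proof -
  have ex: "\<exists>\<sigma>. \<sigma> \<in> A \<and> perm_restrict \<sigma> R = g" if "g \<in> G" for g using that unfolding galois_group_def by auto
  have *: "rep g \<in> A \<and> perm_restrict (rep g) R = g" if "g \<in> G" for g
    unfolding rep_def by (rule someI_ex[of "\<lambda>\<sigma>. \<sigma> \<in> A \<and> perm_restrict \<sigma> R = g"]) (rule ex[OF that])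
  show "g \<in> G \<Longrightarrow> rep g \<in> A" "g \<in> G \<Longrightarrow> perm_restrict (rep g) R = g" using * by auto
qed

lemma rep_R: "g \<in> G \<Longrightarrow> x \<in> R \<Longrightarrow> rep g x = g x"
proof -
  assume "g \<in> G" "x \<in> R"
  then have "perm_restrict (rep g) R x = g x" using rep(2) by metis
  then show ?thesis using \<open>x \<in> R\<close> by (simp only: perm_restrict_def if_True)
qed

lemma in_G: "\<sigma> \<in> A \<Longrightarrow> perm_restrict \<sigma> R \<in> G" unfolding galois_group_def by auto

lemma rep_restrict: "\<sigma> \<in> A \<Longrightarrow> x \<in> K \<Longrightarrow> rep (perm_restrict \<sigma> R) x = \<sigma> x"
  by (rule A_determined[OF rep(1)[OF in_G]]) (auto simp: rep_R[OF in_G] perm_restrict_def)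

lemma rep_comp: "g \<in> G \<Longrightarrow> h \<in> G \<Longrightarrow> x \<in> K \<Longrightarrow> rep (g \<circ> h) x = rep g (rep h x)"
proof -
  assume a: "g \<in> G" "h \<in> G" "x \<in> K"
  have "perm_restrict (rep g \<circ> rep h) R = g \<circ> h" using perm_restrict_comp[OF rep(1)[OF a(2)]] rep(2) a by simp
  then show ?thesis using rep_restrict[OF A_comp[OF rep(1)[OF a(1)] rep(1)[OF a(2)]] a(3)] by simp
qed

lemma rep_id: "x \<in> K \<Longrightarrow> rep id x = x"
proof -
  assume "x \<in> K"
  have "perm_restrict id R = id" by (auto simp: perm_restrict_def)
  then show ?thesis using rep_restrict[OF A_id \<open>x \<in> K\<close>] by simp
qed

lemma rep_inv: "g \<in> G \<Longrightarrow> x \<in> K \<Longrightarrow> rep g (rep (inv g) x) = x"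
  using rep_comp[OF _ G_inv, of g g x] rep_id gal.inv_comp(2) by simp

lemma K_algebraic: "x \<in> K \<Longrightarrow> algebraic x" by (rule splitting_field_algebraic[OF f0])

lemma fixed_Rats: "x \<in> K \<Longrightarrow> (\<And>g. g \<in> G \<Longrightarrow> rep g x = x) \<Longrightarrow> x \<in> \<rat>"
proof -
  assume x: "x \<in> K" "\<And>g. g \<in> G \<Longrightarrow> rep g x = x"
  then have "\<sigma> x = x" if "\<sigma> \<in> A" for \<sigma> using in_G[OF that] rep_restrict[OF that x(1)] by metis
  then show ?thesis by (rule fixed_is_rational[OF f0 x(1)])
qed

lemma map_poly_prod_hom:
  assumes "finite I" "\<And>i. i \<in> I \<Longrightarrow> coeffs_in K (F i)" "field_hom K \<sigma>"
  shows "coeffs_in K (\<Prod>i\<in>I. F i) \<and> map_poly \<sigma> (\<Prod>i\<in>I. F i) = (\<Prod>i\<in>I. map_poly \<sigma> (F i))"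
  using assms(1,2)
  by (induction I rule: finite_induct)
     (auto simp: coeffs_in_arith[OF subK] map_poly_hom[OF subK assms(3)] map_poly_1' field_homD[OF assms(3)])

lemma invariant_poly_rational:
  assumes "coeffs_in K P" "\<And>g. g \<in> G \<Longrightarrow> map_poly (rep g) P = P"
  obtains q where "P = cp q"
proof -
  have "coeff P i \<in> \<rat>" for i
  proof (rule fixed_Rats)
    show "coeff P i \<in> K" using assms(1) unfolding coeffs_in_def by simp
    fix g assume g: "g \<in> G"
    have "coeff (map_poly (rep g) P) i = rep g (coeff P i)"
      by (rule coeff_map_poly[where f = "rep g"]) (use field_homD(4)[OF rat_automorphisms_hom[OF rep(1)[OF g]]] in simp)
    then show "rep g (coeff P i) = coeff P i" using assms(2)[OF g] by simp
  qed
  then show ?thesis using coeffs_in_Rats_ex that unfolding coeffs_in_def by metis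
qed

text \<open>An automorphism only permutes the linear factors, so the coefficients are fixed by the
  whole group. This brings the Newton polygon of a rational polynomial to bear on any element of
  \<open>K\<close>.\<close>

lemma char_poly_rational:
  assumes b: "\<beta> \<in> K"
  obtains q where "(\<Prod>g\<in>G. [:- rep g \<beta>, 1:]) = cp q"
proof (rule invariant_poly_rational)
  have lin: "coeffs_in K [:- x, 1:]" if "x \<in> K" for x
    unfolding coeffs_in_def
  proof
    fix i show "coeff [:- x, 1:] i \<in> K"
      using subfieldD(4)[OF subK that] subfieldD(6,7)[OF subK] by (cases i) (simp_all add: coeff_pCons split: nat.split)
  qed
  have repK: "rep g \<beta> \<in> K" if "g \<in> G" for g using A_K[OF rep(1)[OF that] b] .
  show "coeffs_in K (\<Prod>g\<in>G. [:- rep g \<beta>, 1:])"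
    by (rule conjunct1[OF map_poly_prod_hom[OF G_fin lin[OF repK] rat_automorphisms_hom[OF A_id]]])
  fix h assume h: "h \<in> G"
  note hh = rat_automorphisms_hom[OF rep(1)[OF h]]
  have "map_poly (rep h) (\<Prod>g\<in>G. [:- rep g \<beta>, 1:]) = (\<Prod>g\<in>G. map_poly (rep h) [:- rep g \<beta>, 1:])"
    by (rule conjunct2[OF map_poly_prod_hom[OF G_fin lin[OF repK] hh]])
  also have "\<dots> = (\<Prod>g\<in>G. [:- rep (h \<circ> g) \<beta>, 1:])"
  proof (rule prod.cong[OF refl])
    fix g assume g: "g \<in> G"
    show "map_poly (rep h) [:- rep g \<beta>, 1:] = [:- rep (h \<circ> g) \<beta>, 1:]"
    proof (rule poly_eqI)
      fix i
      have "coeff (map_poly (rep h) [:- rep g \<beta>, 1:]) i = rep h (coeff [:- rep g \<beta>, 1:] i)"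
        by (rule coeff_map_poly[where f = "rep h", OF field_homD(4)[OF hh]])
      also have "\<dots> = coeff [:- rep (h \<circ> g) \<beta>, 1:] i"
      proof (cases i)
        case 0 then show ?thesis using field_hom_minus[OF subK hh repK[OF g]] rep_comp[OF h g b] by simp
      next
        case (Suc j) then show ?thesis using field_homD(4,5)[OF hh] by (cases j) simp_all
      qed
      finally show "coeff (map_poly (rep h) [:- rep g \<beta>, 1:]) i = coeff [:- rep (h \<circ> g) \<beta>, 1:] i" .
    qed
  qed
  also have "\<dots> = (\<Prod>g\<in>G. [:- rep g \<beta>, 1:])"
  proof (rule prod.reindex_bij_betw[where h = "\<lambda>g. h \<circ> g" and g = "\<lambda>g. [:- rep g \<beta>, 1:]"])
    have "inj_on (\<lambda>g. h \<circ> g) G"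
      by (rule inj_onI) (metis comp_assoc gal.inv_comp(1) h id_comp)
    moreover from this have "(\<lambda>g. h \<circ> g) ` G = G"
      by (intro endo_inj_surj) (use G_fin G_comp h in auto)
    ultimately show "bij_betw (\<lambda>g. h \<circ> g) G G" unfolding bij_betw_def by simp
  qed
  finally show "map_poly (rep h) (\<Prod>g\<in>G. [:- rep g \<beta>, 1:]) = (\<Prod>g\<in>G. [:- rep g \<beta>, 1:])" .
qed

lemma G_transitive:
  assumes "irreducible f" "x \<in> R" "y \<in> R" shows "\<exists>g\<in>G. g x = y"
proof -
  obtain \<sigma> where s: "\<sigma> \<in> A" "\<sigma> x = y"
    using conjugate_automorphism[OF f0 assms(1), of x y] assms(2,3) unfolding complex_roots_def by auto
  then have "perm_restrict \<sigma> R x = y" using assms(2) by (simp add: perm_restrict_def)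
  then show ?thesis using in_G[OF s(1)] by blast
qed

lemma card_R:
  assumes "irreducible f" shows "card R = degree f"
proof -
  have d: "degree f \<noteq> 0" using assms f0 by (metis irreducible_not_unit is_unit_iff_degree)
  have "rsquarefree (cp f)"
  proof (rule ccontr)
    assume "\<not> rsquarefree (cp f)"
    then obtain u where u: "poly (cp f) u = 0" "poly (pderiv (cp f)) u = 0"
      using rsquarefree_roots by blast
    have "pderiv (cp f) = cp (pderiv f)"
      by (intro poly_eqI) (simp add: coeff_pderiv coeff_map_poly of_rat_mult of_rat_add)
    then have "f dvd pderiv f" using irreducible_root_dvd[OF assms u(1), of "pderiv f"] u(2) by metis
    then show False using d by simp
  qed
  then have "card {z. poly (cp f) z = 0} = degree (cp f)" by (rule rsquarefree_card_roots)
  then show ?thesis unfolding complex_roots_def by (simp add: cp_arith)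
qed

end

section \<open>Extensions of the p-adic absolute value\<close>

text \<open>Only the values of \<open>N\<close> at algebraic numbers matter. Having all of these in
  the domain lets one function serve for coefficients, roots and every element of a splitting
  field.\<close>

locale nonarch =
  fixes p :: nat and N :: "complex \<Rightarrow> real"
  assumes prime: "prime p"
    and N_zero: "N 0 = 0"
    and N_pos: "algebraic x \<Longrightarrow> x \<noteq> 0 \<Longrightarrow> N x > 0"
    and N_mult: "algebraic x \<Longrightarrow> algebraic y \<Longrightarrow> N (x * y) = N x * N y"
    and N_add: "algebraic x \<Longrightarrow> algebraic y \<Longrightarrow> N (x + y) \<le> max (N x) (N y)"
    and N_p: "N (of_nat p) = 1 / real p"
    and N_int: "N (of_int a) \<le> 1"

section \<open>A maximal subring avoiding \<open>1 / p\<close>\<close>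

definition is_subring :: "complex set \<Rightarrow> bool" where
  "is_subring E \<longleftrightarrow> 1 \<in> E \<and> (\<forall>x\<in>E. \<forall>y\<in>E. x + y \<in> E \<and> x * y \<in> E) \<and> (\<forall>x\<in>E. - x \<in> E)"

lemma is_subringD:
  assumes "is_subring E"
  shows "1 \<in> E" "x \<in> E \<Longrightarrow> y \<in> E \<Longrightarrow> x + y \<in> E" "x \<in> E \<Longrightarrow> y \<in> E \<Longrightarrow> x * y \<in> E"
    "x \<in> E \<Longrightarrow> - x \<in> E" "0 \<in> E" "x \<in> E \<Longrightarrow> y \<in> E \<Longrightarrow> x - y \<in> E" "x \<in> E \<Longrightarrow> x ^ n \<in> E" "of_int a \<in> E"
proof -
  show *: "1 \<in> E" "x \<in> E \<Longrightarrow> y \<in> E \<Longrightarrow> x + y \<in> E" "x \<in> E \<Longrightarrow> y \<in> E \<Longrightarrow> x * y \<in> E"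
    "x \<in> E \<Longrightarrow> - x \<in> E" for x y using assms unfolding is_subring_def by auto
  show z: "0 \<in> E" using *(2)[of 1 "- 1"] *(1) *(4)[of 1] by simp
  show "x \<in> E \<Longrightarrow> y \<in> E \<Longrightarrow> x - y \<in> E" using *(2)[of x "- y"] *(4)[of y] by simp
  show "x \<in> E \<Longrightarrow> x ^ n \<in> E" by (induction n) (auto intro: *)
  have n: "of_nat k \<in> E" for k by (induction k) (auto intro: * z)
  show "of_int a \<in> E" by (cases a rule: int_cases2) (auto intro: n * )
qed

lemma is_subring_sum: "is_subring E \<Longrightarrow> (\<And>i. i \<in> A \<Longrightarrow> f i \<in> E) \<Longrightarrow> sum f A \<in> E"
  by (induction A rule: infinite_finite_induct) (auto simp: is_subringD)

lemma coeffs_in_ring: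
  assumes E: "is_subring E"
  shows "coeffs_in E p \<Longrightarrow> coeffs_in E q \<Longrightarrow> coeffs_in E (p + q)"
    "coeffs_in E p \<Longrightarrow> coeffs_in E q \<Longrightarrow> coeffs_in E (p * q)"
    "coeffs_in E p \<Longrightarrow> coeffs_in E (- p)"
    "x \<in> E \<Longrightarrow> coeffs_in E (monom x n)" "x \<in> E \<Longrightarrow> coeffs_in E [:x:]" "coeffs_in E 1"
proof -
  show "coeffs_in E p \<Longrightarrow> coeffs_in E q \<Longrightarrow> coeffs_in E (p + q)"
    "coeffs_in E p \<Longrightarrow> coeffs_in E (- p)"
    unfolding coeffs_in_def by (simp_all add: is_subringD[OF E])
  show "coeffs_in E p \<Longrightarrow> coeffs_in E q \<Longrightarrow> coeffs_in E (p * q)"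
    unfolding coeffs_in_def coeff_mult by (auto intro!: is_subring_sum[OF E] is_subringD(3)[OF E])
  show m: "x \<in> E \<Longrightarrow> coeffs_in E (monom x n)" for x n
    unfolding coeffs_in_def by (simp add: is_subringD[OF E])
  show "x \<in> E \<Longrightarrow> coeffs_in E [:x:]" using m[of x 0] by (simp add: monom_0)
  show "coeffs_in E 1" using m[of 1 0] is_subringD(1)[OF E] by (simp add: monom_0 one_pCons)
qed

text \<open>Zorn's lemma. The integers are a starting point, and unions of chains stay in the class
  because a ring operation involves at most two elements.\<close>

lemma maximal_subring_exists:
  assumes "prime p"
  shows "\<exists>V. is_subring V \<and> V \<subseteq> Collect algebraic \<and> 1 / of_nat p \<notin> V \<and>
    (\<forall>W. is_subring W \<and> W \<subseteq> Collect algebraic \<and> 1 / of_nat p \<notin> W \<and> V \<subseteq> W \<longrightarrow> W = V)"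
proof -
  define \<A> where "\<A> = {V. is_subring V \<and> V \<subseteq> Collect algebraic \<and> 1 / of_nat p \<notin> V}"
  have p1: "p > 1" using assms prime_gt_1_nat by blast
  have "\<int> \<in> \<A>"
  proof -
    have "1 / of_nat p \<notin> (\<int> :: complex set)"
    proof
      assume "1 / of_nat p \<in> (\<int> :: complex set)"
      then obtain a where "1 / of_nat p = (of_int a :: complex)" by (elim Ints_cases)
      then have "(1 :: complex) = of_int (a * int p)" using p1 by (simp add: field_simps)
      then have "a * int p = 1" by (metis of_int_1 of_int_eq_iff)
      then have "int p dvd 1" by (metis dvd_triv_right)
      then show False using p1 by simp
    qed
    moreover have "x \<in> \<int> \<Longrightarrow> algebraic (x :: complex)" for x by (metis Ints_cases Rats_of_int algebraic_Rats)
    ultimately show ?thesis unfolding \<A>_def is_subring_def by auto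
  qed
  then have "\<A> \<noteq> {}" by blast
  moreover have "\<Union>\<C> \<in> \<A>" if ne: "\<C> \<noteq> {}" and ch: "subset.chain \<A> \<C>" for \<C>
  proof -
    have sub: "\<C> \<subseteq> \<A>" using ch unfolding subset_chain_def by simp
    have two: "\<exists>V\<in>\<C>. x \<in> V \<and> y \<in> V" if "x \<in> \<Union>\<C>" "y \<in> \<Union>\<C>" for x y
    proof -
      obtain V W where "V \<in> \<C>" "W \<in> \<C>" "x \<in> V" "y \<in> W" using \<open>x \<in> \<Union>\<C>\<close> \<open>y \<in> \<Union>\<C>\<close> by blast
      moreover from this have "V \<subseteq> W \<or> W \<subseteq> V" using ch unfolding subset_chain_def by blast
      ultimately show ?thesis by blast
    qed
    have "is_subring (\<Union>\<C>)"
      unfolding is_subring_def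
    proof (intro conjI ballI)
      show "1 \<in> \<Union>\<C>" using ne sub is_subringD(1) unfolding \<A>_def by blast
      fix x y assume xy: "x \<in> \<Union>\<C>" "y \<in> \<Union>\<C>"
      then obtain V where V: "V \<in> \<C>" "x \<in> V" "y \<in> V" using two by blast
      then have "is_subring V" using sub unfolding \<A>_def by blast
      then show "x + y \<in> \<Union>\<C>" "x * y \<in> \<Union>\<C>" using V is_subringD(2,3) by blast+
    next
      fix x assume "x \<in> \<Union>\<C>"
      then obtain V where V: "V \<in> \<C>" "x \<in> V" by blast
      then have "is_subring V" using sub unfolding \<A>_def by blast
      then show "- x \<in> \<Union>\<C>" using V is_subringD(4) by blast
    qed
    then show ?thesis using sub unfolding \<A>_def by blast
  qed
  ultimately obtain V where "V \<in> \<A>" "\<forall>X\<in>\<A>. V \<subseteq> X \<longrightarrow> X = V"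
    using subset_Zorn_nonempty[of \<A>] by blast
  then show ?thesis unfolding \<A>_def by blast
qed

text \<open>Chevalley's extension argument: a subring of the algebraic numbers that is maximal among those not containing
  \<open>1 / p\<close> is a valuation ring. Every algebraic number has a power that is a unit times a power of \<open>p\<close>, which gives
  the absolute value.\<close>

locale max_subring =
  fixes p :: nat and V :: "complex set"
  assumes pr: "prime p" and ring: "is_subring V" and alg: "V \<subseteq> Collect algebraic" and np: "1 / of_nat p \<notin> V"
    and maxi: "\<And>W. is_subring W \<Longrightarrow> W \<subseteq> Collect algebraic \<Longrightarrow> 1 / of_nat p \<notin> W \<Longrightarrow> V \<subseteq> W \<Longrightarrow> W = V"
begin

lemmas rg = is_subringD[OF ring]
lemmas cr = coeffs_in_ring[OF ring]

abbreviation P where "P \<equiv> (of_nat p :: complex)"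

lemma P0: "P \<noteq> 0" using pr prime_gt_0_nat by auto
lemma PV: "P \<in> V" using rg(8)[of "int p"] by simp

text \<open>Adjoining \<open>x\<close> to \<open>V\<close> gives a larger ring, which by maximality
  contains \<open>1 / P\<close>.\<close>

lemma polynomial_eq_inverse:
  assumes "algebraic x" "x \<notin> V" obtains q where "coeffs_in V q" "poly q x = 1 / P"
proof -
  define W where "W = {poly q x | q. coeffs_in V q}"
  have "is_subring W"
    unfolding is_subring_def
  proof (intro conjI ballI)
    show "1 \<in> W" unfolding W_def using cr(6) by (metis (mono_tags, lifting) mem_Collect_eq poly_1)
    fix a b assume "a \<in> W" "b \<in> W"
    then obtain q r where qr: "coeffs_in V q" "coeffs_in V r" "a = poly q x" "b = poly r x" unfolding W_def by blast
    have "a + b = poly (q + r) x" "a * b = poly (q * r) x" using qr by simp_all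
    then show "a + b \<in> W" "a * b \<in> W" unfolding W_def using cr(1,2) qr(1,2) by blast+
  next
    fix a assume "a \<in> W"
    then obtain q where q: "coeffs_in V q" "a = poly q x" unfolding W_def by blast
    then have "- a = poly (- q) x" by simp
    then show "- a \<in> W" unfolding W_def using cr(3) q(1) by blast
  qed
  moreover have "V \<subseteq> W"
  proof
    fix a assume "a \<in> V"
    then have "coeffs_in V [:a:]" "a = poly [:a:] x" using cr(5) by auto
    then show "a \<in> W" unfolding W_def by blast
  qed
  moreover have "W \<subseteq> Collect algebraic"
  proof
    fix a assume "a \<in> W"
    then obtain q where q: "coeffs_in V q" "a = poly q x" unfolding W_def by blast
    have "algebraic (coeff q i * x ^ i)" for i
    proof (intro algebraic_mult algebraic_power assms(1))
      show "algebraic (coeff q i)" using q(1) alg unfolding coeffs_in_def by blast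
    qed
    then show "a \<in> Collect algebraic" unfolding q(2) poly_altdef by (simp add: algebraic_sum)
  qed
  moreover have "x \<in> W"
  proof -
    have "coeffs_in V (monom 1 1)" using cr(4) rg(1) by blast
    moreover have "x = poly (monom 1 1) x" by (simp add: poly_monom)
    ultimately show ?thesis unfolding W_def by blast
  qed
  ultimately have "1 / P \<in> W" using maxi[of W] assms(2) by blast
  then show ?thesis using that unfolding W_def by force
qed

text \<open>Were the inverse of \<open>u = 1 - P * b\<close> missing from \<open>V\<close>, then
  \<open>1 / P\<close> would be a polynomial in it. Clearing denominators makes \<open>u ^ d\<close>
  a multiple of \<open>P\<close>, while every power of \<open>u\<close> is 1 modulo
  \<open>P\<close>; together these put \<open>1 / P\<close> into \<open>V\<close>.\<close>

lemma one_minus_unit: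
  assumes b: "b \<in> V" shows "1 - P * b \<noteq> 0" "inverse (1 - P * b) \<in> V"
proof -
  define u where "u = 1 - P * b"
  have uV: "u \<in> V" unfolding u_def by (intro rg(6,1,3) PV b)
  show u0: "1 - P * b \<noteq> 0"
  proof
    assume "1 - P * b = 0"
    then have "1 / P = b" using P0 by (simp add: field_simps)
    then show False using b np by simp
  qed
  then have u0: "u \<noteq> 0" unfolding u_def .
  have ua: "algebraic (inverse u)" using uV alg by auto
  have upow: "\<exists>e\<in>V. u ^ d = 1 - P * e" for d
  proof (induction d)
    case 0 then show ?case using rg(5) by (intro bexI[of _ 0]) auto
  next
    case (Suc d)
    then obtain e where e: "e \<in> V" "u ^ d = 1 - P * e" by blast
    have "u ^ Suc d = (1 - P * b) * (1 - P * e)" using e(2) unfolding u_def by simp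
    then have "u ^ Suc d = 1 - P * (b + e - P * b * e)" by (simp add: algebra_simps)
    moreover have "b + e - P * b * e \<in> V" by (intro rg(6,2,3) PV b e(1))
    ultimately show ?case by blast
  qed
  show "inverse (1 - P * b) \<in> V"
  proof (rule ccontr)
    assume "inverse (1 - P * b) \<notin> V"
    then obtain q where q: "coeffs_in V q" "poly q (inverse u) = 1 / P" using polynomial_eq_inverse[OF ua] unfolding u_def by blast
    define d where "d = degree q"
    define c where "c = (\<Sum>i\<le>d. coeff q i * u ^ (d - i))"
    have cV: "c \<in> V" unfolding c_def using q(1) uV by (intro is_subring_sum[OF ring] rg) (auto simp: coeffs_in_def)
    have "u ^ d * poly q (inverse u) = c"
      unfolding c_def poly_altdef d_def[symmetric] sum_distrib_left
      by (intro sum.cong) (use u0 in \<open>auto simp: field_simps power_diff\<close>)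
    then have "u ^ d = P * c" using q(2) P0 by (simp add: field_simps)
    moreover obtain e where e: "e \<in> V" "u ^ d = 1 - P * e" using upow by blast
    ultimately have "1 = P * (c + e)" by (simp add: algebra_simps)
    then have "1 / P = c + e" using P0 by (simp add: field_simps)
    then show False using np rg(2)[OF cV e(1)] by simp
  qed
qed

definition inverse_relation :: "complex \<Rightarrow> nat \<Rightarrow> bool" where
  "inverse_relation x n \<longleftrightarrow> (\<exists>q. coeffs_in V q \<and> degree q \<le> n \<and> poly q x = 1 / P)"

text \<open>The relation for \<open>inverse x\<close> expresses \<open>x ^ m\<close> by lower powers
  of \<open>x\<close>, because its constant term is absorbed into the unit
  \<open>1 - P * b 0\<close>. Substituting this into the leading term of a relation for
  \<open>x\<close> lowers the degree.\<close>

lemma descent: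
  assumes x: "x \<noteq> 0" and n: "inverse_relation x n" and m: "inverse_relation (inverse x) m" and mn: "m \<le> n"
  shows "\<exists>k<n. inverse_relation x k"
proof -
  obtain r where r: "coeffs_in V r" "degree r \<le> m" "poly r (inverse x) = 1 / P" using m unfolding inverse_relation_def by blast
  obtain q where q: "coeffs_in V q" "degree q \<le> n" "poly q x = 1 / P" using n unfolding inverse_relation_def by blast
  have m0: "m \<noteq> 0"
  proof
    assume "m = 0"
    then obtain c where "r = [:c:]" using r(2) by (metis degree_eq_zeroE le_zero_eq)
    then show False using r np by (auto simp: coeffs_in_def coeff_pCons dest: spec[of _ 0])
  qed
  define b where "b i = coeff r i" for i
  have bV: "b i \<in> V" for i using r(1) unfolding b_def coeffs_in_def by simp
  define w where "w = inverse (1 - P * b 0)"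
  have wV: "w \<in> V" "w * (1 - P * b 0) = 1" unfolding w_def using one_minus_unit[OF bV] by auto
  have rsum: "poly r (inverse x) = (\<Sum>i\<le>m. b i * inverse x ^ i)"
    unfolding poly_altdef b_def
    by (rule sum.mono_neutral_left) (use r(2) in \<open>auto simp: coeff_eq_0\<close>)
  have "x ^ m * poly r (inverse x) = (\<Sum>i\<le>m. b i * x ^ (m - i))"
    unfolding rsum sum_distrib_left by (intro sum.cong) (use x in \<open>auto simp: field_simps power_diff\<close>)
  also have "\<dots> = b 0 * x ^ m + (\<Sum>i\<in>{1..m}. b i * x ^ (m - i))"
    by (simp add: atMost_atLeast0 sum.atLeast_Suc_atMost)
  finally have "x ^ m = P * b 0 * x ^ m + P * (\<Sum>i\<in>{1..m}. b i * x ^ (m - i))"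
    using r(3) P0 by (simp add: field_simps)
  then have "(1 - P * b 0) * x ^ m = P * (\<Sum>i\<in>{1..m}. b i * x ^ (m - i))" by (simp add: algebra_simps)
  then have "w * ((1 - P * b 0) * x ^ m) = w * (P * (\<Sum>i\<in>{1..m}. b i * x ^ (m - i)))" by simp
  then have xm: "x ^ m = w * (P * (\<Sum>i\<in>{1..m}. b i * x ^ (m - i)))"
    using wV(2) by (simp add: mult.assoc[symmetric])
  define h where "h = (\<Sum>i\<in>{1..m}. monom (w * P * b i) (m - i))"
  have cs: "coeffs_in V (\<Sum>i\<in>I. F i)" if "\<And>i. i \<in> I \<Longrightarrow> coeffs_in V (F i)" for F :: "nat \<Rightarrow> complex poly" and I
  proof -
    have c0: "coeffs_in V 0" unfolding coeffs_in_def using rg(5) by simp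
    show ?thesis using that by (induction I rule: infinite_finite_induct) (auto intro: c0 cr(1))
  qed
  have hV: "coeffs_in V h" unfolding h_def by (intro cs cr(4) rg(3) wV PV bV)
  have hd: "degree h \<le> m - 1" unfolding h_def
    by (intro degree_sum_le) (auto intro!: order_trans[OF degree_monom_le])
  have hx: "poly h x = x ^ m" unfolding xm h_def by (simp add: poly_sum poly_monom sum_distrib_left algebra_simps)
  define q1 where "q1 = (\<Sum>i<n. monom (coeff q i) i)"
  define q' where "q' = q1 + monom (coeff q n) (n - m) * h"
  have qV: "coeff q i \<in> V" for i using q(1) unfolding coeffs_in_def by simp
  have "coeffs_in V q'" unfolding q'_def q1_def by (intro cr(1,2) cs cr(4) qV hV)
  moreover have "degree q' \<le> n - 1"
    unfolding q'_def
  proof (rule degree_add_le)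
    show "degree q1 \<le> n - 1" unfolding q1_def
      by (intro degree_sum_le) (auto intro!: order_trans[OF degree_monom_le])
    have "degree (monom (coeff q n) (n - m) * h) \<le> (n - m) + (m - 1)"
      by (rule order_trans[OF degree_mult_le add_mono[OF degree_monom_le hd]])
    then show "degree (monom (coeff q n) (n - m) * h) \<le> n - 1" using mn m0 by simp
  qed
  moreover have "poly q' x = poly q x"
  proof -
    have "poly q x = (\<Sum>i\<le>n. coeff q i * x ^ i)"
      unfolding poly_altdef by (rule sum.mono_neutral_left) (use q(2) in \<open>auto simp: coeff_eq_0\<close>)
    also have "\<dots> = (\<Sum>i<n. coeff q i * x ^ i) + coeff q n * x ^ n" by (simp add: lessThan_Suc_atMost[symmetric])
    also have "x ^ n = x ^ (n - m) * x ^ m" using mn by (simp add: power_add[symmetric])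
    finally show ?thesis unfolding q'_def q1_def by (simp add: poly_sum poly_monom hx)
  qed
  ultimately have "inverse_relation x (n - 1)" unfolding inverse_relation_def using q(3) by auto
  moreover have "n - 1 < n" using m0 mn by simp
  ultimately show ?thesis by blast
qed

text \<open>If both \<open>x\<close> and its inverse were missing, both would satisfy relations of
  least degree, and by \<open>descent\<close> the shorter one would shorten the longer.\<close>

lemma valuation_ring:
  assumes "algebraic x" "x \<noteq> 0" shows "x \<in> V \<or> inverse x \<in> V"
proof (rule ccontr)
  assume a: "\<not> ?thesis"
  have "\<exists>n. inverse_relation x n" using polynomial_eq_inverse[OF assms(1)] a unfolding inverse_relation_def by blast
  then obtain n where n: "inverse_relation x n" "\<And>k. k < n \<Longrightarrow> \<not> inverse_relation x k" by (metis exists_least_iff)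
  have "algebraic (inverse x)" using assms(1) by auto
  then have "\<exists>n. inverse_relation (inverse x) n" using polynomial_eq_inverse a unfolding inverse_relation_def by blast
  then obtain m where m: "inverse_relation (inverse x) m" "\<And>k. k < m \<Longrightarrow> \<not> inverse_relation (inverse x) k" by (metis exists_least_iff)
  show False
  proof (cases "m \<le> n")
    case True
    then show False using descent[OF assms(2) n(1) m(1)] n(2) by blast
  next
    case False
    have "\<exists>k<m. inverse_relation (inverse x) k" by (rule descent) (use assms(2) m n False in auto)
    then show False using m(2) by blast
  qed
qed

end

section \<open>The absolute value of a maximal subring\<close>

context max_subring
begin

definition unit :: "complex \<Rightarrow> bool" where
  "unit x \<longleftrightarrow> x \<in> V \<and> x \<noteq> 0 \<and> inverse x \<in> V"

lemma unit_mult: "unit x \<Longrightarrow> unit y \<Longrightarrow> unit (x * y)"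
  unfolding unit_def using rg(3) by (simp add: inverse_mult_distrib)

lemma unit_inverse: "unit x \<Longrightarrow> unit (inverse x)"
  unfolding unit_def by simp

lemma unit_one: "unit 1" unfolding unit_def using rg(1) by simp

lemma unit_power: "unit x \<Longrightarrow> unit (x ^ n)"
  by (induction n) (auto intro: unit_one unit_mult)

lemma unit_uminus: "unit x \<Longrightarrow> unit (- x)"
  unfolding unit_def using rg(4) by simp

lemma unit_P_powi: "unit (P powi k) \<longleftrightarrow> k = 0"
proof
  have no: "\<not> unit (P powi k)" if "k > 0" for k
  proof
    assume u: "unit (P powi k)"
    define n where "n = nat k - 1"
    have n: "k = int (Suc n)" using that unfolding n_def by simp
    then have "P powi k = P * P ^ n" by (simp only: power_int_of_nat power_Suc)
    then have "1 / P = P ^ n * inverse (P powi k)" using P0 by (simp add: field_simps)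
    then show False using u np rg(3)[OF rg(7)[OF PV]] unfolding unit_def by metis
  qed
  assume "unit (P powi k)"
  moreover from this have "unit (P powi (- k))" using unit_inverse by (simp add: power_int_minus)
  ultimately show "k = 0" using no[of k] no[of "- k"] by linarith
qed (simp add: unit_one)

lemma unit_of_int:
  assumes "coprime a (int p)" shows "unit (of_int a)"
proof -
  obtain u v where uv: "u * a + v * int p = 1"
    using bezout_int[of a "int p"] assms by (metis coprime_imp_gcd_eq_1)
  have e: "of_int u * of_int a = 1 - P * of_int v"
  proof -
    have "(of_int (u * a + v * int p) :: complex) = 1" using uv by simp
    then show ?thesis by (simp add: algebra_simps)
  qed
  note o = one_minus_unit[OF rg(8)[of v]]
  have a0: "of_int a \<noteq> (0 :: complex)" using e o(1) by auto
  then have "inverse (of_int a) = of_int u * inverse (1 - P * of_int v)"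
    using e o(1) by (simp add: field_simps)
  then show ?thesis unfolding unit_def using a0 rg(8) rg(3)[OF rg(8) o(2)] by simp
qed

lemma unit_int_P:
  assumes "a \<noteq> 0" obtains k where "unit (of_int a * P powi k)"
proof -
  define e where "e = multiplicity (int p) a"
  have "\<not> is_unit (int p)" using prime_gt_1_nat[OF pr] by simp
  then obtain b where b: "a = int p ^ e * b" "\<not> int p dvd b"
    unfolding e_def using multiplicity_decompose'[OF assms] by metis
  have "coprime b (int p)" using b(2) pr
    by (metis coprime_commute prime_imp_coprime prime_nat_int_transfer)
  moreover have "of_int a * P powi (- int e) = of_int b"
    using b(1) P0 by (simp add: power_int_minus)
  ultimately show ?thesis using that[of "- int e"] unit_of_int by simp
qed

lemma unit_rat_P:
  assumes "x \<in> \<rat>" "x \<noteq> 0" obtains k where "unit (x * P powi k)"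
proof -
  obtain q where q: "x = of_rat q" using assms(1) by (elim Rats_cases)
  obtain a b where ab: "quotient_of q = (a, b)" by force
  then have qq: "q = of_int a / of_int b" "b > 0" using quotient_of_div quotient_of_denom_pos by auto
  have x: "x = of_int a / of_int b" unfolding q qq by (simp add: of_rat_divide)
  have "a \<noteq> 0" using x assms(2) by auto
  then obtain k where k: "unit (of_int a * P powi k)" by (rule unit_int_P)
  have "b \<noteq> 0" using qq(2) by simp
  then obtain l where l: "unit (of_int b * P powi l)" by (rule unit_int_P)
  have "unit (of_int a * P powi k * inverse (of_int b * P powi l))" using k l unit_mult unit_inverse by blast
  moreover have "of_int a * P powi k * inverse (of_int b * P powi l) = x * P powi (k - l)"
    unfolding x using P0 by (simp add: power_int_diff field_simps)
  ultimately show ?thesis using that by metis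
qed

text \<open>Of two non-zero elements one divides the other and hence the sum. If the sum is a unit,
  so is that divisor.\<close>

lemma nonunit_add:
  assumes "x \<in> V" "y \<in> V" "\<not> unit x" "\<not> unit y" shows "\<not> unit (x + y)"
proof
  assume u: "unit (x + y)"
  have key: False if "x \<in> V" "y \<in> V" "\<not> unit y" "y \<noteq> 0" "x / y \<in> V" "unit (x + y)" for x y
  proof -
    have "inverse y = (1 + x / y) * inverse (x + y)" using that(4,6) unfolding unit_def by (simp add: field_simps)
    then have "inverse y \<in> V" using rg that unfolding unit_def by metis
    then show False using that unfolding unit_def by simp
  qed
  have "x \<noteq> 0" "y \<noteq> 0" using u assms by auto
  moreover from this have "x / y \<in> V \<or> inverse (x / y) \<in> V"
    using assms alg by (intro valuation_ring algebraic_divide) auto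
  ultimately show False using key[of x y] key[of y x] assms u by (auto simp: add.commute)
qed

lemma nonunit_sum:
  assumes "\<And>i. i \<in> I \<Longrightarrow> f i \<in> V \<and> \<not> unit (f i)"
  shows "sum f I \<in> V \<and> \<not> unit (sum f I)"
  using assms
  by (induction I rule: infinite_finite_induct) (auto simp: rg(2,5) nonunit_add, auto simp: unit_def)

lemma max_element:
  assumes "finite I" "I \<noteq> {}" "\<And>i. i \<in> I \<Longrightarrow> algebraic (t i) \<and> t i \<noteq> 0"
  shows "\<exists>i0\<in>I. \<forall>i\<in>I. t i / t i0 \<in> V"
  using assms
proof (induction I rule: finite_ne_induct)
  case (singleton x) then show ?case using rg(1) by simp
next
  case (insert x F)
  then obtain i0 where i0: "i0 \<in> F" "\<forall>i\<in>F. t i / t i0 \<in> V" by auto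
  have n: "t x \<noteq> 0" "t i0 \<noteq> 0" "algebraic (t x)" "algebraic (t i0)" using insert.prems i0 by auto
  have "t x / t i0 \<in> V \<or> inverse (t x / t i0) \<in> V" by (rule valuation_ring) (use n in auto)
  then show ?case
  proof
    assume "t x / t i0 \<in> V" then show ?thesis using i0 by auto
  next
    assume "inverse (t x / t i0) \<in> V"
    then have v: "t i0 / t x \<in> V" by (simp add: inverse_divide)
    have "t i / t x \<in> V" if "i \<in> insert x F" for i
    proof (cases "i = x")
      case True then show ?thesis using n rg(1) by simp
    next
      case False
      then have "t i / t i0 \<in> V" using that i0 by auto
      moreover have "t i / t x = (t i / t i0) * (t i0 / t x)" using n by simp
      ultimately show ?thesis using v rg(3) by metis
    qed
    then show ?thesis by blast
  qed
qed

text \<open>Divide the terms of a rational relation for \<open>x\<close> by the largest one. The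
  others add up to -1, so they are not all non-units. Two terms whose quotient is a unit give a
  power of \<open>x\<close> times a rational number that is a unit, and a rational number is a unit
  times a power of \<open>P\<close>.\<close>

lemma ex_value:
  assumes "algebraic x" "x \<noteq> 0"
  shows "\<exists>m k. m > 0 \<and> unit (x ^ m * P powi k)"
proof -
  obtain g where g: "\<forall>i. coeff g i \<in> \<rat>" "g \<noteq> 0" "poly g x = 0"
    using assms(1) unfolding algebraic_altdef by blast
  define I where "I = {i. i \<le> degree g \<and> coeff g i \<noteq> 0}"
  define t where "t i = coeff g i * x ^ i" for i
  have "degree g \<in> I" unfolding I_def using g(2) by simp
  then have I: "finite I" "I \<noteq> {}" unfolding I_def by auto
  have tI: "algebraic (t i) \<and> t i \<noteq> 0" if "i \<in> I" for i
    using that g(1) assms unfolding t_def I_def by (auto intro!: algebraic_mult algebraic_power)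
  obtain i0 where i0: "i0 \<in> I" "\<forall>i\<in>I. t i / t i0 \<in> V"
    using max_element[of I t, OF I tI] by auto
  have "(\<Sum>i\<in>I. t i) = (\<Sum>i\<le>degree g. t i)"
    unfolding I_def by (rule sum.mono_neutral_left) (auto simp: t_def)
  also have "\<dots> = 0" using g(3) unfolding poly_altdef t_def .
  finally have "(\<Sum>i\<in>I. t i) = 0" .
  then have "t i0 + (\<Sum>i\<in>I - {i0}. t i) = 0" using sum.remove[OF I(1) i0(1)] by metis
  then have "(\<Sum>i\<in>I - {i0}. t i) / t i0 = - 1" using tI[OF i0(1)] by (simp add: field_simps eq_neg_iff_add_eq_0 add.commute)
  then have "(\<Sum>i\<in>I - {i0}. t i / t i0) = - 1" by (simp add: sum_divide_distrib)
  moreover have "unit (- 1)" using unit_uminus[OF unit_one] .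
  ultimately have "\<not> (\<forall>i\<in>I - {i0}. t i / t i0 \<in> V \<and> \<not> unit (t i / t i0))"
    using nonunit_sum[of "I - {i0}" "\<lambda>i. t i / t i0"] by auto
  then obtain j where j: "j \<in> I" "j \<noteq> i0" "unit (t j / t i0)" using i0(2) by blast
  define a where "a = coeff g j / coeff g i0"
  have a: "a \<in> \<rat>" "a \<noteq> 0" using g(1) i0(1) j(1) unfolding a_def I_def by auto
  obtain k where k: "unit (a * P powi k)" using unit_rat_P[OF a] .
  have main: "\<exists>m k. m > 0 \<and> unit (x ^ m * P powi k)" if "e \<noteq> 0" "unit (x powi e * P powi k)" for e k
  proof (cases "e > 0")
    case True
    then have "x powi e = x ^ nat e" by (simp add: power_int_def)
    then show ?thesis using that True by (intro exI[of _ "nat e"] exI[of _ k]) auto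
  next
    case False
    then have "inverse (x powi e * P powi k) = x ^ nat (- e) * P powi (- k)"
      using that(1) by (simp add: power_int_def[of x] power_int_minus power_inverse)
    then show ?thesis using unit_inverse[OF that(2)] False that(1)
      by (intro exI[of _ "nat (- e)"] exI[of _ "- k"]) auto
  qed
  have "t j / t i0 * inverse (a * P powi k) = x powi (int j - int i0) * P powi (- k)"
    using a(2) assms(2) P0 i0(1) j(1) unfolding t_def a_def I_def
    by (simp add: power_int_diff power_int_minus field_simps)
  moreover have "unit (t j / t i0 * inverse (a * P powi k))" using j(3) k unit_mult unit_inverse by blast
  ultimately show ?thesis using main[of "int j - int i0" "- k"] j(2) by simp
qed

text \<open>If \<open>x ^ m\<close> is a unit times \<open>P powi (- k)\<close> and \<open>P\<close>
  has value \<open>1 / p\<close>, then \<open>x\<close> must have value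
  \<open>p powr (k / m)\<close>. The exponents are not unique, but by \<open>absval_eq\<close> the
  value is.\<close>

definition absval :: "complex \<Rightarrow> real" where
  "absval x = (if x = 0 then 0 else
     (SOME y. \<exists>m k. m > 0 \<and> unit (x ^ m * P powi k) \<and> y = real p powr (real_of_int k / real m)))"

lemma absval_eq:
  assumes "m > 0" "unit (x ^ m * P powi k)"
  shows "absval x = real p powr (real_of_int k / real m)"
proof -
  have x0: "x \<noteq> 0" using assms unfolding unit_def by (auto simp: power_0_left)
  have "real p powr (real_of_int k' / real m') = real p powr (real_of_int k / real m)"
    if "m' > 0" "unit (x ^ m' * P powi k')" for m' k'
  proof -
    have "unit ((x ^ m' * P powi k') ^ m * inverse ((x ^ m * P powi k) ^ m'))"
      using that assms unit_mult unit_inverse unit_power by blast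
    moreover have "(x ^ m' * P powi k') ^ m * inverse ((x ^ m * P powi k) ^ m') = P powi (k' * int m - k * int m')"
      using x0 P0 by (simp add: power_mult_distrib power_mult[symmetric] mult.commute power_int_diff power_int_mult field_simps)
    ultimately have "k' * int m - k * int m' = 0" using unit_P_powi by simp
    then have "real_of_int k' * real m = real_of_int k * real m'"
      by (metis eq_iff_diff_eq_0 of_int_mult of_int_of_nat_eq)
    then have "real_of_int k' / real m' = real_of_int k / real m" using assms(1) that(1) by (simp add: field_simps)
    then show ?thesis by simp
  qed
  then have "(SOME y. \<exists>m k. m > 0 \<and> unit (x ^ m * P powi k) \<and> y = real p powr (real_of_int k / real m)) =
      real p powr (real_of_int k / real m)"
    using assms by (intro some_equality) blast+
  then show ?thesis unfolding absval_def using x0 by simp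
qed

lemma absval_le_1:
  assumes "algebraic x" "x \<noteq> 0" shows "absval x \<le> 1 \<longleftrightarrow> x \<in> V"
proof -
  obtain m k where mk: "m > 0" "unit (x ^ m * P powi k)" using ex_value[OF assms] by blast
  have "real p > 1" using pr prime_gt_1_nat by simp
  then have "absval x \<le> 1 \<longleftrightarrow> k \<le> 0" unfolding absval_eq[OF mk]
    using mk(1) powr_le_cancel_iff[of "real p" "real_of_int k / real m" 0] by (simp add: divide_le_0_iff)
  moreover have "x \<in> V" if "k \<le> 0"
  proof (rule ccontr)
    assume a: "x \<notin> V"
    \<comment> \<open>\<open>V\<close> is integrally closed: with \<open>inverse x\<close> in
      \<open>V\<close>, the element \<open>x\<close> is recovered as \<open>x ^ m\<close> times
      \<open>inverse x ^ (m - 1)\<close>.\<close>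
    then have ix: "inverse x \<in> V" using valuation_ring[OF assms] by simp
    have "x ^ m * P powi k * P ^ nat (- k) = x ^ m"
      using that P0 by (simp add: power_int_def power_mult_distrib[symmetric])
    then have "x ^ m \<in> V" using mk(2) rg(3) rg(7)[OF PV] unfolding unit_def by metis
    then have "x ^ m * inverse x ^ (m - 1) \<in> V" by (rule rg(3)[OF _ rg(7)[OF ix]])
    moreover have "x ^ m * inverse x ^ (m - 1) = x"
    proof -
      have "x ^ m = x * x ^ (m - 1)" using mk(1) by (metis Suc_diff_1 power_Suc)
      then show ?thesis using assms(2) by (simp add: power_inverse)
    qed
    ultimately show False using a by simp
  qed
  moreover have "k \<le> 0" if "x \<in> V"
  proof (rule ccontr)
    assume "\<not> k \<le> 0"
    define n where "n = nat k - 1"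
    have "k = int (Suc n)" using \<open>\<not> k \<le> 0\<close> unfolding n_def by simp
    then have "P powi k = P * P ^ n" by (simp only: power_int_of_nat power_Suc)
    then have "1 / P = x ^ m * P ^ n * inverse (x ^ m * P powi k)" using P0 assms(2) by (simp add: field_simps)
    moreover have "x ^ m * P ^ n * inverse (x ^ m * P powi k) \<in> V"
      using mk(2) unfolding unit_def by (intro rg(3) rg(7) that PV) simp
    ultimately show False using np by simp
  qed
  ultimately show ?thesis by blast
qed

lemma absval_mult:
  assumes "algebraic x" "algebraic y" shows "absval (x * y) = absval x * absval y"
proof (cases "x = 0 \<or> y = 0")
  case True then show ?thesis by (auto simp: absval_def)
next
  case False
  obtain m k where mk: "m > 0" "unit (x ^ m * P powi k)" using ex_value assms(1) False by blast
  obtain m' k' where mk': "m' > 0" "unit (y ^ m' * P powi k')" using ex_value assms(2) False by blast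
  have "unit ((x ^ m * P powi k) ^ m' * (y ^ m' * P powi k') ^ m)"
    using mk mk' unit_mult unit_power by blast
  moreover have "(x ^ m * P powi k) ^ m' * (y ^ m' * P powi k') ^ m = (x * y) ^ (m * m') * P powi (k * int m' + k' * int m)"
    using P0 by (simp add: power_mult_distrib power_mult[symmetric] mult.commute power_int_add power_int_mult algebra_simps)
  ultimately have "absval (x * y) = real p powr (real_of_int (k * int m' + k' * int m) / real (m * m'))"
    using mk(1) mk'(1) by (intro absval_eq) auto
  also have "real_of_int (k * int m' + k' * int m) / real (m * m') = real_of_int k / real m + real_of_int k' / real m'"
    using mk(1) mk'(1) by (simp add: add_divide_distrib)
  finally show ?thesis unfolding absval_eq[OF mk] absval_eq[OF mk'] by (simp add: powr_add)
qed

lemma nonarch_absval: "nonarch p absval"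
proof
  show "prime p" by (rule pr)
  show "absval 0 = 0" by (simp add: absval_def)
  have p1: "real p > 1" using pr prime_gt_1_nat by simp
  show pos: "absval x > 0" if "algebraic x" "x \<noteq> 0" for x
  proof -
    obtain m k where mk: "m > 0" "unit (x ^ m * P powi k)"
      using ex_value[OF \<open>algebraic x\<close> \<open>x \<noteq> 0\<close>] by blast
    then show ?thesis using absval_eq[OF mk] p1 by simp
  qed
  show "absval (x * y) = absval x * absval y" if "algebraic x" "algebraic y" for x y using absval_mult that .
  have "unit (P ^ 1 * P powi (- 1))" using P0 unit_one by (simp add: power_int_minus)
  then have "absval P = real p powr (real_of_int (- 1) / real 1)" by (rule absval_eq[rotated]) simp
  then show "absval P = 1 / real p" using p1 by (simp add: powr_minus field_simps)
  show "absval (of_int a) \<le> 1" for a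
  proof (cases "a = 0")
    case False then show ?thesis using absval_le_1[of "of_int a"] rg(8) alg by auto
  qed (simp add: absval_def)
  \<comment> \<open>After division by the larger summand the ultrametric inequality says that
    \<open>V\<close> is closed under addition.\<close>
  have add: "absval (x + y) \<le> absval x" if "algebraic x" "algebraic y" "absval y \<le> absval x" for x y
  proof (cases "x = 0 \<or> y = 0 \<or> x + y = 0")
    case True
    then show ?thesis
    proof (elim disjE)
      assume "x = 0"
      then have "absval y \<le> 0" using that(3) by (simp add: absval_def)
      then have "y = 0" using pos[OF that(2)] by force
      then show ?thesis using \<open>x = 0\<close> by simp
    next
      assume "x + y = 0"
      then show ?thesis using pos[of x] that by (cases "x = 0") (auto simp: absval_def)
    qed simp
  next
    case False
    have ax: "algebraic (inverse x)" using that by auto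
    have "algebraic (y / x)" using that by auto
    then have "absval (x * (y / x)) = absval x * absval (y / x)" using absval_mult that(1) by blast
    then have "absval x * absval (y / x) = absval y" using False by simp
    then have "absval (y / x) \<le> 1" using that(3) pos[of x] that(1) False by (metis mult_le_cancel_left1 mult_le_cancel_left_pos mult.right_neutral)
    then have "y / x \<in> V" using absval_le_1[of "y / x"] that False by auto
    then have "1 + y / x \<in> V" using rg by blast
    moreover have "1 + y / x \<noteq> 0" using False by (auto simp: field_simps)
    ultimately have "absval (1 + y / x) \<le> 1" using absval_le_1[of "1 + y / x"] alg by auto
    moreover have "absval (x * (1 + y / x)) = absval x * absval (1 + y / x)"
      using \<open>1 + y / x \<in> V\<close> alg that by (intro absval_mult) auto
    moreover have "x * (1 + y / x) = x + y" using False by (simp add: field_simps)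
    ultimately show ?thesis using pos[of x] that False by (simp add: mult_left_le)
  qed
  show "absval (x + y) \<le> max (absval x) (absval y)" if "algebraic x" "algebraic y" for x y
    using add[of x y] add[of y x] that by (cases "absval y \<le> absval x") (auto simp: add.commute)
qed

end

theorem nonarch_exists:
  assumes "prime p" obtains N where "nonarch p N"
proof -
  obtain V where V: "is_subring V" "V \<subseteq> Collect algebraic" "1 / of_nat p \<notin> V"
    "\<forall>W. is_subring W \<and> W \<subseteq> Collect algebraic \<and> 1 / of_nat p \<notin> W \<and> V \<subseteq> W \<longrightarrow> W = V"
    using maximal_subring_exists[OF assms] by blast
  interpret max_subring p V by unfold_locales (use assms V in auto)
  show ?thesis using nonarch_absval that by blast
qed

section \<open>Properties of the absolute value and Newton polygons\<close>

context nonarch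
begin

lemma p1: "real p > 1" using prime prime_gt_1_nat by simp

lemma N_nonneg: "algebraic x \<Longrightarrow> N x \<ge> 0" using N_pos[of x] N_zero by (cases "x = 0") auto

lemma N_one: "N 1 = 1"
proof -
  have "N (1 * 1) = N 1 * N 1" by (rule N_mult) auto
  moreover have "N 1 > 0" by (rule N_pos) auto
  ultimately show ?thesis by simp
qed

lemma N_minus_one: "N (- 1) = 1"
proof -
  have "N (- 1 * - 1) = N (- 1) * N (- 1)" by (rule N_mult) auto
  then have "N (- 1) * N (- 1) = 1" using N_one by simp
  moreover have "N (- 1) > 0" by (rule N_pos) auto
  ultimately have "N (- 1) ^ 2 = 1" "N (- 1) > 0" by (simp_all add: power2_eq_square)
  then show ?thesis by (simp add: power2_eq_1_iff)
qed

lemma N_minus: "algebraic x \<Longrightarrow> N (- x) = N x"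
  using N_mult[of "- 1" x] N_minus_one by auto

lemma N_power: "algebraic x \<Longrightarrow> N (x ^ k) = N x ^ k"
  by (induction k) (auto simp: N_one N_mult algebraic_power)

lemma N_inverse: "algebraic x \<Longrightarrow> N (inverse x) = inverse (N x)"
proof (cases "x = 0")
  case False
  assume a: "algebraic x"
  then have "N (x * inverse x) = N x * N (inverse x)" by (intro N_mult) auto
  then show ?thesis using False N_one by (simp add: inverse_unique)
qed (simp add: N_zero)

lemma N_divide: "algebraic x \<Longrightarrow> algebraic y \<Longrightarrow> N (x / y) = N x / N y"
  unfolding divide_inverse by (subst N_mult) (auto simp: N_inverse)

lemma N_diff: "algebraic x \<Longrightarrow> algebraic y \<Longrightarrow> N (x - y) \<le> max (N x) (N y)"
  using N_add[of x "- y"] N_minus[of y] by auto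

lemma N_add_neq:
  assumes "algebraic x" "algebraic y" "N x < N y" shows "N (x + y) = N y"
proof -
  have "N (x + y) \<le> N y" using N_add[OF assms(1,2)] assms(3) by simp
  moreover have "N y \<le> max (N (x + y)) (N x)"
    using N_diff[of "x + y" x] assms(1,2) by auto
  ultimately show ?thesis using assms(3) by auto
qed

lemma N_diff_neq:
  assumes "algebraic x" "algebraic y" "N x \<noteq> N y" shows "N (x - y) = max (N x) (N y)"
  using N_add_neq[of x "- y"] N_add_neq[of "- y" x] N_minus[of y] assms by (cases "N x < N y") auto

lemma N_coprime: "coprime a (int p) \<Longrightarrow> N (of_int a) = 1"
proof -
  assume "coprime a (int p)"
  then obtain u v where uv: "u * a + v * int p = 1"
    using bezout_int[of a "int p"] by (metis coprime_imp_gcd_eq_1)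
  have "(1 :: complex) = of_int u * of_int a + of_int v * of_nat p"
    using uv by (metis of_int_1 of_int_add of_int_mult of_int_of_nat_eq)
  moreover have "N (of_int u * of_int a + of_int v * of_nat p) \<le> max (N (of_int u * of_int a)) (N (of_int v * of_nat p))"
    by (intro N_add) auto
  ultimately have "1 \<le> max (N (of_int u * of_int a)) (N (of_int v * of_nat p))" using N_one by simp
  moreover have "N (of_int v * of_nat p) < 1"
  proof -
    have "N (of_int v * of_nat p) = N (of_int v) * (1 / real p)" using N_p by (subst N_mult) auto
    also have "\<dots> \<le> 1 * (1 / real p)" by (intro mult_right_mono N_int) simp
    also have "\<dots> < 1" using p1 by simp
    finally show ?thesis .
  qed
  ultimately have "1 \<le> N (of_int u * of_int a)" by simp
  also have "\<dots> = N (of_int u) * N (of_int a)" by (rule N_mult) auto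
  also have "\<dots> \<le> 1 * N (of_int a)" by (intro mult_right_mono N_int N_nonneg) auto
  finally show ?thesis using N_int[of a] by simp
qed

lemma N_of_int: "a \<noteq> 0 \<Longrightarrow> N (of_int a) = (1 / real p) ^ multiplicity (int p) a"
proof -
  assume a: "a \<noteq> 0"
  have "\<not> is_unit (int p)" using prime_gt_1_nat[OF prime] by simp
  then obtain b where b: "a = int p ^ multiplicity (int p) a * b" "\<not> int p dvd b"
    using multiplicity_decompose'[OF a] by metis
  have "coprime b (int p)" using b(2) prime by (metis coprime_commute prime_imp_coprime prime_nat_int_transfer)
  then have "N (of_int b) = 1" by (rule N_coprime)
  moreover have "(of_int a :: complex) = of_nat p ^ multiplicity (int p) a * of_int b"
    using arg_cong[OF b(1), of "of_int :: int \<Rightarrow> complex"] by simp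
  moreover have "N (of_nat p ^ multiplicity (int p) a * of_int b) = N (of_nat p) ^ multiplicity (int p) a * N (of_int b)"
    by (subst N_mult) (auto simp: N_power)
  ultimately show ?thesis using N_p by simp
qed

lemma N_of_nat: "a \<noteq> 0 \<Longrightarrow> N (of_nat a) = (1 / real p) ^ multiplicity p a"
proof -
  assume a: "a \<noteq> 0"
  have "\<not> is_unit p" using prime_gt_1_nat[OF prime] by simp
  then obtain b where b: "a = p ^ multiplicity p a * b" "\<not> p dvd b"
    using multiplicity_decompose'[OF a] by metis
  have "coprime (int b) (int p)" using b(2) prime by (metis coprime_commute coprime_int_iff prime_imp_coprime)
  then have "N (of_int (int b)) = 1" by (rule N_coprime)
  moreover have "(of_nat a :: complex) = of_nat p ^ multiplicity p a * of_int (int b)"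
    using arg_cong[OF b(1), of "of_nat :: nat \<Rightarrow> complex"] by simp
  moreover have "N (of_nat p ^ multiplicity p a * of_int (int b)) = N (of_nat p) ^ multiplicity p a * N (of_int (int b))"
    by (subst N_mult) (auto simp: N_power)
  ultimately show ?thesis using N_p by simp
qed

lemma N_rat:
  assumes "q \<noteq> 0" obtains k :: int where "N (of_rat q) = real p powi k"
proof -
  obtain a b where ab: "quotient_of q = (a, b)" by force
  then have qq: "q = of_int a / of_int b" "b > 0" using quotient_of_div quotient_of_denom_pos by auto
  have x: "of_rat q = (of_int a / of_int b :: complex)" unfolding qq by (simp add: of_rat_divide)
  have "a \<noteq> 0" using qq assms by auto
  then have "N (of_rat q) = (1 / real p) ^ multiplicity (int p) a / (1 / real p) ^ multiplicity (int p) b"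
    unfolding x using qq(2) by (subst N_divide) (auto simp: N_of_int)
  also have "\<dots> = real p powi (int (multiplicity (int p) b) - int (multiplicity (int p) a))"
    using p1 by (simp add: power_int_diff power_divide)
  finally show ?thesis using that by blast
qed

definition rpoly :: "complex multiset \<Rightarrow> complex poly" where
  "rpoly M = (\<Prod>b\<in>#M. [:- b, 1:])"

lemma rpoly_add: "rpoly (add_mset b M) = [:- b, 1:] * rpoly M" unfolding rpoly_def by simp

text \<open>The Newton polygon of a product of linear factors: the indices at which the weighted
  coefficient norms are maximal range from the number of roots of norm less than \<open>\<rho>\<close>
  to the number of roots of norm at most \<open>\<rho>\<close>.\<close>

lemma newton_polygon:
  assumes "\<rho> > 0" "\<And>b. b \<in># M \<Longrightarrow> algebraic b"
  shows "\<exists>X>0. (\<forall>j. algebraic (coeff (rpoly M) j) \<and> N (coeff (rpoly M) j) * \<rho> ^ j \<le> X) \<and>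
    (let a = size (filter_mset (\<lambda>b. N b < \<rho>) M); a' = size (filter_mset (\<lambda>b. N b \<le> \<rho>) M) in
      N (coeff (rpoly M) a) * \<rho> ^ a = X \<and> N (coeff (rpoly M) a') * \<rho> ^ a' = X \<and>
      (\<forall>j<a. N (coeff (rpoly M) j) * \<rho> ^ j < X) \<and> (\<forall>j>a'. N (coeff (rpoly M) j) * \<rho> ^ j < X))"
  using assms(2)
proof (induction M)
  case empty
  show ?case by (rule exI[of _ 1]) (auto simp: rpoly_def N_one N_zero Let_def)
next
  case (add b M)
  define c where "c j = coeff (rpoly M) j" for j
  define a where "a = size (filter_mset (\<lambda>b. N b < \<rho>) M)"
  define a' where "a' = size (filter_mset (\<lambda>b. N b \<le> \<rho>) M)"
  define t where "t j = N (c j) * \<rho> ^ j" for j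
  from add obtain X where X: "X > 0" "\<And>j. algebraic (c j)" "\<And>j. t j \<le> X" "t a = X" "t a' = X"
    "\<And>j. j < a \<Longrightarrow> t j < X" "\<And>j. j > a' \<Longrightarrow> t j < X"
    unfolding Let_def c_def[symmetric] t_def[symmetric] a_def[symmetric] a'_def[symmetric] by auto
  have b: "algebraic b" using add.prems by simp
  define d where "d j = coeff (rpoly (add_mset b M)) j" for j
  define u where "u j = N (d j) * \<rho> ^ j" for j
  have d0: "d 0 = - (b * c 0)" unfolding d_def c_def rpoly_add by simp
  have dS: "d (Suc j) = c j - b * c (Suc j)" for j unfolding d_def c_def rpoly_add by simp
  have dalg: "algebraic (d j)" for j by (cases j) (use X(2) b in \<open>auto simp: d0 dS\<close>)
  have Nb: "N b \<ge> 0" using N_nonneg[OF b] .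
  have u0: "u 0 = N b * t 0" unfolding u_def t_def d0 using N_minus[of "b * c 0"] N_mult[OF b X(2)] b X(2) by auto
  have Nbc: "N (b * c j) = N b * N (c j)" for j using N_mult[OF b X(2)] .
  have max_t: "max (\<rho> * t j) (N b * t (Suc j)) = max (N (c j)) (N b * N (c (Suc j))) * \<rho> ^ Suc j" for j
  proof -
    have e: "\<rho> * t j = N (c j) * \<rho> ^ Suc j" "N b * t (Suc j) = (N b * N (c (Suc j))) * \<rho> ^ Suc j"
      by (simp_all add: t_def)
    show ?thesis unfolding e max_mult_distrib_right using assms(1) by simp
  qed
  have uS: "u (Suc j) \<le> max (\<rho> * t j) (N b * t (Suc j))" for j
  proof -
    have "N (d (Suc j)) \<le> max (N (c j)) (N b * N (c (Suc j)))"
      unfolding dS using N_diff[of "c j" "b * c (Suc j)"] X(2) b Nbc by auto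
    then have "u (Suc j) \<le> max (N (c j)) (N b * N (c (Suc j))) * \<rho> ^ Suc j"
      unfolding u_def using assms(1) by (intro mult_right_mono) auto
    also have "\<dots> = max (\<rho> * t j) (N b * t (Suc j))" unfolding max_t ..
    finally show ?thesis .
  qed
  have uS': "u (Suc j) = max (\<rho> * t j) (N b * t (Suc j))" if ne: "\<rho> * t j \<noteq> N b * t (Suc j)" for j
  proof -
    have "N (c j) \<noteq> N b * N (c (Suc j))" using ne unfolding t_def by (auto simp: algebra_simps)
    then have "N (d (Suc j)) = max (N (c j)) (N b * N (c (Suc j)))"
      unfolding dS using N_diff_neq[of "c j" "b * c (Suc j)"] X(2) b Nbc by auto
    then show ?thesis unfolding u_def max_t by simp
  qed
  have goal: ?case if "size (filter_mset (\<lambda>b. N b < \<rho>) (add_mset b M)) = l"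
    "size (filter_mset (\<lambda>b. N b \<le> \<rho>) (add_mset b M)) = l'"
    "Y > 0" "\<And>j. u j \<le> Y" "u l = Y" "u l' = Y" "\<And>j. j < l \<Longrightarrow> u j < Y" "\<And>j. j > l' \<Longrightarrow> u j < Y" for Y l l'
    unfolding Let_def that(1,2)
    by (rule exI[of _ Y]) (use that(3-) dalg in \<open>simp add: u_def d_def\<close>)
  have r: "\<rho> > 0" by fact
  have tn: "t j \<ge> 0" for j unfolding t_def using N_nonneg[OF X(2)] r by simp
  \<comment> \<open>Multiplication by \<open>[:- b, 1:]\<close> moves both ends of the range up by
    one, only the upper end, or neither, according to whether \<open>N b\<close> is less than, equal
    to or greater than \<rho>.\<close>
  consider "N b < \<rho>" | "N b = \<rho>" | "N b > \<rho>" by linarith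
  then show ?case
  proof cases
    case 1
    have small: "N b * t j < \<rho> * X" for j
      using mult_left_mono[OF X(3)[of j] Nb] mult_strict_right_mono[OF 1 X(1)] by linarith
    have sz: "size (filter_mset (\<lambda>b. N b < \<rho>) (add_mset b M)) = Suc a"
      "size (filter_mset (\<lambda>b. N b \<le> \<rho>) (add_mset b M)) = Suc a'" using 1 unfolding a_def a'_def by auto
    have eq: "u (Suc j) = \<rho> * X" if "t j = X" for j
      using uS'[of j] small[of "Suc j"] that by auto
    have lt: "u (Suc j) < \<rho> * X" if "t j < X" for j
      using uS[of j] small[of "Suc j"] mult_strict_left_mono[OF that r] by auto
    show ?thesis
    proof (rule goal[OF sz, of "\<rho> * X"])
      show "u j \<le> \<rho> * X" for j
        using uS small mult_left_mono[OF X(3)] r u0 by (cases j) (auto simp: le_max_iff_disj less_imp_le intro: order_trans[OF uS])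
      show "u j < \<rho> * X" if "j < Suc a" for j
        using that lt X(6) u0 small[of 0] by (cases j) auto
      show "u j < \<rho> * X" if "j > Suc a'" for j
        using that lt X(7) by (cases j) auto
    qed (use eq X r in auto)
  next
    case 3
    have small: "\<rho> * t j < N b * X" for j
      using mult_left_mono[OF X(3)[of j], of \<rho>] mult_strict_right_mono[OF 3 X(1)] r by linarith
    have sz: "size (filter_mset (\<lambda>b. N b < \<rho>) (add_mset b M)) = a"
      "size (filter_mset (\<lambda>b. N b \<le> \<rho>) (add_mset b M)) = a'" using 3 unfolding a_def a'_def by auto
    have nb: "N b > 0" using 3 r by simp
    have eq: "u j = N b * X" if "t j = X" for j
      using uS'[of "j - 1"] small[of "j - 1"] that u0 by (cases j) auto
    have lt: "u j < N b * X" if "t j < X" for j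
      using uS[of "j - 1"] small[of "j - 1"] mult_strict_left_mono[OF that nb] u0 by (cases j) auto
    show ?thesis
    proof (rule goal[OF sz, of "N b * X"])
      show "u j \<le> N b * X" for j using eq[of j] lt[of j] X(3)[of j] by linarith
    qed (use eq lt X nb in auto)
  next
    case 2
    have sz: "size (filter_mset (\<lambda>b. N b < \<rho>) (add_mset b M)) = a"
      "size (filter_mset (\<lambda>b. N b \<le> \<rho>) (add_mset b M)) = Suc a'" using 2 unfolding a_def a'_def by auto
    have le: "\<rho> * t j \<le> \<rho> * X" for j using mult_left_mono[OF X(3)] r by auto
    have st: "\<rho> * t j < \<rho> * X" if "t j < X" for j using mult_strict_left_mono[OF that r] .
    show ?thesis
    proof (rule goal[OF sz, of "\<rho> * X"])
      show "\<rho> * X > 0" using r X(1) by simp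
      show "u j \<le> \<rho> * X" for j
        using uS[of "j - 1"] le[of j] le[of "j - 1"] u0 2 by (cases j) auto
      show "u a = \<rho> * X"
      proof (cases a)
        case 0 then show ?thesis using u0 X(4) 2 by simp
      next
        case (Suc k)
        then have "\<rho> * t k < \<rho> * X" using X(6) st by simp
        then have "\<rho> * t k < N b * t (Suc k)" using X(4) Suc 2 by simp
        moreover from this have "u (Suc k) = max (\<rho> * t k) (N b * t (Suc k))" by (intro uS') simp
        ultimately show ?thesis using X(4) Suc 2 by simp
      qed
      have "\<rho> * t (Suc a') < \<rho> * X" using X(7) st by simp
      then have "N b * t (Suc a') < \<rho> * t a'" using X(5) 2 by simp
      moreover from this have "u (Suc a') = max (\<rho> * t a') (N b * t (Suc a'))" by (intro uS') simp
      ultimately show "u (Suc a') = \<rho> * X" using X(5) by simp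
      show "u j < \<rho> * X" if "j < a" for j
        using uS[of "j - 1"] st[OF X(6)[OF that]] st[OF X(6), of "j - 1"] u0 that 2 by (cases j) auto
      show "u j < \<rho> * X" if "j > Suc a'" for j
        using uS[of "j - 1"] st[OF X(7), of j] st[OF X(7), of "j - 1"] that 2 by (cases j) auto
    qed
  qed
qed

text \<open>The coefficients at both ends of the range for \<open>t\<close> have the same weighted
  norm. They are rational, so their norms are powers of \<open>p\<close>, and the number of roots of
  norm \<open>t\<close> is the difference of the two indices.\<close>

lemma norm_count_power:
  assumes q: "cp q = rpoly M" and alg: "\<And>b. b \<in># M \<Longrightarrow> algebraic b" and t: "t > 0"
  shows "\<exists>k::int. t ^ size (filter_mset (\<lambda>b. N b = t) M) = real p powi k"
proof -
  define a where "a = size (filter_mset (\<lambda>b. N b < t) M)"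
  define a' where "a' = size (filter_mset (\<lambda>b. N b \<le> t) M)"
  have "filter_mset (\<lambda>b. N b \<le> t) M = filter_mset (\<lambda>b. N b < t) M + filter_mset (\<lambda>b. N b = t) M"
    by (rule multiset_eqI) auto
  then have aa: "a' = a + size (filter_mset (\<lambda>b. N b = t) M)" unfolding a_def a'_def by simp
  obtain X where X: "X > 0" "N (coeff (rpoly M) a) * t ^ a = X" "N (coeff (rpoly M) a') * t ^ a' = X"
    using newton_polygon[OF t alg] unfolding Let_def a_def a'_def by auto
  have c: "coeff (rpoly M) j = of_rat (coeff q j)" for j using q[symmetric] by (simp add: cp_arith)
  have "coeff q a \<noteq> 0" "coeff q a' \<noteq> 0" using X by (metis N_zero c less_irrefl mult_zero_left of_rat_0)+
  then obtain k k' :: int where k: "N (of_rat (coeff q a)) = real p powi k" "N (of_rat (coeff q a')) = real p powi k'"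
    using N_rat by metis
  have "real p powi k' * t ^ a' = real p powi k * t ^ a" using X c k by simp
  then have "t ^ size (filter_mset (\<lambda>b. N b = t) M) = real p powi k / real p powi k'"
    unfolding aa power_add using t p1 by (simp add: field_simps)
  also have "\<dots> = real p powi (k - k')" using p1 by (simp add: power_int_diff)
  finally show ?thesis by blast
qed

end

section \<open>Ramification and Frobenius elements\<close>

locale splitting_nonarch = splitting f + nonarch p N for f p N
begin

text \<open>The decomposition group of the place that \<open>N\<close> defines on
  \<open>K\<close>.\<close>

definition D where "D = {g \<in> G. \<forall>x\<in>K. N (rep g x) = N x}"

lemma repK: "g \<in> G \<Longrightarrow> x \<in> K \<Longrightarrow> rep g x \<in> K" using A_K rep(1) by blast

lemma rep_mult: "g \<in> G \<Longrightarrow> x \<in> K \<Longrightarrow> y \<in> K \<Longrightarrow> rep g (x * y) = rep g x * rep g y"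
  using field_homD(2)[OF rat_automorphisms_hom[OF rep(1)]] by blast

lemma rep_power: "g \<in> G \<Longrightarrow> x \<in> K \<Longrightarrow> x ^ n \<in> K \<and> rep g (x ^ n) = rep g x ^ n"
  by (induction n) (auto simp: rep_mult field_homD(5)[OF rat_automorphisms_hom[OF rep(1)]] subfieldD[OF subK])

lemma rep_nonzero: "g \<in> G \<Longrightarrow> x \<in> K \<Longrightarrow> x \<noteq> 0 \<Longrightarrow> rep g x \<noteq> 0"
  using field_hom_nonzero[OF subK rat_automorphisms_hom[OF rep(1)]] by blast

sublocale dec: perm_group R D
proof
  show "finite R" by (rule finR)
  show "g permutes R" if "g \<in> D" for g using that G_permutes unfolding D_def by blast
  show "id \<in> D" unfolding D_def using G_id rep_id by auto
  show "g \<circ> h \<in> D" if "g \<in> D" "h \<in> D" for g h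
    using that G_comp rep_comp repK unfolding D_def by auto
  show "inv g \<in> D" if g: "g \<in> D" for g
  proof -
    have gG: "g \<in> G" using g unfolding D_def by simp
    have "N (rep (inv g) x) = N x" if x: "x \<in> K" for x
    proof -
      have "rep (inv g) x \<in> K" using repK[OF G_inv[OF gG] x] .
      then have "N (rep g (rep (inv g) x)) = N (rep (inv g) x)" using g unfolding D_def by simp
      then show ?thesis using rep_inv[OF gG x] by simp
    qed
    then show ?thesis unfolding D_def using G_inv[OF gG] by simp
  qed
qed

lemma NK: "x \<in> K \<Longrightarrow> x \<noteq> 0 \<Longrightarrow> N x > 0" using N_pos K_algebraic by blast

lemma NK_mult: "x \<in> K \<Longrightarrow> y \<in> K \<Longrightarrow> N (x * y) = N x * N y" using N_mult K_algebraic by blast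

lemma NK_power: "x \<in> K \<Longrightarrow> N (x ^ n) = N x ^ n" using N_power K_algebraic by blast

text \<open>For each \<open>g\<close> at most one exponent is bad: none if \<open>a g = 1\<close>,
  and otherwise the powers of \<open>a g\<close> are distinct.\<close>

lemma exists_power_avoiding_one:
  fixes a b :: "'b \<Rightarrow> real"
  assumes "finite S" "\<And>g. g \<in> S \<Longrightarrow> a g > 0 \<and> b g > 0" "\<And>g. g \<in> S \<Longrightarrow> a g = 1 \<Longrightarrow> b g \<noteq> 1"
  shows "\<exists>m::nat. \<forall>g\<in>S. a g ^ m * b g \<noteq> 1"
proof -
  have fin: "finite {m. a g ^ m * b g = 1}" if g: "g \<in> S" for g
  proof (cases "a g = 1")
    case True then show ?thesis using assms(3)[OF g] by simp
  next
    case False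
    have "m = n" if "a g ^ m * b g = 1" "a g ^ n * b g = 1" for m n
    proof -
      have "a g ^ m * b g = a g ^ n * b g" using that by simp
      then have "a g ^ m = a g ^ n" using assms(2)[OF g] by simp
      then show ?thesis using assms(2)[OF g] False power_inject_exp'[of "a g" m n] by simp
    qed
    then have "\<exists>x. {m. a g ^ m * b g = 1} \<subseteq> {x}" by blast
    then show ?thesis using finite_subset by blast
  qed
  then have "finite (\<Union>g\<in>S. {m. a g ^ m * b g = 1})" using assms(1) by blast
  then obtain m where "m \<notin> (\<Union>g\<in>S. {m. a g ^ m * b g = 1})" using infinite_UNIV_nat ex_new_if_finite by blast
  then show ?thesis by auto
qed

text \<open>A substitute for weak approximation. Each automorphism outside \<open>D\<close> changes
  the norm of some element; these elements are combined one at a time as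
  \<open>\<gamma> ^ m * y\<close>, where \<open>m\<close> avoids the finitely many exponents at
  which the changes cancel.\<close>

lemma separating_element:
  assumes "finite S" "S \<subseteq> G - D"
  shows "\<exists>\<gamma>\<in>K. \<gamma> \<noteq> 0 \<and> (\<forall>g\<in>S. N (rep g \<gamma>) \<noteq> N \<gamma>)"
  using assms
proof (induction S rule: finite_induct)
  case empty then show ?case using subfieldD(7)[OF subK] by (intro bexI[of _ 1]) auto
next
  case (insert h S)
  then obtain \<gamma> where g: "\<gamma> \<in> K" "\<gamma> \<noteq> 0" "\<forall>g\<in>S. N (rep g \<gamma>) \<noteq> N \<gamma>" by auto
  have hG: "h \<in> G" and SG: "insert h S \<subseteq> G" using insert.prems by auto
  obtain y where y: "y \<in> K" "N (rep h y) \<noteq> N y" using insert.prems hG unfolding D_def by auto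
  have y0: "y \<noteq> 0" using y field_homD(4)[OF rat_automorphisms_hom[OF rep(1)[OF hG]]] by auto
  define a where "a k = N (rep k \<gamma>) / N \<gamma>" for k
  define b where "b k = N (rep k y) / N y" for k
  have pos: "N \<gamma> > 0" "N y > 0" "\<And>k. k \<in> G \<Longrightarrow> N (rep k \<gamma>) > 0" "\<And>k. k \<in> G \<Longrightarrow> N (rep k y) > 0"
    using NK g y y0 repK rep_nonzero by auto
  have "\<exists>m::nat. \<forall>k\<in>insert h S. a k ^ m * b k \<noteq> 1"
  proof (rule exists_power_avoiding_one)
    show "finite (insert h S)" using insert.hyps by simp
    fix k assume k: "k \<in> insert h S"
    then have "k \<in> G" using SG by blast
    then show "a k > 0 \<and> b k > 0" unfolding a_def b_def using pos by simp
    assume "a k = 1"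
    then have "k = h" using k g(3) pos(1) unfolding a_def by (auto simp: field_simps)
    then show "b k \<noteq> 1" using y(2) pos(2) unfolding b_def by (simp add: field_simps)
  qed
  then obtain m where m: "\<And>k. k \<in> insert h S \<Longrightarrow> a k ^ m * b k \<noteq> 1" by blast
  define \<delta> where "\<delta> = \<gamma> ^ m * y"
  have gm: "\<gamma> ^ m \<in> K" using rep_power[OF hG g(1)] by blast
  have "N (rep k \<delta>) \<noteq> N \<delta>" if k: "k \<in> insert h S" for k
  proof
    assume e: "N (rep k \<delta>) = N \<delta>"
    have kG: "k \<in> G" using k SG by auto
    have "N (rep k \<delta>) = N (rep k \<gamma>) ^ m * N (rep k y)"
      unfolding \<delta>_def using rep_mult[OF kG gm y(1)] rep_power[OF kG g(1)] NK_mult NK_power repK[OF kG] g(1) y(1)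
      by (metis rep_power[OF kG])
    moreover have "N \<delta> = N \<gamma> ^ m * N y" unfolding \<delta>_def using NK_mult[OF gm y(1)] NK_power[OF g(1)] by simp
    ultimately have "a k ^ m * b k = 1" using e pos(1,2) pos(3,4)[OF kG] unfolding a_def b_def by (simp add: field_simps)
    then show False using m[OF k] by simp
  qed
  moreover have "\<delta> \<in> K" unfolding \<delta>_def using subfieldD(3)[OF subK gm y(1)] .
  moreover have "\<delta> \<noteq> 0" unfolding \<delta>_def using g y0 by simp
  ultimately show ?case by blast
qed

lemma conjugate_norm_count:
  assumes b: "\<beta> \<in> K" "\<beta> \<noteq> 0"
  shows "\<exists>k::int. N \<beta> ^ card {g \<in> G. N (rep g \<beta>) = N \<beta>} = real p powi k"
proof -
  obtain q where q: "(\<Prod>g\<in>G. [:- rep g \<beta>, 1:]) = cp q" using char_poly_rational[OF b(1)] .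
  define M where "M = image_mset (\<lambda>g. rep g \<beta>) (mset_set G)"
  have "rpoly M = (\<Prod>g\<in>G. [:- rep g \<beta>, 1:])"
    unfolding rpoly_def M_def by (simp add: prod_unfold_prod_mset image_mset.compositionality comp_def)
  then have "cp q = rpoly M" using q by simp
  moreover have "algebraic x" if "x \<in># M" for x
    using that G_fin repK[OF _ b(1)] K_algebraic unfolding M_def by auto
  ultimately have "\<exists>k::int. N \<beta> ^ size (filter_mset (\<lambda>x. N x = N \<beta>) M) = real p powi k"
    using norm_count_power NK[OF b] by blast
  moreover have "size (filter_mset (\<lambda>x. N x = N \<beta>) M) = card {g \<in> G. N (rep g \<beta>) = N \<beta>}"
    unfolding M_def by (simp add: filter_mset_image_mset G_fin)
  ultimately show ?thesis by simp
qed

text \<open>Multiply \<open>\<alpha>\<close> by an element, of norm a power of \<open>p\<close>, such that exactly the conjugates under the decomposition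
  group \<open>D\<close> keep the norm of the product. The number of roots of the characteristic polynomial that have this norm is
  then \<open>card D\<close>, and by the Newton polygon the norm raised to this number is a power of \<open>p\<close>.\<close>

theorem dvd_decomposition_group:
  assumes a: "\<alpha> \<in> K" "\<alpha> \<noteq> 0"
    and exact: "\<And>i::nat. \<exists>k::int. N \<alpha> ^ i = real p powi k \<Longrightarrow> d dvd i"
  shows "d dvd card D"
proof -
  have finGD: "finite (G - D)" using G_fin by simp
  obtain \<gamma> where g: "\<gamma> \<in> K" "\<gamma> \<noteq> 0" "\<And>g. g \<in> G - D \<Longrightarrow> N (rep g \<gamma>) \<noteq> N \<gamma>"
    using separating_element[OF finGD] by blast
  define c where "c = card {g \<in> G. N (rep g \<gamma>) = N \<gamma>}"
  obtain k :: int where k: "N \<gamma> ^ c = real p powi k" using conjugate_norm_count[OF g(1,2)] unfolding c_def by blast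
  have "id \<in> {g \<in> G. N (rep g \<gamma>) = N \<gamma>}" using G_id rep_id g(1) by simp
  then have c0: "c > 0" unfolding c_def using G_fin card_gt_0_iff by fastforce
  \<comment> \<open>By the choice of \<open>c\<close> the norm of \<epsilon> is an integral power of
    \<open>p\<close>, so multiplying \<alpha> by powers of \<epsilon> does not affect which powers
    of its norm are powers of \<open>p\<close>.\<close>
  define \<epsilon> where "\<epsilon> = \<gamma> ^ c"
  have e: "\<epsilon> \<in> K" "\<epsilon> \<noteq> 0" "N \<epsilon> = real p powi k" unfolding \<epsilon>_def
    using rep_power[OF G_id g(1)] g(2) k NK_power[OF g(1)] by auto
  have er: "N (rep h \<epsilon>) = N (rep h \<gamma>) ^ c" if "h \<in> G" for h
    unfolding \<epsilon>_def using rep_power[OF that g(1)] NK_power[OF repK[OF that g(1)]] by simp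
  have pos: "N \<epsilon> > 0" "N \<alpha> > 0" "\<And>h. h \<in> G \<Longrightarrow> N (rep h \<epsilon>) > 0" "\<And>h. h \<in> G \<Longrightarrow> N (rep h \<alpha>) > 0"
    using NK[OF e(1,2)] NK[OF a] NK repK rep_nonzero e(1,2) a by blast+
  have ene: "N (rep h \<epsilon>) \<noteq> N \<epsilon>" if "h \<in> G - D" for h
  proof
    assume "N (rep h \<epsilon>) = N \<epsilon>"
    then have "N (rep h \<gamma>) ^ c = N \<gamma> ^ c" using er that k e(3) by simp
    moreover have "h \<in> G" using that by simp
    then have "N (rep h \<gamma>) > 0" "N \<gamma> > 0" using NK g repK rep_nonzero by auto
    ultimately have "N (rep h \<gamma>) = N \<gamma>" using c0 power_eq_iff_eq_base by (metis less_imp_le)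
    then show False using g(3)[OF that] by simp
  qed
  define u where "u h = N (rep h \<epsilon>) / N \<epsilon>" for h
  define v where "v h = N (rep h \<alpha>) / N \<alpha>" for h
  have "\<exists>m::nat. \<forall>h\<in>G - D. u h ^ m * v h \<noteq> 1"
  proof (rule exists_power_avoiding_one[OF finGD])
    fix h assume h: "h \<in> G - D"
    then show "u h > 0 \<and> v h > 0" unfolding u_def v_def using pos by simp
    assume "u h = 1"
    then show "v h \<noteq> 1" using ene[OF h] pos(1) unfolding u_def by (simp add: field_simps)
  qed
  then obtain m where m: "\<And>h. h \<in> G - D \<Longrightarrow> u h ^ m * v h \<noteq> 1" by blast
  define \<beta> where "\<beta> = \<epsilon> ^ m * \<alpha>"
  have em: "\<epsilon> ^ m \<in> K" using rep_power[OF G_id e(1)] by blast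
  have b: "\<beta> \<in> K" "\<beta> \<noteq> 0" unfolding \<beta>_def using subfieldD(3)[OF subK em a(1)] e a by auto
  have Nb: "N \<beta> = N \<epsilon> ^ m * N \<alpha>" unfolding \<beta>_def using NK_mult[OF em a(1)] NK_power[OF e(1)] by simp
  have "{h \<in> G. N (rep h \<beta>) = N \<beta>} = D"
  proof (intro equalityI subsetI)
    fix h assume h: "h \<in> {h \<in> G. N (rep h \<beta>) = N \<beta>}"
    then have hG: "h \<in> G" by simp
    have "rep h \<beta> = rep h \<epsilon> ^ m * rep h \<alpha>"
      unfolding \<beta>_def using rep_mult[OF hG em a(1)] rep_power[OF hG e(1)] by simp
    moreover have "rep h \<epsilon> ^ m \<in> K" using rep_power[OF G_id repK[OF hG e(1)]] by blast
    ultimately have "N (rep h \<beta>) = N (rep h \<epsilon>) ^ m * N (rep h \<alpha>)"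
      using NK_mult[OF _ repK[OF hG a(1)]] NK_power[OF repK[OF hG e(1)]] by simp
    then have "u h ^ m * v h = 1" using h pos(1,2) Nb unfolding u_def v_def by (simp add: field_simps)
    then show "h \<in> D" using m[of h] hG by blast
  next
    fix h assume "h \<in> D" then show "h \<in> {h \<in> G. N (rep h \<beta>) = N \<beta>}" unfolding D_def using b by simp
  qed
  then obtain l :: int where l: "N \<beta> ^ card D = real p powi l" using conjugate_norm_count[OF b] by auto
  have "N \<alpha> ^ card D * (real p powi k) ^ (m * card D) = real p powi l"
    using l unfolding Nb power_mult_distrib e(3) by (simp add: power_mult mult.commute)
  then have "N \<alpha> ^ card D = real p powi l / (real p powi k) ^ (m * card D)"
    using p1 by (simp add: eq_divide_eq)
  also have "\<dots> = real p powi (l - k * int (m * card D))"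
  proof -
    have "(real p powi k) ^ (m * card D) = real p powi (k * int (m * card D))"
      by (simp only: power_int_mult power_int_of_nat)
    then show ?thesis using p1 by (simp add: power_int_diff)
  qed
  finally show ?thesis using exact by blast
qed

theorem element_of_prime_order:
  assumes "\<alpha> \<in> K" "\<alpha> \<noteq> 0" "Factorial_Ring.prime d"
    and "\<And>i::nat. \<exists>k::int. N \<alpha> ^ i = real p powi k \<Longrightarrow> d dvd i"
  obtains g where "g \<in> G" "g ^^ d = id" "g \<noteq> id"
proof -
  have "d dvd card D" using dvd_decomposition_group[OF assms(1,2,4)] .
  then obtain g where "g \<in> D" "g ^^ d = id" "g \<noteq> id" using dec.cauchy[OF assms(3)] by blast
  then show ?thesis using that unfolding D_def by blast
qed

end

text \<open>The map has to respect the ring operations on \<open>S\<close> only, because the lemma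
  is used with three different maps on polynomials: the identity on integral ones, the action of an
  automorphism of \<open>K\<close>, and the substitution \<open>expand\<close>.\<close>

lemma prod_linear_hom:
  fixes \<phi> :: "'a :: comm_ring_1 \<Rightarrow> 'b :: comm_ring_1"
  assumes "finite I" "\<And>i. i \<in> I \<Longrightarrow> a i \<in> S"
    and S: "0 \<in> S" "1 \<in> S" "\<And>x y. x \<in> S \<Longrightarrow> y \<in> S \<Longrightarrow> x - y \<in> S \<and> x * y \<in> S"
    and \<phi>: "\<phi> 0 = 0" "\<phi> 1 = 1" "\<And>x y. x \<in> S \<Longrightarrow> y \<in> S \<Longrightarrow> \<phi> (x - y) = \<phi> x - \<phi> y \<and> \<phi> (x * y) = \<phi> x * \<phi> y"
  shows "\<forall>j. coeff (\<Prod>i\<in>I. [:- a i, 1:]) j \<in> S \<and> \<phi> (coeff (\<Prod>i\<in>I. [:- a i, 1:]) j) = coeff (\<Prod>i\<in>I. [:- \<phi> (a i), 1:]) j"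
  using assms(1,2)
proof (induction I rule: finite_induct)
  case empty
  show ?case using S \<phi>(1,2) by (auto simp: coeff_1)
next
  case (insert x F)
  define P where "P = (\<Prod>i\<in>F. [:- a i, 1:])"
  define Q where "Q = (\<Prod>i\<in>F. [:- \<phi> (a i), 1:])"
  have IH: "coeff P j \<in> S" "\<phi> (coeff P j) = coeff Q j" for j using insert unfolding P_def Q_def by auto
  have ax: "a x \<in> S" using insert.prems by simp
  have e: "(\<Prod>i\<in>insert x F. [:- a i, 1:]) = [:- a x, 1:] * P" "(\<Prod>i\<in>insert x F. [:- \<phi> (a i), 1:]) = [:- \<phi> (a x), 1:] * Q"
    using insert.hyps unfolding P_def Q_def by simp_all
  have c0: "coeff ([:- y, 1:] * p) 0 = 0 - y * coeff p 0" for y :: "'z :: comm_ring_1" and p by simp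
  have cS: "coeff ([:- y, 1:] * p) (Suc j) = coeff p j - y * coeff p (Suc j)" for y :: "'z :: comm_ring_1" and p j by simp
  show ?case
    unfolding e
  proof
    fix j
    show "coeff ([:- a x, 1:] * P) j \<in> S \<and> \<phi> (coeff ([:- a x, 1:] * P) j) = coeff ([:- \<phi> (a x), 1:] * Q) j"
    proof (cases j)
      case 0
      then show ?thesis unfolding 0 c0 using S(1) S(3) \<phi>(1) \<phi>(3) IH ax by metis
    next
      case (Suc k)
      then show ?thesis unfolding Suc cS using S(3) \<phi>(3) IH ax by metis
    qed
  qed
qed

section \<open>Congruences modulo the maximal ideal\<close>

context nonarch
begin

text \<open>The valuation ring and, next, its maximal ideal. The residue field is not formed; an
  equation in it is expressed by a difference lying in \<open>Mmax\<close>, and for polynomials in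
  \<open>PM\<close>.\<close>

definition Oint :: "complex set" where "Oint = {x. algebraic x \<and> N x \<le> 1}"
definition Mmax :: "complex set" where "Mmax = {x. algebraic x \<and> N x < 1}"

lemma Oint_ring:
  "0 \<in> Oint" "1 \<in> Oint" "x \<in> Oint \<Longrightarrow> y \<in> Oint \<Longrightarrow> x + y \<in> Oint" "x \<in> Oint \<Longrightarrow> y \<in> Oint \<Longrightarrow> x - y \<in> Oint"
  "x \<in> Oint \<Longrightarrow> y \<in> Oint \<Longrightarrow> x * y \<in> Oint" "x \<in> Oint \<Longrightarrow> - x \<in> Oint" "x \<in> Oint \<Longrightarrow> x ^ n \<in> Oint"
  "of_int a \<in> Oint" "of_nat k \<in> Oint"
proof -
  show z: "0 \<in> Oint" "1 \<in> Oint" unfolding Oint_def using N_zero N_one by auto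
  show a: "x \<in> Oint \<Longrightarrow> y \<in> Oint \<Longrightarrow> x + y \<in> Oint" for x y unfolding Oint_def using N_add[of x y] by auto
  show "x \<in> Oint \<Longrightarrow> y \<in> Oint \<Longrightarrow> x - y \<in> Oint" unfolding Oint_def using N_diff[of x y] by auto
  show m: "x \<in> Oint \<Longrightarrow> y \<in> Oint \<Longrightarrow> x * y \<in> Oint" for x y
    unfolding Oint_def using N_mult[of x y] mult_le_one[of "N x" "N y"] N_nonneg[of y] by auto
  show "x \<in> Oint \<Longrightarrow> - x \<in> Oint" unfolding Oint_def using N_minus[of x] by auto
  show "x \<in> Oint \<Longrightarrow> x ^ n \<in> Oint" by (induction n) (auto simp: z m)
  show i: "of_int a \<in> Oint" for a unfolding Oint_def using N_int[of a] by auto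
  show "of_nat k \<in> Oint" using i[of "int k"] by simp
qed

lemma Mmax_ideal:
  "0 \<in> Mmax" "x \<in> Mmax \<Longrightarrow> y \<in> Mmax \<Longrightarrow> x + y \<in> Mmax" "x \<in> Mmax \<Longrightarrow> y \<in> Mmax \<Longrightarrow> x - y \<in> Mmax"
  "x \<in> Mmax \<Longrightarrow> y \<in> Oint \<Longrightarrow> x * y \<in> Mmax" "y \<in> Oint \<Longrightarrow> x \<in> Mmax \<Longrightarrow> y * x \<in> Mmax" "x \<in> Mmax \<Longrightarrow> x \<in> Oint" "1 \<notin> Mmax" "of_nat p \<in> Mmax"
  "x \<in> Mmax \<Longrightarrow> - x \<in> Mmax"
proof -
  show "0 \<in> Mmax" unfolding Mmax_def using N_zero by auto
  show "x \<in> Mmax \<Longrightarrow> y \<in> Mmax \<Longrightarrow> x + y \<in> Mmax" unfolding Mmax_def using N_add[of x y] by auto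
  show "x \<in> Mmax \<Longrightarrow> y \<in> Mmax \<Longrightarrow> x - y \<in> Mmax" unfolding Mmax_def using N_diff[of x y] by auto
  show m: "x \<in> Mmax \<Longrightarrow> y \<in> Oint \<Longrightarrow> x * y \<in> Mmax" for x y
  proof -
    assume a: "x \<in> Mmax" "y \<in> Oint"
    then have "N x * N y \<le> N x * 1" unfolding Mmax_def Oint_def by (intro mult_left_mono N_nonneg) auto
    then show ?thesis using a N_mult[of x y] unfolding Mmax_def Oint_def by auto
  qed
  then show "y \<in> Oint \<Longrightarrow> x \<in> Mmax \<Longrightarrow> y * x \<in> Mmax" by (metis mult.commute)
  show "x \<in> Mmax \<Longrightarrow> x \<in> Oint" unfolding Mmax_def Oint_def by auto
  show "1 \<notin> Mmax" unfolding Mmax_def using N_one by simp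
  show "of_nat p \<in> Mmax" unfolding Mmax_def using N_p p1 by auto
  show "x \<in> Mmax \<Longrightarrow> - x \<in> Mmax" unfolding Mmax_def using N_minus[of x] by auto
qed

lemma Mmax_prime: "x \<in> Oint \<Longrightarrow> y \<in> Oint \<Longrightarrow> x * y \<in> Mmax \<Longrightarrow> x \<in> Mmax \<or> y \<in> Mmax"
  unfolding Oint_def Mmax_def using N_mult[of x y] by (cases "N x < 1"; cases "N y < 1") auto

lemma Mmax_sum: "(\<And>i. i \<in> I \<Longrightarrow> f i \<in> Mmax) \<Longrightarrow> sum f I \<in> Mmax"
  by (induction I rule: infinite_finite_induct) (auto simp: Mmax_ideal)

lemma Oint_sum: "(\<And>i. i \<in> I \<Longrightarrow> f i \<in> Oint) \<Longrightarrow> sum f I \<in> Oint"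
  by (induction I rule: infinite_finite_induct) (auto simp: Oint_ring)

definition PO :: "complex poly set" where "PO = {h. \<forall>i. coeff h i \<in> Oint}"
definition PM :: "complex poly set" where "PM = {h. \<forall>i. coeff h i \<in> Mmax}"

lemma PO_ring:
  "0 \<in> PO" "1 \<in> PO" "x \<in> PO \<Longrightarrow> y \<in> PO \<Longrightarrow> x + y \<in> PO" "x \<in> PO \<Longrightarrow> y \<in> PO \<Longrightarrow> x - y \<in> PO"
  "x \<in> PO \<Longrightarrow> y \<in> PO \<Longrightarrow> x * y \<in> PO" "x \<in> PO \<Longrightarrow> x ^ n \<in> PO" "c \<in> Oint \<Longrightarrow> monom c k \<in> PO" "of_nat l \<in> PO"
proof -
  show z: "0 \<in> PO" "1 \<in> PO" unfolding PO_def by (auto simp: Oint_ring coeff_1)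
  show a: "x \<in> PO \<Longrightarrow> y \<in> PO \<Longrightarrow> x + y \<in> PO" for x y unfolding PO_def by (auto simp: Oint_ring)
  show "x \<in> PO \<Longrightarrow> y \<in> PO \<Longrightarrow> x - y \<in> PO" unfolding PO_def by (auto simp: Oint_ring)
  show m: "x \<in> PO \<Longrightarrow> y \<in> PO \<Longrightarrow> x * y \<in> PO" for x y
    unfolding PO_def by (auto intro!: Oint_sum simp: Oint_ring coeff_mult)
  show "x \<in> PO \<Longrightarrow> x ^ n \<in> PO" by (induction n) (auto simp: z m)
  show "c \<in> Oint \<Longrightarrow> monom c k \<in> PO" unfolding PO_def by (auto simp: Oint_ring)
  show "of_nat l \<in> PO" by (induction l) (auto simp: z a)
qed

lemma PM_ideal:
  "0 \<in> PM" "x \<in> PM \<Longrightarrow> y \<in> PM \<Longrightarrow> x + y \<in> PM" "x \<in> PM \<Longrightarrow> y \<in> PM \<Longrightarrow> x - y \<in> PM"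
  "y \<in> PO \<Longrightarrow> x \<in> PM \<Longrightarrow> y * x \<in> PM" "1 \<notin> PM" "c \<in> Mmax \<Longrightarrow> monom c k \<in> PM" "x \<in> PM \<Longrightarrow> - x \<in> PM"
  "x \<in> PM \<Longrightarrow> x \<in> PO"
proof -
  show "0 \<in> PM" unfolding PM_def by (auto simp: Mmax_ideal)
  show "x \<in> PM \<Longrightarrow> y \<in> PM \<Longrightarrow> x + y \<in> PM" unfolding PM_def by (auto simp: Mmax_ideal)
  show "x \<in> PM \<Longrightarrow> y \<in> PM \<Longrightarrow> x - y \<in> PM" unfolding PM_def by (auto simp: Mmax_ideal)
  show m: "y \<in> PO \<Longrightarrow> x \<in> PM \<Longrightarrow> y * x \<in> PM"
    unfolding PM_def PO_def by (auto intro!: Mmax_sum simp: Mmax_ideal coeff_mult)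
  show "1 \<notin> PM" unfolding PM_def using Mmax_ideal(7) by (auto dest: spec[of _ 0])
  show "c \<in> Mmax \<Longrightarrow> monom c k \<in> PM" unfolding PM_def by (auto simp: Mmax_ideal)
  show "x \<in> PM \<Longrightarrow> - x \<in> PM" unfolding PM_def by (auto simp: Mmax_ideal)
  show "x \<in> PM \<Longrightarrow> x \<in> PO" unfolding PM_def PO_def by (auto simp: Mmax_ideal)
qed

lemma PM_sum: "(\<And>i. i \<in> I \<Longrightarrow> f i \<in> PM) \<Longrightarrow> sum f I \<in> PM"
  by (induction I rule: infinite_finite_induct) (auto simp: PM_ideal)

lemma PO_sum: "(\<And>i. i \<in> I \<Longrightarrow> f i \<in> PO) \<Longrightarrow> sum f I \<in> PO"
  by (induction I rule: infinite_finite_induct) (auto simp: PO_ring)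

text \<open>Gauss's lemma: if \<open>i\<close> and \<open>j\<close> are the first indices of
  coefficients outside \<open>Mmax\<close>, then modulo \<open>Mmax\<close> the coefficient of the
  product at \<open>i + j\<close> is the product of these two.\<close>

lemma PM_prime:
  assumes "x \<in> PO" "y \<in> PO" "x * y \<in> PM" shows "x \<in> PM \<or> y \<in> PM"
proof (rule ccontr)
  assume a: "\<not> ?thesis"
  obtain i where i: "coeff x i \<notin> Mmax" "\<And>k. k < i \<Longrightarrow> coeff x k \<in> Mmax"
    using a exists_least_iff[of "\<lambda>i. coeff x i \<notin> Mmax"] unfolding PM_def by auto
  obtain j where j: "coeff y j \<notin> Mmax" "\<And>k. k < j \<Longrightarrow> coeff y k \<in> Mmax"
    using a exists_least_iff[of "\<lambda>i. coeff y i \<notin> Mmax"] unfolding PM_def by auto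
  have xO: "coeff x k \<in> Oint" "coeff y k \<in> Oint" for k using assms unfolding PO_def by auto
  have "coeff (x * y) (i + j) = (\<Sum>k\<le>i + j. coeff x k * coeff y (i + j - k))" by (rule coeff_mult)
  also have "\<dots> = coeff x i * coeff y j + (\<Sum>k\<in>{..i + j} - {i}. coeff x k * coeff y (i + j - k))"
    by (subst sum.remove[of _ i]) auto
  finally have "coeff x i * coeff y j = coeff (x * y) (i + j) - (\<Sum>k\<in>{..i + j} - {i}. coeff x k * coeff y (i + j - k))"
    by simp
  moreover have "(\<Sum>k\<in>{..i + j} - {i}. coeff x k * coeff y (i + j - k)) \<in> Mmax"
  proof (rule Mmax_sum)
    fix k assume k: "k \<in> {..i + j} - {i}"
    show "coeff x k * coeff y (i + j - k) \<in> Mmax"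
    proof (cases "k < i")
      case True then show ?thesis using Mmax_ideal(4) i(2) xO by blast
    next
      case False
      then have "i + j - k < j" using k by auto
      then show ?thesis using Mmax_ideal(5) j(2) xO by blast
    qed
  qed
  moreover have "coeff (x * y) (i + j) \<in> Mmax" using assms(3) unfolding PM_def by blast
  ultimately have "coeff x i * coeff y j \<in> Mmax" using Mmax_ideal(3) by metis
  then show False using Mmax_prime xO i(1) j(1) by blast
qed

lemma PO_prod: "(\<And>i. i \<in> I \<Longrightarrow> f i \<in> PO) \<Longrightarrow> prod f I \<in> PO"
  by (induction I rule: infinite_finite_induct) (auto simp: PO_ring)

lemma PM_prime_prod:
  assumes "finite I" "\<And>i. i \<in> I \<Longrightarrow> f i \<in> PO" "prod f I \<in> PM" shows "\<exists>i\<in>I. f i \<in> PM"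
  using assms
proof (induction I rule: finite_induct)
  case empty then show ?case using PM_ideal(5) by simp
next
  case (insert x F)
  have "prod f F \<in> PO" using insert.prems(1) by (intro PO_prod) auto
  then have "f x \<in> PM \<or> prod f F \<in> PM" using PM_prime[of "f x" "prod f F"] insert by auto
  then show ?case using insert by auto
qed

lemma freshman:
  assumes "x \<in> PO" "y \<in> PO" shows "(x + y) ^ p - (x ^ p + y ^ p) \<in> PM"
proof -
  have p2: "p \<ge> 2" using prime prime_ge_2_nat by blast
  have "(x + y) ^ p = (\<Sum>k\<le>p. of_nat (p choose k) * x ^ k * y ^ (p - k))" by (rule binomial_ring)
  also have "{..p} = insert 0 (insert p {1..<p})" using p2 by auto
  also have "(\<Sum>k\<in>insert 0 (insert p {1..<p}). of_nat (p choose k) * x ^ k * y ^ (p - k)) =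
      y ^ p + (x ^ p + (\<Sum>k\<in>{1..<p}. of_nat (p choose k) * x ^ k * y ^ (p - k)))"
    using p2 by (subst sum.insert, simp, simp, subst sum.insert) auto
  finally have "(x + y) ^ p - (x ^ p + y ^ p) = (\<Sum>k\<in>{1..<p}. of_nat (p choose k) * x ^ k * y ^ (p - k))" by simp
  also have "\<dots> \<in> PM"
  proof (rule PM_sum)
    fix k assume k: "k \<in> {1..<p}"
    have "p dvd (p choose k)" using k prime by (intro dvd_choose_prime) auto
    then obtain l where l: "p choose k = p * l" by (rule dvdE)
    have "(of_nat p :: complex poly) = monom (of_nat p) 0" by (simp add: of_nat_poly monom_0)
    then have "(of_nat p :: complex poly) \<in> PM" using PM_ideal(6)[OF Mmax_ideal(8)] by metis
    moreover have "of_nat l * x ^ k * y ^ (p - k) \<in> PO" using assms by (intro PO_ring)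
    ultimately have "(of_nat l * x ^ k * y ^ (p - k)) * of_nat p \<in> PM" using PM_ideal(4) by blast
    moreover have "of_nat (p choose k) * x ^ k * y ^ (p - k) = (of_nat l * x ^ k * y ^ (p - k)) * of_nat p"
      unfolding l by (simp add: algebra_simps)
    ultimately show "of_nat (p choose k) * x ^ k * y ^ (p - k) \<in> PM" by metis
  qed
  finally show ?thesis .
qed

lemma freshman_sum:
  assumes "finite I" "\<And>i. i \<in> I \<Longrightarrow> f i \<in> PO" shows "(sum f I) ^ p - (\<Sum>i\<in>I. f i ^ p) \<in> PM"
  using assms
proof (induction I rule: finite_induct)
  case empty
  have "p > 0" using prime prime_gt_0_nat by blast
  then show ?case using PM_ideal(1) by (simp add: power_0_left)
next
  case (insert x F)
  have "sum f F \<in> PO" using insert by (intro PO_sum) auto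
  then have "(f x + sum f F) ^ p - (f x ^ p + sum f F ^ p) \<in> PM" using freshman insert by auto
  moreover have "sum f F ^ p - (\<Sum>i\<in>F. f i ^ p) \<in> PM" using insert by auto
  ultimately have "((f x + sum f F) ^ p - (f x ^ p + sum f F ^ p)) + (sum f F ^ p - (\<Sum>i\<in>F. f i ^ p)) \<in> PM"
    using PM_ideal(2) by blast
  then show ?case using insert.hyps by (simp add: algebra_simps)
qed

lemma nat_fermat: "of_nat n ^ p - of_nat n \<in> Mmax"
proof (induction n)
  case 0
  have "p > 0" using prime prime_gt_0_nat by blast
  then show ?case using Mmax_ideal(1) by (simp add: power_0_left)
next
  case (Suc n)
  \<comment> \<open>Constant polynomials carry the congruence \<open>freshman\<close> over to
    numbers.\<close>
  have "([:of_nat n:] + [:1:]) ^ p - ([:of_nat n:] ^ p + [:1:] ^ p) \<in> PM"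
    using PO_ring(7)[OF Oint_ring(9), of n 0] PO_ring(7)[OF Oint_ring(2), of 0] by (intro freshman) (simp_all add: monom_0)
  then have "[:(of_nat n + 1) ^ p - (of_nat n ^ p + 1):] \<in> PM" by (simp add: poly_const_pow)
  then have "(of_nat n + 1) ^ p - (of_nat n ^ p + 1) \<in> Mmax" unfolding PM_def by (auto dest: spec[of _ 0])
  then have "((of_nat n + 1) ^ p - (of_nat n ^ p + 1)) + (of_nat n ^ p - of_nat n) \<in> Mmax"
    using Suc Mmax_ideal(2) by blast
  then show ?case by (simp add: algebra_simps)
qed

lemma cong_power:
  assumes "x \<in> Oint" "y \<in> Oint" "x - y \<in> Mmax" shows "x ^ k - y ^ k \<in> Mmax"
proof (induction k)
  case 0 then show ?case using Mmax_ideal(1) by simp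
next
  case (Suc k)
  have "x ^ Suc k - y ^ Suc k = x * (x ^ k - y ^ k) + (x - y) * y ^ k" by (simp add: algebra_simps)
  then show ?case using Mmax_ideal(2)[OF Mmax_ideal(5)[OF assms(1) Suc] Mmax_ideal(4)[OF assms(3) Oint_ring(7)[OF assms(2)]]] by metis
qed

lemma int_cong_nat: "\<exists>n<p. of_int a - of_nat n \<in> Mmax"
proof -
  define n where "n = nat (a mod int p)"
  have p0: "p > 0" using prime prime_gt_0_nat by blast
  then have n: "int n = a mod int p" unfolding n_def by simp
  have "a = int p * (a div int p) + int n" using n by simp
  then have "of_int a - of_nat n = (of_nat p * of_int (a div int p) :: complex)"
    by (metis add_diff_cancel_right' of_int_add of_int_mult of_int_of_nat_eq)
  then have "of_int a - of_nat n \<in> Mmax" using Mmax_ideal(4)[OF Mmax_ideal(8) Oint_ring(8)] by metis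
  moreover have "n < p" using n p0 by (metis of_nat_0_less_iff of_nat_less_iff pos_mod_bound)
  ultimately show ?thesis by blast
qed

text \<open>In lowest terms the denominator is prime to \<open>p\<close>, and a Bezout relation
  inverts it modulo \<open>p\<close>.\<close>

lemma rational_cong_nat:
  assumes "c \<in> \<rat>" "c \<in> Oint" shows "\<exists>n<p. c - of_nat n \<in> Mmax"
proof -
  obtain q where q: "c = of_rat q" using assms(1) by (elim Rats_cases)
  obtain a b where ab: "quotient_of q = (a, b)" by force
  then have qq: "q = of_int a / of_int b" "b > 0" "coprime a b" using quotient_of_div quotient_of_denom_pos quotient_of_coprime by auto
  have c: "c = of_int a / of_int b" unfolding q qq(1) by (simp add: of_rat_divide)
  have cb: "coprime b (int p)"
  proof (rule ccontr)
    assume "\<not> coprime b (int p)"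
    then have pb: "int p dvd b" using prime by (metis coprime_commute prime_imp_coprime prime_nat_int_transfer)
    then have "\<not> int p dvd a" using qq(3) prime by (meson coprime_common_divisor not_prime_unit prime_nat_int_transfer)
    then have "N (of_int a) = 1" using prime by (metis N_coprime coprime_commute prime_imp_coprime prime_nat_int_transfer)
    moreover have "of_int a = c * of_int b" using c qq(2) by simp
    moreover have "c * of_int b \<in> Mmax"
    proof -
      obtain k where "b = int p * k" using pb by (rule dvdE)
      then have "of_int b = of_nat p * (of_int k :: complex)" by simp
      then have "of_int b \<in> Mmax" using Mmax_ideal(4)[OF Mmax_ideal(8) Oint_ring(8)] by metis
      then show ?thesis using Mmax_ideal(5) assms(2) by blast
    qed
    ultimately show False unfolding Mmax_def by simp
  qed
  obtain u v where uv: "u * b + v * int p = 1"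
    using bezout_int[of b "int p"] cb by (metis coprime_imp_gcd_eq_1)
  have "of_int u * of_int b + of_int v * of_nat p = (1 :: complex)"
    using uv by (metis of_int_1 of_int_add of_int_mult of_int_of_nat_eq)
  then have "c = c * (of_int u * of_int b + of_int v * of_nat p)" by simp
  also have "\<dots> = of_int (u * a) + c * of_int v * of_nat p" using c qq(2) by (simp add: field_simps)
  finally have 1: "c - of_int (u * a) = (c * of_int v) * of_nat p" by (metis add_diff_cancel_left')
  have 2: "c - of_int (u * a) \<in> Mmax" unfolding 1
    by (intro Mmax_ideal(5) Oint_ring(5) Oint_ring(8) assms(2) Mmax_ideal(8))
  obtain n where n: "n < p" "of_int (u * a) - of_nat n \<in> Mmax" using int_cong_nat by blast
  have "(c - of_int (u * a)) + (of_int (u * a) - of_nat n) \<in> Mmax" by (rule Mmax_ideal(2)[OF 2 n(2)])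
  then show ?thesis using n(1) by auto
qed

lemma rational_fermat:
  assumes "c \<in> \<rat>" "c \<in> Oint" shows "c ^ p - c \<in> Mmax"
proof -
  obtain n where n: "c - of_nat n \<in> Mmax" using rational_cong_nat[OF assms] by blast
  have "(c ^ p - of_nat n ^ p) + (of_nat n ^ p - of_nat n) \<in> Mmax"
    by (rule Mmax_ideal(2)[OF cong_power[OF assms(2) Oint_ring(9) n] nat_fermat])
  then have "c ^ p - of_nat n \<in> Mmax" by simp
  from Mmax_ideal(3)[OF this n] show ?thesis by (simp add: algebra_simps)
qed

text \<open>Over the field with \<open>p\<close> elements this substitution is the
  \<open>p\<close>-th power of the polynomial, see \<open>frobenius_rational_poly\<close>.\<close>

definition expand :: "complex poly \<Rightarrow> complex poly" where "expand c = pcompose c (monom 1 p)"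

lemma expand_arith: "expand 0 = 0" "expand 1 = 1" "expand (x - y) = expand x - expand y" "expand (x * y) = expand x * expand y" "expand (x + y) = expand x + expand y"
  unfolding expand_def by (simp_all add: pcompose_diff pcompose_mult pcompose_add pcompose_1)

lemma expand_monom: "expand (monom c i) = monom c (p * i)"
proof -
  have e: "monom c i = smult c (monom 1 i)" by (simp add: smult_monom)
  have "pcompose (monom 1 i) (monom 1 p) = (monom 1 p :: complex poly) ^ i"
    by (induction i) (simp_all add: pcompose_1 monom_Suc pcompose_pCons)
  also have "\<dots> = monom 1 (p * i)" by (simp add: monom_power mult.commute)
  finally have "smult c (pcompose (monom 1 i) (monom 1 p)) = monom c (p * i)" by (simp add: smult_monom)
  then show ?thesis unfolding expand_def e pcompose_smult .
qed

lemma expand_sum: "expand (sum f I) = (\<Sum>i\<in>I. expand (f i))"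
  by (induction I rule: infinite_finite_induct) (auto simp: expand_arith)

lemma frobenius_rational_poly:
  assumes "h \<in> PO" "\<And>i. coeff h i \<in> \<rat>" shows "h ^ p - expand h \<in> PM"
proof -
  define m where "m i = monom (coeff h i) i" for i
  have h: "h = (\<Sum>i\<le>degree h. m i)" unfolding m_def by (rule poly_as_sum_of_monoms[symmetric])
  have mO: "m i \<in> PO" for i using assms(1) unfolding m_def by (intro PO_ring) (auto simp: PO_def)
  have "(\<Sum>i\<le>degree h. m i) ^ p - (\<Sum>i\<le>degree h. m i ^ p) \<in> PM" using freshman_sum mO by blast
  moreover have "(\<Sum>i\<le>degree h. m i ^ p) - (\<Sum>i\<le>degree h. expand (m i)) \<in> PM"
  proof -
    have "m i ^ p - expand (m i) \<in> PM" for i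
    proof -
      have "m i ^ p - expand (m i) = monom (coeff h i ^ p - coeff h i) (p * i)"
        unfolding m_def expand_monom by (simp add: monom_power diff_monom mult.commute)
      moreover have "coeff h i ^ p - coeff h i \<in> Mmax" using assms by (intro rational_fermat) (auto simp: PO_def)
      ultimately show ?thesis using PM_ideal(6) by metis
    qed
    then show ?thesis unfolding sum_subtractf[symmetric] by (intro PM_sum)
  qed
  ultimately have "((\<Sum>i\<le>degree h. m i) ^ p - (\<Sum>i\<le>degree h. m i ^ p)) + ((\<Sum>i\<le>degree h. m i ^ p) - (\<Sum>i\<le>degree h. expand (m i))) \<in> PM"
    using PM_ideal(2) by blast
  then have "(\<Sum>i\<le>degree h. m i) ^ p - expand (\<Sum>i\<le>degree h. m i) \<in> PM" unfolding expand_sum by (simp add: algebra_simps)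
  then show ?thesis using h by simp
qed

end

context splitting_nonarch
begin

text \<open>Kronecker's argument: the generic linear forms \<open>a g = (\<Sum>x. g x Y\<^sub>x)\<close> are conjugate, where \<open>Y\<^sub>x\<close> is encoded as a
  power of one variable. So \<open>\<Prod>\<^sub>g (X - a g)\<close> is rational, hence congruent to its \<open>p\<close>-th power twist, and evaluating
  at the \<open>p\<close>-th power of \<open>a id\<close> exhibits a \<open>g\<close> that reduces to Frobenius.\<close>

theorem frobenius_element:
  assumes int: "\<And>x. x \<in> R \<Longrightarrow> N x \<le> 1"
  shows "\<exists>g\<in>G. \<forall>x\<in>R. g x - x ^ p \<in> Mmax"
proof -
  obtain idx where idx: "inj_on (idx :: complex \<Rightarrow> nat) R" using finite_imp_inj_to_nat_seg[OF finR] by blast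
  define a where "a g = (\<Sum>x\<in>R. monom (g x) (idx x))" for g :: "complex \<Rightarrow> complex"
  have p0: "p > 0" using prime prime_gt_0_nat by blast
  have RO: "x \<in> Oint" if "x \<in> R" for x
    using int[OF that] RK K_algebraic that unfolding Oint_def by blast
  have gR: "g x \<in> R" if "g \<in> G" "x \<in> R" for g x using permutes_in_image[OF G_permutes[OF that(1)]] that(2) by simp
  have aPO: "a g \<in> PO" if "g \<in> G" for g unfolding a_def by (intro PO_sum PO_ring(7)) (use gR[OF that] RO in blast)
  have aK: "a g \<in> {h. coeffs_in K h}" if "g \<in> G" for g
  proof -
    have "coeffs_in K (\<Sum>x\<in>X. monom (g x) (idx x))" if "X \<subseteq> R" for X
      using finite_subset[OF that finR] that
    proof (induction X rule: finite_induct)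
      case (insert x F)
      then have "g x \<in> K" using gR[OF \<open>g \<in> G\<close>] RK by auto
      then show ?case using insert by (simp add: coeffs_in_arith(1,5)[OF subK])
    qed (simp add: coeffs_in_arith(6)[OF subK])
    then show ?thesis unfolding a_def by simp
  qed
  \<comment> \<open>The coefficients of \<open>P\<close> are themselves polynomials, in the variable
    whose powers encode the roots.\<close>
  define P where "P = (\<Prod>g\<in>G. [:- a g, 1:])"
  have PPO: "coeff P j \<in> PO" for j
    using prod_linear_hom[of G a PO "\<lambda>x. x"] G_fin aPO PO_ring unfolding P_def by auto
  have PK: "coeff P j \<in> {h. coeffs_in K h} \<and> map_poly (rep h) (coeff P j) = coeff P j" if h: "h \<in> G" for h j
  proof -
    note hh = rat_automorphisms_hom[OF rep(1)[OF h]]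
    have mm: "map_poly (rep h) 1 = 1" by (simp add: map_poly_1' field_homD(5)[OF hh])
    have ha: "map_poly (rep h) (a g) = a (h \<circ> g)" if g: "g \<in> G" for g
    proof -
      have "map_poly (rep h) (\<Sum>x\<in>X. monom (g x) (idx x)) = (\<Sum>x\<in>X. monom ((h \<circ> g) x) (idx x)) \<and>
        coeffs_in K (\<Sum>x\<in>X. monom (g x) (idx x))" if "X \<subseteq> R" for X
        using finite_subset[OF that finR] that
      proof (induction X rule: finite_induct)
        case empty then show ?case by (simp add: coeffs_in_arith[OF subK])
      next
        case (insert x F)
        have xR: "g x \<in> R" "g x \<in> K" using gR[OF g] insert.prems RK by auto
        have "map_poly (rep h) (monom (g x) (idx x)) = monom (h (g x)) (idx x)"
          using rep_R[OF h xR(1)] by (simp add: map_poly_monom field_homD(4)[OF hh])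
        then show ?case using insert xR map_poly_hom(1)[OF subK hh] coeffs_in_arith[OF subK] by auto
      qed
      then show ?thesis unfolding a_def by simp
    qed
    have "\<forall>j. coeff P j \<in> {h. coeffs_in K h} \<and> map_poly (rep h) (coeff P j) = coeff (\<Prod>g\<in>G. [:- map_poly (rep h) (a g), 1:]) j"
      unfolding P_def
    proof (rule prod_linear_hom[OF G_fin aK])
      show "\<And>x y. x \<in> {h. coeffs_in K h} \<Longrightarrow> y \<in> {h. coeffs_in K h} \<Longrightarrow> x - y \<in> {h. coeffs_in K h} \<and> x * y \<in> {h. coeffs_in K h}"
        by (simp add: coeffs_in_arith[OF subK])
      show "\<And>x y. x \<in> {h. coeffs_in K h} \<Longrightarrow> y \<in> {h. coeffs_in K h} \<Longrightarrow>
        map_poly (rep h) (x - y) = map_poly (rep h) x - map_poly (rep h) y \<and> map_poly (rep h) (x * y) = map_poly (rep h) x * map_poly (rep h) y"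
        by (simp add: map_poly_hom[OF subK hh])
    qed (auto simp: coeffs_in_arith[OF subK] mm)
    moreover have "(\<Prod>g\<in>G. [:- map_poly (rep h) (a g), 1:]) = P"
    proof -
      have "(\<Prod>g\<in>G. [:- map_poly (rep h) (a g), 1:]) = (\<Prod>g\<in>G. [:- a (h \<circ> g), 1:])"
        by (intro prod.cong) (simp_all add: ha)
      also have "\<dots> = P"
        unfolding P_def
      proof (rule prod.reindex_bij_betw[where h = "\<lambda>g. h \<circ> g" and g = "\<lambda>g. [:- a g, 1:]"])
        have "inj_on (\<lambda>g. h \<circ> g) G"
          by (rule inj_onI) (metis comp_assoc gal.inv_comp(1) h id_comp)
        moreover from this have "(\<lambda>g. h \<circ> g) ` G = G"
          by (intro endo_inj_surj) (use G_fin G_comp h in auto)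
        ultimately show "bij_betw (\<lambda>g. h \<circ> g) G G" unfolding bij_betw_def by simp
      qed
      finally show ?thesis .
    qed
    ultimately show ?thesis by simp
  qed
  have PQ: "coeff (coeff P j) i \<in> \<rat>" for i j
  proof -
    obtain q where "coeff P j = cp q"
      using invariant_poly_rational[of "coeff P j"] PK G_id by blast
    then show ?thesis by (simp add: cp_arith)
  qed
  define Q where "Q = (\<Prod>g\<in>G. [:- expand (a g), 1:])"
  have Qc: "coeff Q j = expand (coeff P j)" for j
    using prod_linear_hom[of G a UNIV expand] G_fin expand_arith unfolding P_def Q_def by auto
  define n where "n = card G"
  have dP: "degree P \<le> n" "degree Q \<le> n"
    unfolding P_def Q_def n_def by (rule order_trans[OF degree_prod_sum_le[OF G_fin]]; simp)+
  have polyP: "poly P z = (\<Sum>j\<le>n. coeff P j * z ^ j)" "poly Q z = (\<Sum>j\<le>n. coeff Q j * z ^ j)" for z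
    using dP by (auto simp: poly_altdef intro!: sum.mono_neutral_left coeff_eq_0)
  define z where "z = a id"
  have zO: "z \<in> PO" unfolding z_def by (rule aPO[OF G_id])
  have "poly P z = 0" unfolding P_def z_def poly_prod using G_fin G_id by (auto simp: prod_zero_iff)
  then have "(\<Sum>j\<le>n. coeff P j * z ^ j) = 0" using polyP by simp
  \<comment> \<open>Taken termwise, the \<open>p\<close>-th power of \<open>poly P z\<close> is
    congruent to the twisted polynomial \<open>Q\<close> evaluated at \<open>z ^ p\<close>.\<close>
  then have "(\<Sum>j\<le>n. coeff P j * z ^ j) ^ p = 0" using p0 by (simp add: power_0_left)
  moreover have "(\<Sum>j\<le>n. coeff P j * z ^ j) ^ p - (\<Sum>j\<le>n. (coeff P j * z ^ j) ^ p) \<in> PM"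
    by (rule freshman_sum) (auto intro!: PO_ring PPO zO)
  ultimately have "- (\<Sum>j\<le>n. (coeff P j * z ^ j) ^ p) \<in> PM" by (metis diff_0)
  from PM_ideal(7)[OF this] have 1: "(\<Sum>j\<le>n. (coeff P j * z ^ j) ^ p) \<in> PM" by simp
  have "(\<Sum>j\<le>n. (coeff P j * z ^ j) ^ p) - poly Q (z ^ p) \<in> PM"
  proof -
    have "(coeff P j * z ^ j) ^ p - coeff Q j * (z ^ p) ^ j \<in> PM" for j
    proof -
      have "(coeff P j * z ^ j) ^ p - coeff Q j * (z ^ p) ^ j = (z ^ p) ^ j * (coeff P j ^ p - expand (coeff P j))"
        unfolding Qc by (simp add: power_mult_distrib power_mult[symmetric] mult.commute algebra_simps)
      moreover have "coeff P j ^ p - expand (coeff P j) \<in> PM" by (rule frobenius_rational_poly[OF PPO PQ])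
      ultimately show ?thesis using PM_ideal(4)[of "(z ^ p) ^ j"] zO PO_ring(6) by metis
    qed
    then show ?thesis unfolding polyP sum_subtractf[symmetric] by (intro PM_sum)
  qed
  from PM_ideal(3)[OF 1 this] have "poly Q (z ^ p) \<in> PM" by simp
  then have "(\<Prod>g\<in>G. z ^ p - expand (a g)) \<in> PM" unfolding Q_def poly_prod by simp
  moreover have frO: "expand (a g) \<in> PO" if "g \<in> G" for g
    unfolding a_def expand_sum expand_monom by (intro PO_sum PO_ring(7)) (use gR[OF that] RO in blast)
  ultimately obtain g where g: "g \<in> G" "z ^ p - expand (a g) \<in> PM"
    using PM_prime_prod[OF G_fin, of "\<lambda>g. z ^ p - expand (a g)"] PO_ring(4)[OF PO_ring(6)[OF zO]] by blast
  have "z ^ p - (\<Sum>x\<in>R. monom x (idx x) ^ p) \<in> PM"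
    unfolding z_def a_def id_apply by (rule freshman_sum[OF finR]) (auto intro!: PO_ring RO)
  from PM_ideal(3)[OF g(2) this] have h: "(\<Sum>x\<in>R. monom x (idx x) ^ p) - expand (a g) \<in> PM" by simp
  have "(\<Sum>x\<in>R. monom x (idx x) ^ p) - expand (a g) = (\<Sum>x\<in>R. monom (x ^ p - g x) (p * idx x))"
    unfolding a_def expand_sum expand_monom sum_subtractf[symmetric]
    by (intro sum.cong) (simp_all add: monom_power diff_monom mult.commute)
  then have h': "(\<Sum>x\<in>R. monom (x ^ p - g x) (p * idx x)) \<in> PM" using h by (simp only:)
  have "g x - x ^ p \<in> Mmax" if x: "x \<in> R" for x
  proof -
    \<comment> \<open>The exponents \<open>p * idx y\<close> are distinct, so the coefficient at
      \<open>p * idx x\<close> isolates the congruence for \<open>x\<close>.\<close>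
    have "coeff (\<Sum>y\<in>R. monom (y ^ p - g y) (p * idx y)) (p * idx x) = (\<Sum>y\<in>R. if y = x then y ^ p - g y else 0)"
      unfolding coeff_sum
    proof (rule sum.cong[OF refl])
      fix y assume "y \<in> R"
      then have "idx y = idx x \<longleftrightarrow> y = x" using idx x by (auto simp: inj_on_def)
      then show "coeff (monom (y ^ p - g y) (p * idx y)) (p * idx x) = (if y = x then y ^ p - g y else 0)"
        using p0 by simp
    qed
    also have "\<dots> = x ^ p - g x" using x finR by simp
    finally have e: "coeff (\<Sum>y\<in>R. monom (y ^ p - g y) (p * idx y)) (p * idx x) = x ^ p - g x" .
    have "coeff (\<Sum>y\<in>R. monom (y ^ p - g y) (p * idx y)) (p * idx x) \<in> Mmax"
      using h' unfolding PM_def by blast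
    from Mmax_ideal(9)[OF this] show ?thesis unfolding e by simp
  qed
  then show ?thesis using g(1) by blast
qed

end

section \<open>Dedekind's theorem for a cubic factor\<close>

context nonarch
begin

text \<open>Horner's scheme from the top: each coefficient of the quotient is a coefficient of
  \<open>h\<close> plus \<open>z\<close> times the quotient coefficient above it.\<close>

lemma synthetic_div_PO:
  assumes h: "h \<in> PO" and z: "z \<in> Oint" shows "synthetic_div h z \<in> PO"
proof -
  have cs: "coeff (synthetic_div h z) i = coeff h (Suc i) + z * coeff (synthetic_div h z) (Suc i)" for i
    using arg_cong[OF synthetic_div_correct[of h z], of "\<lambda>t. coeff t (Suc i)"] by simp
  have big: "coeff (synthetic_div h z) i = 0" if "i \<ge> degree h" for i
  proof (cases "degree h = 0")
    case True
    then have "synthetic_div h z = 0" by (simp add: synthetic_div_eq_0_iff)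
    then show ?thesis by simp
  next
    case False
    then show ?thesis using that by (intro coeff_eq_0) (simp add: degree_synthetic_div)
  qed
  have *: "coeff (synthetic_div h z) (degree h - k) \<in> Oint" for k
  proof (induction k)
    case 0 then show ?case using big Oint_ring(1) by simp
  next
    case (Suc k)
    show ?case
    proof (cases "k < degree h")
      case True
      then have "Suc (degree h - Suc k) = degree h - k" by simp
      then show ?thesis using cs[of "degree h - Suc k"] Suc h z unfolding PO_def by (simp add: Oint_ring)
    next
      case False then show ?thesis using Suc by simp
    qed
  qed
  have "coeff (synthetic_div h z) i \<in> Oint" for i
  proof (cases "i \<le> degree h")
    case True then show ?thesis using *[of "degree h - i"] by simp
  next
    case False then show ?thesis using big[of i] Oint_ring(1) by simp
  qed
  then show ?thesis unfolding PO_def by blast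
qed

text \<open>Lagrange's bound over the residue field: splitting off the linear factor of one root
  leaves a monic integral polynomial that still vanishes modulo \<open>Mmax\<close> at the other,
  incongruent roots.\<close>

lemma roots_mod_bound:
  assumes "finite B" "B \<subseteq> Oint" "\<And>x y. x \<in> B \<Longrightarrow> y \<in> B \<Longrightarrow> x \<noteq> y \<Longrightarrow> x - y \<notin> Mmax"
    "q \<in> PO" "lead_coeff q = 1" "\<And>x. x \<in> B \<Longrightarrow> poly q x \<in> Mmax"
  shows "card B \<le> degree q"
  using assms
proof (induction "card B" arbitrary: B q)
  case 0 then show ?case by simp
next
  case (Suc n)
  then obtain b where b: "b \<in> B" by fastforce
  have bO: "b \<in> Oint" using b Suc.prems by blast
  define s where "s = synthetic_div q b"
  have e: "q + smult b s = pCons (poly q b) s" unfolding s_def by (rule synthetic_div_correct)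
  have cs: "coeff s i = coeff q (Suc i) + b * coeff s (Suc i)" for i
    using arg_cong[OF e, of "\<lambda>t. coeff t (Suc i)"] by simp
  have ds: "degree s = degree q - 1" unfolding s_def by (rule degree_synthetic_div)
  have dq: "degree q \<noteq> 0"
  proof
    assume "degree q = 0"
    then have "q = 1" using Suc.prems(5) by (metis degree_eq_zeroE lead_coeff_pCons(2) one_pCons coeff_pCons_0 degree_pCons_0)
    then show False using Suc.prems(6)[OF b] Mmax_ideal(7) by simp
  qed
  have sO: "s \<in> PO" unfolding s_def by (rule synthetic_div_PO[OF \<open>q \<in> PO\<close> bO])
  have ls: "lead_coeff s = 1"
    using cs[of "degree q - 1"] Suc.prems(5) dq ds coeff_eq_0[of s "degree q"] by simp
  have px: "(x - b) * poly s x = poly q x - poly q b" for x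
    using arg_cong[OF e, of "\<lambda>t. poly t x"] by (simp add: algebra_simps)
  have "card (B - {b}) \<le> degree s"
  proof (rule Suc.hyps(1))
    show "n = card (B - {b})" using Suc.hyps(2) b Suc.prems(1) by simp
    show "finite (B - {b})" "B - {b} \<subseteq> Oint" using Suc.prems by auto
    show "s \<in> PO" "lead_coeff s = 1" by fact+
    show "x - y \<notin> Mmax" if "x \<in> B - {b}" "y \<in> B - {b}" "x \<noteq> y" for x y using that Suc.prems(3) by blast
    show "poly s x \<in> Mmax" if x: "x \<in> B - {b}" for x
    proof -
      have xO: "x \<in> Oint" using x Suc.prems by blast
      have "(x - b) * poly s x \<in> Mmax" unfolding px using Suc.prems(6) x b Mmax_ideal(3) by blast
      moreover have "x - b \<notin> Mmax" using Suc.prems(3) x b by blast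
      moreover have "poly s x \<in> Oint" unfolding poly_altdef
        using sO xO unfolding PO_def by (intro Oint_sum Oint_ring) auto
      ultimately show ?thesis using Mmax_prime Oint_ring(4)[OF xO bO] by blast
    qed
  qed
  then show ?case using ds dq b Suc.prems(1) by simp
qed

end

abbreviation ip :: "int poly \<Rightarrow> complex poly" where "ip F \<equiv> map_poly of_int F"

lemma ip_arith:
  "ip (x + y) = ip x + ip y" "ip (x - y) = ip x - ip y" "ip (x * y) = ip x * ip y" "ip 1 = 1"
  "degree (ip x) = degree x" "lead_coeff (ip x) = of_int (lead_coeff x)" "ip (prod_list xs) = prod_list (map ip xs)"
  "pderiv (ip x) = ip (pderiv x)"
proof -
  show d: "degree (ip x) = degree x" for x by (rule degree_map_poly) simp
  show "lead_coeff (ip x) = of_int (lead_coeff x)" using d by (simp add: coeff_map_poly)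
  show m: "ip (x * y) = ip x * ip y" for x y by (intro poly_eqI) (simp add: coeff_map_poly coeff_mult)
  show o: "ip 1 = 1" by (simp add: map_poly_1')
  show "ip (x + y) = ip x + ip y" "ip (x - y) = ip x - ip y" by (intro poly_eqI; simp add: coeff_map_poly)+
  show "ip (prod_list xs) = prod_list (map ip xs)" by (induction xs) (auto simp: m o)
  show "pderiv (ip x) = ip (pderiv x)" by (intro poly_eqI) (simp add: coeff_map_poly coeff_pderiv)
qed

context nonarch
begin

lemma ip_PO: "ip F \<in> PO" unfolding PO_def by (simp add: coeff_map_poly Oint_ring)

lemma ip_PM: "(\<And>i. int p dvd coeff F i) \<Longrightarrow> ip F \<in> PM"
  unfolding PM_def
proof (simp add: coeff_map_poly, intro allI)
  fix i assume a: "\<And>i. int p dvd coeff F i"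
  then obtain k where "coeff F i = int p * k" by blast
  then show "of_int (coeff F i) \<in> Mmax" using Mmax_ideal(4)[OF Mmax_ideal(8) Oint_ring(8)] by simp
qed

lemma poly_PO: "h \<in> PO \<Longrightarrow> x \<in> Oint \<Longrightarrow> poly h x \<in> Oint"
  unfolding poly_altdef PO_def by (auto intro!: Oint_sum Oint_ring(5,7))

lemma poly_PM: "h \<in> PM \<Longrightarrow> x \<in> Oint \<Longrightarrow> poly h x \<in> Mmax"
  unfolding poly_altdef PM_def by (auto intro!: Mmax_sum Mmax_ideal(4) Oint_ring(7))

lemma cong_poly:
  assumes "h \<in> PO" "x \<in> Oint" "y \<in> Oint" "x - y \<in> Mmax" shows "poly h x - poly h y \<in> Mmax"
proof -
  have "poly h x - poly h y = (\<Sum>i\<le>degree h. coeff h i * (x ^ i - y ^ i))"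
    unfolding poly_altdef sum_subtractf[symmetric] by (simp add: algebra_simps)
  then show ?thesis using assms cong_power[OF assms(2-4)]
    by (auto simp: PO_def intro!: Mmax_sum Mmax_ideal(5))
qed

text \<open>Frobenius fixes the integer coefficients, so the value at \<open>x ^ p\<close> is
  congruent to the \<open>p\<close>-th power of the value at \<open>x\<close>.\<close>

lemma poly_ip_frob:
  assumes "x \<in> Oint" "poly (ip c) x \<in> Mmax" shows "poly (ip c) (x ^ p) \<in> Mmax"
proof -
  have "ip c ^ p - expand (ip c) \<in> PM" by (rule frobenius_rational_poly[OF ip_PO]) (simp add: coeff_map_poly)
  from poly_PM[OF this assms(1)] have "poly (ip c) x ^ p - poly (ip c) (x ^ p) \<in> Mmax"
    unfolding expand_def by (simp add: poly_pcompose poly_monom)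
  moreover have "poly (ip c) x ^ p \<in> Mmax"
  proof -
    have "poly (ip c) x ^ p = poly (ip c) x * poly (ip c) x ^ (p - 1)"
      using prime_gt_0_nat[OF prime] by (metis Suc_diff_1 power_Suc)
    then show ?thesis using Mmax_ideal(4)[OF assms(2) Oint_ring(7)[OF poly_PO[OF ip_PO assms(1)]]] by simp
  qed
  ultimately show ?thesis using Mmax_ideal(3) by force
qed

text \<open>Modulo \<open>Mmax\<close> the monic polynomial \<open>q\<close> of degree
  \<open>p\<close> already vanishes at the numbers below \<open>p\<close>; another root would exceed
  its degree.\<close>

lemma frob_fixed_cong_nat:
  assumes x: "x \<in> Oint" "x - x ^ p \<in> Mmax" shows "\<exists>n<p. x - of_nat n \<in> Mmax"
proof (rule ccontr)
  assume a: "\<not> ?thesis"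
  define B where "B = insert x (of_nat ` {..<p})"
  have xn: "x \<notin> of_nat ` {..<p}" using a Mmax_ideal(1) by force
  have p1': "p > 1" using prime prime_gt_1_nat by blast
  have nat_ne: "(of_nat i :: complex) - of_nat j \<notin> Mmax" if "i < p" "j < p" "i \<noteq> j" for i j
  proof -
    have "\<not> int p dvd int i - int j" using that
      by (metis mod_eq_dvd_iff mod_pos_pos_trivial of_nat_0_le_iff of_nat_less_iff of_nat_eq_iff)
    then have "coprime (int i - int j) (int p)" using prime by (metis coprime_commute prime_imp_coprime prime_nat_int_transfer)
    then have "N (of_int (int i - int j)) = 1" by (rule N_coprime)
    then show ?thesis unfolding Mmax_def by simp
  qed
  define q where "q = monom 1 p - monom (1 :: complex) 1"
  have "degree (monom (1 :: complex) 1) < degree (monom (1 :: complex) p)" using p1' by (simp add: degree_monom_eq)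
  then have dq: "degree q = p" unfolding q_def using degree_add_eq_left[of "- monom (1 :: complex) 1" "monom 1 p"]
    by (simp add: degree_monom_eq)
  have "card B \<le> degree q"
  proof (rule roots_mod_bound)
    show "finite B" unfolding B_def by simp
    show "B \<subseteq> Oint" unfolding B_def using x Oint_ring by auto
    show "q \<in> PO" unfolding q_def by (intro PO_ring(4,7) Oint_ring)
    show "lead_coeff q = 1" unfolding dq using p1' by (simp add: q_def)
    show "u - v \<notin> Mmax" if "u \<in> B" "v \<in> B" "u \<noteq> v" for u v
    proof -
      have 1: "x - of_nat n \<notin> Mmax" if "n < p" for n using a that by blast
      then have "of_nat n - x \<notin> Mmax" if "n < p" for n using that Mmax_ideal(9)[of "of_nat n - x"] by auto
      then show ?thesis using that 1 nat_ne unfolding B_def by auto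
    qed
    show "poly q u \<in> Mmax" if "u \<in> B" for u
    proof -
      have "poly q u = u ^ p - u" unfolding q_def by (simp add: poly_monom)
      moreover have "x ^ p - x \<in> Mmax" using Mmax_ideal(9)[OF x(2)] by simp
      ultimately show ?thesis using that nat_fermat unfolding B_def by auto
    qed
  qed
  moreover have "card B = Suc p"
  proof -
    have "card (of_nat ` {..<p} :: complex set) = p" by (subst card_image) (auto simp: inj_on_def)
    then show ?thesis unfolding B_def using xn by simp
  qed
  ultimately show False using dq by simp
qed

end

context splitting_nonarch
begin

text \<open>The Frobenius element \<open>g\<close> permutes the roots of every factor modulo
  \<open>p\<close>. On the three roots of \<open>c\<close> it has no fixed point, since
  \<open>c\<close> has no root among the integers modulo \<open>p\<close>; the other factors have at
  most two roots each. So \<open>g \<circ> g\<close> is the identity outside the roots of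
  \<open>c\<close> and a 3-cycle on them.\<close>

theorem three_cycle_of_factorization:
  assumes F: "cp f = ip F" "lead_coeff F = 1" "degree F = card R"
    and c: "degree c = 3" "lead_coeff c = 1"
    and qs: "\<And>q. q \<in> set qs \<Longrightarrow> degree q \<le> 2 \<and> lead_coeff q = 1"
    and deg: "3 + sum_list (map degree qs) = card R"
    and fact: "\<And>i. int p dvd coeff (F - c * prod_list qs) i"
    and bez: "\<And>i. int p dvd coeff (u * F + v * pderiv F - 1) i"
    and noroot: "\<And>a. a < p \<Longrightarrow> \<not> int p dvd poly c (int a)"
  shows "\<exists>x y z. x \<noteq> y \<and> y \<noteq> z \<and> x \<noteq> z \<and> cyc3 x y z \<in> G"
proof -
  have FPO: "ip h \<in> PO" for h by (rule ip_PO)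
  have root: "poly (ip F) x = 0" if "x \<in> R" for x using that F(1) unfolding complex_roots_def by simp
  have Ralg: "algebraic x" if "x \<in> R" for x using that RK K_algebraic by blast
  have RO: "x \<in> Oint" if x: "x \<in> R" for x
  proof (rule ccontr)
    assume "x \<notin> Oint"
    then have Nx: "N x > 1" using Ralg[OF x] unfolding Oint_def by auto
    define n where "n = degree F"
    have n0: "n \<noteq> 0" using F(3) x finR unfolding n_def by auto
    have "poly (ip F) x = (\<Sum>i\<le>n. of_int (coeff F i) * x ^ i)" unfolding poly_altdef n_def ip_arith by (simp add: coeff_map_poly)
    also have "\<dots> = (\<Sum>i<n. of_int (coeff F i) * x ^ i) + x ^ n"
      using F(2) unfolding n_def by (simp add: lessThan_Suc_atMost[symmetric])
    finally have e: "x ^ n = - (\<Sum>i<n. of_int (coeff F i) * x ^ i)" using root[OF x] by (simp add: eq_neg_iff_add_eq_0 add.commute)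
    have ax: "algebraic (inverse x)" using Ralg[OF x] by auto
    have "N (inverse x) < 1" using Nx N_inverse[OF Ralg[OF x]] by (simp add: inverse_less_1_iff)
    then have ix: "inverse x \<in> Mmax" "inverse x \<in> Oint" using ax unfolding Mmax_def Oint_def by auto
    have x0: "x \<noteq> 0" using Nx N_zero by auto
    \<comment> \<open>For \<open>N x > 1\<close>, dividing the monic equation by
      \<open>x ^ n\<close> would put 1 into the maximal ideal.\<close>
    have "1 = - (\<Sum>i<n. of_int (coeff F i) * x ^ i) * inverse x ^ n" using e x0 by (metis power_inverse right_inverse power_not_zero)
    also have "\<dots> = - (\<Sum>i<n. inverse x * (of_int (coeff F i) * inverse x ^ (n - 1 - i)))"
      unfolding sum_distrib_right minus_mult_left[symmetric]
    proof (intro arg_cong[of _ _ uminus] sum.cong refl)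
      fix i assume "i \<in> {..<n}"
      then have "n = i + Suc (n - 1 - i)" by simp
      then have "inverse x ^ n = inverse x ^ i * inverse x ^ Suc (n - 1 - i)" by (metis power_add)
      then show "of_int (coeff F i) * x ^ i * inverse x ^ n = inverse x * (of_int (coeff F i) * inverse x ^ (n - 1 - i))"
        using x0 by (simp add: field_simps power_inverse)
    qed
    also have "\<dots> \<in> Mmax" by (intro Mmax_ideal(9) Mmax_sum Mmax_ideal(4) ix Oint_ring(5,7,8))
    finally show False using Mmax_ideal(7) by simp
  qed
  have "\<exists>g\<in>G. \<forall>x\<in>R. g x - x ^ p \<in> Mmax" by (rule frobenius_element) (use RO in \<open>auto simp: Oint_def\<close>)
  then obtain g where g: "g \<in> G" "\<And>x. x \<in> R \<Longrightarrow> g x - x ^ p \<in> Mmax" by blast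
  have gR: "g x \<in> R" if "x \<in> R" for x using permutes_in_image[OF G_permutes[OF g(1)]] that by simp
  \<comment> \<open>Congruent roots would make the derivative vanish at \<open>y\<close> modulo
    \<open>Mmax\<close>, contrary to the Bezout relation between \<open>F\<close> and
    \<open>pderiv F\<close>.\<close>
  have sep: "x - y \<notin> Mmax" if xy: "x \<in> R" "y \<in> R" "x \<noteq> y" for x y
  proof
    assume m: "x - y \<in> Mmax"
    define D where "D = poly (pderiv (ip F)) y"
    define t where "t = synthetic_div (ip F) y"
    have t: "ip F = [:- y, 1:] * t" unfolding t_def
      using synthetic_div_correct'[of y "ip F"] root[OF xy(2)] by simp
    have "pderiv (ip F) = [:- y, 1:] * pderiv t + t" unfolding t pderiv_mult by (simp add: pderiv_pCons)
    then have Dt: "D = poly t y" unfolding D_def by simp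
    have "(x - y) * poly t x = 0" using root[OF xy(1)] unfolding t by (simp add: algebra_simps)
    then have tx: "poly t x = 0" using xy(3) by simp
    have "t = [:- x, 1:] * synthetic_div t x" using synthetic_div_correct'[of x t] tx by simp
    then have "poly t y = poly ([:- x, 1:] * synthetic_div t x) y" by simp
    then have D2: "D = (y - x) * poly (synthetic_div t x) y" unfolding Dt poly_mult by simp
    have "synthetic_div t x \<in> PO" unfolding t_def using FPO RO xy by (intro synthetic_div_PO) auto
    then have "poly (synthetic_div t x) y \<in> Oint" using RO xy by (intro poly_PO) auto
    then obtain w where w: "w \<in> Oint" "D = (y - x) * w" using D2 by blast
    have "y - x \<in> Mmax" using Mmax_ideal(9)[OF m] by simp
    then have "D \<in> Mmax" unfolding w(2) by (rule Mmax_ideal(4)[OF _ w(1)])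
    moreover have "poly (ip (u * F + v * pderiv F - 1)) y \<in> Mmax"
      using bez RO xy by (intro poly_PM ip_PM) auto
    moreover have "poly (ip (u * F + v * pderiv F - 1)) y = poly (ip v) y * D - 1"
      unfolding D_def using root[OF xy(2)] by (simp add: ip_arith)
    ultimately have "poly (ip v) y * D - (poly (ip v) y * D - 1) \<in> Mmax"
      using Mmax_ideal(3,5) poly_PO[OF FPO RO[OF xy(2)]] by metis
    then show False using Mmax_ideal(7) by simp
  qed
  define Z where "Z h = {x \<in> R. poly (ip h) x \<in> Mmax}" for h
  have finZ: "finite (Z h)" for h unfolding Z_def using finR by simp
  have cardZ: "card (Z h) \<le> degree h" if "lead_coeff h = 1" for h
  proof -
    have lc: "lead_coeff (ip h) = 1" unfolding ip_arith(6) using that by simp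
    have "card (Z h) \<le> degree (ip h)"
      by (rule roots_mod_bound[OF finZ _ _ FPO lc]) (use RO sep in \<open>auto simp: Z_def\<close>)
    then show ?thesis by (simp add: ip_arith)
  qed
  have gZ: "g x \<in> Z h" if "x \<in> Z h" for x h
  proof -
    have x: "x \<in> R" "poly (ip h) x \<in> Mmax" using that unfolding Z_def by auto
    have "poly (ip h) (x ^ p) \<in> Mmax" by (rule poly_ip_frob[OF RO[OF x(1)] x(2)])
    moreover have "poly (ip h) (g x) - poly (ip h) (x ^ p) \<in> Mmax"
      by (rule cong_poly[OF FPO RO[OF gR[OF x(1)]] Oint_ring(7)[OF RO[OF x(1)]] g(2)[OF x(1)]])
    ultimately have "poly (ip h) (g x) \<in> Mmax" using Mmax_ideal(2) by force
    then show ?thesis unfolding Z_def using gR x by simp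
  qed
  have cover: "R \<subseteq> Z c \<union> (\<Union>q\<in>set qs. Z q)"
  proof
    fix x assume x: "x \<in> R"
    have "poly (ip (F - c * prod_list qs)) x \<in> Mmax" using fact RO[OF x] by (intro poly_PM ip_PM) auto
    moreover have "poly (ip (F - c * prod_list qs)) x = - (poly (ip c) x * poly (ip (prod_list qs)) x)"
      using root[OF x] by (simp add: ip_arith)
    ultimately have "poly (ip c) x * poly (ip (prod_list qs)) x \<in> Mmax" using Mmax_ideal(9) by fastforce
    then have "poly (ip c) x \<in> Mmax \<or> poly (ip (prod_list qs)) x \<in> Mmax"
      using Mmax_prime poly_PO[OF FPO RO[OF x]] by blast
    moreover have "\<exists>q\<in>set xs. poly (ip q) x \<in> Mmax" if "poly (ip (prod_list xs)) x \<in> Mmax" for xs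
      using that
    proof (induction xs)
      case Nil then show ?case using Mmax_ideal(7) by (simp add: ip_arith)
    next
      case (Cons h xs)
      then have "poly (ip h) x * poly (ip (prod_list xs)) x \<in> Mmax" by (simp add: ip_arith)
      then show ?case using Cons.IH Mmax_prime poly_PO[OF FPO RO[OF x]] by (metis list.set_intros)
    qed
    ultimately show "x \<in> Z c \<union> (\<Union>q\<in>set qs. Z q)" unfolding Z_def using x by blast
  qed
  have "card (\<Union>q\<in>set xs. Z q) \<le> sum_list (map degree xs)" if "set xs \<subseteq> set qs" for xs
    using that
  proof (induction xs)
    case (Cons h xs)
    have "card (\<Union>q\<in>set (h # xs). Z q) \<le> card (Z h) + card (\<Union>q\<in>set xs. Z q)" by (simp add: card_Un_le)
    then show ?case using Cons cardZ[of h] qs[of h] by simp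
  qed simp
  then have "card (\<Union>q\<in>set qs. Z q) \<le> sum_list (map degree qs)" by simp
  moreover have "card R \<le> card (Z c) + card (\<Union>q\<in>set qs. Z q)"
    by (rule order_trans[OF card_mono[OF _ cover] card_Un_le]) (use finZ in auto)
  moreover have "card (Z c) \<le> 3" using cardZ[OF c(2)] c(1) by simp
  \<comment> \<open>The degrees of the factors add up to the number of roots, so the upper bound for
    \<open>Z c\<close> has to be attained.\<close>
  ultimately have c3: "card (Z c) = 3" using deg by linarith
  have ginj: "g x = g y \<longleftrightarrow> x = y" for x y using gal.injG[OF g(1)] .
  have nofix: "g x \<noteq> x" if x: "x \<in> Z c" for x
  proof
    assume "g x = x"
    have xR: "x \<in> R" "poly (ip c) x \<in> Mmax" using x unfolding Z_def by auto
    have "x - x ^ p \<in> Mmax" using g(2)[OF xR(1)] \<open>g x = x\<close> by simp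
    then obtain n where n: "n < p" "x - of_nat n \<in> Mmax" using frob_fixed_cong_nat[OF RO[OF xR(1)]] by blast
    have "poly (ip c) x - poly (ip c) (of_nat n) \<in> Mmax"
      by (rule cong_poly[OF FPO RO[OF xR(1)] Oint_ring(9) n(2)])
    then have "poly (ip c) x - (poly (ip c) x - poly (ip c) (of_nat n)) \<in> Mmax" by (rule Mmax_ideal(3)[OF xR(2)])
    then have m: "poly (ip c) (of_nat n) \<in> Mmax" by simp
    have "poly (ip c) (of_nat n) = of_int (poly c (int n))"
      unfolding poly_altdef ip_arith by (simp add: coeff_map_poly)
    moreover have "coprime (poly c (int n)) (int p)" using noroot[OF n(1)] prime
      by (metis coprime_commute prime_imp_coprime prime_nat_int_transfer)
    ultimately have "N (poly (ip c) (of_nat n)) = 1" using N_coprime by simp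
    then show False using m unfolding Mmax_def by simp
  qed
  have sq_fix: "g (g x) = x" if x: "x \<notin> Z c" for x
  proof (cases "x \<in> R")
    case False
    then show ?thesis using permutes_not_in[OF G_permutes[OF g(1)]] by simp
  next
    case True
    then obtain q where q: "q \<in> set qs" "x \<in> Z q" using cover x by blast
    have "card (Z q) \<le> 2" using cardZ[of q] qs[OF q(1)] by simp
    moreover have "{x, g x, g (g x)} \<subseteq> Z q" using q(2) gZ by auto
    ultimately have "card {x, g x, g (g x)} \<le> 2" using card_mono[OF finZ] by (meson order_trans)
    then have "x = g x \<or> x = g (g x) \<or> g x = g (g x)" by (auto simp: card_insert_if split: if_splits)
    then show ?thesis using ginj by metis
  qed
  define h where "h = g \<circ> g"
  have hG: "h \<in> G" unfolding h_def using G_comp g(1) by blast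
  have "\<exists>a b d. a \<noteq> b \<and> b \<noteq> d \<and> a \<noteq> d \<and> h = cyc3 a b d"
  proof -
    \<comment> \<open>Otherwise \<open>g\<close> would exchange \<open>x\<close> and
      \<open>g x\<close> and fix the third point of \<open>Z c\<close>.\<close>
    have nf: "h x \<noteq> x" if x: "x \<in> Z c" for x
    proof
      assume e: "h x = x"
      have "card (Z c - {x, g x}) = 1"
        using c3 x gZ[OF x] nofix[OF x] by (subst card_Diff_subset) (auto simp: card_insert_if)
      then obtain z where "Z c - {x, g x} = {z}" by (metis card_1_singletonE)
      then have z: "z \<in> Z c" "z \<noteq> x" "z \<noteq> g x" "Z c = {x, g x, z}" using x gZ[OF x] by auto
      have "g z \<in> {x, g x, z}" using gZ[OF z(1)] z(4) by simp
      moreover have "g z \<noteq> z" using nofix z by blast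
      moreover have "g z \<noteq> g x" using ginj z by blast
      moreover have "g z \<noteq> x" using e ginj z unfolding h_def by (metis comp_apply)
      ultimately show False by blast
    qed
    have "inj h" using permutes_inj[OF G_permutes[OF hG]] .
    moreover have "h x \<in> Z c" if "x \<in> Z c" for x using gZ that unfolding h_def by simp
    moreover have "h x = x" if "x \<notin> Z c" for x using sq_fix that unfolding h_def by simp
    ultimately show ?thesis using three_cycleI[OF c3, of h] nf by metis
  qed
  then show ?thesis using hG by blast
qed

end

section \<open>Newton polygons of the Laguerre polynomials\<close>

text \<open>By Legendre's formula this is the sum of the base-\<open>p\<close> digits of \<open>j\<close>.\<close>

definition dsum :: "nat \<Rightarrow> nat \<Rightarrow> int" where
  "dsum p j = int j - (int p - 1) * int (multiplicity p (fact j :: nat))"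

text \<open>Legendre's formula in recursive form: the multiples of \<open>p\<close> up to
  \<open>m\<close> are \<open>p\<close> times the numbers up to \<open>m div p\<close>.\<close>

lemma multiplicity_fact_div:
  assumes "prime (p :: nat)"
  shows "multiplicity p (fact m :: nat) = m div p + multiplicity p (fact (m div p) :: nat)"
proof (induction m)
  case (Suc m)
  have p1: "p > 1" using assms prime_gt_1_nat by blast
  have S: "multiplicity p (fact (Suc k) :: nat) = multiplicity p (Suc k) + multiplicity p (fact k :: nat)" for k
    using assms by (simp add: prime_elem_multiplicity_mult_distrib del: mult_Suc)
  show ?case
  proof (cases "p dvd Suc m")
    case True
    then obtain q where q: "Suc m = p * q" by (rule dvdE)
    then have q0: "q \<noteq> 0" by (metis Suc_not_Zero mult_0_right)
    then obtain q' where q': "q = Suc q'" by (metis not0_implies_Suc)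
    have "m = p * q' + (p - 1)" using q q' p1 by simp
    then have "m div p = (p - 1 + p * q') div p" by (simp add: add.commute)
    also have "\<dots> = q' + (p - 1) div p" using p1 by (intro div_mult_self2) simp
    finally have "m div p = q'" using p1 by simp
    moreover have "Suc m div p = q" using q p1 by simp
    moreover have "multiplicity p (Suc m) = Suc (multiplicity p q)"
      unfolding q using q0 p1 assms by (subst prime_elem_multiplicity_mult_distrib) auto
    ultimately show ?thesis using Suc S[of m] S[of q'] q' by simp
  next
    case False
    then have "multiplicity p (Suc m) = 0" by (rule not_dvd_imp_multiplicity_0)
    moreover have "Suc m div p = m div p" using False by (simp add: div_Suc dvd_eq_mod_eq_0)
    ultimately show ?thesis using Suc S[of m] by simp
  qed
qed simp

text \<open>The Newton polygon function of \<open>(n - j + r choose r) / j!\<close>, scaled by \<open>p - 1\<close> and shifted by a linear function.\<close>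

definition newton_fun :: "nat \<Rightarrow> nat \<Rightarrow> nat \<Rightarrow> real \<Rightarrow> nat \<Rightarrow> real" where
  "newton_fun p n r \<delta> j = real_of_int (int (p - 1) * int (multiplicity p ((n - j + r) choose r)) + dsum p j) - real j * \<delta>"

section \<open>Digit sums and carries\<close>

context
  fixes p :: nat
  assumes p: "prime p"
begin

lemma p_gt1: "p > 1" using p prime_gt_1_nat by blast

lemma dsum_0 [simp]: "dsum p 0 = 0" unfolding dsum_def by simp

lemma dsum_Suc: "dsum p (Suc j) \<le> dsum p j + 1"
proof -
  have "multiplicity p (fact j :: nat) \<le> multiplicity p (fact (Suc j) :: nat)"
    by (intro dvd_imp_multiplicity_le) (auto simp: fact_dvd)
  then have "(int p - 1) * int (multiplicity p (fact j :: nat)) \<le> (int p - 1) * int (multiplicity p (fact (Suc j) :: nat))"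
    using p_gt1 by (intro mult_left_mono) auto
  then show ?thesis unfolding dsum_def by simp
qed

lemma dsum_step: "b < p \<Longrightarrow> dsum p (p * a + b) = dsum p a + int b"
proof -
  assume b: "b < p"
  then have "(p * a + b) div p = a" by simp
  then have "multiplicity p (fact (p * a + b) :: nat) = a + multiplicity p (fact a :: nat)"
    using multiplicity_fact_div[OF p, of "p * a + b"] by simp
  then show ?thesis unfolding dsum_def by (simp add: algebra_simps)
qed

lemma dsum_small: "b < p \<Longrightarrow> dsum p b = int b" using dsum_step[of b 0] by simp

lemma dsum_split: "b < p ^ e \<Longrightarrow> dsum p (p ^ e * a + b) = dsum p a + dsum p b"
proof (induction e arbitrary: b)
  case (Suc e)
  define b' where "b' = b div p"
  define c where "c = b mod p"
  have b: "b = p * b' + c" "c < p" unfolding b'_def c_def using p_gt1 by auto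
  have "b' < p ^ e" unfolding b'_def using Suc.prems p_gt1 by (simp add: less_mult_imp_div_less mult.commute)
  then have IH: "dsum p (p ^ e * a + b') = dsum p a + dsum p b'" by (rule Suc.IH)
  have e: "p ^ Suc e * a + b = p * (p ^ e * a + b') + c" using b by (simp add: algebra_simps)
  show ?case unfolding e dsum_step[OF b(2)] IH using dsum_step[OF b(2), of b'] b(1) by simp
qed simp

text \<open>\<open>b\<close> has at most \<open>e + 1\<close> digits, each weighted by at most
  \<open>p ^ e\<close>.\<close>

lemma dsum_lower: "b < p ^ Suc e \<Longrightarrow> int b \<le> int p ^ e * dsum p b"
proof (induction e arbitrary: b)
  case 0 then show ?case by (simp add: dsum_small)
next
  case (Suc e)
  define b' where "b' = b div p"
  define c where "c = b mod p"
  have b: "b = p * b' + c" "c < p" unfolding b'_def c_def using p_gt1 by auto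
  have "b' < p ^ Suc e" unfolding b'_def using Suc.prems p_gt1 by (simp add: less_mult_imp_div_less mult.commute)
  then have IH: "int b' \<le> int p ^ e * dsum p b'" by (rule Suc.IH)
  have "int p ^ Suc e * dsum p b = int p * (int p ^ e * dsum p b') + int p ^ Suc e * int c"
    unfolding b(1) dsum_step[OF b(2)] by (simp add: algebra_simps)
  moreover have "int p * int b' \<le> int p * (int p ^ e * dsum p b')" using IH by (intro mult_left_mono) auto
  moreover have "1 * int c \<le> int p ^ Suc e * int c"
    using p_gt1 one_le_power[of "int p" "Suc e"] by (intro mult_right_mono) auto
  ultimately show ?case unfolding b(1) by simp
qed

lemma dsum_pos: "b > 0 \<Longrightarrow> dsum p b > 0"
proof -
  assume b: "b > 0"
  have "b < 2 ^ b" by (rule less_exp)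
  also have "(2::nat) ^ b \<le> p ^ b" using p_gt1 by (intro power_mono) auto
  also have "p ^ b \<le> p ^ Suc b" using p_gt1 by (intro power_increasing) auto
  finally have "b < p ^ Suc b" .
  then have "int b \<le> int p ^ b * dsum p b" by (rule dsum_lower)
  then have "0 < int p ^ b * dsum p b" using b by linarith
  then show ?thesis using p_gt1 by (simp add: zero_less_mult_iff)
qed

text \<open>Kummer's theorem in terms of digit sums: every carry in \<open>a + r\<close> lowers the
  digit sum by \<open>p - 1\<close>.\<close>

lemma multiplicity_binomial:
  "(int p - 1) * int (multiplicity p ((a + r) choose r)) = dsum p a + dsum p r - dsum p (a + r)"
proof -
  have "(fact r * fact a * ((a + r) choose r) :: nat) = fact (a + r)"
    using binomial_fact_lemma[of r "a + r"] by simp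
  then have "multiplicity p (fact (a + r) :: nat) = multiplicity p (fact r * fact a * ((a + r) choose r) :: nat)" by simp
  also have "\<dots> = multiplicity p (fact r :: nat) + multiplicity p (fact a :: nat) + multiplicity p ((a + r) choose r)"
    using p by (simp add: prime_elem_multiplicity_mult_distrib)
  finally show ?thesis unfolding dsum_def by (simp add: algebra_simps)
qed

lemma dsum_subadd: "dsum p (a + r) \<le> dsum p a + dsum p r"
proof -
  have "0 \<le> (int p - 1) * int (multiplicity p ((a + r) choose r))" using p_gt1 by simp
  then show ?thesis using multiplicity_binomial[of a r] by simp
qed

lemma not_dvd_binomial_iff: "\<not> p dvd ((a + r) choose r) \<longleftrightarrow> dsum p (a + r) = dsum p a + dsum p r"
proof -
  have "\<not> p dvd ((a + r) choose r) \<longleftrightarrow> multiplicity p ((a + r) choose r) = 0"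
    using p_gt1 by (metis One_nat_def binomial_eq_0_iff le_add2 less_irrefl multiplicity_eq_zero_iff nat_dvd_1_iff_1 not_less)
  then show ?thesis using multiplicity_binomial[of a r] p_gt1 by auto
qed

text \<open>An addition without carries stays free of carries when the digits of \<open>a\<close>
  from position \<open>e\<close> on are dropped.\<close>

lemma not_dvd_binomial_mod:
  assumes "\<not> p dvd ((a + r) choose r)"
  shows "\<not> p dvd ((a mod p ^ e + r) choose r)"
proof -
  define u where "u = a div p ^ e"
  define b where "b = a mod p ^ e"
  have b: "a = p ^ e * u + b" "b < p ^ e" unfolding u_def b_def using p_gt1 by auto
  have "dsum p (a + r) = dsum p a + dsum p r" using assms not_dvd_binomial_iff by simp
  moreover have "dsum p a = dsum p u + dsum p b" unfolding b(1) by (rule dsum_split[OF b(2)])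
  moreover have "dsum p (a + r) \<le> dsum p (p ^ e * u) + dsum p (b + r)"
    unfolding b(1) add.assoc by (rule dsum_subadd)
  moreover have "dsum p (p ^ e * u) = dsum p u" using dsum_split[of 0 e u] p_gt1 by simp
  moreover have "dsum p (b + r) \<le> dsum p b + dsum p r" by (rule dsum_subadd)
  ultimately have "dsum p (b + r) = dsum p b + dsum p r" by linarith
  then show ?thesis using not_dvd_binomial_iff unfolding b_def by simp
qed

lemma not_dvd_binomial_large:
  assumes "n mod p + r < p" shows "\<not> p dvd ((n + r) choose r)"
proof -
  have "n + r = p * (n div p) + (n mod p + r)" by (simp add: add.assoc[symmetric])
  then have "dsum p (n + r) = dsum p (n div p) + int (n mod p + r)" using dsum_step[OF assms] by metis
  moreover have "dsum p n = dsum p (n div p) + int (n mod p)" using dsum_step[of "n mod p" "n div p"] p_gt1 by simp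
  moreover have "dsum p r = int r" using assms by (intro dsum_small) simp
  ultimately show ?thesis using not_dvd_binomial_iff by simp
qed

text \<open>The last \<open>e\<close> digits of \<open>n\<close> are 0, and \<open>r\<close>
  occupies only these positions.\<close>

lemma not_dvd_binomial_power:
  assumes "p ^ e dvd n" "r < p ^ e" shows "\<not> p dvd ((n + r) choose r)"
proof -
  obtain u where u: "n = p ^ e * u" using assms(1) by (rule dvdE)
  have "dsum p (n + r) = dsum p u + dsum p r" unfolding u by (rule dsum_split[OF assms(2)])
  moreover have "dsum p n = dsum p u" unfolding u using dsum_split[of 0 e u] p_gt1 by simp
  ultimately show ?thesis using not_dvd_binomial_iff by simp
qed

lemma newton_fun_ge: "newton_fun p n r \<delta> j \<ge> real_of_int (dsum p j) - real j * \<delta>"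
  unfolding newton_fun_def by simp

lemma newton_min_nonpos:
  assumes "\<not> p dvd ((n + r) choose r)" "\<delta> \<le> 0" "j > 0"
  shows "newton_fun p n r \<delta> j > newton_fun p n r \<delta> 0"
proof -
  have "multiplicity p ((n + r) choose r) = 0" using assms(1) by (rule not_dvd_imp_multiplicity_0)
  then have "newton_fun p n r \<delta> 0 = 0" unfolding newton_fun_def by simp
  moreover have "real j * \<delta> \<le> 0" using assms(2) by (simp add: mult_nonneg_nonpos)
  moreover have "real_of_int (dsum p j) > 0" using dsum_pos[OF assms(3)] by simp
  ultimately show ?thesis using newton_fun_ge[where n = n and r = r and \<delta> = \<delta> and j = j] by linarith
qed

text \<open>Let \<open>q = p ^ Suc e\<close>. At the largest multiple of \<open>q\<close> up to
  \<open>n\<close> the binomial coefficient is prime to \<open>p\<close> and adds nothing. Other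
  indices are worse: a further multiple of \<open>q\<close> raises the digit sum by at most 1 and
  gains \<open>q * \<delta> > 1\<close>, while a remainder \<open>b < q\<close> costs
  \<open>dsum p b\<close>, which is at least \<open>b / p ^ e\<close>, and gains only
  \<open>b * \<delta>\<close>.\<close>

lemma newton_min_pos:
  assumes nd: "\<not> p dvd ((n + r) choose r)" and d: "real p ^ e * \<delta> < 1" "1 < real p ^ Suc e * \<delta>"
    and j: "j \<le> n" "j \<noteq> p ^ Suc e * (n div p ^ Suc e)"
  shows "newton_fun p n r \<delta> j > newton_fun p n r \<delta> (p ^ Suc e * (n div p ^ Suc e))"
proof -
  define q where "q = p ^ Suc e"
  define J where "J = q * (n div q)"
  define a where "a = j div q"
  define b where "b = j mod q"
  have q0: "q > 0" unfolding q_def using p_gt1 by simp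
  have jab: "j = q * a + b" "b < q" unfolding a_def b_def using q0 by auto
  have an: "a \<le> n div q" unfolding a_def using j(1) by (rule div_le_mono)
  have nJ: "n - J = n mod q" unfolding J_def by (simp add: minus_mult_div_eq_mod)
  have "\<not> p dvd ((n mod q + r) choose r)" unfolding q_def by (rule not_dvd_binomial_mod[OF nd])
  then have "multiplicity p ((n - J + r) choose r) = 0" unfolding nJ by (rule not_dvd_imp_multiplicity_0)
  then have HJ: "newton_fun p n r \<delta> J = real_of_int (dsum p J) - real J * \<delta>" unfolding newton_fun_def by simp
  have dJ: "dsum p J = dsum p (n div q)" unfolding J_def q_def using dsum_split[of 0 "Suc e"] p_gt1 by simp
  have dj: "dsum p j = dsum p a + dsum p b" unfolding jab(1) q_def by (rule dsum_split) (use jab(2) q_def in simp)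
  have d0: "\<delta> > 0"
  proof (rule ccontr)
    assume "\<not> \<delta> > 0"
    then have "real p ^ Suc e * \<delta> \<le> 0" by (intro mult_nonneg_nonpos) auto
    then show False using d(2) by linarith
  qed
  have mono: "real_of_int (dsum p (a + k)) - real (a + k) * (real q * \<delta>) \<le> real_of_int (dsum p a) - real a * (real q * \<delta>)
     \<and> (k > 0 \<longrightarrow> real_of_int (dsum p (a + k)) - real (a + k) * (real q * \<delta>) < real_of_int (dsum p a) - real a * (real q * \<delta>))" for k
  proof (induction k)
    case (Suc k)
    have "real_of_int (dsum p (Suc (a + k))) \<le> real_of_int (dsum p (a + k)) + 1" using dsum_Suc[of "a + k"] by linarith
    moreover have "real q * \<delta> > 1" using d(2) unfolding q_def by simp
    moreover have "real (Suc (a + k)) * (real q * \<delta>) = real (a + k) * (real q * \<delta>) + real q * \<delta>" by (simp add: algebra_simps)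
    ultimately show ?case using Suc by simp
  qed simp
  have low: "real_of_int (dsum p b) - real b * \<delta> \<ge> 0 \<and> (b > 0 \<longrightarrow> real_of_int (dsum p b) - real b * \<delta> > 0)"
  proof (cases "b = 0")
    case False
    have "int b \<le> int p ^ e * dsum p b" using jab(2) unfolding q_def by (rule dsum_lower)
    then have "real_of_int (int b) \<le> real_of_int (int p ^ e * dsum p b)" by linarith
    then have "real b \<le> real p ^ e * real_of_int (dsum p b)" by simp
    then have "real b * \<delta> \<le> (real p ^ e * real_of_int (dsum p b)) * \<delta>" using d0 by (intro mult_right_mono) auto
    then have "real b * \<delta> \<le> real p ^ e * \<delta> * real_of_int (dsum p b)" by (simp add: algebra_simps)
    also have "real p ^ e * \<delta> * real_of_int (dsum p b) < 1 * real_of_int (dsum p b)" using d(1) dsum_pos[of b] False by (intro mult_strict_right_mono) auto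
    finally show ?thesis by simp
  qed simp
  obtain k where k: "n div q = a + k" using an le_Suc_ex by blast
  have RJ: "real J * \<delta> = real (a + k) * (real q * \<delta>)" unfolding J_def k by (simp add: algebra_simps)
  have Rj: "real j * \<delta> = real a * (real q * \<delta>) + real b * \<delta>" unfolding jab(1) by (simp add: algebra_simps)
  have ne: "k > 0 \<or> b > 0" using j(2) jab k unfolding q_def[symmetric] by auto
  have "real_of_int (dsum p j) - real j * \<delta> > real_of_int (dsum p J) - real J * \<delta>"
    using mono[of k] low ne unfolding RJ Rj dj dJ k by auto
  then show ?thesis using HJ newton_fun_ge[where n = n and r = r and \<delta> = \<delta> and j = j] unfolding J_def q_def by linarith
qed

end

section \<open>The coefficients of L and of its integral multiple\<close>

lemma coeff_L: "coeff (L_poly r n) j = (if j \<le> n then of_nat ((n - j + r) choose (n - j)) / fact j else 0)"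
  unfolding L_poly_def by (simp add: coeff_sum)

lemma degree_L: "degree (L_poly r n) = n"
proof (rule antisym)
  show "degree (L_poly r n) \<le> n" by (rule degree_le) (simp add: coeff_L)
  show "n \<le> degree (L_poly r n)" by (rule le_degree) (simp add: coeff_L)
qed

lemma L_nonzero: "L_poly r n \<noteq> 0"
  using coeff_L[of r n n] by auto

definition Lint :: "nat \<Rightarrow> nat \<Rightarrow> int poly" where
  "Lint r n = (\<Sum>j\<le>n. monom (int ((fact n div fact j) * ((n - j + r) choose (n - j)))) j)"

lemma coeff_Lint: "coeff (Lint r n) j = (if j \<le> n then int ((fact n div fact j) * ((n - j + r) choose (n - j))) else 0)"
  unfolding Lint_def by (simp add: coeff_sum)

lemma cp_Lint: "cp (smult (fact n) (L_poly r n)) = ip (Lint r n)"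
proof (rule poly_eqI)
  fix j
  have F: "(of_rat (fact k) :: complex) = of_nat (fact k)" for k by (metis of_nat_fact of_rat_of_nat_eq)
  show "coeff (cp (smult (fact n) (L_poly r n))) j = coeff (ip (Lint r n)) j"
  proof (cases "j \<le> n")
    case True
    obtain k :: nat where k: "fact n = fact j * k" using fact_dvd[OF True, where 'a = nat] by (rule dvdE)
    then have "(of_nat (fact n) :: complex) = of_nat (fact j) * of_nat k" by (metis of_nat_mult)
    then have "(of_nat (fact n) :: complex) / of_nat (fact j) = of_nat k" by simp
    moreover have "fact n div fact j = k" using k by simp
    ultimately have "of_nat (fact n) * X / of_nat (fact j) = of_nat (fact n div fact j) * X" for X :: complex
      by (metis times_divide_eq_left)
    then show ?thesis using True
      by (simp add: coeff_map_poly coeff_L coeff_Lint of_rat_mult of_rat_divide F del: of_nat_fact)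
  qed (simp add: coeff_map_poly coeff_L coeff_Lint)
qed

lemma degree_Lint: "degree (Lint r n) = n"
proof -
  have "degree (ip (Lint r n)) = n" unfolding cp_Lint[symmetric] by (simp add: cp_arith degree_L)
  then show ?thesis by (simp add: ip_arith)
qed

lemma lead_coeff_Lint: "lead_coeff (Lint r n) = 1"
  unfolding degree_Lint by (simp add: coeff_Lint)

lemma factor_roots_mset:
  assumes "L_poly r n = g * h" shows "proots (cp (L_poly r n)) = proots (cp g) + proots (cp h)"
proof -
  have "cp g \<noteq> 0" "cp h \<noteq> 0" using assms L_nonzero[of r n] by (auto simp: cp_arith)
  then show ?thesis unfolding assms cp_arith(3) by (rule proots_mult)
qed

lemma powr_pow_nat: "x > 0 \<Longrightarrow> (x powr a) ^ n = x powr (a * real n)"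
  for x :: real
  by (subst powr_realpow[symmetric]) (simp_all add: powr_powr)

section \<open>Norms of the roots of rational polynomials\<close>

context nonarch
begin

lemma rpoly_proots: "q \<noteq> 0 \<Longrightarrow> q = smult (lead_coeff q) (rpoly (proots q))"
  unfolding rpoly_def by (rule complex_poly_decompose_multiset[symmetric])

lemma proots_algebraic: "g \<noteq> 0 \<Longrightarrow> x \<in># proots (cp g) \<Longrightarrow> algebraic x"
  using algebraic_of_rat_poly[of g x] by (simp add: cp_arith)

lemma newton_rational:
  assumes g: "g \<noteq> 0" and \<rho>: "\<rho> > 0"
  defines "T \<equiv> \<lambda>j. N (of_rat (coeff g j)) * \<rho> ^ j"
  defines "a \<equiv> size (filter_mset (\<lambda>b. N b < \<rho>) (proots (cp g)))"
  defines "a' \<equiv> size (filter_mset (\<lambda>b. N b \<le> \<rho>) (proots (cp g)))"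
  shows "T a' = T a" "T a > 0" "T j \<le> T a" "j < a \<Longrightarrow> T j < T a" "j > a' \<Longrightarrow> T j < T a"
proof -
  define M where "M = proots (cp g)"
  define l where "l = lead_coeff (cp g)"
  have l0: "l \<noteq> 0" "algebraic l" unfolding l_def using g by (auto simp: cp_arith)
  have Nl: "N l > 0" using N_pos l0 by blast
  obtain X where X: "X > 0" "\<And>j. algebraic (coeff (rpoly M) j)" "\<And>j. N (coeff (rpoly M) j) * \<rho> ^ j \<le> X"
    "N (coeff (rpoly M) a) * \<rho> ^ a = X" "N (coeff (rpoly M) a') * \<rho> ^ a' = X"
    "\<And>j. j < a \<Longrightarrow> N (coeff (rpoly M) j) * \<rho> ^ j < X" "\<And>j. j > a' \<Longrightarrow> N (coeff (rpoly M) j) * \<rho> ^ j < X"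
    using newton_polygon[OF \<rho>, of M] proots_algebraic[OF g] unfolding M_def[symmetric] a_def a'_def Let_def by auto
  have T: "T j = N l * (N (coeff (rpoly M) j) * \<rho> ^ j)" for j
  proof -
    have "cp g = smult l (rpoly M)" unfolding l_def M_def by (rule rpoly_proots) (use g in \<open>simp add: cp_arith\<close>)
    then have "of_rat (coeff g j) = l * coeff (rpoly M) j" by (metis coeff_smult cp_arith(9))
    then show ?thesis unfolding T_def using N_mult[OF l0(2) X(2)] by simp
  qed
  show "T a' = T a" "T a > 0" "T j \<le> T a" unfolding T X(4,5) using X Nl by auto
  show "T j < T a" if "j < a" unfolding T X(4) using X(6)[OF that] Nl by simp
  show "T j < T a" if "j > a'" unfolding T X(4) using X(7)[OF that] Nl by simp
qed

text \<open>If a single index attains the maximum, both ends of the range coincide: no root has norm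
  \<rho>, and the position of the index counts the roots of smaller norm.\<close>

lemma newton_count_unique:
  assumes "g \<noteq> 0" "\<rho> > 0" "\<And>j. j \<le> degree g \<Longrightarrow> j \<noteq> J \<Longrightarrow>
    N (of_rat (coeff g j)) * \<rho> ^ j < N (of_rat (coeff g J)) * \<rho> ^ J"
  shows "size (filter_mset (\<lambda>b. N b < \<rho>) (proots (cp g))) = J"
    "b \<in># proots (cp g) \<Longrightarrow> N b \<noteq> \<rho>"
proof -
  define a where "a = size (filter_mset (\<lambda>b. N b < \<rho>) (proots (cp g)))"
  define a' where "a' = size (filter_mset (\<lambda>b. N b \<le> \<rho>) (proots (cp g)))"
  note n = newton_rational[OF assms(1,2), folded a_def a'_def]
  have sz: "size (proots (cp g)) = degree g" by (simp add: size_proots_complex cp_arith)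
  have "a \<le> degree g" "a' \<le> degree g"
    unfolding a_def a'_def sz[symmetric] by (intro size_mset_mono multiset_filter_subset)+
  then have aJ: "a = J" "a' = J" using assms(3)[of a] assms(3)[of a'] n(1) n(3)[of J] by force+
  then show "size (filter_mset (\<lambda>b. N b < \<rho>) (proots (cp g))) = J" unfolding a_def by simp
  assume b: "b \<in># proots (cp g)"
  show "N b \<noteq> \<rho>"
  proof
    assume "N b = \<rho>"
    have "filter_mset (\<lambda>b. N b \<le> \<rho>) (proots (cp g)) = filter_mset (\<lambda>b. N b < \<rho>) (proots (cp g)) + filter_mset (\<lambda>b. N b = \<rho>) (proots (cp g))"
      by (rule multiset_eqI) auto
    then have "a' = a + size (filter_mset (\<lambda>b. N b = \<rho>) (proots (cp g)))" unfolding a_def a'_def by simp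
    moreover have "b \<in># filter_mset (\<lambda>b. N b = \<rho>) (proots (cp g))" using b \<open>N b = \<rho>\<close> by simp
    then have "size (filter_mset (\<lambda>b. N b = \<rho>) (proots (cp g))) > 0" by (metis empty_iff nonempty_has_size set_mset_empty)
    ultimately show False using aJ by linarith
  qed
qed

lemma count_norm_dvd:
  assumes g: "g \<noteq> 0" and t: "t > 0" and ex: "\<And>i::nat. \<exists>k::int. t ^ i = real p powi k \<Longrightarrow> d dvd i"
  shows "d dvd size (filter_mset (\<lambda>b. N b = t) (proots (cp g)))"
proof (rule ex, rule norm_count_power)
  define q where "q = smult (inverse (lead_coeff g)) g"
  have lg: "lead_coeff g \<noteq> 0" using g by simp
  have cl: "lead_coeff (cp g) = of_rat (lead_coeff g)" by (rule cp_arith(7))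
  have "cp q = smult (inverse (of_rat (lead_coeff g))) (cp g)"
    unfolding q_def by (rule poly_eqI) (simp add: coeff_map_poly of_rat_mult of_rat_inverse)
  also have "cp g = smult (of_rat (lead_coeff g)) (rpoly (proots (cp g)))"
    using rpoly_proots[of "cp g"] g unfolding cl by (simp add: cp_arith(8))
  finally show "cp q = rpoly (proots (cp g))" using lg by (simp del: leading_coeff_0_iff)
qed (use proots_algebraic[OF g] t in auto)

text \<open>The roots are sorted by norm, and each class has a multiple of \<open>d\<close>
  elements.\<close>

lemma count_norms_dvd:
  assumes g: "g \<noteq> 0" and ex: "\<And>b. b \<in># proots (cp g) \<Longrightarrow> Q (N b) \<Longrightarrow> N b > 0 \<and> (\<forall>i::nat. (\<exists>k::int. N b ^ i = real p powi k) \<longrightarrow> d dvd i)"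
  shows "d dvd size (filter_mset (\<lambda>b. Q (N b)) (proots (cp g)))"
proof -
  define M where "M = proots (cp g)"
  define V where "V = N ` set_mset (filter_mset (\<lambda>b. Q (N b)) M)"
  have "size (filter_mset (\<lambda>b. Q (N b)) M) = (\<Sum>t\<in>V. size (filter_mset (\<lambda>b. N b = t) (filter_mset (\<lambda>b. Q (N b)) M)))"
  proof -
    have "size W = (\<Sum>t\<in>V. size (filter_mset (\<lambda>b. N b = t) W))" if "finite V" "N ` set_mset W \<subseteq> V" for W :: "complex multiset" and V
      using that(2)
    proof (induction W)
      case (add x W)
      have "(\<Sum>t\<in>V. size (filter_mset (\<lambda>b. N b = t) (add_mset x W))) =
          (\<Sum>t\<in>V. size (filter_mset (\<lambda>b. N b = t) W) + (if t = N x then 1 else 0))"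
        by (intro sum.cong) auto
      also have "\<dots> = size W + 1" using add that(1) by (simp add: sum.distrib)
      finally show ?case by simp
    qed simp
    then show ?thesis unfolding V_def by simp
  qed
  moreover have "d dvd (\<Sum>t\<in>V. size (filter_mset (\<lambda>b. N b = t) (filter_mset (\<lambda>b. Q (N b)) M)))"
  proof (rule dvd_sum)
    fix t assume "t \<in> V"
    then obtain b where b: "b \<in># M" "Q (N b)" "t = N b" unfolding V_def by auto
    have "filter_mset (\<lambda>b. N b = t) (filter_mset (\<lambda>b. Q (N b)) M) = filter_mset (\<lambda>b. N b = t) M"
      using b by (auto simp: filter_filter_mset intro!: filter_mset_cong)
    then show "d dvd size (filter_mset (\<lambda>b. N b = t) (filter_mset (\<lambda>b. Q (N b)) M))"
      using count_norm_dvd[OF g, of t d] ex[of b] b unfolding M_def by simp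
  qed
  ultimately show ?thesis unfolding M_def by simp
qed

text \<open>\<delta> measures how far the valuation \<mu> stays below the limit
  \<open>1 / (p - 1)\<close> that belongs to the exponential series; in this parameter the slopes of
  the exponential polynomial become \<open>1 / p ^ \<nu>\<close>.\<close>

lemma N_coeff_L:
  assumes "j \<le> n" "\<rho> = real p powr (- \<mu>)" "\<delta> = 1 - (real p - 1) * \<mu>"
  shows "N (of_rat (coeff (L_poly r n) j)) * \<rho> ^ j = real p powr (- newton_fun p n r \<delta> j / (real p - 1))"
proof -
  have p1': "real p - 1 > 0" using p1 by simp
  define C where "C = (n - j + r) choose r"
  have sym: "(n - j + r) choose (n - j) = C" unfolding C_def using binomial_symmetric[of "n - j" "n - j + r"] by simp
  have C0: "C \<noteq> 0" unfolding C_def by simp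
  have pw: "(1 / real p) ^ k = real p powr (- real k)" for k
    using p1 by (simp add: powr_minus powr_realpow power_one_over inverse_eq_divide)
  have "of_rat (coeff (L_poly r n) j) = (of_nat C / of_nat (fact j) :: complex)"
  proof -
    have "(of_rat (fact j) :: complex) = of_nat (fact j)" by (metis of_nat_fact of_rat_of_nat_eq)
    then show ?thesis using assms(1) sym by (simp add: coeff_L of_rat_divide)
  qed
  then have "N (of_rat (coeff (L_poly r n) j)) = N (of_nat C) / N (of_nat (fact j))" by (simp add: N_divide del: of_nat_fact)
  also have "\<dots> = real p powr (- real (multiplicity p C)) / real p powr (- real (multiplicity p (fact j :: nat)))"
    using C0 by (simp add: N_of_nat pw del: of_nat_fact)
  also have "\<dots> = real p powr (real (multiplicity p (fact j :: nat)) - real (multiplicity p C))"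
    by (simp add: powr_diff powr_minus field_simps)
  finally have 1: "N (of_rat (coeff (L_poly r n) j)) = real p powr (real (multiplicity p (fact j :: nat)) - real (multiplicity p C))" .
  have "\<rho> ^ j = real p powr (- \<mu> * real j)" unfolding assms(2) using p1 by (simp add: powr_pow_nat)
  then have "N (of_rat (coeff (L_poly r n) j)) * \<rho> ^ j = real p powr (real (multiplicity p (fact j :: nat)) - real (multiplicity p C) - \<mu> * real j)"
    unfolding 1 by (simp add: powr_add[symmetric])
  also have "real (multiplicity p (fact j :: nat)) - real (multiplicity p C) - \<mu> * real j = - newton_fun p n r \<delta> j / (real p - 1)"
  proof -
    have "newton_fun p n r \<delta> j = (real p - 1) * real (multiplicity p C) + (real j - (real p - 1) * real (multiplicity p (fact j :: nat))) - real j * (1 - (real p - 1) * \<mu>)"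
      unfolding newton_fun_def C_def[symmetric] dsum_def assms(3) using p1 by (simp add: of_nat_diff)
    also have "\<dots> = - (real p - 1) * (real (multiplicity p (fact j :: nat)) - real (multiplicity p C) - \<mu> * real j)"
      by (simp add: algebra_simps)
    finally have N: "newton_fun p n r \<delta> j = - (real p - 1) * (real (multiplicity p (fact j :: nat)) - real (multiplicity p C) - \<mu> * real j)" .
    have aux: "y = - x / d" if "d > 0" "x = - d * y" for d x y :: real using that by simp
    show ?thesis by (rule aux[OF p1' N])
  qed
  finally show ?thesis .
qed

end

text \<open>A point \<open>(j0, \<dots>)\<close> and a point \<open>(j1, \<dots>)\<close> of the \<open>p\<close>-adic Newton polygon of \<open>n! L\<close> on the supporting line
  \<open>j \<mapsto> (m - a j) / d\<close>, in a form suitable for evaluation.\<close>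

definition edge :: "nat \<Rightarrow> nat \<Rightarrow> nat \<Rightarrow> nat \<Rightarrow> nat \<Rightarrow> nat \<Rightarrow> nat \<Rightarrow> nat \<Rightarrow> bool" where
  "edge n r p d a m j0 j1 \<longleftrightarrow> j0 < j1 \<and> j1 \<le> n \<and> a * j0 \<le> m \<and> a * j1 \<le> m \<and> d dvd m - a * j0 \<and> d dvd m - a * j1 \<and>
    (\<forall>j\<in>{..n}. p ^ ((m - a * j + d - 1) div d) dvd (fact n div fact j) * ((n - j + r) choose (n - j))) \<and>
    \<not> p ^ Suc ((m - a * j0) div d) dvd (fact n div fact j0) * ((n - j0 + r) choose (n - j0)) \<and>
    \<not> p ^ Suc ((m - a * j1) div d) dvd (fact n div fact j1) * ((n - j1 + r) choose (n - j1))"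

context nonarch
begin

text \<open>The exponent is \<open>(p ^ \<nu> - 1) / (p - 1)\<close> over \<open>p ^ \<nu>\<close>,
  and this numerator is prime to \<open>p\<close>.\<close>

lemma exact_power:
  fixes i \<nu> :: nat
  assumes t: "t = real p powr (- ((1 - 1 / real p ^ \<nu>) / (real p - 1)))" and k: "t ^ i = real p powi (k :: int)"
  shows "p ^ \<nu> dvd i"
proof -
  have p1': "real p - 1 > 0" using p1 by simp
  have "t ^ i = real p powr (- ((1 - 1 / real p ^ \<nu>) / (real p - 1)) * real i)"
    unfolding t using p1 by (simp add: powr_pow_nat)
  moreover have "real p powi k = real p powr real_of_int k" using p1 by (simp add: powr_real_of_int')
  ultimately have "real p powr (- ((1 - 1 / real p ^ \<nu>) / (real p - 1)) * real i) = real p powr real_of_int k"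
    using k by simp
  then have e: "- ((1 - 1 / real p ^ \<nu>) / (real p - 1)) * real i = real_of_int k"
    using p1 powr_inj[of "real p"] by fastforce
  have "(1 - 1 / real p ^ \<nu>) * real i = - real_of_int k * (real p - 1)"
    using e p1' by (simp add: field_simps)
  then have "(real p ^ \<nu> - 1) * real i = - real_of_int k * (real p - 1) * real p ^ \<nu>"
    using p1 by (simp add: field_simps)
  then have "real_of_int ((int p ^ \<nu> - 1) * int i) = real_of_int (- k * (int p - 1) * int p ^ \<nu>)" by simp
  then have "(int p ^ \<nu> - 1) * int i = - k * (int p - 1) * int p ^ \<nu>" by (simp only: of_int_eq_iff)
  then have d: "int p ^ \<nu> dvd (int p ^ \<nu> - 1) * int i" by simp
  have "coprime (int p ^ \<nu>) (int p ^ \<nu> - 1)" by (metis coprime_commute coprime_diff_one_left)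
  then have "int p ^ \<nu> dvd int i" using d by (simp add: coprime_dvd_mult_right_iff)
  then show ?thesis by (metis of_nat_dvd_iff of_nat_power)
qed

text \<open>Where the Newton function has a unique minimum there is no root. By
  \<open>newton_min_nonpos\<close> and \<open>newton_min_pos\<close> this rules out every \<delta>
  except the values \<open>1 / p ^ \<nu>\<close>; the bound on the norm puts \<delta> below
  \<open>\<delta>'\<close> and thus \<nu> beyond \<open>e\<close>.\<close>

lemma L_root_norm:
  assumes nd: "\<not> p dvd ((n + r) choose r)" and x: "x \<in># proots (cp (L_poly r n))"
    and small: "N x < real p powr (- ((1 - \<delta>') / (real p - 1)))" and d': "real p ^ e * \<delta>' < 1"
  shows "N x > 0 \<and> (\<exists>\<nu>>e. N x = real p powr (- ((1 - 1 / real p ^ \<nu>) / (real p - 1))))"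
proof -
  have p1': "real p - 1 > 0" using p1 by simp
  have ax: "algebraic x" using proots_algebraic[OF L_nonzero x] .
  have "poly (cp (L_poly r n)) 0 \<noteq> 0" by (simp add: poly_0_coeff_0 coeff_map_poly coeff_L)
  then have x0: "x \<noteq> 0" using x L_nonzero[of r n] by (auto simp: cp_arith)
  have Nx: "N x > 0" using N_pos[OF ax x0] .
  define \<mu> where "\<mu> = - log (real p) (N x)"
  have Nmu: "N x = real p powr (- \<mu>)" unfolding \<mu>_def using Nx p1 by simp
  define \<delta> where "\<delta> = 1 - (real p - 1) * \<mu>"
  have mu: "\<mu> = (1 - \<delta>) / (real p - 1)" unfolding \<delta>_def using p1' by simp
  have "- \<mu> < - ((1 - \<delta>') / (real p - 1))" using small unfolding Nmu using p1 by simp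
  then have dd: "\<delta> < \<delta>'" unfolding mu using p1' by (simp add: divide_less_cancel)
  have uniq: False if "\<And>j. j \<le> n \<Longrightarrow> j \<noteq> J \<Longrightarrow> newton_fun p n r \<delta> j > newton_fun p n r \<delta> J" "J \<le> n" for J
  proof -
    have lt: "N (of_rat (coeff (L_poly r n) j)) * N x ^ j < N (of_rat (coeff (L_poly r n) J)) * N x ^ J"
      if j: "j \<le> degree (L_poly r n)" "j \<noteq> J" for j
    proof -
      have "j \<le> n" using j degree_L by simp
      then have "- newton_fun p n r \<delta> j / (real p - 1) < - newton_fun p n r \<delta> J / (real p - 1)"
        using \<open>\<And>j. j \<le> n \<Longrightarrow> j \<noteq> J \<Longrightarrow> newton_fun p n r \<delta> j > newton_fun p n r \<delta> J\<close> j(2) p1' by (intro divide_strict_right_mono) auto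
      then show ?thesis using N_coeff_L[OF \<open>j \<le> n\<close> Nmu \<delta>_def] N_coeff_L[OF \<open>J \<le> n\<close> Nmu \<delta>_def] p1 by simp
    qed
    show False using newton_count_unique(2)[OF L_nonzero Nx lt x] by simp
  qed
  have dpos: "\<delta> > 0"
  proof (rule ccontr)
    assume "\<not> \<delta> > 0"
    then show False using uniq[of 0] newton_min_nonpos[OF prime nd, of \<delta>] by force
  qed
  have de: "real p ^ e * \<delta> < 1"
  proof -
    have "real p ^ e * \<delta> < real p ^ e * \<delta>'" using dd p1 by simp
    then show ?thesis using d' by simp
  qed
  \<comment> \<open>At this exponent the product with \<delta> reaches 1. If it were larger than 1,
    then \<delta> would lie strictly between two neighbouring slopes.\<close>
  define \<nu> where "\<nu> = (LEAST k. real p ^ k * \<delta> \<ge> 1)"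
  obtain k where "1 / \<delta> < real p ^ k" using real_arch_pow[OF p1] by blast
  then have "real p ^ k * \<delta> \<ge> 1" using dpos by (simp add: field_simps)
  then have nu: "real p ^ \<nu> * \<delta> \<ge> 1" unfolding \<nu>_def by (rule LeastI)
  have below: "real p ^ k * \<delta> < 1" if "k < \<nu>" for k using not_less_Least[of k "\<lambda>k. real p ^ k * \<delta> \<ge> 1"] that unfolding \<nu>_def by auto
  have "\<nu> > e"
  proof (rule ccontr)
    assume "\<not> \<nu> > e"
    then have "real p ^ \<nu> \<le> real p ^ e" using p1 by (intro power_increasing) auto
    then have "real p ^ \<nu> * \<delta> \<le> real p ^ e * \<delta>" using dpos by simp
    then show False using nu de by simp
  qed
  then obtain l where l: "\<nu> = Suc l" by (cases \<nu>) auto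
  have "real p ^ \<nu> * \<delta> = 1"
  proof (rule ccontr)
    assume "real p ^ \<nu> * \<delta> \<noteq> 1"
    then have gt: "1 < real p ^ Suc l * \<delta>" using nu l by simp
    have lt: "real p ^ l * \<delta> < 1" using below l by simp
    show False using uniq[OF newton_min_pos[OF prime nd lt gt]] by simp
  qed
  then have "\<delta> = 1 / real p ^ \<nu>" using p1 by (simp add: field_simps)
  then have "N x = real p powr (- ((1 - 1 / real p ^ \<nu>) / (real p - 1)))" using Nmu mu by simp
  then show ?thesis using Nx \<open>\<nu> > e\<close> by blast
qed

lemma exists_threshold: "\<exists>\<delta>. real p ^ e * \<delta> < 1 \<and> 1 < real p ^ Suc e * \<delta>"
proof -
  have "1 / real p ^ Suc e < 1 / real p ^ e" using p1 by (simp add: field_simps)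
  then obtain \<delta> where "1 / real p ^ Suc e < \<delta>" "\<delta> < 1 / real p ^ e" using dense by blast
  then show ?thesis using p1 by (intro exI[of _ \<delta>]) (simp add: field_simps)
qed

text \<open>Strictly between two slopes the minimum is unique, and its position counts the roots of
  smaller norm.\<close>

lemma L_roots_below:
  assumes nd: "\<not> p dvd ((n + r) choose r)" and d: "real p ^ e * \<delta> < 1" "1 < real p ^ Suc e * \<delta>"
  shows "size (filter_mset (\<lambda>x. N x < real p powr (- ((1 - \<delta>) / (real p - 1)))) (proots (cp (L_poly r n)))) = p ^ Suc e * (n div p ^ Suc e)"
proof (rule newton_count_unique(1)[OF L_nonzero])
  have p1': "real p - 1 > 0" using p1 by simp
  show "real p powr (- ((1 - \<delta>) / (real p - 1))) > 0" using p1 by simp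
  define \<mu> where "\<mu> = (1 - \<delta>) / (real p - 1)"
  have dm: "\<delta> = 1 - (real p - 1) * \<mu>" unfolding \<mu>_def using p1' by simp
  fix j assume j: "j \<le> degree (L_poly r n)" "j \<noteq> p ^ Suc e * (n div p ^ Suc e)"
  then have jn: "j \<le> n" using degree_L by simp
  have Jn: "p ^ Suc e * (n div p ^ Suc e) \<le> n" by simp
  have "- newton_fun p n r \<delta> j / (real p - 1) < - newton_fun p n r \<delta> (p ^ Suc e * (n div p ^ Suc e)) / (real p - 1)"
    using newton_min_pos[OF prime nd d jn j(2)] p1' by (intro divide_strict_right_mono) auto
  then show "N (of_rat (coeff (L_poly r n) j)) * (real p powr (- ((1 - \<delta>) / (real p - 1)))) ^ j
    < N (of_rat (coeff (L_poly r n) (p ^ Suc e * (n div p ^ Suc e)))) * (real p powr (- ((1 - \<delta>) / (real p - 1)))) ^ (p ^ Suc e * (n div p ^ Suc e))"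
    using N_coeff_L[OF jn refl dm] N_coeff_L[OF Jn refl dm] p1 unfolding \<mu>_def by simp
qed

text \<open>Choose \<rho> between the slopes belonging to \<open>e - 1\<close> and \<open>e\<close>.
  The roots of L of norm less than \<rho> have valuations whose denominators are multiples of
  \<open>p ^ e\<close>, so \<open>g\<close> contains a multiple of \<open>p ^ e\<close> of them. Its
  other roots are among the \<open>n mod p ^ e\<close> other roots of L.\<close>

theorem factor_degree_mod:
  assumes nd: "\<not> p dvd ((n + r) choose r)" and fac: "L_poly r n = g * h"
  shows "degree g mod p ^ e \<le> n mod p ^ e"
proof (cases e)
  case 0 then show ?thesis by simp
next
  case (Suc e')
  obtain \<delta> where d: "real p ^ e' * \<delta> < 1" "1 < real p ^ Suc e' * \<delta>" using exists_threshold by blast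
  define \<rho> where "\<rho> = real p powr (- ((1 - \<delta>) / (real p - 1)))"
  have g0: "g \<noteq> 0" using fac L_nonzero[of r n] by auto
  have sub: "proots (cp (L_poly r n)) = proots (cp g) + proots (cp h)" by (rule factor_roots_mset[OF fac])
  have "p ^ e dvd size (filter_mset (\<lambda>x. N x < \<rho>) (proots (cp g)))"
  proof (rule count_norms_dvd[OF g0])
    fix b assume b: "b \<in># proots (cp g)" "N b < \<rho>"
    have "b \<in># proots (cp (L_poly r n))" using b sub by simp
    from L_root_norm[OF nd this b(2)[unfolded \<rho>_def] d(1)]
    obtain \<nu> where nu: "N b > 0" "\<nu> > e'" "N b = real p powr (- ((1 - 1 / real p ^ \<nu>) / (real p - 1)))" by blast
    have "p ^ e dvd p ^ \<nu>" using nu(2) Suc by (intro le_imp_power_dvd) simp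
    then show "N b > 0 \<and> (\<forall>i::nat. (\<exists>k::int. N b ^ i = real p powi k) \<longrightarrow> p ^ e dvd i)"
      using nu(1) exact_power[OF nu(3)] dvd_trans by blast
  qed
  then obtain w where w: "size (filter_mset (\<lambda>x. N x < \<rho>) (proots (cp g))) = p ^ e * w" by (rule dvdE)
  have "size (filter_mset (\<lambda>x. \<not> N x < \<rho>) (proots (cp g))) \<le> size (filter_mset (\<lambda>x. \<not> N x < \<rho>) (proots (cp (L_poly r n))))"
    unfolding sub by simp
  also have "\<dots> = n - p ^ e * (n div p ^ e)"
  proof -
    have "size (proots (cp (L_poly r n))) = n" by (simp add: size_proots_complex cp_arith degree_L)
    moreover have "size (proots (cp (L_poly r n))) = size (filter_mset (\<lambda>x. N x < \<rho>) (proots (cp (L_poly r n)))) + size (filter_mset (\<lambda>x. \<not> N x < \<rho>) (proots (cp (L_poly r n))))"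
      by (metis multiset_partition size_union)
    ultimately show ?thesis using L_roots_below[OF nd d] unfolding \<rho>_def Suc by simp
  qed
  also have "\<dots> = n mod p ^ e" by (rule minus_mult_div_eq_mod)
  finally have le: "size (filter_mset (\<lambda>x. \<not> N x < \<rho>) (proots (cp g))) \<le> n mod p ^ e" .
  define s where "s = size (filter_mset (\<lambda>x. \<not> N x < \<rho>) (proots (cp g)))"
  have "degree g = size (proots (cp g))" by (simp add: size_proots_complex cp_arith)
  also have "\<dots> = p ^ e * w + s" unfolding s_def using w by (metis multiset_partition size_union)
  finally have "degree g mod p ^ e = s mod p ^ e" by simp
  also have "\<dots> \<le> s" by simp
  finally show ?thesis using le unfolding s_def by simp
qed

text \<open>The threshold for \<open>e = 0\<close> cuts off \<open>p * (n div p)\<close> roots, all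
  of them with \<nu> positive.\<close>

lemma exists_ramified_root:
  assumes "n mod p + r < p" "p \<le> n"
  obtains x where "x \<in> complex_roots (L_poly r n)" "x \<noteq> 0" "\<And>i::nat. \<exists>k::int. N x ^ i = real p powi k \<Longrightarrow> p dvd i"
proof -
  have nd: "\<not> p dvd ((n + r) choose r)" by (rule not_dvd_binomial_large[OF prime assms(1)])
  obtain \<delta> where d: "real p ^ 0 * \<delta> < 1" "1 < real p ^ Suc 0 * \<delta>" using exists_threshold by blast
  have "p > 0" using prime prime_gt_0_nat by blast
  then have "n div p > 0" using assms(2) by (simp add: div_greater_zero_iff)
  then have "size (filter_mset (\<lambda>x. N x < real p powr (- ((1 - \<delta>) / (real p - 1)))) (proots (cp (L_poly r n)))) > 0"
    unfolding L_roots_below[OF nd d] using \<open>p > 0\<close> by simp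
  then obtain x where x: "x \<in># proots (cp (L_poly r n))" "N x < real p powr (- ((1 - \<delta>) / (real p - 1)))"
    by (metis (no_types, lifting) multiset_nonemptyE filter_mset_eq_conv nonempty_has_size in_diff_count set_mset_filter mem_Collect_eq)
  obtain \<nu> where nu: "N x > 0" "\<nu> > 0" "N x = real p powr (- ((1 - 1 / real p ^ \<nu>) / (real p - 1)))"
    using L_root_norm[OF nd x d(1)] by blast
  have "p dvd p ^ \<nu>" using nu(2) by simp
  then have "p dvd i" if "\<exists>k::int. N x ^ i = real p powi k" for i :: nat
    using exact_power[OF nu(3)] that dvd_trans by blast
  moreover have "x \<in> complex_roots (L_poly r n)" using x(1) L_nonzero[of r n] unfolding complex_roots_def by (simp add: cp_arith)
  moreover have "x \<noteq> 0" using nu(1) N_zero by auto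
  ultimately show ?thesis using that by blast
qed

text \<open>The divisibilities say that no point lies below the line, while \<open>j0\<close> and
  \<open>j1\<close> lie on it. Two different indices of maximal weighted norm enclose at least one
  root of that norm.\<close>

lemma edge_root:
  assumes e: "edge n r p d a m j0 j1" and d: "prime d" and ap: "\<not> d dvd a"
  obtains x where "x \<in># proots (cp (L_poly r n))" "x \<noteq> 0" "N x = real p powr (- real a / real d)"
proof -
  define \<rho> where "\<rho> = real p powr (- real a / real d)"
  have r0: "\<rho> > 0" unfolding \<rho>_def using p1 by simp
  define c where "c j = (fact n div fact j) * ((n - j + r) choose (n - j))" for j :: nat
  define f where "f = smult (fact n) (L_poly r n)"
  have f0: "f \<noteq> 0" unfolding f_def using L_nonzero by simp
  have pf: "proots (cp f) = proots (cp (L_poly r n))"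
  proof -
    have "cp f = smult (fact n) (cp (L_poly r n))"
    proof (rule poly_eqI)
      fix i
      have "(of_rat (fact n) :: complex) = fact n" by (metis of_nat_fact of_rat_of_nat_eq)
      then show "coeff (cp f) i = coeff (smult (fact n) (cp (L_poly r n))) i"
        unfolding f_def by (simp add: coeff_map_poly of_rat_mult)
    qed
    then show ?thesis by simp
  qed
  have cf: "of_rat (coeff f j) = (of_nat (c j) :: complex)" if "j \<le> n" for j
  proof -
    have "of_rat (coeff f j) = coeff (cp f) j" by (simp add: cp_arith)
    also have "\<dots> = of_int (coeff (Lint r n) j)" unfolding f_def cp_Lint by (simp add: coeff_map_poly)
    finally show ?thesis using that unfolding coeff_Lint c_def by simp
  qed
  define T where "T j = N (of_rat (coeff f j)) * \<rho> ^ j" for j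
  have c0: "c j \<noteq> 0" if "j \<le> n" for j
    unfolding c_def using that fact_dvd[OF that, where 'a = nat] by (simp add: dvd_div_eq_0_iff)
  have T: "T j = real p powr (- (real (multiplicity p (c j)) + real a * real j / real d))" if "j \<le> n" for j
  proof -
    have "(1 / real p) ^ k = real p powr (- real k)" for k
      using p1 by (simp add: powr_minus powr_realpow power_one_over inverse_eq_divide)
    moreover have "\<rho> ^ j = real p powr (- real a / real d * real j)" unfolding \<rho>_def using p1 by (simp add: powr_pow_nat)
    ultimately show ?thesis unfolding T_def cf[OF that] N_of_nat[OF c0[OF that]] by (simp add: powr_add[symmetric])
  qed
  have d0: "real d > 0" using prime_gt_0_nat[OF d] by simp
  have not_unit: "\<not> is_unit p" using prime_gt_1_nat[OF prime] by simp
  have ge: "real (multiplicity p (c j)) + real a * real j / real d \<ge> real m / real d" if "j \<le> n" for j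
  proof -
    have "p ^ ((m - a * j + d - 1) div d) dvd c j" using e that unfolding edge_def c_def by auto
    then have "(m - a * j + d - 1) div d \<le> multiplicity p (c j)"
      using multiplicity_geI[OF c0[OF that] not_unit] by blast
    then have "d * ((m - a * j + d - 1) div d) \<le> d * multiplicity p (c j)" by simp
    \<comment> \<open>The division in \<open>edge\<close> rounds up; where \<open>m < a * j\<close>,
      truncated subtraction makes the requirement trivial.\<close>
    moreover have "m - a * j \<le> d * ((m - a * j + d - 1) div d)"
    proof -
      have "d > 0" using d prime_gt_0_nat by blast
      have "d * ((m - a * j + d - 1) div d) + (m - a * j + d - 1) mod d = m - a * j + d - 1" by (rule mult_div_mod_eq)
      moreover have "(m - a * j + d - 1) mod d \<le> d - 1" using mod_less_divisor[OF \<open>d > 0\<close>, of "m - a * j + d - 1"] by linarith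
      ultimately show ?thesis using \<open>d > 0\<close> by arith
    qed
    ultimately have "m \<le> d * multiplicity p (c j) + a * j" by linarith
    then have "real m \<le> real d * real (multiplicity p (c j)) + real a * real j" by (metis of_nat_add of_nat_le_iff of_nat_mult)
    then have "real m / real d \<le> (real d * real (multiplicity p (c j)) + real a * real j) / real d" by (intro divide_right_mono) auto
    also have "\<dots> = real (multiplicity p (c j)) + real a * real j / real d" using d0 by (simp add: add_divide_distrib)
    finally show ?thesis .
  qed
  have eq: "real (multiplicity p (c j)) + real a * real j / real d = real m / real d"
    if j: "j \<le> n" "a * j \<le> m" "d dvd m - a * j" "\<not> p ^ Suc ((m - a * j) div d) dvd c j" for j
  proof -
    have "multiplicity p (c j) < Suc ((m - a * j) div d)"
      using j(4) multiplicity_dvd'[of "Suc ((m - a * j) div d)" p "c j"] by (meson not_le)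
    then have "d * multiplicity p (c j) \<le> m - a * j" using j(3) by (metis dvd_mult_div_cancel less_Suc_eq_le mult_le_mono2)
    then have "d * multiplicity p (c j) + a * j \<le> m" using j(2) by linarith
    then have "real d * real (multiplicity p (c j)) + real a * real j \<le> real m" by (metis of_nat_add of_nat_le_iff of_nat_mult)
    then have "(real d * real (multiplicity p (c j)) + real a * real j) / real d \<le> real m / real d" by (intro divide_right_mono) auto
    moreover have "(real d * real (multiplicity p (c j)) + real a * real j) / real d = real (multiplicity p (c j)) + real a * real j / real d"
      using d0 by (simp add: add_divide_distrib)
    ultimately have "real (multiplicity p (c j)) + real a * real j / real d \<le> real m / real d" by simp
    then show ?thesis using ge[OF j(1)] by simp
  qed
  have jn: "j0 \<le> n" "j1 \<le> n" "j0 < j1" using e unfolding edge_def by auto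
  have T0: "T j0 = real p powr (- (real m / real d))" unfolding T[OF jn(1)] using e jn by (subst eq) (auto simp: edge_def c_def)
  have T1: "T j1 = real p powr (- (real m / real d))" unfolding T[OF jn(2)] using e jn by (subst eq) (auto simp: edge_def c_def)
  have Tle: "T j \<le> real p powr (- (real m / real d))" if "j \<le> n" for j unfolding T[OF that] using ge[OF that] p1 by simp
  define M where "M = proots (cp f)"
  define b where "b = size (filter_mset (\<lambda>b. N b < \<rho>) M)"
  define b' where "b' = size (filter_mset (\<lambda>b. N b \<le> \<rho>) M)"
  note nr = newton_rational[OF f0 r0, folded T_def M_def, folded b_def b'_def]
  have dn: "degree f = n" unfolding f_def by (simp add: degree_L)
  have "b \<le> n" unfolding b_def M_def
    by (rule order_trans[OF size_mset_mono[OF multiset_filter_subset]]) (simp add: size_proots_complex cp_arith dn)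
  then have Tb: "T b \<le> real p powr (- (real m / real d))" by (rule Tle)
  have "b \<le> j0" using nr(4)[of j0] T0 Tb by linarith
  moreover have "j1 \<le> b'" using nr(5)[of j1] T1 Tb by linarith
  ultimately have "b < b'" using jn(3) by simp
  moreover have "filter_mset (\<lambda>b. N b \<le> \<rho>) M = filter_mset (\<lambda>b. N b < \<rho>) M + filter_mset (\<lambda>b. N b = \<rho>) M"
    by (rule multiset_eqI) auto
  then have "b' = b + size (filter_mset (\<lambda>b. N b = \<rho>) M)" unfolding b_def b'_def by simp
  ultimately have "size (filter_mset (\<lambda>b. N b = \<rho>) M) > 0" by linarith
  then have "filter_mset (\<lambda>b. N b = \<rho>) M \<noteq> {#}" using nonempty_has_size by blast
  then obtain x where "x \<in># filter_mset (\<lambda>b. N b = \<rho>) M" by (rule multiset_nonemptyE)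
  then have "x \<in># proots (cp (L_poly r n))" "N x = \<rho>" unfolding M_def pf by auto
  moreover have "x \<noteq> 0" using \<open>N x = \<rho>\<close> r0 N_zero by auto
  ultimately show ?thesis using that unfolding \<rho>_def by blast
qed

lemma edge_exact:
  fixes i :: nat
  assumes t: "t = real p powr (- real a / real d)" and d: "prime d" and ap: "\<not> d dvd a" and k: "t ^ i = real p powi (k :: int)"
  shows "d dvd i"
proof -
  have d0: "real d > 0" using prime_gt_0_nat[OF d] by simp
  have "t ^ i = real p powr (- real a / real d * real i)"
    unfolding t using p1 by (simp add: powr_pow_nat)
  moreover have "real p powi k = real p powr real_of_int k" using p1 by (simp add: powr_real_of_int')
  ultimately have "real p powr (- real a / real d * real i) = real p powr real_of_int k"
    using k by simp
  then have "- real a / real d * real i = real_of_int k" using p1 powr_inj[of "real p"] by fastforce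
  then have "real a * real i = - real_of_int k * real d" using d0 by (simp add: field_simps)
  then have "real_of_int (int a * int i) = real_of_int (- k * int d)" by simp
  then have "int a * int i = - k * int d" by (simp only: of_int_eq_iff)
  then have "int d dvd int (a * i)" by simp
  then have "d dvd a * i" by (simp only: of_nat_dvd_iff)
  then show ?thesis using ap d by (simp add: prime_dvd_mult_iff)
qed

text \<open>In the factor that has \<open>x\<close> as a root, the number of roots of norm
  \<open>N x\<close> is positive and divisible by \<open>d\<close>.\<close>

lemma edge_factor_degree:
  assumes "edge n r p d a m j0 j1" "prime d" "\<not> d dvd a" "L_poly r n = g * h"
  shows "d \<le> degree g \<or> d \<le> degree h"
proof -
  obtain x where x: "x \<in># proots (cp (L_poly r n))" "x \<noteq> 0" "N x = real p powr (- real a / real d)"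
    using edge_root[OF assms(1,2,3)] .
  have main: "d \<le> degree u" if u: "u \<noteq> 0" "x \<in># proots (cp u)" for u
  proof -
    have Nx: "N x > 0" unfolding x(3) using p1 by simp
    have "d dvd size (filter_mset (\<lambda>b. N b = N x) (proots (cp u)))"
      using count_norm_dvd[OF u(1) Nx, of d] edge_exact[OF x(3) assms(2,3)] by blast
    moreover have "x \<in># filter_mset (\<lambda>b. N b = N x) (proots (cp u))" using u(2) by simp
    then have "filter_mset (\<lambda>b. N b = N x) (proots (cp u)) \<noteq> {#}" by force
    then have "size (filter_mset (\<lambda>b. N b = N x) (proots (cp u))) > 0" using nonempty_has_size by blast
    ultimately have "d \<le> size (filter_mset (\<lambda>b. N b = N x) (proots (cp u)))" by (rule dvd_imp_le)
    also have "\<dots> \<le> size (proots (cp u))" by (rule size_mset_mono[OF multiset_filter_subset])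
    finally show ?thesis by (simp add: size_proots_complex cp_arith)
  qed
  have "g \<noteq> 0" "h \<noteq> 0" using assms(4) L_nonzero[of r n] by auto
  then show ?thesis using main x(1) factor_roots_mset[OF assms(4)] by auto
qed

end

section \<open>Large prime factors of products of consecutive integers\<close>

definition primes_upto :: "nat \<Rightarrow> nat set" where
  "primes_upto x = {p. prime p \<and> p \<le> x}"

lemma finite_primes_upto [simp]: "finite (primes_upto x)"
  unfolding primes_upto_def by (rule finite_subset[of _ "{..x}"]) auto

text \<open>Eight of the thirty residues are prime to 30. One period is peeled off at a time, and
  the first one is evaluated.\<close>

lemma card_coprime_30: "15 * card {j\<in>{..x}. coprime j (30::nat)} \<le> 4 * x + 15"
proof (induction x rule: less_induct)
  case (less x)
  define A where "A y = {j\<in>{..y}. coprime j (30::nat)}" for y :: nat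
  have fin: "finite (A y)" for y unfolding A_def by simp
  have list: "A y = set (filter (\<lambda>j. gcd j 30 = 1) [0..<Suc y])" for y
    unfolding A_def by (auto simp: coprime_iff_gcd_eq_1 simp del: upt_Suc)
  show ?case
  proof (cases "x < 30")
    case True
    have all: "\<forall>y\<in>set [0..<30]. 15 * length (filter (\<lambda>j. gcd j 30 = 1) [0..<Suc y]) \<le> 4 * y + (15::nat)" by code_simp
    have "card (A x) \<le> length (filter (\<lambda>j. gcd j 30 = 1) [0..<Suc x])" unfolding list by (rule card_length)
    moreover have "x \<in> set [0..<30]" using True by simp
    ultimately have "15 * card (A x) \<le> 4 * x + 15" using all by (meson le_trans mult_le_mono2)
    then show ?thesis unfolding A_def .
  next
    case False
    have "A x \<subseteq> (\<lambda>j. j + 30) ` A (x - 30) \<union> A 29"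
    proof
      fix j assume j: "j \<in> A x"
      show "j \<in> (\<lambda>j. j + 30) ` A (x - 30) \<union> A 29"
      proof (cases "j < 30")
        case True then show ?thesis using j unfolding A_def by auto
      next
        case False
        then have "coprime (j - 30 + 30) 30" using j unfolding A_def by simp
        then have "coprime (j - 30) 30" by (simp only: coprime_iff_gcd_eq_1 gcd_add1)
        then have "j - 30 \<in> A (x - 30)" using j False unfolding A_def by auto
        moreover have "j = j - 30 + 30" using False by simp
        ultimately show ?thesis by blast
      qed
    qed
    then have "card (A x) \<le> card ((\<lambda>j. j + 30) ` A (x - 30) \<union> A 29)" using fin by (intro card_mono) auto
    also have "\<dots> \<le> card (A (x - 30)) + card (A 29)"
      using card_Un_le[of "(\<lambda>j. j + 30) ` A (x - 30)" "A 29"] card_image_le[OF fin, of "\<lambda>j. j + 30" "x - 30"] by linarith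
    also have "card (A 29) \<le> 8"
    proof -
      have "length (filter (\<lambda>j. gcd j 30 = 1) [0..<Suc 29]) = (8::nat)" by code_simp
      then show ?thesis unfolding list using card_length by metis
    qed
    finally show ?thesis using less[of "x - 30"] False unfolding A_def[symmetric] by simp
  qed
qed

text \<open>A sieve by 2, 3 and 5. Three primes are added to the previous count and the number 1 is
  removed, which turns 15 into 45.\<close>

lemma card_primes_upto: "15 * card (primes_upto x) \<le> 4 * x + 45"
proof (cases "x = 0")
  case True
  then have "primes_upto x = {}" unfolding primes_upto_def by auto
  then show ?thesis by simp
next
  case False
  define A where "A = {j\<in>{..x}. coprime j (30::nat)}"
  have "primes_upto x \<subseteq> {2, 3, 5} \<union> (A - {1})"
  proof
    fix p assume p: "p \<in> primes_upto x"
    then have pr: "prime p" "p \<le> x" unfolding primes_upto_def by auto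
    have "coprime p 30" if "p \<noteq> 2" "p \<noteq> 3" "p \<noteq> 5"
    proof -
      have "prime (3::nat)" "prime (5::nat)" by simp_all
      then have "coprime p 2" "coprime p 3" "coprime p 5"
        using primes_coprime[OF pr(1) two_is_prime_nat] primes_coprime[OF pr(1)] that by blast+
      then have "coprime p (2 * 3 * 5)" by (simp only: coprime_mult_right_iff)
      then show ?thesis by simp
    qed
    then show "p \<in> {2, 3, 5} \<union> (A - {1})" using pr unfolding A_def by auto
  qed
  then have "card (primes_upto x) \<le> card ({2, 3, 5} \<union> (A - {1}))" unfolding A_def by (intro card_mono) auto
  also have "\<dots> \<le> card {2, 3, 5 :: nat} + card (A - {1})" by (rule card_Un_le)
  also have "card {2, 3, 5 :: nat} = 3" by simp
  also have "card (A - {1}) = card A - 1" using False unfolding A_def by simp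
  finally have "card (primes_upto x) \<le> 3 + (card A - 1)" .
  moreover have "15 * card A \<le> 4 * x + 15" unfolding A_def by (rule card_coprime_30)
  ultimately show ?thesis by linarith
qed

text \<open>The row of \<open>2 * m + 1\<close> has two equal middle entries, and its sum is
  \<open>2 * 4 ^ m\<close>.\<close>

lemma binomial_middle_le: "(2 * m + 1) choose m \<le> 4 ^ m"
proof -
  have "2 * ((2 * m + 1) choose m) = ((2 * m + 1) choose m) + ((2 * m + 1) choose (Suc m))"
    using binomial_symmetric[of m "2 * m + 1"] by simp
  also have "\<dots> = (\<Sum>k\<in>{m, Suc m}. (2 * m + 1) choose k)" by simp
  also have "\<dots> \<le> (\<Sum>k\<le>2 * m + 1. (2 * m + 1) choose k)" by (rule sum_mono2) auto
  also have "\<dots> = 2 ^ (2 * m + 1)" by (rule choose_row_sum)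
  also have "\<dots> = 2 * 4 ^ m" by (simp add: power_mult)
  finally show ?thesis by simp
qed

lemma prod_primes_dvd:
  assumes "finite A" "\<And>p. p \<in> A \<Longrightarrow> prime p" "\<And>p. p \<in> A \<Longrightarrow> p dvd (N :: nat)"
  shows "\<Prod>A dvd N"
  using assms
proof (induction A rule: finite_induct)
  case (insert p A)
  have "coprime p (\<Prod>A)"
    using insert by (intro prod_coprime_right) (metis insertI1 insertI2 primes_coprime)
  then show ?case using insert by (simp add: divides_mult)
qed simp

text \<open>Erdos's induction: for \<open>x = 2 * m + 1\<close> the primes above
  \<open>m + 1\<close> divide \<open>x choose m\<close>, which is at most \<open>4 ^ m\<close>; even
  \<open>x > 2\<close> are not prime.\<close>

lemma primorial_le: "\<Prod>(primes_upto x) \<le> 4 ^ x"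
proof (induction x rule: less_induct)
  case (less x)
  consider "x \<le> 2" | "x > 2" "even x" | "x > 2" "odd x" by linarith
  then show ?case
  proof cases
    case 1
    then have "primes_upto x \<subseteq> {2}" unfolding primes_upto_def using prime_ge_2_nat le_antisym le_trans by blast
    then consider "primes_upto x = {}" | "primes_upto x = {2}" "x \<ge> 2" unfolding primes_upto_def by blast
    then show ?thesis using 1 by cases auto
  next
    case 2
    have "\<not> prime x" using 2 prime_odd_nat by auto
    then have "primes_upto x = primes_upto (x - 1)" unfolding primes_upto_def using le_eq_less_or_eq by fastforce
    then have "\<Prod>(primes_upto x) \<le> 4 ^ (x - 1)" using less[of "x - 1"] 2 by simp
    also have "(4 :: nat) ^ (x - 1) \<le> 4 ^ x" by (rule power_increasing) auto
    finally show ?thesis .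
  next
    case 3
    obtain m where m: "x = 2 * m + 1" using 3 oddE by blast
    have m1: "m \<ge> 1" using 3 m by simp
    define B where "B = {p. prime p \<and> m + 1 < p \<and> p \<le> x}"
    have finB: "finite B" unfolding B_def by (rule finite_subset[of _ "{..x}"]) auto
    have "\<Prod>B dvd (2 * m + 1) choose m"
    proof (rule prod_primes_dvd[OF finB])
      fix p assume p: "p \<in> B"
      then show "prime p" unfolding B_def by simp
      have "fact m * fact (m + 1) * ((2 * m + 1) choose m) = (fact x :: nat)"
        using binomial_fact_lemma[of m "2 * m + 1"] unfolding m by simp
      moreover have "p dvd (fact x :: nat)" "\<not> p dvd (fact m :: nat)" "\<not> p dvd (fact (m + 1) :: nat)"
        using p unfolding B_def by (auto simp: prime_dvd_fact_iff simp del: fact_Suc)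
      ultimately show "p dvd (2 * m + 1) choose m" using \<open>prime p\<close> prime_dvd_multD by metis
    qed
    then have "\<Prod>B \<le> (2 * m + 1) choose m" by (intro dvd_imp_le) auto
    then have B: "\<Prod>B \<le> 4 ^ m" using binomial_middle_le[of m] by linarith
    have "primes_upto x = primes_upto (m + 1) \<union> B" unfolding primes_upto_def B_def using m by auto
    moreover have "primes_upto (m + 1) \<inter> B = {}" unfolding primes_upto_def B_def by auto
    ultimately have "\<Prod>(primes_upto x) = \<Prod>(primes_upto (m + 1)) * \<Prod>B"
      using finB by (simp add: prod.union_disjoint)
    also have "\<dots> \<le> 4 ^ (m + 1) * 4 ^ m" using less[of "m + 1"] B m m1 by (intro mult_mono) auto
    also have "\<dots> = 4 ^ x" unfolding m by (simp add: power_add[symmetric] mult_2)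
    finally show ?thesis .
  qed
qed

text \<open>For the induction the hypothesis \<open>n = a + b\<close> has to be weakened, as a carry may occur when dividing by \<open>p\<close>.\<close>

lemma multiplicity_fact_quotient:
  assumes p: "prime (p :: nat)" and "n \<ge> 1" "a + b \<le> n" "n \<le> a + b + 1"
  shows "\<exists>e. p ^ e \<le> n \<and> multiplicity p (fact n :: nat) \<le> multiplicity p (fact a :: nat) + multiplicity p (fact b :: nat) + e"
  using assms(2-4)
proof (induction n arbitrary: a b rule: less_induct)
  case (less n)
  have p1: "p > 1" using p prime_gt_1_nat by blast
  show ?case
  proof (cases "n < p")
    case True
    then have "multiplicity p (fact n :: nat) = 0" using multiplicity_fact_div[OF p, of n] by simp
    then show ?thesis using less.prems by (intro exI[of _ 0]) simp
  next
    case False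
    have "n div p < n" using less.prems p1 by simp
    moreover have n1: "n div p \<ge> 1" using False p1 by (simp add: div_greater_zero_iff Suc_le_eq)
    moreover have "a div p + b div p \<le> n div p"
    proof -
      have "a div p + b div p \<le> (a + b) div p" using div_add1_eq[of a b p] by simp
      also have "\<dots> \<le> n div p" using less.prems by (intro div_le_mono)
      finally show ?thesis .
    qed
    moreover have "n div p \<le> a div p + b div p + 1"
    proof -
      have "a mod p < p" "b mod p < p" using p1 by auto
      then have "a < p * (a div p) + p" "b < p * (b div p) + p"
        using mult_div_mod_eq[of p a] mult_div_mod_eq[of p b] by linarith+
      then have "n < p * (a div p + b div p + 2)" using less.prems by (simp add: algebra_simps)
      then have "n div p < a div p + b div p + 2" by (simp add: less_mult_imp_div_less mult.commute)
      then show ?thesis by simp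
    qed
    ultimately obtain e where e: "p ^ e \<le> n div p" "multiplicity p (fact (n div p) :: nat) \<le> multiplicity p (fact (a div p) :: nat) + multiplicity p (fact (b div p) :: nat) + e"
      using less.IH[of "n div p" "a div p" "b div p"] by blast
    have "p * p ^ e \<le> p * (n div p)" using e(1) by simp
    also have "\<dots> \<le> n" by simp
    finally have "p ^ Suc e \<le> n" by simp
    moreover have "multiplicity p (fact n :: nat) \<le> multiplicity p (fact a :: nat) + multiplicity p (fact b :: nat) + Suc e"
      using e(2) \<open>n div p \<le> a div p + b div p + 1\<close>
      unfolding multiplicity_fact_div[OF p, of n] multiplicity_fact_div[OF p, of a] multiplicity_fact_div[OF p, of b] by linarith
    ultimately show ?thesis by blast
  qed
qed

text \<open>Each power of \<open>p\<close> up to \<open>n\<close> contributes at most 1 to the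
  exponent.\<close>

lemma prime_power_binomial_le:
  assumes p: "prime (p :: nat)" and k: "k \<le> n" and n: "n \<ge> 1"
  shows "p ^ multiplicity p (n choose k) \<le> n"
proof -
  have p1: "p > 1" using p prime_gt_1_nat by blast
  obtain e where e: "p ^ e \<le> n" "multiplicity p (fact n :: nat) \<le> multiplicity p (fact k :: nat) + multiplicity p (fact (n - k) :: nat) + e"
    using multiplicity_fact_quotient[OF p n, of k "n - k"] k by auto
  have "multiplicity p (fact n :: nat) = multiplicity p (fact k * fact (n - k) * (n choose k) :: nat)"
    using binomial_fact_lemma[OF k] by simp
  also have "\<dots> = multiplicity p (fact k :: nat) + multiplicity p (fact (n - k) :: nat) + multiplicity p (n choose k)"
    using p k by (simp add: prime_elem_multiplicity_mult_distrib)
  finally have "multiplicity p (n choose k) \<le> e" using e(2) by simp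
  then have "p ^ multiplicity p (n choose k) \<le> p ^ e" using p1 by (intro power_increasing) auto
  then show ?thesis using e(1) by simp
qed

text \<open>Otherwise \<open>n\<close> and \<open>n - k\<close> have the same quotient by
  \<open>p\<close>, and as \<open>k < p\<close>, the prime occurs equally often in
  \<open>fact n\<close> and in the denominator.\<close>

lemma prime_dvd_binomialD:
  assumes p: "prime (p :: nat)" and d: "p dvd n choose k" and k: "k < p"
  shows "n mod p < k"
proof (rule ccontr)
  assume "\<not> n mod p < k"
  then have k': "k \<le> n mod p" by simp
  have p1: "p > 0" using p prime_gt_0_nat by blast
  have kn: "k \<le> n" using k' mod_less_eq_dividend le_trans by blast
  have nk: "(n - k) div p = n div p"
  proof -
    have "n - k = (n mod p - k) + p * (n div p)" using k' mult_div_mod_eq[of p n] by linarith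
    then have "(n - k) div p = (n mod p - k) div p + n div p" using p1 by simp
    moreover have "n mod p - k < p" using p1 by (meson less_imp_diff_less mod_less_divisor)
    ultimately show ?thesis by simp
  qed
  have "multiplicity p (fact n :: nat) = multiplicity p (fact k * fact (n - k) * (n choose k) :: nat)"
    using binomial_fact_lemma[OF kn] by simp
  also have "\<dots> = multiplicity p (fact k :: nat) + multiplicity p (fact (n - k) :: nat) + multiplicity p (n choose k)"
    using p kn by (simp add: prime_elem_multiplicity_mult_distrib)
  finally have "multiplicity p (n choose k) = 0"
    using multiplicity_fact_div[OF p, of n] multiplicity_fact_div[OF p, of "n - k"] nk by simp
  moreover have "n choose k \<noteq> 0" using kn by simp
  ultimately show False using d p not_dvd_imp_multiplicity_0 multiplicity_eq_zero_iff[of "n choose k" p] p1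
    by (metis not_prime_unit)
qed

section \<open>Estimates of binomial coefficients\<close>

lemma binomial_prime_prod:
  assumes "k \<le> n"
  shows "n choose k = (\<Prod>p\<in>prime_factors (n choose k). p ^ multiplicity p (n choose k))"
  using prod_prime_factors[of "n choose k"] assms by simp

text \<open>That is, \<open>fact k\<close> is at most \<open>e k (k / e) ^ k\<close>; the induction
  uses that \<open>ln (k + 1) - ln k\<close> is at least \<open>1 / (k + 1)\<close>.\<close>

lemma ln_fact_le:
  assumes "k \<ge> 1" shows "ln (fact k) \<le> 1 + ln (real k) + real k * ln (real k) - real k"
  using assms
proof (induction k rule: dec_induct)
  case base
  show ?case by simp
next
  case (step k)
  have k: "real k > 0" using step by simp
  have "ln (real (Suc k)) - ln (real k) \<ge> 1 / real (Suc k)"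
  proof -
    have "ln (real k / real (Suc k)) \<le> real k / real (Suc k) - 1" using k by (intro ln_le_minus_one) simp
    also have "\<dots> = - (1 / real (Suc k))" by (simp add: field_simps)
    finally show ?thesis using k by (simp add: ln_div)
  qed
  then have "real (Suc k) * (1 / real (Suc k)) \<le> real (Suc k) * (ln (real (Suc k)) - ln (real k))" by (intro mult_left_mono) auto
  then have 1: "1 + (real k + 1) * ln (real k) \<le> (real k + 1) * ln (real (Suc k))" by (simp add: algebra_simps)
  have "ln (fact (Suc k)) = ln (real (Suc k)) + ln (fact k)" by (simp add: ln_mult del: of_nat_Suc)
  also have "\<dots> \<le> ln (real (Suc k)) + (1 + ln (real k) + real k * ln (real k) - real k)" using step by simp
  also have "\<dots> \<le> 1 + ln (real (Suc k)) + real (Suc k) * ln (real (Suc k)) - real (Suc k)"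
    using 1 by (simp add: algebra_simps)
  finally show ?case .
qed

text \<open>Each of the \<open>k\<close> factors of the numerator is at least
  \<open>n - k\<close>.\<close>

lemma ln_binomial_ge:
  assumes "k \<ge> 1" "k < n"
  shows "ln (real (n choose k)) \<ge> real k * ln (real n / real k - 1) + real k - 1 - ln (real k)"
proof -
  have k: "real k > 0" "real n - real k > 0" using assms by auto
  have "(real n - real k) ^ k \<le> real (n choose k) * fact k"
  proof -
    have "(real n - real k) ^ k = (\<Prod>i = 0..<k. real n - real k)" by simp
    also have "\<dots> \<le> (\<Prod>i = 0..<k. real n - real i)" using assms by (intro prod_mono) auto
    also have "\<dots> = real (n choose k) * fact k"
      using gbinomial_mult_fact'[of "real n" k] by (simp add: binomial_gbinomial)
    finally show ?thesis .
  qed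
  moreover have "real (n choose k) > 0" using assms by simp
  ultimately have "ln ((real n - real k) ^ k) \<le> ln (real (n choose k) * fact k)" using k by (subst ln_le_cancel_iff) auto
  then have "real k * ln (real n - real k) \<le> ln (real (n choose k)) + ln (fact k)"
    using k \<open>real (n choose k) > 0\<close> by (simp add: ln_mult ln_realpow)
  moreover have "ln (real n / real k - 1) = ln (real n - real k) - ln (real k)"
  proof -
    have "real n / real k - 1 = (real n - real k) / real k" using k by (simp add: diff_divide_distrib)
    then show ?thesis using k by (simp add: ln_div)
  qed
  then have "real k * ln (real n / real k - 1) = real k * ln (real n - real k) - real k * ln (real k)" by (simp add: right_diff_distrib)
  ultimately show ?thesis using ln_fact_le[OF assms(1)] by linarith
qed

lemma prod_prime_powers_le:
  assumes A: "A \<subseteq> prime_factors (n choose k)" and k: "k \<le> n" "n \<ge> 1"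
  shows "(\<Prod>p\<in>A. p ^ multiplicity p (n choose k)) \<le> n ^ card A"
proof -
  have "(\<Prod>p\<in>A. p ^ multiplicity p (n choose k)) \<le> (\<Prod>p\<in>A. n)"
  proof (intro prod_mono conjI)
    fix p assume "p \<in> A"
    then have "prime p" using A by auto
    then show "p ^ multiplicity p (n choose k) \<le> n" using prime_power_binomial_le k by blast
  qed simp
  then show ?thesis by simp
qed

lemma binomial_le_power:
  assumes k: "k \<le> n" "n \<ge> 1" and y: "\<And>p. prime p \<Longrightarrow> p dvd n choose k \<Longrightarrow> p \<le> y"
  shows "n choose k \<le> n ^ card (primes_upto y)"
proof -
  have sub: "prime_factors (n choose k) \<subseteq> primes_upto y"
    unfolding primes_upto_def using y by (auto simp: in_prime_factors_iff)
  have "n choose k \<le> n ^ card (prime_factors (n choose k))"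
    using prod_prime_powers_le[OF subset_refl k] binomial_prime_prod[OF k(1)] by metis
  also have "\<dots> \<le> n ^ card (primes_upto y)" using k(2) card_mono[OF _ sub] by (intro power_increasing) auto
  finally show ?thesis .
qed

text \<open>Primes up to \<open>s\<close>, about the square root of \<open>n\<close>, and those in
  \<open>E\<close> contribute at most \<open>n\<close> each. A larger prime occurs at most once,
  since its square exceeds \<open>n\<close>, and the product of these is bounded by the primorial of
  \<open>m\<close>.\<close>

lemma binomial_le_power_primorial:
  assumes k: "k \<le> n" "n \<ge> 1" and s: "n < (s + 1) * (s + 1)"
    and E: "finite E" "\<And>p. prime p \<Longrightarrow> p dvd n choose k \<Longrightarrow> p \<le> m \<or> p \<in> E"
  shows "n choose k \<le> n ^ (card (primes_upto s) + card E) * 4 ^ m"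
proof -
  define F where "F = prime_factors (n choose k)"
  define w where "w p = p ^ multiplicity p (n choose k)" for p
  have fin: "finite F" unfolding F_def by simp
  define A where "A = {p\<in>F. p \<le> s \<or> p \<in> E}"
  define B where "B = F - A"
  have sub: "A \<subseteq> primes_upto s \<union> E" unfolding A_def F_def primes_upto_def by auto
  have "card A \<le> card (primes_upto s \<union> E)" by (rule card_mono[OF _ sub]) (simp add: E(1))
  also have "\<dots> \<le> card (primes_upto s) + card E" by (rule card_Un_le)
  finally have cA: "card A \<le> card (primes_upto s) + card E" .
  have "prod w A \<le> n ^ card A" unfolding w_def by (rule prod_prime_powers_le[OF _ k]) (auto simp: A_def F_def)
  also have "\<dots> \<le> n ^ (card (primes_upto s) + card E)" using k(2) cA by (intro power_increasing) auto
  finally have wA: "prod w A \<le> n ^ (card (primes_upto s) + card E)" .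
  have "prod w B \<le> \<Prod>B"
  proof (intro prod_mono conjI)
    fix p assume p: "p \<in> B"
    then have pr: "prime p" "p > s" unfolding B_def A_def F_def by auto
    have "multiplicity p (n choose k) \<le> 1"
    proof (rule ccontr)
      assume "\<not> multiplicity p (n choose k) \<le> 1"
      then have "p ^ 2 \<le> p ^ multiplicity p (n choose k)" using prime_gt_0_nat[OF pr(1)] by (intro power_increasing) auto
      also have "\<dots> \<le> n" by (rule prime_power_binomial_le[OF pr(1) k])
      finally have "p * p \<le> n" by (simp add: power2_eq_square)
      moreover have "(s + 1) * (s + 1) \<le> p * p" using pr(2) by (intro mult_mono) auto
      ultimately show False using s by linarith
    qed
    then have "p ^ multiplicity p (n choose k) \<le> p ^ 1" using prime_gt_0_nat[OF pr(1)] by (intro power_increasing) auto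
    then show "w p \<le> p" unfolding w_def by simp
  qed simp
  also have "\<dots> \<le> \<Prod>(primes_upto m)"
  proof (rule dvd_imp_le)
    have "B \<subseteq> primes_upto m" using E(2) unfolding B_def A_def F_def primes_upto_def by (auto simp: in_prime_factors_iff)
    then show "\<Prod>B dvd \<Prod>(primes_upto m)" by (intro prod_dvd_prod_subset) auto
    show "\<Prod>(primes_upto m) > 0" using prime_gt_0_nat by (intro prod_pos) (auto simp: primes_upto_def)
  qed
  also have "\<dots> \<le> 4 ^ m" by (rule primorial_le)
  finally have wB: "prod w B \<le> 4 ^ m" .
  have "n choose k = prod w F" using binomial_prime_prod[OF k(1)] unfolding w_def F_def .
  also have "\<dots> = prod w B * prod w A" using prod.subset_diff[of A F w] fin unfolding B_def A_def by auto
  also have "\<dots> \<le> 4 ^ m * n ^ (card (primes_upto s) + card E)" using wA wB by (intro mult_mono) auto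
  finally show ?thesis by (simp add: mult.commute)
qed

lemma exp_1_ge: "exp (1::real) \<ge> 2711 / 1000"
proof -
  \<comment> \<open>The fraction is the quadratic Taylor polynomial of \<open>exp\<close> at
    1/8.\<close>
  have "(145 / 128 :: real) \<le> exp (1 / 8)" using exp_lower_Taylor_quadratic[of "1 / 8 :: real"] by (simp add: power2_eq_square)
  then have "(145 / 128 :: real) ^ 8 \<le> exp (1 / 8) ^ 8" by (intro power_mono) auto
  also have "exp (1 / 8 :: real) ^ 8 = exp 1" by (simp add: exp_of_nat_mult[symmetric])
  finally show ?thesis by (simp add: power_divide)
qed

lemma exp_1_le: "exp (1::real) \<le> 272 / 100"
proof -
  obtain t :: real where t: "\<bar>t\<bar> \<le> \<bar>1\<bar>" "exp 1 = (\<Sum>m<7. 1 ^ m / fact m) + exp t / fact 7 * 1 ^ 7"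
    using Maclaurin_exp_le[of 1 7] by blast
  have "exp t \<le> exp 1" using t(1) by simp
  then have "exp t \<le> 3" using exp_le by linarith
  then show ?thesis using t(2) by (simp add: eval_nat_numeral)
qed

text \<open>As 2711/1000 is a lower bound of \<open>exp 1\<close>, a rational bound for a logarithm
  becomes a comparison of powers of rational numbers.\<close>

lemma ln_le_frac:
  assumes "x > 0" "b > 0" "x ^ b \<le> (2711 / 1000) ^ a" shows "ln (x :: real) \<le> real a / real b"
proof -
  have "x ^ b \<le> exp 1 ^ a" using assms(3) power_mono[OF exp_1_ge, of a] by simp
  then have "ln (x ^ b) \<le> ln (exp 1 ^ a)" using assms(1) by (subst ln_le_cancel_iff) auto
  then have "real b * ln x \<le> real a" using assms(1) by (simp add: ln_realpow)
  then show ?thesis using assms(2) by (simp add: field_simps)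
qed

lemma ln_ge_frac:
  assumes "x > 0" "b > 0" "(272 / 100) ^ a \<le> x ^ b" shows "ln (x :: real) \<ge> real a / real b"
proof -
  have "exp 1 ^ a \<le> (272 / 100 :: real) ^ a" using exp_1_le by (intro power_mono) auto
  then have "exp 1 ^ a \<le> x ^ b" using assms(3) by linarith
  then have "ln (exp 1 ^ a) \<le> ln (x ^ b)" using assms(1) by (subst ln_le_cancel_iff) auto
  then have "real a \<le> real b * ln x" using assms(1) by (simp add: ln_realpow)
  then show ?thesis using assms(2) by (simp add: field_simps)
qed

lemma ln_bounds:
  "ln (3/2::real) \<le> 5/12" "ln (4::real) \<le> 7/5" "ln (3::real) \<ge> 12/11" "ln (7::real) \<le> 2" "ln (7::real) \<ge> 19/10"
  "ln (60::real) \<le> 33/8" "ln (60::real) \<ge> 4" "ln (840::real) \<le> 34/5" "ln (36::real) \<le> 18/5"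
  "ln (8::real) \<ge> 29/14" "ln (50::real) \<le> 4" "ln (150::real) \<le> 51/10" "ln (600::real) \<le> 13/2" "ln (1296::real) \<le> 36/5"
proof -
  show "ln (3/2::real) \<le> 5/12" using ln_le_frac[of "3/2" 12 5] by (simp add: power_divide)
  show "ln (4::real) \<le> 7/5" using ln_le_frac[of "4" 5 7] by (simp add: power_divide)
  show "ln (3::real) \<ge> 12/11" using ln_ge_frac[of "3" 11 12] by (simp add: power_divide)
  show "ln (7::real) \<le> 2" using ln_le_frac[of "7" 1 2] by (simp add: power_divide)
  show "ln (7::real) \<ge> 19/10" using ln_ge_frac[of "7" 10 19] by (simp add: power_divide)
  show "ln (60::real) \<le> 33/8" using ln_le_frac[of "60" 8 33] by (simp add: power_divide)
  show "ln (60::real) \<ge> 4" using ln_ge_frac[of "60" 1 4] by (simp add: power_divide)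
  show "ln (840::real) \<le> 34/5" using ln_le_frac[of "840" 5 34] by (simp add: power_divide)
  show "ln (36::real) \<le> 18/5" using ln_le_frac[of "36" 5 18] by (simp add: power_divide)
  show "ln (8::real) \<ge> 29/14" using ln_ge_frac[of "8" 14 29] by (simp add: power_divide)
  show "ln (50::real) \<le> 4" using ln_le_frac[of "50" 1 4] by (simp add: power_divide)
  show "ln (150::real) \<le> 51/10" using ln_le_frac[of "150" 10 51] by (simp add: power_divide)
  show "ln (600::real) \<le> 13/2" using ln_le_frac[of "600" 2 13] by (simp add: power_divide)
  show "ln (1296::real) \<le> 36/5" using ln_le_frac[of "1296" 5 36] by (simp add: power_divide)
qed

text \<open>With \<open>t = n / k\<close> the left side bounds \<open>ln (n choose k)\<close> from
  below. On the right, \<open>4 * k / 15 + 77 / 15\<close> bounds the number of primes up to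
  \<open>k + 8\<close>, each of which contributes at most \<open>ln n\<close>.\<close>

lemma small_k_inequality:
  assumes k: "30 \<le> k" "k \<le> 1296" and t: "8 \<le> (t::real)"
  shows "k * ln (t - 1) + k - 1 - ln k > (4 * k / 15 + 77 / 15) * (ln k + ln t)"
proof -
  have "(29/14 * (11 * k / 15 - 77/15)) \<le> ln t * (11 * k / 15 - 77/15)"
  proof (rule mult_right_mono)
    have "ln 8 \<le> ln t" using t by simp
    then show "29/14 \<le> ln t" using ln_bounds(10) by linarith
  qed (use k in simp)
  moreover have "ln t - ln (t - 1) \<le> 1/7"
  proof -
    have "ln t - ln (t - 1) = ln (t / (t - 1))" using t by (simp add: ln_div)
    also have "\<dots> \<le> t / (t - 1) - 1" using t by (intro ln_le_minus_one) simp
    also have "\<dots> = 1 / (t - 1)" using t by (simp add: field_simps)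
    also have "\<dots> \<le> 1 / 7" using t by (intro divide_left_mono) auto
    finally show ?thesis .
  qed
  then have "k * (ln t - ln (t - 1)) \<le> k * (1 / 7)" using k by (intro mult_left_mono) auto
  \<comment> \<open>The estimates in \<open>t\<close> leave an inequality in \<open>k\<close> alone,
    in which \<open>k\<close> has the coefficient \<open>41 / 14 = 29 / 14 + 1 - 1 / 7\<close>. On
    each subinterval \<open>ln k\<close> is replaced by its value at the right end.\<close>
  moreover have "(4 * k / 15 + 92 / 15) * ln k < 41 / 14 * k - 1 - (4 * k / 15 + 77 / 15) * (29 / 14)"
  proof -
    have bound: "(4 * k / 15 + 92 / 15) * ln k \<le> (4 * k / 15 + 92 / 15) * L" if "k \<le> b" "ln b \<le> L" for b L
    proof (rule mult_left_mono)
      have "ln k \<le> ln b" using that k by simp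
      then show "ln k \<le> L" using that by linarith
    qed (use k in simp)
    consider "k \<le> 50" | "50 \<le> k" "k \<le> 150" | "150 \<le> k" "k \<le> 600" | "600 \<le> k" by linarith
    then show ?thesis
    proof cases
      case 1 then show ?thesis using bound[OF 1 ln_bounds(11)] k by (simp add: field_simps)
    next
      case 2 then show ?thesis using bound[OF 2(2) ln_bounds(12)] k by (simp add: field_simps)
    next
      case 3 then show ?thesis using bound[OF 3(2) ln_bounds(13)] k by (simp add: field_simps)
    next
      case 4 then show ?thesis using bound[OF k(2) ln_bounds(14)] k by (simp add: field_simps)
    qed
  qed
  moreover define X Y W where "X = k * ln k" and "Y = k * ln t" and "W = k * ln (t - 1)"
  ultimately have "29/14 * (11 * k / 15 - 77/15) \<le> 11/15 * Y - 77/15 * ln t" "Y - W \<le> k / 7"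
    "4/15 * X + 92/15 * ln k < 41/14 * k - 1 - (4 * k / 15 + 77/15) * (29/14)"
    by (simp_all add: algebra_simps)
  then have "4/15 * X + 77/15 * ln k + (4/15 * Y + 77/15 * ln t) < W + k - 1 - ln k" by argo
  moreover have "(4 * k / 15 + 77 / 15) * (ln k + ln t) = 4/15 * X + 77/15 * ln k + (4/15 * Y + 77/15 * ln t)"
    unfolding X_def Y_def by (simp add: field_simps)
  ultimately show ?thesis unfolding W_def by linarith
qed

text \<open>Bounding \<open>ln z\<close> by its tangent at 36 makes both sides linear in
  \<open>z\<close>; the two conditions \<open>c\<close> compare their values at 36 and their slopes.
  The logarithm of \<open>t\<close> is replaced by its bounds on the interval, and \<open>U\<close>
  bounds the square root of \<open>t\<close>.\<close>

lemma large_k_piece: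
  assumes z: "36 \<le> (z::real)" and t: "a \<le> t" "t \<le> b" "a > 0"
    and la: "la \<le> ln a" and lb: "ln b \<le> lb" and U: "b \<le> U\<^sup>2" "U > 0"
    and c: "(4 * U / 15 + 2/9) * (36/5 + lb) < 36 * (la - 49/60)" "(4 * U / 15 + 2/9) / 18 \<le> la - 49/60"
  shows "z * (ln t - 49/60) > (4 * sqrt t / 15 + 8 / z) * (2 * ln z + ln t)"
proof -
  have "ln a \<le> ln t" "ln t \<le> ln b" using t by auto
  then have lt: "la \<le> ln t" "ln t \<le> lb" using la lb by auto
  have "sqrt t \<le> sqrt (U\<^sup>2)" using t(2) U(1) by (intro real_sqrt_le_mono) simp
  then have "sqrt t \<le> U" using U(2) by simp
  moreover have "8 / z \<le> 2/9" using z by (simp add: field_simps)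
  ultimately have C: "4 * sqrt t / 15 + 8 / z \<le> 4 * U / 15 + 2/9" by simp
  have "ln (z / 36) \<le> z / 36 - 1" using z by (intro ln_le_minus_one) simp
  then have lz: "2 * ln z \<le> 26/5 + z / 18" using z ln_bounds(9) by (simp add: ln_div)
  have C0: "0 \<le> 4 * U / 15 + 2/9" using U(2) by simp
  have "0 \<le> (4 * U / 15 + 2/9) / 18" using C0 by simp
  also have "\<dots> \<le> la - 49/60" by (rule c(2))
  also have "\<dots> \<le> ln t" using lt(1) by simp
  finally have "0 \<le> ln t" .
  moreover have "0 \<le> ln z" using z by simp
  ultimately have "(4 * sqrt t / 15 + 8 / z) * (2 * ln z + ln t) \<le> (4 * U / 15 + 2/9) * (26/5 + z / 18 + lb)"
    using C C0 lz lt by (intro mult_mono) auto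
  also have "\<dots> = (4 * U / 15 + 2/9) * (36/5 + lb) + (4 * U / 15 + 2/9) / 18 * (z - 36)"
  proof -
    have "C * (26/5 + z / 18 + lb) = C * (36/5 + lb) + C / 18 * (z - 36)" for C by (simp add: distrib_left right_diff_distrib)
    then show ?thesis .
  qed
  also have "\<dots> < 36 * (la - 49/60) + (la - 49/60) * (z - 36)"
    using c z mult_right_mono[OF c(2), of "z - 36"] by linarith
  also have "\<dots> = z * (la - 49/60)"
  proof -
    have "36 * D + D * (z - 36) = z * D" for D by (simp add: algebra_simps)
    then show ?thesis .
  qed
  also have "\<dots> \<le> z * (ln t - 49/60)" using z lt by simp
  finally show ?thesis .
qed

text \<open>In \<open>binomial_not_smooth\<close>, \<open>z\<close> is the square root of
  \<open>m\<close> and \<open>t = n / m\<close>. There \<open>49 / 60 = 5 / 12 + 7 / 5 - 1\<close>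
  collects the bounds of \<open>ln (3 / 2)\<close> and \<open>ln 4\<close> and the summand
  \<open>m\<close> of the lower estimate.\<close>

lemma large_k_inequality:
  assumes z: "36 \<le> (z::real)" and t: "3 \<le> t" "t \<le> 840"
  shows "z\<^sup>2 * (ln t - 49/60) > (4 * (z * sqrt t) / 15 + 8) * (2 * ln z + ln t)"
proof -
  consider "t \<le> 7" | "7 \<le> t" "t \<le> 60" | "60 \<le> t" by linarith
  then have "z * (ln t - 49/60) > (4 * sqrt t / 15 + 8 / z) * (2 * ln z + ln t)"
  proof cases
    case 1
    show ?thesis by (rule large_k_piece[OF z t(1) 1 _ ln_bounds(3,4), where U = "53/20"]) (simp_all add: power2_eq_square)
  next
    case 2
    show ?thesis by (rule large_k_piece[OF z 2 _ ln_bounds(5,6), where U = "31/4"]) (simp_all add: power2_eq_square)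
  next
    case 3
    show ?thesis by (rule large_k_piece[OF z 3 t(2) _ ln_bounds(7,8), where U = "29"]) (simp_all add: power2_eq_square)
  qed
  then have "z * ((4 * sqrt t / 15 + 8 / z) * (2 * ln z + ln t)) < z * (z * (ln t - 49/60))" using z by (intro mult_strict_left_mono) auto
  moreover have "z * ((4 * sqrt t / 15 + 8 / z) * (2 * ln z + ln t)) = (4 * (z * sqrt t) / 15 + 8) * (2 * ln z + ln t)"
  proof -
    have "z * (4 * sqrt t / 15 + 8 / z) = 4 * (z * sqrt t) / 15 + 8" using z by (simp add: distrib_left)
    then show ?thesis by (metis mult.assoc)
  qed
  ultimately show ?thesis by (simp add: power2_eq_square mult.assoc)
qed

section \<open>Primes in short intervals\<close>

definition small_primes :: "int list" where
  "small_primes = [2, 3, 5, 7, 11, 13, 17, 19, 23, 29, 31, 37, 41, 43, 47, 53, 59, 61, 67, 71, 73, 79, 83, 89, 97, 101]"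

text \<open>Integers rather than natural numbers, because the code equations of the latter are unary.\<close>

definition prime_check :: "int \<Rightarrow> bool" where
  "prime_check p \<longleftrightarrow> 1 < p \<and> p < 10609 \<and> list_all (\<lambda>q. q < p \<longrightarrow> p mod q \<noteq> 0) small_primes"

lemma small_primes:
  assumes q: "prime q" "q < 103" shows "int q \<in> set small_primes"
proof (rule ccontr)
  assume n: "int q \<notin> set small_primes"
  \<comment> \<open>Trial division by 2, 3, 5 and 7 decides primality below 121.\<close>
  have "list_all (\<lambda>q. list_ex (\<lambda>x. x = q) small_primes \<or> q < 2 \<or> list_ex (\<lambda>d. d < q \<and> q mod d = 0) [2, 3, 5, 7]) [0..102]"
    by code_simp
  then have "\<forall>q\<in>set [0..102]. list_ex (\<lambda>x. x = q) small_primes \<or> q < 2 \<or> list_ex (\<lambda>d. d < q \<and> q mod d = 0) [2, 3, 5, 7]"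
    unfolding list_all_iff .
  moreover have "int q \<in> set [0..102]" using q by simp
  ultimately have "list_ex (\<lambda>x. x = int q) small_primes \<or> int q < 2 \<or> list_ex (\<lambda>d. d < int q \<and> int q mod d = 0) [2, 3, 5, 7]"
    by (rule bspec)
  moreover have "\<not> list_ex (\<lambda>x. x = int q) small_primes" unfolding list_ex_iff using n by blast
  moreover have "\<not> int q < 2" using prime_ge_2_nat[OF q(1)] by simp
  ultimately have "\<exists>d\<in>set [2, 3, 5, 7]. d < int q \<and> int q mod d = 0" by (simp only: list_ex_iff simp_thms)
  then obtain d where d: "d \<in> set [2, 3, 5, 7]" "d < int q \<and> int q mod d = 0" by (rule bexE)
  define d' where "d' = nat d"
  have "d = int d'" using d(1) unfolding d'_def by auto
  moreover have "d dvd int q" using d(2) by (simp only: mod_eq_0_iff_dvd)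
  ultimately have "d' dvd q" by (simp only: of_nat_dvd_iff)
  moreover have "1 < d" using d(1) by auto
  then have "1 < d'" "d' < q" using d(2) \<open>d = int d'\<close> by linarith+
  ultimately show False using q(1) by (auto simp: prime_nat_iff)
qed

lemma prime_check: "prime_check (int p) \<Longrightarrow> prime p"
proof -
  assume c: "prime_check (int p)"
  then have p: "p > 1" "p < 10609" and d: "\<And>d. d \<in> set small_primes \<Longrightarrow> d < int p \<Longrightarrow> int p mod d \<noteq> 0"
    unfolding prime_check_def by (auto simp: list_all_iff)
  show "prime p"
  proof (rule ccontr)
    assume "\<not> prime p"
    then obtain a where a: "a dvd p" "a \<noteq> 1" "a \<noteq> p" using p(1) prime_nat_iff by blast
    from a(1) obtain b where b: "p = a * b" by (rule dvdE)
    have ab: "a > 1" "b > 1" "a < p" "b < p"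
    proof -
      have "a * b \<noteq> 0" using b p(1) by linarith
      then have "a \<noteq> 0" "b \<noteq> 0" by (metis mult_0, metis mult_0_right)
      moreover have "b \<noteq> 1" using b a by auto
      ultimately have "a \<noteq> 0" "b \<noteq> 0" "b \<noteq> 1" by blast+
      then show "a > 1" "b > 1" using a by auto
      then show "a < p" "b < p" using b by auto
    qed
    \<comment> \<open>The bound 10609 in \<open>prime_check\<close> is the square of 103.\<close>
    have "a < 103 \<or> b < 103"
    proof (rule ccontr)
      assume "\<not> (a < 103 \<or> b < 103)"
      then have "103 * 103 \<le> a * b" by (intro mult_mono) auto
      then show False using p b by simp
    qed
    moreover have "c dvd p" if "c = a \<or> c = b" for c using that b by auto
    ultimately obtain c where c: "c dvd p" "1 < c" "c < p" "c < 103" using ab by blast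
    obtain q where q: "prime q" "q dvd c" using prime_factor_nat[of c] c by auto
    have "q \<le> c" using q c by (intro dvd_imp_le) auto
    then have "int q \<in> set small_primes" "int q < int p" using small_primes[OF q(1)] c by auto
    then have "int p mod int q \<noteq> 0" by (rule d)
    moreover have "int q dvd int p" using dvd_trans[OF q(2) c(1)] by (simp only: of_nat_dvd_iff)
    then have "int p mod int q = 0" by (rule dvd_imp_mod_0)
    ultimately show False by (rule notE)
  qed
qed

text \<open>Consecutive primes of the list have ratio less than \<open>8 / 7\<close>.\<close>

definition prime_chain :: "int list" where
  "prime_chain = [59, 67, 73, 83, 89, 101, 113, 127, 139, 157, 179, 199, 227, 257, 293, 331, 379, 433, 491, 557, 631, 719, 821,
    937, 1069, 1217, 1381, 1579, 1801, 2053, 2347, 2683, 3067, 3499, 3989, 4549, 5197, 5939, 6781, 7741, 8839, 10099]"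

lemma prime_in_interval:
  fixes n :: nat
  assumes "59 \<le> n" "n < 10368"
  obtains p where "prime p" "p \<le> n" "7 * n < 8 * p"
proof -
  have "list_all prime_check prime_chain" by code_simp
  then have primes: "\<And>p. p \<in> set prime_chain \<Longrightarrow> prime_check p" by (simp add: list_all_iff)
  \<comment> \<open>If \<open>n\<close> lies between neighbours \<open>p\<close> and
    \<open>q\<close> of the chain, then \<open>n \<le> q - 1\<close>, so
    \<open>7 * q < 8 * p + 7\<close> gives \<open>7 * n < 8 * p\<close>.\<close>
  have step: "(\<exists>p\<in>set (x # xs). p \<le> int n \<and> 7 * int n < 8 * p)"
    if "x \<le> int n" "successively (\<lambda>p q. 7 * q < 8 * p + 7) (x # xs)" "7 * int n < 8 * last (x # xs)" for x xs
    using that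
  proof (induction xs arbitrary: x)
    case (Cons y ys)
    show ?case
    proof (cases "y \<le> int n")
      case True
      then show ?thesis using Cons.IH[of y] Cons.prems by auto
    next
      case False
      then have "7 * int n < 8 * x" using Cons.prems(2) by simp
      then show ?thesis using Cons.prems(1) by auto
    qed
  qed auto
  have "\<exists>p\<in>set prime_chain. p \<le> int n \<and> 7 * int n < 8 * p"
    unfolding prime_chain_def by (rule step) (use assms in simp_all)
  then obtain p where p: "p \<in> set prime_chain" "p \<le> int n" "7 * int n < 8 * p" by blast
  have e: "int (nat p) = p" using p(3) by simp
  have "prime (nat p)" using prime_check[of "nat p"] primes[OF p(1)] unfolding e by blast
  moreover have "nat p \<le> n" "7 * n < 8 * nat p" using p(2,3) e by linarith+
  ultimately show ?thesis by (rule that)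
qed

text \<open>All these primes are odd, and eight consecutive numbers contain four odd ones.\<close>

lemma card_primes_between: "card {p. prime p \<and> k < p \<and> p \<le> k + 8} \<le> 4" if "k \<ge> 2" for k :: nat
proof -
  let ?A = "{p. prime p \<and> k < p \<and> p \<le> k + 8}"
  have odd: "p = 2 * (p div 2) + 1" if "p \<in> ?A" for p
    using that \<open>k \<ge> 2\<close> prime_odd_nat[of p] by auto
  have inj: "inj_on (\<lambda>p. p div 2) ?A" using odd by (metis (no_types, lifting) inj_onI)
  have "(\<lambda>p. p div 2) ` ?A \<subseteq> {(k + 1) div 2..<(k + 1) div 2 + 4}"
  proof (rule image_subsetI)
    fix p assume "p \<in> ?A"
    then show "p div 2 \<in> {(k + 1) div 2..<(k + 1) div 2 + 4}" using odd[of p] by auto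
  qed
  then have "card ((\<lambda>p. p div 2) ` ?A) \<le> card {(k + 1) div 2..<(k + 1) div 2 + 4}" by (intro card_mono) auto
  then show ?thesis using card_image[OF inj] by simp
qed

text \<open>The prime occurs twice in \<open>fact n\<close> and once in each of
  \<open>fact k\<close> and \<open>fact (n - k)\<close>, as in Erdos's proof of Bertrand's
  postulate.\<close>

lemma not_dvd_binomial_third:
  assumes p: "prime (p :: nat)" "3 \<le> p" and k: "p \<le> k" "2 * k \<le> n" "n < 3 * p"
  shows "\<not> p dvd n choose k"
proof -
  have two: "multiplicity p (fact 2 :: nat) = 0" "multiplicity p (fact 1 :: nat) = 0"
    using multiplicity_fact_div[OF p(1), of 2] p(2) by simp_all
  have "n div p = 2" "k div p = 1" "(n - k) div p = 1" using k p(2) by (auto intro!: div_nat_eqI)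
  then have "multiplicity p (fact n :: nat) = 2" "multiplicity p (fact k :: nat) = 1" "multiplicity p (fact (n - k) :: nat) = 1"
    using multiplicity_fact_div[OF p(1), of n] multiplicity_fact_div[OF p(1), of k] multiplicity_fact_div[OF p(1), of "n - k"] two
    by simp_all
  moreover have "multiplicity p (fact n :: nat) = multiplicity p (fact k * fact (n - k) * (n choose k) :: nat)"
    using binomial_fact_lemma[of k n] k by simp
  then have "multiplicity p (fact n :: nat) = multiplicity p (fact k :: nat) + multiplicity p (fact (n - k) :: nat) + multiplicity p (n choose k)"
    using p k by (simp add: prime_elem_multiplicity_mult_distrib)
  ultimately have "multiplicity p (n choose k) = 0" by simp
  moreover have "n choose k \<noteq> 0" using k by simp
  ultimately show ?thesis using p(1) by (metis multiplicity_eq_zero_iff not_prime_unit)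
qed

text \<open>Applied with \<open>m = min k (n div 3)\<close>; by
  \<open>not_dvd_binomial_third\<close> no prime between \<open>m\<close> and \<open>k\<close>
  divides. Passing to \<open>n choose m\<close> makes the lower estimate refer to the same
  \<open>m\<close> as the factor \<open>4 ^ m\<close> from the primorial. The start 1296 is the
  square of 36.\<close>

lemma binomial_not_smooth:
  assumes m: "1296 \<le> m" "m \<le> k" "2 * k \<le> n" "3 * m \<le> n" "n \<le> 840 * m"
    and smooth: "\<And>p. prime p \<Longrightarrow> p dvd n choose k \<Longrightarrow> p \<le> m \<or> (k < p \<and> p \<le> k + 8)"
  shows False
proof -
  define s where "s = nat \<lfloor>sqrt (real n)\<rfloor>"
  define E where "E = {p. prime p \<and> k < p \<and> p \<le> k + 8}"
  have "real s = real_of_int \<lfloor>sqrt (real n)\<rfloor>" unfolding s_def by simp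
  then have s: "real s \<le> sqrt (real n)" "sqrt (real n) < real s + 1" by linarith+
  have "sqrt (real n) * sqrt (real n) < (real s + 1) * (real s + 1)" using s(2) by (intro mult_strict_mono) auto
  then have "real n < real ((s + 1) * (s + 1))" by (simp add: algebra_simps)
  then have sn: "n < (s + 1) * (s + 1)" by (simp only: of_nat_less_iff)
  have finE: "finite E" unfolding E_def by (rule finite_subset[of _ "{..k + 8}"]) auto
  have cE: "card E \<le> 4" unfolding E_def using m by (intro card_primes_between) simp
  have k: "k \<le> n" "n \<ge> 1" using m by auto
  have n0: "real n > 0" "real m > 0" using m by auto
  have "n choose m \<le> n choose k" using m by (intro binomial_mono) auto
  also have "\<dots> \<le> n ^ (card (primes_upto s) + card E) * 4 ^ m"
    by (rule binomial_le_power_primorial[OF k sn finE]) (use smooth in \<open>auto simp: E_def\<close>)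
  finally have "real (n choose m) \<le> real (n ^ (card (primes_upto s) + card E) * 4 ^ m)" by (simp only: of_nat_le_iff)
  moreover have "n choose m > 0" using m by simp
  ultimately have "ln (real (n choose m)) \<le> ln (real (n ^ (card (primes_upto s) + card E) * 4 ^ m))"
    by (metis ln_le_cancel_iff less_le_trans of_nat_0_less_iff)
  also have "\<dots> = real (card (primes_upto s) + card E) * ln (real n) + real m * ln 4"
    using n0 by (simp add: ln_mult ln_realpow del: of_nat_add)
  also have "\<dots> \<le> (4 * sqrt (real n) / 15 + 7) * ln (real n) + real m * (7/5)"
  proof (intro add_mono mult_mono)
    have "real (15 * card (primes_upto s)) \<le> real (4 * s + 45)" by (simp only: of_nat_le_iff card_primes_upto)
    then show "real (card (primes_upto s) + card E) \<le> 4 * sqrt (real n) / 15 + 7" using s(1) cE by simp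
  qed (use k ln_bounds(2) in auto)
  finally have up: "ln (real (n choose m)) \<le> (4 * sqrt (real n) / 15 + 7) * ln (real n) + real m * (7/5)" .
  define t where "t = real n / real m"
  have nt: "real n = real m * t" unfolding t_def using n0 by simp
  have "3 * real m \<le> real n" "real n \<le> 840 * real m" using m(4,5) by linarith+
  then have t: "3 \<le> t" "t \<le> 840" unfolding t_def using n0 by (auto simp: field_simps)
  have lnn: "ln (real n) = ln (real m) + ln t" unfolding nt using n0 t by (simp add: ln_mult)
  have "ln t - 5/12 \<le> ln (t - 1)"
  proof -
    have "ln (t / (3/2)) \<le> ln (t - 1)" using t by (subst ln_le_cancel_iff) auto
    moreover have "ln (t / (3/2)) = ln t - ln (3/2)" using t by (subst ln_div) auto
    ultimately show ?thesis using ln_bounds(1) by linarith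
  qed
  then have "real m * (ln t - 5/12) \<le> real m * ln (t - 1)" by (intro mult_left_mono) auto
  moreover have "real m * ln (t - 1) + real m - 1 - ln (real m) \<le> ln (real (n choose m))"
    unfolding t_def using m by (intro ln_binomial_ge) auto
  \<comment> \<open>This absorbs the lower order terms into one more \<open>ln n\<close> and turns 7
    into 8; the 7 consists of 3 from the sieve and 4 primes beyond \<open>k\<close>.\<close>
  moreover have "1 + ln (real m) \<le> ln (real n)"
  proof -
    have "ln 3 \<le> ln t" using t by simp
    then show ?thesis using lnn ln_bounds(3) by linarith
  qed
  ultimately have "real m * (ln t - 5/12) + real m - real m * (7/5) \<le> (4 * sqrt (real n) / 15 + 8) * ln (real n)"
    using up by (simp add: algebra_simps)
  then have le: "real m * (ln t - 49/60) \<le> (4 * sqrt (real n) / 15 + 8) * ln (real n)" by (simp add: algebra_simps)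
  define z where "z = sqrt (real m)"
  have z: "36 \<le> z" unfolding z_def by (rule real_le_rsqrt) (use m(1) in simp)
  have zm: "z\<^sup>2 = real m" unfolding z_def by simp
  have "sqrt (real n) = z * sqrt t" unfolding nt z_def by (rule real_sqrt_mult)
  moreover have "2 * ln z = ln (real m)" unfolding zm[symmetric] using z by (simp add: ln_realpow)
  ultimately show False using large_k_inequality[OF z t] le unfolding zm lnn by simp
qed

text \<open>For \<open>n < 8 * k\<close> a prime above \<open>7 * n / 8\<close> works while the
  table lasts. For \<open>n \<ge> 8 * k\<close> and \<open>k < 1296\<close> counting the primes up
  to \<open>k + 8\<close> is enough. Otherwise \<open>k\<close> and \<open>n div 3\<close> are both
  at least 1296, since the table ends at \<open>10368 = 8 * 1296\<close>, and the primorial is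
  used.\<close>

theorem prime_dvd_consecutive:
  fixes n k :: nat
  assumes k: "30 \<le> k" "2 * k \<le> n" "n \<le> 840 * k"
  obtains p where "prime p" "p > k + 8" "n mod p < k"
proof -
  consider "n < 8 * k" "n < 10368" | "8 * k \<le> n" "k < 1296" | "1296 \<le> min k (n div 3)" "n \<le> 840 * min k (n div 3)"
    using k(3) by linarith
  then show ?thesis
  proof cases
    case 1
    obtain p where p: "prime p" "p \<le> n" "7 * n < 8 * p" using prime_in_interval[of n] 1 k by auto
    have "n mod p = n - p" using p by (intro mod_nat_eqI) (auto simp: dvd_minus_self)
    then show ?thesis using that[of p] p 1 k by simp
  next
    case 2
    have "\<exists>p. prime p \<and> p > k + 8 \<and> n mod p < k"
    proof (rule ccontr)
      assume no: "\<nexists>p. prime p \<and> p > k + 8 \<and> n mod p < k"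
      have "n choose k \<le> n ^ card (primes_upto (k + 8))"
      proof (rule binomial_le_power)
        fix p assume p: "prime p" "p dvd n choose k"
        show "p \<le> k + 8"
        proof (rule ccontr)
          assume "\<not> p \<le> k + 8"
          then show False using no p prime_dvd_binomialD[OF p] by auto
        qed
      qed (use k in auto)
      moreover have "n choose k > 0" using k by simp
      ultimately have "ln (real (n choose k)) \<le> ln (real (n ^ card (primes_upto (k + 8))))"
        by (metis ln_le_cancel_iff less_le_trans of_nat_0_less_iff of_nat_le_iff)
      also have "\<dots> = real (card (primes_upto (k + 8))) * ln (real n)" using k by (simp add: ln_realpow)
      also have "\<dots> \<le> (4 * real k / 15 + 77 / 15) * ln (real n)"
      proof (rule mult_right_mono)
        have "15 * card (primes_upto (k + 8)) \<le> 4 * (k + 8) + 45" by (rule card_primes_upto)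
        then have "real (15 * card (primes_upto (k + 8))) \<le> real (4 * (k + 8) + 45)" by (simp only: of_nat_le_iff)
        then show "real (card (primes_upto (k + 8))) \<le> 4 * real k / 15 + 77 / 15" by simp
      qed (use k in simp)
      finally have up: "ln (real (n choose k)) \<le> (4 * real k / 15 + 77 / 15) * ln (real n)" .
      define t where "t = real n / real k"
      have "8 * real k \<le> real n" using 2 by linarith
      then have t: "8 \<le> t" unfolding t_def using k by (simp add: field_simps)
      have "ln (real n) = ln (real k) + ln t" unfolding t_def using k by (simp add: ln_div)
      moreover have "real k * ln (t - 1) + real k - 1 - ln (real k) \<le> ln (real (n choose k))"
        unfolding t_def using k by (intro ln_binomial_ge) auto
      ultimately show False using small_k_inequality[of "real k" t] t 2 k up by simp
    qed
    then show ?thesis using that by blast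
  next
    case 3
    have "\<exists>p. prime p \<and> p > k + 8 \<and> n mod p < k"
    proof (rule ccontr)
      assume no: "\<nexists>p. prime p \<and> p > k + 8 \<and> n mod p < k"
      show False
      proof (rule binomial_not_smooth[OF 3(1) _ k(2) _ 3(2)])
        fix p assume p: "prime p" "p dvd n choose k"
        have "p \<le> k + 8"
        proof (rule ccontr)
          assume "\<not> p \<le> k + 8"
          then show False using no p prime_dvd_binomialD[OF p] by auto
        qed
        moreover have "\<not> (n div 3 < p \<and> p \<le> k)"
        proof
          assume "n div 3 < p \<and> p \<le> k"
          moreover from this have "3 \<le> p" "n < 3 * p" using k by linarith+
          ultimately show False using not_dvd_binomial_third[OF p(1) _ _ k(2)] p(2) by blast
        qed
        ultimately show "p \<le> min k (n div 3) \<or> (k < p \<and> p \<le> k + 8)" by linarith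
      qed auto
    qed
    then show ?thesis using that by blast
  qed
qed

section \<open>Irreducibility\<close>

definition L_real :: "nat \<Rightarrow> nat \<Rightarrow> real poly" where
  "L_real r n = map_poly of_rat (L_poly r n)"

lemma coeff_L_real: "coeff (L_real r n) j = (if j \<le> n then real ((n - j + r) choose (n - j)) / fact j else 0)"
proof -
  have "(of_rat (fact j) :: real) = fact j" by (metis of_nat_fact of_rat_of_nat_eq)
  then show ?thesis unfolding L_real_def by (simp add: coeff_map_poly coeff_L of_rat_divide)
qed

lemma degree_L_real: "degree (L_real r n) = n"
  by (rule antisym) (auto intro: degree_le le_degree simp: coeff_L_real)

lemma lead_coeff_L_real: "lead_coeff (L_real r n) > 0"
  unfolding degree_L_real by (simp add: coeff_L_real)

lemma pderiv_L_real: "pderiv (L_real r (Suc n)) = L_real r n"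
proof (rule poly_eqI)
  fix j
  have "Suc n - Suc j + r = n - j + r" by simp
  then show "coeff (pderiv (L_real r (Suc n))) j = coeff (L_real r n) j"
    by (simp add: coeff_pderiv coeff_L_real)
qed

lemma L_real_0: "L_real 0 (Suc n) = L_real 0 n + monom (1 / fact (Suc n)) (Suc n)"
  by (rule poly_eqI) (auto simp: coeff_L_real le_Suc_eq)

text \<open>Pascal's rule. At a zero of \<open>L_real (Suc r) n\<close> it identifies the values of
  \<open>L_real (Suc r) (Suc n)\<close> and \<open>L_real r (Suc n)\<close>.\<close>

lemma L_real_Suc: "L_real (Suc r) (Suc n) = L_real (Suc r) n + L_real r (Suc n)"
proof (rule poly_eqI)
  fix j
  consider "j \<le> n" | "j = Suc n" | "j > Suc n" by linarith
  then show "coeff (L_real (Suc r) (Suc n)) j = coeff (L_real (Suc r) n + L_real r (Suc n)) j"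
  proof cases
    case 1
    then obtain m where m: "n = j + m" using le_Suc_ex by blast
    have "Suc m + Suc r choose Suc m = (m + Suc r choose m) + (Suc m + r choose Suc m)" by simp
    then show ?thesis unfolding m by (simp add: coeff_L_real Suc_diff_le add_divide_distrib del: binomial_Suc_Suc)
  qed (auto simp: coeff_L_real)
qed

lemma poly_even_ge_lead_coeff:
  fixes q :: "real poly"
  assumes "even (degree q)" "lead_coeff q > 0"
  shows "\<exists>M. \<forall>x. \<bar>x\<bar> \<ge> M \<longrightarrow> poly q x \<ge> lead_coeff q"
proof -
  obtain a where a: "\<And>x. x \<ge> a \<Longrightarrow> poly q x \<ge> lead_coeff q" using poly_pinfty_gt_lc[OF assms(2)] by blast
  define q' where "q' = q \<circ>\<^sub>p [:0, -1:]"
  have "lead_coeff q' = lead_coeff q" unfolding q'_def using assms(1) by (subst lead_coeff_comp) auto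
  then obtain b where b: "\<And>x. x \<ge> b \<Longrightarrow> poly q' x \<ge> lead_coeff q" using poly_pinfty_gt_lc[of q'] assms(2) by auto
  have "poly q x \<ge> lead_coeff q" if "\<bar>x\<bar> \<ge> max a b" for x
  proof (cases "x \<ge> 0")
    case True then show ?thesis using a[of x] that by simp
  next
    case False then show ?thesis using b[of "- x"] that unfolding q'_def by (simp add: poly_pcompose)
  qed
  then show ?thesis by blast
qed

text \<open>At a minimum the derivative \<open>L_real r (n - 1)\<close> vanishes, so there \<open>L_real r n\<close> coincides with
  \<open>L_real (r - 1) n\<close>, which is positive by induction.\<close>

lemma L_real_pos: "even n \<Longrightarrow> poly (L_real r n) x > 0"
proof (induction r arbitrary: x)
  have *: "poly (L_real r n) x > 0"
    if ev: "even n" and step: "\<And>x m. n = Suc m \<Longrightarrow> poly (L_real r m) x = 0 \<Longrightarrow> poly (L_real r n) x > 0" for r x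
  proof (cases n)
    case 0
    then have "L_real r n = [:1:]" by (intro poly_eqI) (auto simp: coeff_L_real coeff_pCons split: nat.split)
    then show ?thesis by simp
  next
    case (Suc m)
    let ?f = "poly (L_real r n)"
    show ?thesis
    proof (rule ccontr)
      assume "\<not> ?f x > 0"
      obtain M where M: "\<And>x. \<bar>x\<bar> \<ge> M \<Longrightarrow> ?f x > 0"
        using poly_even_ge_lead_coeff[of "L_real r n"] ev lead_coeff_L_real[of r n] unfolding degree_L_real by (metis less_le_trans)
      define K where "K = max M 1"
      have K: "K > 0" "\<And>x. \<bar>x\<bar> \<ge> K \<Longrightarrow> ?f x > 0" unfolding K_def using M by auto
      have x: "\<bar>x\<bar> < K" using K(2)[of x] \<open>\<not> ?f x > 0\<close> by (meson not_le)
      obtain y where y: "- K \<le> y" "y \<le> K" "\<And>z. - K \<le> z \<Longrightarrow> z \<le> K \<Longrightarrow> ?f y \<le> ?f z"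
        using isCont_eq_Lb[of "- K" K ?f] K(1) by auto
      have "?f y \<le> ?f x" using y(3)[of x] x by simp
      then have fy: "\<not> ?f y > 0" using \<open>\<not> ?f x > 0\<close> by linarith
      then have yK: "\<bar>y\<bar> < K" using K(2)[of y] by (meson not_le)
      have "poly (pderiv (L_real r n)) y = 0"
      proof (rule DERIV_local_min[OF poly_DERIV])
        show "0 < K - \<bar>y\<bar>" using yK by simp
        show "\<forall>z. \<bar>y - z\<bar> < K - \<bar>y\<bar> \<longrightarrow> ?f y \<le> ?f z" using y(3) by (auto simp: abs_if split: if_splits)
      qed
      then show False using step[OF Suc] fy unfolding Suc pderiv_L_real by blast
    qed
  qed
  {
    case 0
    show ?case
    proof (rule *[OF 0])
      fix x m assume n: "n = Suc m" and root: "poly (L_real 0 m) x = 0"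
      have "x \<noteq> 0"
      proof
        assume "x = 0"
        then show False using root by (simp add: poly_0_coeff_0 coeff_L_real)
      qed
      then have "x ^ n > 0" using 0 by (metis zero_less_power_eq)
      then show "poly (L_real 0 n) x > 0" unfolding n L_real_0 using root n by (simp add: poly_monom del: power_Suc)
    qed
  next
    case (Suc r)
    show ?case
    proof (rule *[OF Suc.prems])
      fix x m assume n: "n = Suc m" and root: "poly (L_real (Suc r) m) x = 0"
      show "poly (L_real (Suc r) n) x > 0" using Suc.IH[OF Suc.prems, of x] root unfolding n L_real_Suc by simp
    qed
  }
qed

lemma no_linear_factor:
  assumes "even n" "L_poly r n = g * h" shows "degree g \<noteq> 1"
proof
  assume "degree g = 1"
  define a b where "a = coeff g 0" and "b = coeff g 1"
  have g: "g = [:a, b:]"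
  proof (rule poly_eqI)
    fix i
    show "coeff g i = coeff [:a, b:] i"
      using coeff_eq_0[of g i] \<open>degree g = 1\<close> unfolding a_def b_def by (cases i; cases "i - 1") (auto simp: coeff_pCons)
  qed
  have "b \<noteq> 0" using leading_coeff_0_iff[of g] \<open>degree g = 1\<close> unfolding b_def by force
  define x where "x = - a / b"
  have "poly g x = 0" unfolding g x_def using \<open>b \<noteq> 0\<close> by simp
  then have "poly (L_poly r n) x = 0" unfolding assms(2) by simp
  have "poly (L_real r n) (of_rat x) = of_rat (poly (L_poly r n) x)"
    unfolding L_real_def by (simp add: poly_altdef degree_map_poly coeff_map_poly of_rat_sum of_rat_mult of_rat_power)
  then have "poly (L_real r n) (of_rat x) = 0" using \<open>poly (L_poly r n) x = 0\<close> by simp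
  then show False using L_real_pos[OF assms(1), of r "of_rat x"] by simp
qed

section \<open>Conditions on the degree of a factor\<close>

lemma factor_degree_mod_prime_power:
  assumes "prime p" "\<not> p dvd ((n + r) choose r)" "L_poly r n = g * h"
  shows "degree g mod p ^ e \<le> n mod p ^ e"
proof -
  obtain N where "nonarch p N" using nonarch_exists[OF assms(1)] .
  then interpret nonarch p N .
  show ?thesis by (rule factor_degree_mod[OF assms(2,3)])
qed

lemma factor_degree_edge:
  assumes "prime p" "prime d" "edge n r p d a m j0 j1" "\<not> d dvd a" "L_poly r n = g * h"
  shows "d \<le> degree g \<or> d \<le> degree h"
proof -
  obtain N where "nonarch p N" using nonarch_exists[OF assms(1)] .
  then interpret nonarch p N .
  show ?thesis by (rule edge_factor_degree[OF assms(3,2,4,5)])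
qed

text \<open>Here \<open>840\<close> is the least common multiple of \<open>1, \<dots>, 8\<close>.\<close>

lemma dvd_840_degree:
  assumes r: "r \<le> 8" and n: "n \<ge> 1" and fac: "L_poly r n = g * h"
  shows "n dvd 840 * degree g"
proof (cases "degree g = 0")
  case False
  show ?thesis
  proof (rule multiplicity_le_imp_dvd)
    fix p :: nat assume p: "prime p"
    define v where "v = multiplicity p n"
    have dv: "p ^ v dvd n" unfolding v_def by (rule multiplicity_dvd)
    have "p ^ v dvd 840 * degree g"
    \<comment> \<open>Prime powers up to 8 divide 840. For a larger one no carry occurs in
      \<open>n + r\<close>, and as \<open>n mod p ^ v = 0\<close>, it divides the degree of
      \<open>g\<close>.\<close>
    proof (cases "p ^ v \<le> 8")
      case True
      have cases8: "x = 1 \<or> x = 2 \<or> x = 3 \<or> x = 4 \<or> x = 5 \<or> x = 6 \<or> x = 7 \<or> x = 8" if "x > 0" "x \<le> 8" for x :: nat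
        using that by arith
      then have "x dvd 840" if "x > 0" "x \<le> 8" for x :: nat
      proof -
        from cases8[OF that] show ?thesis by (elim disjE) simp_all
      qed
      then have "p ^ v dvd 840" using True prime_gt_0_nat[OF p] by simp
      then show ?thesis by simp
    next
      case False
      then have "\<not> p dvd ((n + r) choose r)" using r by (intro not_dvd_binomial_power[OF p dv]) simp
      then have "degree g mod p ^ v \<le> n mod p ^ v" by (rule factor_degree_mod_prime_power[OF p _ fac])
      then have "p ^ v dvd degree g" using dv by (simp add: mod_eq_0_iff_dvd)
      then show ?thesis by simp
    qed
    then show "multiplicity p n \<le> multiplicity p (840 * degree g)"
      unfolding v_def using False p by (intro multiplicity_geI) auto
  qed (use n in simp)
qed simp

text \<open>As the degree is below \<open>p\<close>, the condition modulo \<open>p\<close> would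
  make it at most \<open>n mod p\<close>. The margin 8 prevents a carry in
  \<open>n + r\<close>.\<close>

lemma no_large_prime:
  assumes r: "r \<le> 8" and fac: "L_poly r n = g * h" and p: "prime p" "p > degree g + 8"
  shows "\<not> n mod p < degree g"
proof
  assume lt: "n mod p < degree g"
  have "\<not> p dvd ((n + r) choose r)" using lt p r by (intro not_dvd_binomial_large) auto
  then have "degree g mod p ^ 1 \<le> n mod p ^ 1" by (rule factor_degree_mod_prime_power[OF p(1) _ fac])
  then show False using lt p(2) by simp
qed

section \<open>Executable checks for factors of small degree\<close>

fun binomial_int :: "int \<Rightarrow> nat \<Rightarrow> int" where
  "binomial_int n 0 = 1"
| "binomial_int n (Suc r) = (n + int (Suc r)) * binomial_int n r div int (Suc r)"

lemma binomial_int: "binomial_int (int n) r = int ((n + r) choose r)"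
proof (induction r)
  case (Suc r)
  have "Suc (n + r) * ((n + r) choose r) = (Suc (n + r) choose Suc r) * Suc r"
    by (rule Suc_times_binomial_eq)
  then have "int (Suc (n + r)) * int ((n + r) choose r) = int (Suc (n + r) choose Suc r) * int (Suc r)"
    by (simp only: of_nat_mult[symmetric])
  moreover have "int n + int (Suc r) = int (Suc (n + r))" by simp
  ultimately have "binomial_int (int n) (Suc r) = int (Suc (n + r) choose Suc r) * int (Suc r) div int (Suc r)"
    by (simp only: binomial_int.simps Suc)
  also have "\<dots> = int (Suc (n + r) choose Suc r)" by (rule nonzero_mult_div_cancel_right) simp
  finally show ?case by simp
qed simp

text \<open>The coefficients of \<open>Lint\<close> in a form that avoids quotients of factorials
  and keeps the lower index \<open>r\<close> of the binomial coefficient small.\<close>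

definition edge_coeff :: "nat \<Rightarrow> nat \<Rightarrow> nat \<Rightarrow> int" where
  "edge_coeff n r j = prod_list (map int [Suc j..<Suc n]) * binomial_int (int (n - j)) r"

lemma edge_coeff:
  assumes "j \<le> n" shows "edge_coeff n r j = int ((fact n div fact j) * ((n - j + r) choose (n - j)))"
proof -
  have "fact n div fact j = prod_list [Suc j..<Suc n]"
  proof -
    obtain m where m: "n = j + m" using assms le_Suc_ex by blast
    have "fact (j + m) = fact j * prod_list [Suc j..<Suc (j + m)]" by (induction m) (simp_all add: algebra_simps)
    then show ?thesis unfolding m by simp
  qed
  moreover have "prod_list (map int xs) = int (prod_list xs)" for xs by (induction xs) simp_all
  moreover have "(n - j + r) choose (n - j) = (n - j + r) choose r" using binomial_symmetric[of "n - j" "n - j + r"] by simp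
  ultimately show ?thesis unfolding edge_coeff_def binomial_int by simp
qed

definition edge_check :: "nat \<Rightarrow> nat \<Rightarrow> nat \<Rightarrow> nat \<Rightarrow> nat \<Rightarrow> nat \<Rightarrow> nat \<Rightarrow> nat \<Rightarrow> bool" where
  "edge_check n r p d a m j0 j1 \<longleftrightarrow> j0 < j1 \<and> j1 \<le> n \<and> a * j0 \<le> m \<and> a * j1 \<le> m \<and> (m - a * j0) mod d = 0 \<and> (m - a * j1) mod d = 0 \<and>
    list_all (\<lambda>j. edge_coeff n r j mod int p ^ ((m - a * j + d - 1) div d) = 0) [0..<Suc n] \<and>
    edge_coeff n r j0 mod int p ^ Suc ((m - a * j0) div d) \<noteq> 0 \<and>
    edge_coeff n r j1 mod int p ^ Suc ((m - a * j1) div d) \<noteq> 0"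

lemma edge_check: "edge_check n r p d a m j0 j1 \<Longrightarrow> edge n r p d a m j0 j1"
proof -
  assume c: "edge_check n r p d a m j0 j1"
  have D: "edge_coeff n r j mod int p ^ e = 0 \<longleftrightarrow> p ^ e dvd (fact n div fact j) * ((n - j + r) choose (n - j))" if "j \<le> n" for j e
  proof -
    have "edge_coeff n r j mod int p ^ e = 0 \<longleftrightarrow> int (p ^ e) dvd int ((fact n div fact j) * ((n - j + r) choose (n - j)))"
      unfolding edge_coeff[OF that] by (simp only: of_nat_power mod_eq_0_iff_dvd)
    then show ?thesis by (simp only: of_nat_dvd_iff)
  qed
  have jn: "j0 \<le> n" "j1 \<le> n" using c unfolding edge_check_def by auto
  moreover have "p ^ ((m - a * j + d - 1) div d) dvd (fact n div fact j) * ((n - j + r) choose (n - j))" if "j \<le> n" for j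
  proof -
    have "j \<in> set [0..<Suc n]" using that by (simp add: less_Suc_eq_le del: upt_Suc)
    then have "edge_coeff n r j mod int p ^ ((m - a * j + d - 1) div d) = 0"
      using c unfolding edge_check_def list_all_iff by blast
    then show ?thesis using D[OF that] by simp
  qed
  moreover have "\<not> p ^ Suc ((m - a * j0) div d) dvd (fact n div fact j0) * ((n - j0 + r) choose (n - j0))"
    "\<not> p ^ Suc ((m - a * j1) div d) dvd (fact n div fact j1) * ((n - j1 + r) choose (n - j1))"
    using c D[OF \<open>j0 \<le> n\<close>] D[OF \<open>j1 \<le> n\<close>] unfolding edge_check_def by blast+
  moreover have "j0 < j1" "a * j0 \<le> m" "a * j1 \<le> m" "d dvd m - a * j0" "d dvd m - a * j1"
    using c unfolding edge_check_def mod_eq_0_iff_dvd by blast+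
  ultimately show ?thesis unfolding edge_def by (simp only: atMost_iff simp_thms) blast
qed

text \<open>Lists of primes \<open>p > k + 8\<close>, one of which divides \<open>n (n - 1) \<cdots> (n - k + 1)\<close>, for all \<open>n\<close> dividing \<open>840 k\<close> except
  those recorded in the second list.\<close>

definition small_degree_primes :: "(int \<times> int list) list" where
  "small_degree_primes = [(1, []),
    (2, [13, 11, 23, 17, 19, 29, 31, 37, 41, 47, 59, 67, 79, 83, 139, 167, 239, 419, 839]),
    (3, [17, 13, 19, 31, 23, 29, 41, 89, 251, 43, 71, 83, 157, 179, 229, 419]),
    (4, [13, 19, 23, 31, 53, 17, 37, 83, 29, 61]),
    (5, [19, 23, 29, 17, 37, 41, 131, 53, 97, 127, 197]),
    (6, [17, 19, 31, 23, 41, 37, 179, 29, 47, 167]),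
    (7, [17, 19, 163, 23, 29, 41, 47, 53, 61]),
    (8, [17, 23, 29, 37, 31, 41]),
    (9, [19, 23, 29, 31, 53, 59, 37, 97]),
    (10, [19, 23, 29, 37, 97, 47]),
    (11, [23, 29, 31, 37, 101, 59]),
    (12, [23, 31, 37, 59, 41, 47]),
    (13, [23, 31, 29, 37, 89, 43]),
    (14, [23, 29, 163, 37]),
    (15, [29, 31, 37, 43, 53]),
    (16, [29, 31, 37, 43, 47]),
    (17, [29, 31, 41]),
    (18, [29, 31, 37, 43]),
    (19, [29, 31, 41, 53, 43]),
    (20, [29, 31, 37, 43]),
    (21, [31, 43, 41, 59]),
    (22, [31, 37, 41, 151]),
    (23, [37, 61, 41, 43]),
    (24, [37, 41, 53, 43]),
    (25, [41, 37, 47]),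
    (26, [37, 41, 59]),
    (27, [37, 43, 47]),
    (28, [37, 43, 41]),
    (29, [41, 67, 47, 43])]"

definition small_degree_exceptions :: "(int \<times> int) list" where
  "small_degree_exceptions = [(840, 1), (420, 1), (280, 1), (210, 1), (168, 1), (140, 1), (120, 1), (105, 1), (84, 1), (70, 1), (60, 1), (56, 1), (42, 1), (40, 1), (35, 1), (30, 1), (28, 1), (24, 1), (21, 1), (20, 1), (15, 1), (14, 1), (12, 1), (10, 1), (8, 1), (7, 1), (6, 1), (5, 1), (4, 1), (3, 1), (2, 1), (28, 2), (21, 2), (16, 2), (15, 2), (10, 2), (8, 2), (7, 2), (6, 2), (5, 2), (4, 2), (56, 3), (12, 3), (10, 3), (9, 3), (8, 3), (7, 3), (6, 3), (12, 4), (10, 4), (8, 4), (28, 5), (15, 5), (14, 5), (12, 5), (10, 5), (16, 6), (15, 6), (14, 6), (12, 6), (15, 7), (14, 7), (16, 8), (18, 9), (22, 11)]"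

function int_all :: "(int \<Rightarrow> bool) \<Rightarrow> int \<Rightarrow> int \<Rightarrow> bool" where
  "int_all P a b = (if b < a then True else if P a then int_all P (a + 1) b else False)"
  by auto
termination by (relation "measure (\<lambda>(P, a, b). nat (b + 1 - a))") auto

lemma int_allD: "int_all P a b \<Longrightarrow> a \<le> x \<Longrightarrow> x \<le> b \<Longrightarrow> P x"
proof (induction P a b rule: int_all.induct)
  case (1 P a b)
  then show ?case by (cases "x = a") (simp_all add: int_all.simps[of P a b] split: if_splits)
qed

declare int_all.simps [simp del]

text \<open>The case distinction runs over the cofactor \<open>d\<close> of \<open>n\<close> in
  \<open>840 * k\<close> instead of \<open>n\<close>; the condition \<open>2 * k \<le> n\<close>
  bounds it by 420.\<close>

definition small_degree_covered :: "int \<Rightarrow> int list \<Rightarrow> int \<Rightarrow> bool" where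
  "small_degree_covered k ps d \<longleftrightarrow> 840 * k mod d \<noteq> 0 \<or> (let n = 840 * k div d in
    list_ex (\<lambda>p. n mod p < k) ps \<or> list_ex (\<lambda>x. fst x = n \<and> snd x = k) small_degree_exceptions)"

lemma small_degree_primes:
  "list_all (\<lambda>x. int_all (small_degree_covered (fst x) (snd x)) 1 420) small_degree_primes"
  "list_all (\<lambda>x. list_all (\<lambda>p. prime_check p \<and> fst x + 8 < p) (snd x)) small_degree_primes"
  "map fst small_degree_primes = [1..29]"
  by code_simp+

definition mod_obstruction :: "int \<Rightarrow> int \<Rightarrow> nat \<Rightarrow> bool" where
  "mod_obstruction n k r \<longleftrightarrow> list_ex (\<lambda>x. binomial_int n r mod fst x \<noteq> 0 \<and> n mod fst x ^ snd x < k mod fst x ^ snd x)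
    [(2, 1), (2, 2), (2, 3), (2, 4), (3, 1), (3, 2), (3, 3), (5, 1), (5, 2), (7, 1), (7, 2), (11, 1), (13, 1), (17, 1), (19, 1)]"

text \<open>What the congruences leave are linear factors for even \<open>n\<close>, excluded by
  positivity, and eight triples \<open>(r, n, k)\<close> that need a Newton polygon.\<close>

lemma small_degree_exceptions:
  "list_all (\<lambda>x. list_all (\<lambda>r. mod_obstruction (fst x) (snd x) r \<or> (snd x = 1 \<and> fst x mod 2 = 0) \<or>
    list_ex (\<lambda>y. y = (r, fst x, snd x)) [(6, 3, 1), (7, 3, 1), (8, 3, 1), (4, 6, 2), (4, 6, 3), (5, 4, 2), (6, 4, 2), (7, 4, 2)])
    [0..<9]) small_degree_exceptions"
  by code_simp

lemma mod_obstruction: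
  assumes "mod_obstruction (int n) (int (degree g)) r" shows "L_poly r n \<noteq> g * h"
proof
  assume fac: "L_poly r n = g * h"
  obtain p e where pe: "(p, e) \<in> set [(2, 1), (2, 2), (2, 3), (2, 4), (3, 1), (3, 2), (3, 3), (5, 1), (5, 2), (7, 1), (7, 2), (11, 1), (13, 1), (17, 1), (19, 1)]"
      "binomial_int (int n) r mod p \<noteq> 0" "int n mod p ^ e < int (degree g) mod p ^ e"
    using assms unfolding mod_obstruction_def list_ex_iff by (metis prod.collapse)
  have "p \<in> {2, 3, 5, 7, 11, 13, 17, 19}" using pe(1) by auto
  then have p: "p = int (nat p)" "prime (nat p)" by auto
  have "\<not> nat p dvd ((n + r) choose r)"
  proof
    assume "nat p dvd ((n + r) choose r)"
    then have "int (nat p) dvd int ((n + r) choose r)" by (simp only: of_nat_dvd_iff)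
    then show False using pe(2) p(1) unfolding binomial_int by simp
  qed
  then have "degree g mod nat p ^ e \<le> n mod nat p ^ e" by (rule factor_degree_mod_prime_power[OF p(2) _ fac])
  then have "int (degree g mod nat p ^ e) \<le> int (n mod nat p ^ e)" by (simp only: of_nat_le_iff)
  then have "int (degree g) mod p ^ e \<le> int n mod p ^ e" using p(1) by (simp add: zmod_int)
  then show False using pe(3) by simp
qed

lemma no_factor_of_small_degree:
  assumes r: "r \<le> 8" and fac: "L_poly r n = g * h" and k: "1 \<le> degree g" "2 * degree g \<le> n"
  shows False
proof -
  define k where "k = degree g"
  have k': "1 \<le> k" "2 * k \<le> n" using k unfolding k_def by auto
  have dv: "n dvd 840 * k" using dvd_840_degree[OF r _ fac] k' unfolding k_def by simp
  then have le: "n \<le> 840 * k" using k' by (intro dvd_imp_le) auto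
  have dh: "degree h = n - k"
  proof -
    have "g \<noteq> 0" "h \<noteq> 0" using fac L_nonzero[of r n] by auto
    then have "degree (L_poly r n) = degree g + degree h" unfolding fac by (rule degree_mult_eq)
    then show ?thesis unfolding degree_L k_def by simp
  qed
  show False
  proof (cases "k < 30")
    case False
    then obtain p where "prime p" "p > k + 8" "n mod p < k" using prime_dvd_consecutive[of k n] k' le by auto
    then show False using no_large_prime[OF r fac] unfolding k_def by blast
  next
    case True
    obtain d where d: "840 * k = n * d" using dv by (rule dvdE)
    have d0: "d \<noteq> 0"
    proof
      assume "d = 0"
      then show False using d k' by simp
    qed
    have "2 * k * d \<le> 840 * k" unfolding d using k'(2) by simp
    then have d420: "d \<le> 420" using k' by simp
    have "int k \<in> set (map fst small_degree_primes)" unfolding small_degree_primes(3) using True k' by simp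
    then obtain ps where ps: "(int k, ps) \<in> set small_degree_primes" by auto
    have "int_all (small_degree_covered (int k) ps) 1 420"
      using small_degree_primes(1) ps unfolding list_all_iff by (metis fst_conv snd_conv)
    then have "small_degree_covered (int k) ps (int d)" by (rule int_allD) (use d0 d420 in auto)
    moreover have "840 * int k = int n * int d"
    proof -
      have "int (840 * k) = int (n * d)" unfolding d ..
      then show ?thesis by simp
    qed
    ultimately consider p where "p \<in> set ps" "int n mod p < int k" | "(int n, int k) \<in> set small_degree_exceptions"
      unfolding small_degree_covered_def list_ex_iff Let_def using d0 by auto
    then show False
    proof cases
      case 1
      have "prime_check p \<and> int k + 8 < p" using small_degree_primes(2) ps 1(1) unfolding list_all_iff by fastforce
      then have p: "prime_check p" "int k + 8 < p" by auto
      have e: "int (nat p) = p" using p(2) by simp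
      have "prime (nat p)" using prime_check[of "nat p"] p(1) unfolding e by blast
      moreover have "nat p > k + 8" using p(2) by simp
      moreover have "n mod nat p < k"
      proof -
        have "int (n mod nat p) < int k" unfolding zmod_int e by (rule 1(2))
        then show ?thesis by simp
      qed
      ultimately show False using no_large_prime[OF r fac] unfolding k_def by blast
    next
      case 2
      have "r \<in> set [0..<9]" using r by simp
      then consider "mod_obstruction (int n) (int k) r" | "k = 1" "even n"
        | "(r, int n, int k) \<in> set [(6, 3, 1), (7, 3, 1), (8, 3, 1), (4, 6, 2), (4, 6, 3), (5, 4, 2), (6, 4, 2), (7, 4, 2)]"
        using small_degree_exceptions 2 unfolding list_all_iff list_ex_iff
        by (metis (no_types, lifting) even_iff_mod_2_eq_zero even_of_nat_iff fst_conv of_nat_eq_1_iff snd_conv)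
      then show False
      proof cases
        case 1 then show False using mod_obstruction fac unfolding k_def by blast
      next
        case 2 then show False using no_linear_factor[OF 2(2) fac] unfolding k_def by simp
      next
        case 3
        \<comment> \<open>Each edge has a slope whose denominator is a prime larger than both
          degrees of the supposed factorisation; two of the eight triples share an edge.\<close>
        have edges: "edge_check 3 6 7 3 1 3 0 3" "edge_check 3 7 2 3 4 12 0 3" "edge_check 3 8 3 3 2 6 0 3" "edge_check 6 4 5 5 1 6 1 6"
          "edge_check 4 5 3 3 1 4 1 4" "edge_check 4 6 3 3 2 6 0 3" "edge_check 4 7 3 3 2 6 0 3"
          by code_simp+
        have no: False if "edge_check n r p q a m j0 j1" "prime p" "prime q" "\<not> q dvd a" "k < q" "n - k < q" for p q a m j0 j1
          using factor_degree_edge[OF that(2,3) edge_check[OF that(1)] that(4) fac] that(5,6) dh unfolding k_def by linarith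
        from 3 consider "r = 6" "n = 3" "k = 1" | "r = 7" "n = 3" "k = 1" | "r = 8" "n = 3" "k = 1" | "r = 4" "n = 6" "k = 2 \<or> k = 3"
          | "r = 5" "n = 4" "k = 2" | "r = 6" "n = 4" "k = 2" | "r = 7" "n = 4" "k = 2" by auto
        then show False
        proof cases
          case 1 show False by (rule no[OF edges(1)[folded 1]]) (simp_all add: 1)
        next
          case 2 show False by (rule no[OF edges(2)[folded 2]]) (simp_all add: 2)
        next
          case 3 show False by (rule no[OF edges(3)[folded 3]]) (simp_all add: 3)
        next
          case 4 show False by (rule no[OF edges(4)[folded 4(1,2)]]) (use 4 in auto)
        next
          case 5 show False by (rule no[OF edges(5)[folded 5]]) (simp_all add: 5)
        next
          case 6 show False by (rule no[OF edges(6)[folded 6]]) (simp_all add: 6)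
        next
          case 7 show False by (rule no[OF edges(7)[folded 7]]) (simp_all add: 7)
        qed
      qed
    qed
  qed
qed

theorem irreducible_L:
  assumes r: "r \<le> 8" and n: "n \<ge> 1"
  shows "irreducible (L_poly r n)"
proof (rule irreducibleI)
  show "L_poly r n \<noteq> 0" by (rule L_nonzero)
  show "\<not> is_unit (L_poly r n)" using n degree_L[of r n] by (auto simp: is_unit_iff_degree[OF L_nonzero])
  fix g h assume fac: "L_poly r n = g * h"
  then have nz: "g \<noteq> 0" "h \<noteq> 0" using L_nonzero[of r n] by auto
  then have "n = degree g + degree h" using degree_mult_eq[OF nz] fac degree_L[of r n] by simp
  then have "degree g = 0 \<or> degree h = 0"
    using no_factor_of_small_degree[OF r fac] no_factor_of_small_degree[OF r, of n h g] fac
    by (cases "degree g \<le> degree h") (auto simp: mult.commute Suc_le_eq)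
  then show "is_unit g \<or> is_unit h" using is_unit_iff_degree nz by blast
qed

section \<open>The Galois group contains the alternating group\<close>

fun list_add :: "int list \<Rightarrow> int list \<Rightarrow> int list" where
  "list_add [] ys = ys"
| "list_add xs [] = xs"
| "list_add (x # xs) (y # ys) = (x + y) # list_add xs ys"

fun list_mult :: "int list \<Rightarrow> int list \<Rightarrow> int list" where
  "list_mult [] ys = []"
| "list_mult (x # xs) ys = list_add (map ((*) x) ys) (0 # list_mult xs ys)"

fun list_pderiv :: "int list \<Rightarrow> int list" where
  "list_pderiv [] = []"
| "list_pderiv (x # xs) = list_add xs (0 # list_pderiv xs)"

definition list_dvd :: "int \<Rightarrow> int list \<Rightarrow> bool" where
  "list_dvd m xs \<longleftrightarrow> list_all (\<lambda>x. x mod m = 0) xs"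

lemma Poly_map_mult: "Poly (map ((*) c) xs) = smult c (Poly xs)" for c :: int
  by (induction xs) simp_all

lemma Poly_list_add: "Poly (list_add xs ys) = Poly xs + Poly ys"
  by (induction xs ys rule: list_add.induct) simp_all

lemma Poly_list_mult: "Poly (list_mult xs ys) = Poly xs * Poly ys"
  by (induction xs) (simp_all add: Poly_list_add Poly_map_mult)

lemma Poly_list_pderiv: "Poly (list_pderiv xs) = pderiv (Poly xs)"
  by (induction xs) (simp_all add: Poly_list_add pderiv_pCons)

lemma Poly_foldr_list_mult: "Poly (foldr list_mult qs [1]) = prod_list (map Poly qs)"
  by (induction qs) (simp_all add: Poly_list_mult one_pCons)

lemma list_dvdD: "list_dvd m xs \<Longrightarrow> m dvd coeff (Poly xs) i"
  unfolding list_dvd_def by (auto simp: coeff_Poly_eq nth_default_def list_all_length mod_eq_0_iff_dvd)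

lemma degree_Poly_monic:
  assumes "xs \<noteq> []" "last xs = (1 :: int)"
  shows "degree (Poly xs) = length xs - 1" "lead_coeff (Poly xs) = 1"
proof -
  have c: "coeffs (Poly xs) = xs" using assms by (simp add: strip_while_idem_iff no_trailing_unfold)
  have "Poly xs \<noteq> 0"
  proof
    assume "Poly xs = 0"
    then show False using c assms(1) by simp
  qed
  then show d: "degree (Poly xs) = length xs - 1" using degree_eq_length_coeffs[of "Poly xs"] c by simp
  show "lead_coeff (Poly xs) = 1"
    unfolding d using assms by (simp add: coeff_Poly_eq nth_default_def last_conv_nth)
qed

definition L_list :: "nat \<Rightarrow> nat \<Rightarrow> int list" where
  "L_list r n = map (edge_coeff n r) [0..<Suc n]"

lemma Poly_L_list: "Poly (L_list r n) = Lint r n"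
proof (rule poly_eqI)
  fix j
  show "coeff (Poly (L_list r n)) j = coeff (Lint r n) j"
    unfolding L_list_def coeff_Poly_eq nth_default_def coeff_Lint using edge_coeff[of j n r]
    by (auto simp: less_Suc_eq_le nth_append simp del: upt_Suc)
qed

text \<open>The hypotheses of \<open>three_cycle_of_factorization\<close> in executable form, for
  the prime \<open>l\<close>. Coefficients are listed in ascending order, so a last entry 1 means
  monic; \<open>u\<close> and \<open>v\<close> witness that \<open>F\<close> and its derivative are
  coprime modulo \<open>l\<close>.\<close>

definition cubic_check :: "nat \<Rightarrow> nat \<Rightarrow> int \<Rightarrow> int list \<Rightarrow> int list list \<Rightarrow> int list \<Rightarrow> int list \<Rightarrow> bool" where
  "cubic_check n r l c qs u v \<longleftrightarrow> (let F = L_list r n in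
    prime_check l \<and> length c = 4 \<and> last c = 1 \<and>
    list_all (\<lambda>q. q \<noteq> [] \<and> length q \<le> 3 \<and> last q = 1) qs \<and>
    3 + sum_list (map (\<lambda>q. length q - 1) qs) = n \<and>
    list_dvd l (list_add F (map ((*) (- 1)) (list_mult c (foldr list_mult qs [1])))) \<and>
    list_dvd l (list_add (list_add (list_mult u F) (list_mult v (list_pderiv F))) [- 1]) \<and>
    list_all (\<lambda>a. foldr (\<lambda>x y. x + a * y) c 0 mod l \<noteq> 0) [0..l - 1])"

text \<open>Allows the passage to \<open>fact n\<close> times L, which is monic with integer
  coefficients, as the Frobenius argument requires.\<close>

lemma galois_group_smult:
  assumes "c \<noteq> 0"
  shows "complex_roots (smult c f) = complex_roots f" "galois_group (smult c f) = galois_group f"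
proof -
  have "cp (smult c f) = smult (of_rat c) (cp f)"
    by (rule poly_eqI) (simp add: coeff_map_poly of_rat_mult)
  then show "complex_roots (smult c f) = complex_roots f" unfolding complex_roots_def using assms by simp
  then show "galois_group (smult c f) = galois_group f" unfolding galois_group_def splitting_field_def by simp
qed

text \<open>The only non-trivial permutation of two points is a transposition, hence odd.\<close>

lemma alternating_group_small:
  assumes "finite S" "card S \<le> 2" "g \<in> alternating_group S" shows "g = id"
proof -
  have g: "g permutes S" "evenperm g" using assms(3) unfolding alternating_group_def by auto
  show ?thesis
  proof (rule ccontr)
    assume "g \<noteq> id"
    then obtain x where x: "g x \<noteq> x" by (metis eq_id_iff)
    have xS: "x \<in> S" "g x \<in> S" using x g(1) by (meson permutes_not_in, metis permutes_in_image permutes_not_in)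
    have "card {x, g x} = 2" using x by simp
    then have S: "S = {x, g x}" using card_seteq[of S "{x, g x}"] xS assms(1,2) by auto
    have "g (g x) \<in> S" using xS(2) g(1) by (meson permutes_in_image)
    moreover have "g (g x) \<noteq> g x" using x permutes_inj[OF g(1)] by (metis injD)
    ultimately have "g (g x) = x" using S by blast
    then have "g = transpose x (g x)" using g(1) S permutes_not_in[OF g(1)] by (auto simp: fun_eq_iff transpose_def)
    then have "\<not> evenperm g" using x by (metis evenperm_swap)
    then show False using g(2) by blast
  qed
qed

section \<open>Cycles in the Galois group\<close>

context
  fixes r n :: nat
  assumes r: "r \<le> 8" and n: "n \<ge> 1"
begin

abbreviation "Lroots \<equiv> complex_roots (L_poly r n)"
abbreviation "Lgal \<equiv> galois_group (L_poly r n)"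

interpretation L: splitting "L_poly r n" by unfold_locales (rule L_nonzero)

lemma card_roots_L: "card Lroots = n"
  using L.card_R[OF irreducible_L[OF r n]] degree_L by simp

text \<open>The ramified root yields an element of order \<open>d\<close>, a single cycle since
  \<open>n < 2 * d\<close>; transitivity comes from irreducibility.\<close>

lemma cycle_groupI:
  assumes N: "nonarch p N" and x: "x \<in> Lroots" "x \<noteq> 0" "\<And>i::nat. \<exists>k::int. N x ^ i = real p powi k \<Longrightarrow> d dvd i"
    and d: "prime d" "n < 2 * d"
  obtains c C where "cycle_group Lroots Lgal c C d"
proof -
  interpret nonarch p N by (rule N)
  interpret splitting_nonarch "L_poly r n" p N by unfold_locales
  obtain g where g: "g \<in> Lgal" "g ^^ d = id" "g \<noteq> id"
    using element_of_prime_order[OF _ x(2) d(1) x(3)] L.RK x(1) by blast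
  obtain C where C: "is_cycle d g C" "C \<subseteq> Lroots"
    using is_cycle_of_order[OF L.finR d(1) _ L.G_permutes[OF g(1)] g(2,3)] d(2) unfolding card_roots_L by blast
  have "cycle_group Lroots Lgal g C d"
    by unfold_locales (use L.G_transitive[OF irreducible_L[OF r n]] g(1) d C card_roots_L in auto)
  then show ?thesis by (rule that)
qed

lemma cycle_group_of_edge:
  assumes e: "edge n r p d a m j0 j1" and pd: "prime p" "prime d" "\<not> d dvd a" "n < 2 * d"
  obtains c C where "cycle_group Lroots Lgal c C d"
proof -
  obtain N where N: "nonarch p N" using nonarch_exists[OF pd(1)] .
  then interpret nonarch p N .
  obtain x where x: "x \<in># proots (cp (L_poly r n))" "x \<noteq> 0" "N x = real p powr (- real a / real d)"
    using edge_root[OF e pd(2,3)] .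
  have "x \<in> Lroots" using x(1) L_nonzero[of r n] unfolding complex_roots_def by (simp add: cp_arith)
  moreover have "d dvd i" if "\<exists>k::int. N x ^ i = real p powi k" for i :: nat
    using edge_exact[OF x(3) pd(2,3)] that by blast
  ultimately show ?thesis using cycle_groupI[OF N _ x(2) _ pd(2,4)] that by blast
qed

lemma cycle_group_of_prime:
  assumes p: "prime p" "n mod p + r < p" "p \<le> n" "n < 2 * p"
  obtains c C where "cycle_group Lroots Lgal c C p"
proof -
  obtain N where N: "nonarch p N" using nonarch_exists[OF p(1)] .
  then interpret nonarch p N .
  obtain x where "x \<in> Lroots" "x \<noteq> 0" "\<And>i::nat. \<exists>k::int. N x ^ i = real p powi k \<Longrightarrow> p dvd i"
    using exists_ramified_root[OF p(2,3)] by blast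
  from cycle_groupI[OF N this p(1,4)] that show ?thesis by blast
qed

text \<open>Here \<open>n mod p = n - p\<close>, and the first inequality gives
  \<open>n - p + r < p\<close>, so no carry occurs in \<open>n + r\<close>. The second leaves the
  three points outside the cycle that \<open>jordan\<close> needs.\<close>

lemma alternating_of_prime:
  assumes p: "prime p" "n + 8 < 2 * p" "p + 3 \<le> n"
  shows "alternating_group Lroots \<subseteq> Lgal"
proof -
  have "n mod p = n - p" using p by (intro mod_nat_eqI) (auto simp: dvd_minus_self)
  then have "n mod p + r < p" using p r by simp
  then obtain c C where "cycle_group Lroots Lgal c C p" using cycle_group_of_prime[OF p(1)] p by auto
  then interpret cycle_group Lroots Lgal c C p .
  show ?thesis by (rule jordan) (use p card_roots_L in simp)
qed

lemma three_cycle_of_cubic_check: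
  assumes c: "cubic_check n r l c qs u v"
  shows "\<exists>x y z. x \<noteq> y \<and> y \<noteq> z \<and> x \<noteq> z \<and> cyc3 x y z \<in> Lgal"
proof -
  define F where "F = L_list r n"
  note ck = c[unfolded cubic_check_def Let_def, folded F_def]
  define p where "p = nat l"
  have "l > 1" using ck unfolding prime_check_def by auto
  then have l: "l = int p" unfolding p_def by simp
  have pp: "prime p" using ck prime_check[of p] unfolding l by blast
  define f where "f = smult (fact n) (L_poly r n)"
  have "(fact n :: rat) \<noteq> 0" by simp
  note same = galois_group_smult[OF this, of "L_poly r n", folded f_def]
  obtain N where N: "nonarch p N" using nonarch_exists[OF pp] .
  then interpret nonarch p N .
  interpret splitting_nonarch f p N by unfold_locales (use L_nonzero in \<open>simp add: f_def\<close>)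
  have PF: "Poly F = Lint r n" unfolding F_def by (rule Poly_L_list)
  have "\<exists>x y z. x \<noteq> y \<and> y \<noteq> z \<and> x \<noteq> z \<and> cyc3 x y z \<in> galois_group f"
  proof (rule three_cycle_of_factorization[where F = "Poly F" and c = "Poly c" and qs = "map Poly qs" and u = "Poly u" and v = "Poly v"])
    show "cp f = ip (Poly F)" unfolding f_def PF by (rule cp_Lint)
    show "lead_coeff (Poly F) = 1" unfolding PF by (rule lead_coeff_Lint)
    show "degree (Poly F) = card (complex_roots f)" unfolding PF same card_roots_L by (rule degree_Lint)
    have cl: "length c = 4" "last c = 1" using ck by blast+
    then have "c \<noteq> []" by force
    then show "degree (Poly c) = 3" "lead_coeff (Poly c) = 1" using degree_Poly_monic[of c] cl by simp_all
    have qs: "q \<noteq> []" "length q \<le> 3" "last q = 1" if "q \<in> set qs" for q using ck that unfolding list_all_iff by auto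
    show "degree q \<le> 2 \<and> lead_coeff q = 1" if q: "q \<in> set (map Poly qs)" for q
    proof -
      obtain q' where q': "q' \<in> set qs" "q = Poly q'" using q by auto
      show ?thesis using degree_Poly_monic[OF qs(1,3)[OF q'(1)]] qs(2)[OF q'(1)] unfolding q'(2) by simp
    qed
    have e: "map degree (map Poly qs) = map (\<lambda>q. length q - 1) qs"
      using degree_Poly_monic(1)[OF qs(1,3)] by simp
    show "3 + sum_list (map degree (map Poly qs)) = card (complex_roots f)" unfolding same card_roots_L e using ck by blast
    show "int p dvd coeff (Poly F - Poly c * prod_list (map Poly qs)) i" for i
    proof -
      have "list_dvd l (list_add F (map ((*) (- 1)) (list_mult c (foldr list_mult qs [1]))))" using ck by blast
      from list_dvdD[OF this, of i] show ?thesis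
        unfolding l Poly_list_add Poly_map_mult Poly_list_mult Poly_foldr_list_mult by simp
    qed
    show "int p dvd coeff (Poly u * Poly F + Poly v * pderiv (Poly F) - 1) i" for i
    proof -
      have "list_dvd l (list_add (list_add (list_mult u F) (list_mult v (list_pderiv F))) [- 1])" using ck by blast
      moreover have m: "Poly [- 1 :: int] = - 1" by (simp add: one_pCons)
      ultimately show ?thesis
        using list_dvdD[of l "list_add (list_add (list_mult u F) (list_mult v (list_pderiv F))) [- 1]" i]
        unfolding l Poly_list_add Poly_list_mult Poly_list_pderiv m by simp
    qed
    show "\<not> int p dvd poly (Poly c) (int a)" if "a < p" for a
    proof -
      have "poly (Poly xs) (int a) = foldr (\<lambda>x y. x + int a * y) xs 0" for xs by (induction xs) simp_all
      moreover have "int a \<in> set [0..l - 1]" using that unfolding l by simp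
      moreover have "list_all (\<lambda>a. foldr (\<lambda>x y. x + a * y) c 0 mod l \<noteq> 0) [0..l - 1]" using ck by blast
      ultimately show ?thesis unfolding list_all_iff l by (simp add: mod_eq_0_iff_dvd)
    qed
  qed
  then show ?thesis unfolding same .
qed

end

text \<open>Entries \<open>(n, r, p, d, a, m, j0, j1)\<close>.\<close>

type_synonym edge_entry = "nat \<times> nat \<times> nat \<times> nat \<times> nat \<times> nat \<times> nat \<times> nat"

text \<open>For \<open>n \<le> 5\<close> the cycle itself is to be a 3-cycle, and from 8 on Jordan's
  theorem needs \<open>d + 3 \<le> n\<close>. For 6 and 7 no prime satisfies both this and
  \<open>n < 2 * d\<close>; the 5-cycle serves for two-transitivity only.\<close>

definition edge_entry_ok :: "edge_entry \<Rightarrow> bool" where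
  "edge_entry_ok = (\<lambda>(n, r, p, d, a, m, j0, j1). edge_check n r p d a m j0 j1 \<and> list_ex ((=) p) [2, 3, 5, 7, 11, 13] \<and>
    list_ex ((=) d) [3, 5, 7, 11, 13] \<and> a mod d \<noteq> 0 \<and> n < 2 * d \<and> (if n \<le> 5 then d = 3 else if n \<le> 7 then d = 5 else d + 3 \<le> n))"

text \<open>Where \<open>p = d\<close> and \<open>a = 1\<close> the slope is that of the exponential
  polynomial at \<open>d\<close>. The remaining entries use a steeper edge at 3 or an edge at
  another prime.\<close>

definition edge_table1 :: "edge_entry list" where
  "edge_table1 = [(3, 0, 3, 3, 1, 3, 0, 3), (3, 1, 3, 3, 1, 3, 0, 3), (3, 2, 3, 3, 1, 3, 0, 3), (3, 3, 3, 3, 1, 3, 0, 3),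
    (3, 4, 3, 3, 1, 3, 0, 3), (3, 5, 3, 3, 1, 3, 0, 3), (3, 6, 7, 3, 1, 3, 0, 3), (3, 7, 3, 3, 2, 6, 0, 3),
    (3, 8, 3, 3, 2, 6, 0, 3), (4, 0, 3, 3, 1, 3, 0, 3), (4, 1, 3, 3, 1, 3, 0, 3), (4, 2, 3, 3, 1, 4, 1, 4),
    (4, 3, 3, 3, 1, 3, 0, 3), (4, 4, 3, 3, 1, 3, 0, 3), (4, 5, 3, 3, 1, 4, 1, 4), (4, 6, 3, 3, 2, 6, 0, 3),
    (4, 7, 3, 3, 2, 6, 0, 3), (4, 8, 3, 3, 2, 8, 1, 4), (5, 0, 3, 3, 1, 3, 0, 3), (5, 1, 3, 3, 1, 4, 1, 4),
    (5, 2, 3, 3, 1, 5, 2, 5), (5, 3, 3, 3, 1, 3, 0, 3), (5, 4, 3, 3, 1, 4, 1, 4), (5, 5, 3, 3, 1, 5, 2, 5),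
    (5, 6, 3, 3, 2, 6, 0, 3), (5, 7, 3, 3, 2, 8, 1, 4), (5, 8, 11, 3, 1, 3, 0, 3), (6, 0, 5, 5, 1, 5, 0, 5),
    (6, 1, 5, 5, 1, 5, 0, 5), (6, 2, 5, 5, 1, 5, 0, 5), (6, 3, 5, 5, 1, 5, 0, 5), (6, 4, 5, 5, 1, 6, 1, 6),
    (6, 5, 5, 5, 1, 5, 0, 5), (6, 6, 5, 5, 1, 5, 0, 5), (6, 7, 5, 5, 1, 5, 0, 5), (6, 8, 5, 5, 1, 5, 0, 5),
    (7, 0, 5, 5, 1, 5, 0, 5), (7, 1, 5, 5, 1, 5, 0, 5), (7, 2, 5, 5, 1, 5, 0, 5), (7, 3, 5, 5, 1, 6, 1, 6),
    (7, 4, 5, 5, 1, 7, 2, 7), (7, 5, 5, 5, 1, 5, 0, 5), (7, 6, 5, 5, 1, 5, 0, 5), (7, 7, 5, 5, 1, 5, 0, 5),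
    (7, 8, 5, 5, 1, 6, 1, 6), (8, 0, 5, 5, 1, 5, 0, 5), (8, 1, 5, 5, 1, 5, 0, 5), (8, 2, 5, 5, 1, 6, 1, 6),
    (8, 3, 5, 5, 1, 7, 2, 7), (8, 4, 5, 5, 1, 8, 3, 8), (8, 5, 5, 5, 1, 5, 0, 5), (8, 6, 5, 5, 1, 5, 0, 5),
    (8, 7, 5, 5, 1, 6, 1, 6), (8, 8, 5, 5, 1, 7, 2, 7), (9, 0, 5, 5, 1, 5, 0, 5), (9, 1, 5, 5, 1, 6, 1, 6),
    (9, 2, 5, 5, 1, 7, 2, 7), (9, 3, 5, 5, 1, 8, 3, 8), (9, 4, 5, 5, 1, 9, 4, 9), (9, 5, 5, 5, 1, 5, 0, 5),
    (9, 6, 5, 5, 1, 6, 1, 6), (9, 7, 5, 5, 1, 7, 2, 7), (9, 8, 5, 5, 1, 8, 3, 8), (10, 0, 7, 7, 1, 7, 0, 7),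
    (10, 1, 7, 7, 1, 7, 0, 7), (10, 2, 7, 7, 1, 7, 0, 7), (10, 3, 7, 7, 1, 7, 0, 7), (10, 4, 7, 7, 1, 8, 1, 8),
    (10, 5, 7, 7, 1, 9, 2, 9), (10, 6, 7, 7, 1, 10, 3, 10), (10, 7, 7, 7, 1, 7, 0, 7), (10, 8, 7, 7, 1, 7, 0, 7)]"

definition edge_table2 :: "edge_entry list" where
  "edge_table2 = [(11, 0, 7, 7, 1, 7, 0, 7), (11, 1, 7, 7, 1, 7, 0, 7), (11, 2, 7, 7, 1, 7, 0, 7), (11, 3, 7, 7, 1, 8, 1, 8),
    (11, 4, 7, 7, 1, 9, 2, 9), (11, 5, 7, 7, 1, 10, 3, 10), (11, 6, 7, 7, 1, 11, 4, 11), (11, 7, 7, 7, 1, 7, 0, 7),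
    (11, 8, 7, 7, 1, 7, 0, 7), (12, 0, 7, 7, 1, 7, 0, 7), (12, 1, 7, 7, 1, 7, 0, 7), (12, 2, 7, 7, 1, 8, 1, 8),
    (12, 3, 7, 7, 1, 9, 2, 9), (12, 4, 7, 7, 1, 10, 3, 10), (12, 5, 7, 7, 1, 11, 4, 11), (12, 6, 7, 7, 1, 12, 5, 12),
    (12, 7, 7, 7, 1, 7, 0, 7), (12, 8, 7, 7, 1, 7, 0, 7), (13, 0, 7, 7, 1, 7, 0, 7), (13, 1, 7, 7, 1, 8, 1, 8),
    (13, 2, 7, 7, 1, 9, 2, 9), (13, 3, 7, 7, 1, 10, 3, 10), (13, 4, 7, 7, 1, 11, 4, 11), (13, 5, 7, 7, 1, 12, 5, 12),
    (13, 6, 7, 7, 1, 13, 6, 13), (13, 7, 7, 7, 1, 7, 0, 7), (13, 8, 7, 7, 1, 8, 1, 8), (14, 0, 11, 11, 1, 11, 0, 11),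
    (14, 1, 11, 11, 1, 11, 0, 11), (14, 2, 11, 11, 1, 11, 0, 11), (14, 3, 11, 11, 1, 11, 0, 11),
    (14, 4, 11, 11, 1, 11, 0, 11), (14, 5, 11, 11, 1, 11, 0, 11), (14, 6, 11, 11, 1, 11, 0, 11),
    (14, 7, 11, 11, 1, 11, 0, 11), (14, 8, 11, 11, 1, 12, 1, 12)]"

definition edge_table3 :: "edge_entry list" where
  "edge_table3 = [(15, 0, 11, 11, 1, 11, 0, 11), (15, 1, 11, 11, 1, 11, 0, 11), (15, 2, 11, 11, 1, 11, 0, 11),
    (15, 3, 11, 11, 1, 11, 0, 11), (15, 4, 11, 11, 1, 11, 0, 11), (15, 5, 11, 11, 1, 11, 0, 11),
    (15, 6, 11, 11, 1, 11, 0, 11), (15, 7, 11, 11, 1, 12, 1, 12), (15, 8, 11, 11, 1, 13, 2, 13),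
    (16, 0, 11, 11, 1, 11, 0, 11), (16, 1, 11, 11, 1, 11, 0, 11), (16, 2, 11, 11, 1, 11, 0, 11),
    (16, 3, 11, 11, 1, 11, 0, 11), (16, 4, 11, 11, 1, 11, 0, 11), (16, 5, 11, 11, 1, 11, 0, 11),
    (16, 6, 11, 11, 1, 12, 1, 12), (16, 7, 11, 11, 1, 13, 2, 13), (16, 8, 13, 13, 1, 13, 0, 13),
    (17, 0, 11, 11, 1, 11, 0, 11), (17, 1, 11, 11, 1, 11, 0, 11), (17, 2, 11, 11, 1, 11, 0, 11),
    (17, 3, 11, 11, 1, 11, 0, 11), (17, 4, 11, 11, 1, 11, 0, 11), (17, 5, 11, 11, 1, 12, 1, 12),
    (17, 6, 11, 11, 1, 13, 2, 13), (17, 7, 13, 13, 1, 13, 0, 13), (17, 8, 13, 13, 1, 13, 0, 13)]"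

definition edge_table4 :: "edge_entry list" where
  "edge_table4 = [(18, 0, 11, 11, 1, 11, 0, 11), (18, 1, 11, 11, 1, 11, 0, 11), (18, 2, 11, 11, 1, 11, 0, 11),
    (18, 3, 11, 11, 1, 11, 0, 11), (18, 4, 11, 11, 1, 12, 1, 12), (18, 5, 11, 11, 1, 13, 2, 13),
    (18, 6, 13, 13, 1, 13, 0, 13), (18, 7, 13, 13, 1, 13, 0, 13), (18, 8, 13, 13, 1, 14, 1, 14),
    (19, 0, 11, 11, 1, 11, 0, 11), (19, 1, 11, 11, 1, 11, 0, 11), (19, 2, 11, 11, 1, 11, 0, 11),
    (19, 3, 11, 11, 1, 12, 1, 12), (19, 4, 11, 11, 1, 13, 2, 13), (19, 5, 13, 13, 1, 13, 0, 13),
    (19, 6, 13, 13, 1, 13, 0, 13), (19, 7, 13, 13, 1, 14, 1, 14), (19, 8, 13, 13, 1, 15, 2, 15)]"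

lemma edge_table1: "list_all edge_entry_ok edge_table1" by code_simp
lemma edge_table2: "list_all edge_entry_ok edge_table2" by code_simp
lemma edge_table3: "list_all edge_entry_ok edge_table3" by code_simp
lemma edge_table4: "list_all edge_entry_ok edge_table4" by code_simp

text \<open>Entries \<open>(n, r, l, c, qs, u, v)\<close>. Besides the cubic, the factors have
  degrees 1 and 2 for \<open>n = 6\<close> and twice degree 2 for \<open>n = 7\<close>, so the
  square of Frobenius acts on the roots of the cubic only.\<close>

definition cubic_table :: "(nat \<times> nat \<times> int \<times> int list \<times> int list list \<times> int list \<times> int list) list" where
  "cubic_table = [(6, 0, 7, [5, 6, 4, 1], [[2, 1], [2, 0, 1]], [5, 0, 1, 0, 1], [1, 1, 2, 6, 1, 1]),
    (6, 1, 19, [4, 5, 14, 1], [[14, 1], [14, 3, 1]], [9, 14, 7, 6, 11], [10, 17, 12, 7, 8, 14]),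
    (6, 2, 19, [16, 6, 6, 1], [[17, 1], [16, 14, 1]], [3, 12, 0, 17, 14], [10, 1, 6, 4, 6, 4]),
    (6, 3, 17, [5, 15, 7, 1], [[7, 1], [11, 10, 1]], [16, 2, 9, 16, 7], [14, 2, 14, 7, 4, 13]),
    (6, 4, 13, [2, 6, 6, 1], [[2, 1], [9, 9, 1]], [1, 11, 10, 1, 9], [5, 1, 8, 12, 1, 5]),
    (6, 5, 13, [5, 9, 12, 1], [[5, 1], [4, 6, 1]], [5, 8, 9, 12, 11], [5, 6, 5, 3, 0, 9]),
    (6, 6, 13, [9, 1, 8, 1], [[6, 1], [9, 2, 1]], [12, 1, 7, 1, 6], [5, 5, 2, 6, 8, 12]),
    (6, 7, 7, [5, 6, 4, 1], [[2, 1], [2, 0, 1]], [5, 0, 1, 0, 1], [1, 1, 2, 6, 1, 1]),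
    (6, 8, 19, [14, 5, 14, 1], [[3, 1], [9, 18, 1]], [2, 16, 11, 7, 2], [10, 7, 16, 17, 18, 6]),
    (7, 0, 41, [37, 27, 29, 1], [[27, 36, 1], [8, 24, 1]], [0, 4, 0, 6, 0, 31], [27, 10, 34, 10, 37, 19, 19]),
    (7, 1, 11, [7, 5, 3, 1], [[4, 5, 1], [10, 6, 1]], [1, 1, 1, 4, 5, 1], [6, 10, 4, 7, 1, 10, 3]),
    (7, 2, 31, [20, 11, 2, 1], [[6, 1, 1], [24, 18, 1]], [9, 28, 8, 4, 22, 27], [19, 26, 19, 1, 18, 3, 5]),
    (7, 3, 17, [3, 1, 0, 1], [[1, 6, 1], [14, 5, 1]], [13, 13, 3, 10, 16, 9], [15, 7, 14, 15, 12, 12, 6]),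
    (7, 4, 67, [44, 35, 46, 1], [[31, 30, 1], [22, 26, 1]], [1, 59, 6, 20, 24, 28], [9, 10, 8, 16, 61, 34, 63]),
    (7, 5, 97, [77, 44, 13, 1], [[69, 27, 1], [47, 2, 1]], [36, 14, 28, 69, 60, 80], [24, 68, 73, 12, 40, 6, 44]),
    (7, 6, 13, [5, 9, 12, 1], [[0, 5, 1], [4, 6, 1]], [4, 3, 12, 0, 4, 1], [3, 1, 12, 3, 3, 4, 11]),
    (7, 7, 79, [53, 17, 63, 1], [[29, 60, 1], [2, 12, 1]], [8, 60, 46, 57, 78, 9], [74, 8, 45, 30, 78, 35, 10]),
    (7, 8, 67, [21, 18, 31, 1], [[8, 28, 1], [23, 4, 1]], [39, 34, 2, 52, 31, 46], [9, 47, 65, 22, 19, 13, 3])]"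

lemma cubic_table: "list_all (\<lambda>(n, r, l, c, qs, u, v). cubic_check n r l c qs u v) cubic_table"
  by code_simp

lemma edge_entry:
  assumes "3 \<le> n" "n \<le> 19" "r \<le> 8"
  obtains p d a m j0 j1 where "edge n r p d a m j0 j1" "prime p" "prime d" "\<not> d dvd a" "n < 2 * d"
    "n \<le> 5 \<Longrightarrow> d = 3" "n = 6 \<or> n = 7 \<Longrightarrow> d = 5" "n \<ge> 8 \<Longrightarrow> d + 3 \<le> n"
proof -
  define T where "T = edge_table1 @ edge_table2 @ edge_table3 @ edge_table4"
  have "map (\<lambda>x. (fst x, fst (snd x))) T = List.product [3..<20] [0..<9]"
    unfolding T_def edge_table1_def edge_table2_def edge_table3_def edge_table4_def by code_simp
  moreover have "(n, r) \<in> set (List.product [3..<20] [0..<9])" unfolding set_product set_upt using assms by simp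
  ultimately have "(n, r) \<in> (\<lambda>x. (fst x, fst (snd x))) ` set T" by (metis set_map)
  then obtain p d a m j0 j1 where t: "(n, r, p, d, a, m, j0, j1) \<in> set T" by auto
  have "edge_entry_ok (n, r, p, d, a, m, j0, j1)"
    using t edge_table1 edge_table2 edge_table3 edge_table4 unfolding T_def list_all_iff by auto
  then have ok: "edge_check n r p d a m j0 j1" "p \<in> {2, 3, 5, 7, 11, 13}" "d \<in> {3, 5, 7, 11, 13}" "a mod d \<noteq> 0" "n < 2 * d"
    "if n \<le> 5 then d = 3 else if n \<le> 7 then d = 5 else d + 3 \<le> n"
    unfolding edge_entry_ok_def by auto
  have "prime p" "prime d" using ok(2,3) by auto
  then show ?thesis using that[OF edge_check[OF ok(1)]] ok(4-6) by (simp add: dvd_eq_mod_eq_0 split: if_splits)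
qed

lemma cubic_entry:
  assumes "n = 6 \<or> n = 7" "r \<le> 8"
  obtains l c qs u v where "cubic_check n r l c qs u v"
proof -
  have "map (\<lambda>x. (fst x, fst (snd x))) cubic_table = List.product [6, 7] [0..<9]"
    by code_simp
  moreover have "(n, r) \<in> set (List.product [6, 7] [0..<9])" unfolding set_product using assms by (intro SigmaI) auto
  ultimately have "(n, r) \<in> (\<lambda>x. (fst x, fst (snd x))) ` set cubic_table" by (metis set_map)
  then obtain l c qs u v where "(n, r, l, c, qs, u, v) \<in> set cubic_table" by auto
  then show ?thesis using that cubic_table unfolding list_all_iff by auto
qed

theorem alternating_subset_galois:
  assumes r: "r \<le> 8" and n: "n \<ge> 1"
  shows "alternating_group (complex_roots (L_poly r n)) \<subseteq> galois_group (L_poly r n)"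
proof -
  interpret L: splitting "L_poly r n" by unfold_locales (rule L_nonzero)
  note card = card_roots_L[OF r n]
  consider "n \<le> 2" | "3 \<le> n" "n \<le> 19" | "20 \<le> n" "n < 63" | "63 \<le> n" by linarith
  then show ?thesis
  proof cases
    case 1
    then show ?thesis using alternating_group_small[OF L.finR] card L.G_id by auto
  next
    case 2
    obtain p d a m j0 j1 where e: "edge n r p d a m j0 j1" "prime p" "prime d" "\<not> d dvd a" "n < 2 * d"
      "n \<le> 5 \<Longrightarrow> d = 3" "n = 6 \<or> n = 7 \<Longrightarrow> d = 5" "n \<ge> 8 \<Longrightarrow> d + 3 \<le> n"
      using edge_entry[OF 2 r] by metis
    obtain c C where "cycle_group (complex_roots (L_poly r n)) (galois_group (L_poly r n)) c C d"
      using cycle_group_of_edge[OF r n e(1-5)] .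
    then interpret cycle_group "complex_roots (L_poly r n)" "galois_group (L_poly r n)" c C d .
    consider "n = 3" | "n = 4 \<or> n = 5" | "n = 6 \<or> n = 7" | "n \<ge> 8" using 2 by linarith
    then show ?thesis
    proof cases
      case 1
      have "d = 3" using e(6) 1 by simp
      moreover have "C = complex_roots (L_poly r n)"
        using card_subset_eq[OF L.finR CS] cardC card 1 \<open>d = 3\<close> by simp
      ultimately show ?thesis by (rule alternating_three)
    next
      case 2
      then have d: "d = 3" using e(6) by auto
      obtain x y z where xyz: "x \<noteq> y" "y \<noteq> z" "x \<noteq> z" "c = cyc3 x y z" using is_cycle_3[OF cyc[unfolded d]] by metis
      have "C \<noteq> complex_roots (L_poly r n)" using cardC card 2 d by auto
      then show ?thesis using alternating_of_three_cycle[OF _ _ xyz(1-3)] cG xyz(4) by simp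
    next
      case 3
      then have d: "d = 5" using e(7) by auto
      obtain l c' qs u v where "cubic_check n r l c' qs u v" using cubic_entry[OF 3 r] .
      then obtain x y z where xyz: "x \<noteq> y" "y \<noteq> z" "x \<noteq> z" "cyc3 x y z \<in> galois_group (L_poly r n)"
        using three_cycle_of_cubic_check[OF r n] by blast
      have "C \<noteq> complex_roots (L_poly r n)" using cardC card 3 d by auto
      then show ?thesis using alternating_of_three_cycle[OF _ xyz(4,1-3)] by simp
    next
      case 4
      then show ?thesis using e(8) card by (intro jordan) simp
    qed
  next
    case 3
    note n20 = 3
    \<comment> \<open>A prime \<open>p\<close> serves all \<open>n\<close> with
      \<open>p + 3 \<le> n\<close> and \<open>n + 8 < 2 * p\<close>; 17, 23, 31 and 47 together
      cover the range.\<close>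
    consider "n < 26" | "26 \<le> n" "n < 38" | "38 \<le> n" "n < 54" | "54 \<le> n" by linarith
    then show ?thesis
    proof cases
      case 1 show ?thesis by (rule alternating_of_prime[OF r n, of 17]) (use 1 n20 in simp_all)
    next
      case 2 show ?thesis by (rule alternating_of_prime[OF r n, of 23]) (use 2 n20 in simp_all)
    next
      case 3 show ?thesis by (rule alternating_of_prime[OF r n, of 31]) (use 3 n20 in simp_all)
    next
      case 4 show ?thesis by (rule alternating_of_prime[OF r n, of 47]) (use 4 n20 in simp_all)
    qed
  next
    case 4
    \<comment> \<open>The shift by 3 leaves room for the three points outside the cycle. With
      \<open>k\<close> about half of \<open>n'\<close>, the bound \<open>p > k + 8\<close> gives
      \<open>n + 8 < 2 * p\<close>; and \<open>k\<close> is at least 30 because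
      \<open>n \<ge> 63\<close>.\<close>
    define n' where "n' = n - 3"
    define k where "k = n' div 2"
    have k: "30 \<le> k" "2 * k \<le> n'" "n' \<le> 2 * k + 1" using 4 unfolding k_def n'_def by linarith+
    obtain p where p: "prime p" "p > k + 8" "n' mod p < k" using prime_dvd_consecutive[of k n'] k by auto
    have "p \<le> n'"
    proof (rule ccontr)
      assume "\<not> p \<le> n'"
      then show False using p(3) k by simp
    qed
    then show ?thesis using p k 4 unfolding n'_def by (intro alternating_of_prime[OF r n, of p]) auto
  qed
qed

theorem theorem1p4:
  fixes r n :: nat
  assumes "r \<le> 8" and "n \<ge> 1"
  shows "irreducible (L_poly r n) \<and>
         alternating_group (complex_roots (L_poly r n)) \<subseteq> galois_group (L_poly r n)"
  using irreducible_L[OF assms] alternating_subset_galois[OF assms] by blast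

end
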